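(* Let $C=\begin{pmatrix}0&1\\-1&1\end{pmatrix}$ and $L=\begin{pmatrix}1&1\\0&1\end{pmatrix}$ in $\mathrm{PSL}(2,\mathbb Z)$, and put $R^2:=C^2LC^2L$. Then $L^2$ and $R^2$ freely generate a subgroup $\mathcal E$ of $\mathrm{PSL}(2,\mathbb Z)$ of index $6$. Let $w\in\mathbb Z_2$, let $T_0\in\mathcal T_w\setminus\mathcal T_{deg}$, and let $h^{-1}[h(T_0)]$ be the set of tilings $T\in\mathcal T_w\setminus\mathcal T_{deg}$ with $h(T)=h(T_0)$. Identify the symmetry group of the horoball packing $h(T_0)$ with $\mathrm{PSL}(2,\mathbb Z)$ by a conjugation in $\mathrm{PSL}(2,\mathbb R)$. Then, under this identification, the symmetry group of $h^{-1}[h(T_0)]$, i.e. the subgroup of $\mathrm{PSL}(2,\mathbb R)$ of those elements which fix every tiling in $h^{-1}[h(T_0)]$, is the kernel of the abelianization map $\mathcal E=\langle L^2,R^2\rangle\to\mathbb Z\oplus\mathbb Z$.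
   Context: Work in the upper half-plane model of $\mathbb H^2$, with orientation-preserving isometry group $\mathrm{PSL}(2,\mathbb R)$ acting by Möbius maps. Let $\mathcal F$ be the packing by horoballs consisting of all images of $\{y\ge1\}$ under $\mathrm{PSL}(2,\mathbb Z)$; its symmetry group is $\mathrm{PSL}(2,\mathbb Z)$, so the symmetry group of $g\mathcal F$ is $g\,\mathrm{PSL}(2,\mathbb Z)g^{-1}$, and identifying it with $\mathrm{PSL}(2,\mathbb Z)$ means choosing such a $g$. The closures of the components of the complement of the union of the horoballs are called triangles (each is bounded by arcs of three mutually tangent horoballs). Tile $\bar\tau$: start with the core $\gamma=\{x+iy:0\le x\le2,\ 1\le y\le2\}$. Attach below it two prongs: the region bounded by the horocyclic segment from $i$ to $i+1$ and the geodesic segments from $i$ and $i+1$ to $e^{i\pi/3}$ (one third of a triangle), and its translate by $1$. Remove from the top a dent: the image of the first prong under $z\mapsto2z$. Add a small bump on the left vertical edge and remove the matching dent (its translate by $2$) on the right one, so that tiles meeting along vertical edges must be positioned like $\gamma$ and $\gamma+2$. $\mathcal T(\bar\tau)$ is the set of tilings of $\mathbb H^2$ by images of $\bar\tau$ under $\mathrm{PSL}(2,\mathbb R)$. A tiling is identified with the set of $g\in\mathrm{PSL}(2,\mathbb R)$ such that $g\bar\tau$ is one of its tiles; the topology is that of convergence on compact sets (Fell topology on closed subsets of $\mathrm{PSL}(2,\mathbb R)$), which is compact metrizable, and $\mathrm{PSL}(2,\mathbb R)$ acts continuously. The tilings in $\mathcal T(\bar\tau)$ are exactly of two kinds. Nondegenerate: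 the union of the cores is the union of a horoball packing $h(T)=g\mathcal F$, $g\in\mathrm{PSL}(2,\mathbb R)$, and each horoball is tiled by cores as follows (independently for different horoballs): after an isometry in $\mathrm{PSL}(2,\mathbb R)$ taking the horoball to $\{y\ge1\}$ and its tangency points with other horoballs to $i+k$, $k\in\mathbb Z$, the cores are the sets $\{c_j+2^{j+1}l\le x\le c_j+2^{j+1}(l+1),\ 2^j\le y\le2^{j+1}\}$, $j\ge0$, $l\in\mathbb Z$, where $c_j\in\mathbb Z$ and $c_{j+1}\equiv c_j \pmod{2^{j+1}}$. Degenerate: the cores themselves tile $\mathbb H^2$; up to an isometry they are given by the same formula with $j$ ranging over all of $\mathbb Z$, $c_j\in\mathbb R$ and $c_{j+1}-c_j\in2^{j+1}\mathbb Z$. Let $\mathcal T_{deg}$ be the set of degenerate tilings. Dyadic integers are elements of the ring $\mathbb Z_2$ of $2$-adic integers. For a nondegenerate tiling, a horoball $H$ of $h(T)$ and a triangle $t$ touching $H$, the dyadic index of $H$ at $t$ is $-\lim_j c_j\in\mathbb Z_2$, computed after the isometry taking $H$ to $\{y\ge1\}$ and $t$ to the triangle directly beneath the segment from $i$ to $i+1$. (Its first digit tells whether the left ($0$) or right ($1$) prong of a tile of $H$ fills part of $t$, the next digit whether that tile hangs from the left or right prong of the tile above it, and so on.) For $w\in\mathbb Z_2$, $\mathcal T_w$ is the closure in $\mathcal T(\bar\tau)$ of the set of nondegenerate tilings for which, at every triangle, the sum of the dyadic indices of the three horoballs meeting at it equals $w$. *)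

theory Defs
  imports "HOL-Analysis.Analysis" "HOL-Number_Theory.Cong"
    "HOL-Algebra.Generated_Groups" "HOL-Algebra.Elementary_Groups"
begin

text \<open>The ring of 2-adic integers as the inverse limit of the rings of integers modulo
  \<open>2 ^ n\<close>: \<open>residue x n\<close> is the representative of \<open>x\<close> modulo \<open>2 ^ n\<close> in \<open>{0..<2 ^ n}\<close>.\<close>

typedef dyadic = "{f :: nat \<Rightarrow> int. \<forall>n. f n = f (Suc n) mod 2 ^ n}"
  morphisms residue Abs_dyadic
  by (rule exI[of _ "\<lambda>_. 0"]) simp

setup_lifting type_definition_dyadic

lemma residue_Suc_mod: "residue x (Suc n) mod 2 ^ n = residue x n"
  using residue[of x, unfolded mem_Collect_eq, rule_format, of n] by (rule sym)

lemma residue_mod [simp]: "residue x n mod 2 ^ n = residue x n"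
  by (metis (no_types) residue_Suc_mod mod_mod_trivial)

lemma residue_0 [simp]: "residue x 0 = 0"
  using residue_mod[of x 0] by simp

lemma dyadic_eqI:
  assumes "\<And>n. residue x n = residue y n"
  shows "x = y"
  using assms by (simp add: ext flip: residue_inject)

lemma coherent_mod:
  fixes a b :: int
  assumes "b mod 2 ^ n = a mod 2 ^ n"
  shows "a mod 2 ^ n = b mod 2 ^ Suc n mod 2 ^ n"
proof -
  have "b mod 2 ^ Suc n mod 2 ^ n = b mod 2 ^ n"
    by (rule mod_mod_cancel) (simp add: le_imp_power_dvd)
  then show ?thesis using assms by simp
qed

instantiation dyadic :: comm_ring_1
begin

lift_definition zero_dyadic :: dyadic is "\<lambda>_. 0" by simp

lift_definition one_dyadic :: dyadic is "\<lambda>n. 1 mod 2 ^ n"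
  by (rule coherent_mod) simp

lift_definition plus_dyadic :: "dyadic \<Rightarrow> dyadic \<Rightarrow> dyadic"
  is "\<lambda>f g n. (f n + g n) mod 2 ^ n"
proof (rule coherent_mod)
  fix f g :: "nat \<Rightarrow> int" and n
  assume "\<And>n. f n = f (Suc n) mod 2 ^ n" "\<And>n. g n = g (Suc n) mod 2 ^ n"
  note * = this[of n]
  show "(f (Suc n) + g (Suc n)) mod 2 ^ n = (f n + g n) mod 2 ^ n"
    unfolding * by (rule mod_add_eq[symmetric])
qed

lift_definition minus_dyadic :: "dyadic \<Rightarrow> dyadic \<Rightarrow> dyadic"
  is "\<lambda>f g n. (f n - g n) mod 2 ^ n"
proof (rule coherent_mod)
  fix f g :: "nat \<Rightarrow> int" and n
  assume "\<And>n. f n = f (Suc n) mod 2 ^ n" "\<And>n. g n = g (Suc n) mod 2 ^ n"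
  note * = this[of n]
  show "(f (Suc n) - g (Suc n)) mod 2 ^ n = (f n - g n) mod 2 ^ n"
    unfolding * by (rule mod_diff_eq[symmetric])
qed

lift_definition times_dyadic :: "dyadic \<Rightarrow> dyadic \<Rightarrow> dyadic"
  is "\<lambda>f g n. (f n * g n) mod 2 ^ n"
proof (rule coherent_mod)
  fix f g :: "nat \<Rightarrow> int" and n
  assume "\<And>n. f n = f (Suc n) mod 2 ^ n" "\<And>n. g n = g (Suc n) mod 2 ^ n"
  note * = this[of n]
  show "(f (Suc n) * g (Suc n)) mod 2 ^ n = (f n * g n) mod 2 ^ n"
    unfolding * by (rule mod_mult_eq[symmetric])
qed

lift_definition uminus_dyadic :: "dyadic \<Rightarrow> dyadic" is "\<lambda>f n. (- f n) mod 2 ^ n"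
proof (rule coherent_mod)
  fix f :: "nat \<Rightarrow> int" and n
  assume "\<And>n. f n = f (Suc n) mod 2 ^ n"
  note * = this[of n]
  show "(- f (Suc n)) mod 2 ^ n = (- f n) mod 2 ^ n"
    unfolding * by (rule mod_minus_eq[symmetric])
qed

lemmas residue_simps = zero_dyadic.rep_eq one_dyadic.rep_eq plus_dyadic.rep_eq
  minus_dyadic.rep_eq times_dyadic.rep_eq uminus_dyadic.rep_eq

instance
proof
  fix a b c :: dyadic
  show "a * b * c = a * (b * c)"
    by (rule dyadic_eqI) (simp add: residue_simps mod_simps mult.assoc)
  show "a * b = b * a"
    by (rule dyadic_eqI) (simp add: residue_simps mult.commute)
  show "1 * a = a"
    by (rule dyadic_eqI) (simp add: residue_simps mod_simps)
  show "a + b + c = a + (b + c)"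
    by (rule dyadic_eqI) (simp add: residue_simps mod_simps add.assoc)
  show "a + b = b + a"
    by (rule dyadic_eqI) (simp add: residue_simps add.commute)
  show "0 + a = a"
    by (rule dyadic_eqI) (simp add: residue_simps)
  show "- a + a = 0"
    by (rule dyadic_eqI) (simp add: residue_simps mod_simps)
  show "a - b = a + - b"
    by (rule dyadic_eqI) (simp add: residue_simps mod_simps)
  show "(a + b) * c = a * c + b * c"
    by (rule dyadic_eqI) (simp add: residue_simps mod_simps distrib_right)
  have "residue 0 1 \<noteq> residue 1 1"
    by (simp add: residue_simps)
  then show "(0 :: dyadic) \<noteq> 1" by metis
qed

end

instantiation dyadic :: t2_space
begin

definition open_dyadic :: "dyadic set \<Rightarrow> bool" where
  "open_dyadic U \<longleftrightarrow> (\<forall>x\<in>U. \<exists>n. \<forall>y. residue y n = residue x n \<longrightarrow> y \<in> U)"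

lemma residue_eq_mono:
  assumes "residue y n = residue x n" "m \<le> n"
  shows "residue y m = residue x m"
  using assms(2,1)
  by (induction rule: inc_induct) (auto, metis residue_Suc_mod)

instance
proof
  show "open (UNIV :: dyadic set)" by (simp add: open_dyadic_def)
next
  fix S T :: "dyadic set"
  assume S: "open S" and T: "open T"
  show "open (S \<inter> T)"
    unfolding open_dyadic_def
  proof
    fix x assume "x \<in> S \<inter> T"
    then obtain m n where m: "\<And>y. residue y m = residue x m \<Longrightarrow> y \<in> S"
      and n: "\<And>y. residue y n = residue x n \<Longrightarrow> y \<in> T"
      using S T unfolding open_dyadic_def by blast
    show "\<exists>n. \<forall>y. residue y n = residue x n \<longrightarrow> y \<in> S \<inter> T"
    proof (intro exI allI impI)
      fix y assume *: "residue y (max m n) = residue x (max m n)"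
      have "residue y m = residue x m" "residue y n = residue x n"
        by (rule residue_eq_mono[OF *], simp)+
      then show "y \<in> S \<inter> T" using m n by simp
    qed
  qed
next
  fix K :: "dyadic set set"
  assume K: "\<forall>S\<in>K. open S"
  show "open (\<Union>K)"
    unfolding open_dyadic_def
  proof
    fix x assume "x \<in> \<Union>K"
    then obtain S where S: "S \<in> K" "x \<in> S" by blast
    with K obtain n where "\<And>y. residue y n = residue x n \<Longrightarrow> y \<in> S"
      unfolding open_dyadic_def by metis
    with S show "\<exists>n. \<forall>y. residue y n = residue x n \<longrightarrow> y \<in> \<Union>K" by blast
  qed
next
  fix x y :: dyadic
  assume "x \<noteq> y"
  then obtain n where n: "residue x n \<noteq> residue y n"
    using dyadic_eqI by blast
  show "\<exists>U V. open U \<and> open V \<and> x \<in> U \<and> y \<in> V \<and> U \<inter> V = {}"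
  proof (intro exI conjI)
    show "open {z. residue z n = residue x n}" "open {z. residue z n = residue y n}"
      unfolding open_dyadic_def by (metis mem_Collect_eq)+
  qed (use n in auto)
qed

end

definition upper_half_plane :: "complex set" where
  "upper_half_plane = {z. Im z > 0}"

definition SL2R :: "(real^2^2) monoid" where
  "SL2R = \<lparr>carrier = {A. det A = 1}, mult = (**), one = mat 1\<rparr>"

definition PSL2R :: "(real^2^2) set monoid" where
  "PSL2R = SL2R Mod {mat 1, - mat 1}"

definition psl :: "real^2^2 \<Rightarrow> (real^2^2) set" where
  "psl A = {mat 1, - mat 1} #>\<^bsub>SL2R\<^esub> A"

definition PSL2Z :: "(real^2^2) set monoid" where
  "PSL2Z = PSL2R\<lparr>carrier := psl ` {A \<in> carrier SL2R. \<forall>i j. A $ i $ j \<in> \<int>}\<rparr>"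

definition C_mat :: "(real^2^2) set" where
  "C_mat = psl (vector [vector [0, 1], vector [-1, 1]])"

definition L_mat :: "(real^2^2) set" where
  "L_mat = psl (vector [vector [1, 1], vector [0, 1]])"

text \<open>A matrix and its negative give the same Moebius map, so the set in the following definition
  is a singleton.\<close>

definition psl_act :: "(real^2^2) set \<Rightarrow> complex \<Rightarrow> complex" where
  "psl_act g z = the_elem ((\<lambda>A. moebius (of_real (A $ 1 $ 1)) (of_real (A $ 1 $ 2))
     (of_real (A $ 2 $ 1)) (of_real (A $ 2 $ 2)) z) ` g)"

text \<open>The quotient topology: for a set \<open>U\<close> of cosets, \<open>\<Union>U\<close> is its preimage in \<open>SL(2,R)\<close>.\<close>

definition PSL2R_topology :: "(real^2^2) set topology" where
  "PSL2R_topology = topology (\<lambda>U. U \<subseteq> carrier PSL2R \<and>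
     openin (top_of_set (carrier SL2R)) (\<Union>U))"

lemma openin_PSL2R_topology:
  "openin PSL2R_topology U \<longleftrightarrow>
     U \<subseteq> carrier PSL2R \<and> openin (top_of_set (carrier SL2R)) (\<Union>U)"
proof -
  have eq: "g = psl A" if "g \<in> carrier PSL2R" "A \<in> g" for g A
  proof -
    obtain B where g: "g = psl B"
      using \<open>g \<in> carrier PSL2R\<close>
      by (auto simp: PSL2R_def FactGroup_def RCOSETS_def psl_def)
    have *: "psl X = {X, - X}" for X
    proof -
      have "(- mat 1) ** X = - X"
        by (simp add: vec_eq_iff matrix_matrix_mult_def mat_def forall_2 sum_2)
      then show ?thesis by (auto simp: psl_def r_coset_def SL2R_def)
    qed
    show ?thesis using that(2) by (auto simp: g *)
  qed
  have "istopology (\<lambda>U. U \<subseteq> carrier PSL2R \<and> openin (top_of_set (carrier SL2R)) (\<Union>U))"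
    unfolding istopology_def
  proof (intro conjI allI impI)
    fix S T
    assume S: "S \<subseteq> carrier PSL2R \<and> openin (top_of_set (carrier SL2R)) (\<Union>S)"
      and T: "T \<subseteq> carrier PSL2R \<and> openin (top_of_set (carrier SL2R)) (\<Union>T)"
    have "\<Union>(S \<inter> T) = \<Union>S \<inter> \<Union>T"
    proof
      show "\<Union>S \<inter> \<Union>T \<subseteq> \<Union>(S \<inter> T)"
      proof
        fix A assume "A \<in> \<Union>S \<inter> \<Union>T"
        then obtain g k where gk: "g \<in> S" "k \<in> T" "A \<in> g" "A \<in> k" by blast
        then have "g = k" using eq S T by blast
        with gk show "A \<in> \<Union>(S \<inter> T)" by blast
      qed
    qed blast
    then show "openin (top_of_set (carrier SL2R)) (\<Union>(S \<inter> T))"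
      using S T by (simp add: openin_Int)
  next
    fix K
    assume K: "\<forall>S\<in>K. S \<subseteq> carrier PSL2R \<and> openin (top_of_set (carrier SL2R)) (\<Union>S)"
    have "openin (top_of_set (carrier SL2R)) (\<Union>(Union ` K))"
      by (rule openin_Union) (use K in blast)
    moreover have "\<Union>(\<Union>K) = \<Union>(Union ` K)" by blast
    ultimately show "openin (top_of_set (carrier SL2R)) (\<Union>(\<Union>K))" by (simp only:)
  qed blast+
  then show ?thesis
    unfolding PSL2R_topology_def by simp
qed

text \<open>Words are lists of pairs \<open>(i, e)\<close>, standing for the \<open>i\<close>-th generator if \<open>e\<close> holds and for its
  inverse otherwise.\<close>

definition word_value :: "('a, 'b) monoid_scheme \<Rightarrow> 'a list \<Rightarrow> (nat \<times> bool) list \<Rightarrow> 'a" where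
  "word_value G gs ws = foldr (\<lambda>(i, e) x.
     (if e then gs ! i else inv\<^bsub>G\<^esub> (gs ! i)) \<otimes>\<^bsub>G\<^esub> x) ws \<one>\<^bsub>G\<^esub>"

definition reduced_word :: "(nat \<times> bool) list \<Rightarrow> bool" where
  "reduced_word ws \<longleftrightarrow> successively (\<lambda>(i, e) (j, e'). \<not> (i = j \<and> e \<noteq> e')) ws"

definition freely_generate :: "('a, 'b) monoid_scheme \<Rightarrow> 'a list \<Rightarrow> 'a set \<Rightarrow> bool" where
  "freely_generate G gs H \<longleftrightarrow> set gs \<subseteq> carrier G \<and> generate G (set gs) = H \<and>
     (\<forall>ws. ws \<noteq> [] \<and> fst ` set ws \<subseteq> {..<length gs} \<and> reduced_word ws
        \<longrightarrow> word_value G gs ws \<noteq> \<one>\<^bsub>G\<^esub>)"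

definition abelianization_map ::
  "('a, 'b) monoid_scheme \<Rightarrow> ('c, 'd) monoid_scheme \<Rightarrow> ('a \<Rightarrow> 'c) \<Rightarrow> bool" where
  "abelianization_map G A \<alpha> \<longleftrightarrow> comm_group A \<and> \<alpha> \<in> hom G A \<and> \<alpha> ` carrier G = carrier A \<and>
     kernel G A \<alpha> = derived G (carrier G)"

definition horoball_inf :: "complex set" where
  "horoball_inf = {z. Im z \<ge> 1}"

definition modular_packing :: "complex set set" where
  "modular_packing = (\<lambda>g. psl_act g ` horoball_inf) ` carrier PSL2Z"

definition move_packing :: "(real^2^2) set \<Rightarrow> complex set set \<Rightarrow> complex set set" where
  "move_packing g P = (\<lambda>H. psl_act g ` H) ` P"

definition triangles :: "complex set set \<Rightarrow> complex set set" where
  "triangles P = closure ` components (upper_half_plane - \<Union>P)"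

definition tangency_points :: "complex set set \<Rightarrow> complex set \<Rightarrow> complex set" where
  "tangency_points P H = (\<Union>H'\<in>P - {H}. H \<inter> H')"

text \<open>The triangle directly beneath the segment from \<open>\<i>\<close> to \<open>\<i> + 1\<close>: the other two horoballs are the
  Euclidean discs of radius 1/2 tangent to the real axis at 0 and 1, which touch at height 1/2.\<close>

definition triangle_beneath :: "complex set" where
  "triangle_beneath = {z. 0 \<le> Re z \<and> Re z \<le> 1 \<and> 1/2 \<le> Im z \<and> Im z \<le> 1 \<and>
     1/2 \<le> cmod (z - \<i>/2) \<and> 1/2 \<le> cmod (z - (1 + \<i>/2))}"

definition core :: "complex set" where
  "core = {z. 0 \<le> Re z \<and> Re z \<le> 2 \<and> 1 \<le> Im z \<and> Im z \<le> 2}"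

text \<open>The geodesics from \<open>\<i>\<close> and from \<open>\<i> + 1\<close> to \<open>exp (\<i> * pi / 3)\<close> lie on the unit circles centred
  at 0 and at 1.\<close>

definition prong :: "complex set" where
  "prong = {z. 0 \<le> Re z \<and> Re z \<le> 1 \<and> 0 < Im z \<and> Im z \<le> 1 \<and> 1 \<le> cmod z \<and> 1 \<le> cmod (z - 1)}"

definition dent :: "complex set" where
  "dent = (\<lambda>z. 2 * z) ` prong"

text \<open>The bump added to the left vertical edge is not specified further, so it is a parameter of
  everything below. It lies to the left of that edge, inside the translate by -2 of the core with its
  dent removed, so that the matching piece can be cut out of the right-hand side of the core.\<close>

definition small_bump :: "complex set \<Rightarrow> bool" where
  "small_bump \<beta> \<longleftrightarrow> compact \<beta> \<and> connected \<beta> \<and> \<beta> \<noteq> {} \<and> closure (interior \<beta>) = \<beta> \<and>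
     \<beta> \<subseteq> {z. -1 < Re z \<and> Re z \<le> 0 \<and> 1 < Im z \<and> Im z < 2} - (\<lambda>z. z - 2) ` dent \<and>
     (\<exists>z\<in>\<beta>. Re z = 0)"

lemma small_bump_half_disc:
  "small_bump {z. Re z \<le> 0 \<and> cmod (z - 3/2 * \<i>) \<le> 1/4}" (is "small_bump ?B")
proof -
  have B: "?B = {z. Re z \<le> 0} \<inter> cball (3/2 * \<i>) (1/4)"
    by (auto simp: dist_norm norm_minus_commute)
  have conv: "convex ?B"
    unfolding B by (intro convex_Int convex_halfspace_Re_le convex_cball)
  have comp: "compact ?B"
    unfolding B by (intro closed_Int_compact closed_halfspace_Re_le compact_cball)
  have "ball (3/2 * \<i> - 1/8) (1/8) \<subseteq> ?B"
  proof
    fix z assume "z \<in> ball (3/2 * \<i> - 1/8) (1/8)"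
    then have n: "cmod (z - (3/2 * \<i> - 1/8)) < 1/8"
      by (simp add: dist_norm norm_minus_commute)
    have "\<bar>Re (z - (3/2 * \<i> - 1/8))\<bar> < 1/8"
      using abs_Re_le_cmod n by (rule le_less_trans)
    then have "Re z \<le> 0" unfolding abs_less_iff by simp
    moreover have "cmod (z - 3/2 * \<i>) \<le> cmod (z - (3/2 * \<i> - 1/8)) + cmod (1/8)"
      using norm_triangle_ineq4[of "z - (3/2 * \<i> - 1/8)" "1/8"] by (simp add: algebra_simps)
    ultimately show "z \<in> ?B" using n by simp
  qed
  then have "3/2 * \<i> - 1/8 \<in> interior ?B"
    by (auto simp: mem_interior intro!: exI[of _ "1/8"])
  then have reg: "closure (interior ?B) = ?B"
    using convex_closure_interior[OF conv] compact_imp_closed[OF comp] by auto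
  have sub: "-1 < Re z \<and> Re z \<le> 0 \<and> 1 < Im z \<and> Im z < 2" if "z \<in> ?B" for z
    using that abs_Re_le_cmod[of "z - 3/2 * \<i>"] abs_Im_le_cmod[of "z - 3/2 * \<i>"] by auto
  have "z \<notin> (\<lambda>z. z - 2) ` dent" if "z \<in> ?B" for z
  proof
    assume "z \<in> (\<lambda>z. z - 2) ` dent"
    then obtain p where p: "1 \<le> cmod (p - 1)" "z = 2 * (p - 1)"
      by (auto simp: dent_def prong_def algebra_simps)
    then have "2 \<le> cmod z" unfolding p(2) norm_mult by simp
    moreover have "cmod z \<le> cmod (z - 3/2 * \<i>) + cmod (3/2 * \<i>)"
      using norm_triangle_ineq[of "z - 3/2 * \<i>" "3/2 * \<i>"] by simp
    ultimately show False using that by (simp add: norm_mult)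
  qed
  then have "?B \<subseteq> {z. -1 < Re z \<and> Re z \<le> 0 \<and> 1 < Im z \<and> Im z < 2} - (\<lambda>z. z - 2) ` dent"
    using sub by blast
  moreover have "\<exists>z\<in>?B. Re z = 0" by (rule bexI[of _ "3/2 * \<i>"]) auto
  ultimately show ?thesis
    using comp reg convex_connected[OF conv] by (auto simp: small_bump_def)
qed

definition tile :: "complex set \<Rightarrow> complex set" where
  "tile \<beta> = closure ((core \<union> prong \<union> (\<lambda>z. z + 1) ` prong \<union> \<beta>) - (dent \<union> (\<lambda>z. z + 2) ` \<beta>))"

definition is_tiling :: "complex set \<Rightarrow> complex set set \<Rightarrow> bool" where
  "is_tiling \<beta> \<T> \<longleftrightarrow> \<T> \<subseteq> (\<lambda>g. psl_act g ` tile \<beta>) ` carrier PSL2R \<and>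
     \<Union>\<T> = upper_half_plane \<and>
     (\<forall>t\<in>\<T>. \<forall>t'\<in>\<T>. t \<noteq> t' \<longrightarrow> interior t \<inter> interior t' = {})"

text \<open>A tiling is represented by the set of all \<open>g\<close> in \<open>PSL(2,R)\<close> that carry the prototile to one of
  its tiles.\<close>

definition tilings :: "complex set \<Rightarrow> (real^2^2) set set set" where
  "tilings \<beta> = {{g \<in> carrier PSL2R. psl_act g ` tile \<beta> \<in> \<T>} | \<T>. is_tiling \<beta> \<T>}"

definition fell_topology :: "'a topology \<Rightarrow> 'a set topology" where
  "fell_topology X = topology_generated_by
     ({{A. closedin X A \<and> A \<inter> K = {}} | K. compactin X K} \<union>
      {{A. closedin X A \<and> A \<inter> U \<noteq> {}} | U. openin X U})"

definition tiling_space :: "complex set \<Rightarrow> (real^2^2) set set topology" where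
  "tiling_space \<beta> = subtopology (fell_topology PSL2R_topology) (tilings \<beta>)"

definition cores :: "(real^2^2) set set \<Rightarrow> complex set set" where
  "cores T = (\<lambda>g. psl_act g ` core) ` T"

definition core_box :: "real \<Rightarrow> int \<Rightarrow> int \<Rightarrow> complex set" where
  "core_box c j l = {z. c + 2 powi (j + 1) * of_int l \<le> Re z \<and>
     Re z \<le> c + 2 powi (j + 1) * of_int (l + 1) \<and> 2 powi j \<le> Im z \<and> Im z \<le> 2 powi (j + 1)}"

definition horoball_cores :: "(nat \<Rightarrow> int) \<Rightarrow> complex set set" where
  "horoball_cores c = {core_box (of_int (c j)) (int j) l | j l. True}"

definition coherent :: "(nat \<Rightarrow> int) \<Rightarrow> bool" where
  "coherent c \<longleftrightarrow> (\<forall>j. [c (Suc j) = c j] (mod 2 ^ (j + 1)))"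

definition nondegenerate_over ::
  "complex set \<Rightarrow> (real^2^2) set set \<Rightarrow> complex set set \<Rightarrow> bool" where
  "nondegenerate_over \<beta> T P \<longleftrightarrow> T \<in> tilings \<beta> \<and>
     (\<exists>g\<in>carrier PSL2R. P = move_packing g modular_packing) \<and> \<Union>(cores T) = \<Union>P \<and>
     (\<forall>H\<in>P. \<exists>u\<in>carrier PSL2R. \<exists>c. coherent c \<and> psl_act u ` H = horoball_inf \<and>
        psl_act u ` tangency_points P H = {\<i> + of_int k | k. True} \<and>
        {psl_act u ` K | K. K \<in> cores T \<and> K \<subseteq> H} = horoball_cores c)"

definition nondegenerate :: "complex set \<Rightarrow> (real^2^2) set set \<Rightarrow> bool" where
  "nondegenerate \<beta> T \<longleftrightarrow> (\<exists>P. nondegenerate_over \<beta> T P)"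

definition packing_of :: "complex set \<Rightarrow> (real^2^2) set set \<Rightarrow> complex set set" where
  "packing_of \<beta> T = (THE P. nondegenerate_over \<beta> T P)"

definition degenerate_tilings :: "complex set \<Rightarrow> (real^2^2) set set set" where
  "degenerate_tilings \<beta> = {T \<in> tilings \<beta>. \<exists>u\<in>carrier PSL2R. \<exists>c :: int \<Rightarrow> real.
     (\<forall>j. \<exists>m :: int. c (j + 1) - c j = 2 powi (j + 1) * of_int m) \<and>
     (\<lambda>K. psl_act u ` K) ` cores T = {core_box (c j) j l | j l. True}}"

text \<open>The isometry \<open>u\<close> below is unique, and it determines \<open>c j\<close> modulo \<open>2 ^ (j + 1)\<close>.\<close>

definition dyadic_index ::
  "(real^2^2) set set \<Rightarrow> complex set \<Rightarrow> complex set \<Rightarrow> dyadic" where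
  "dyadic_index T H t = (THE d. \<exists>u\<in>carrier PSL2R. \<exists>c. coherent c \<and>
     psl_act u ` H = horoball_inf \<and> psl_act u ` t = triangle_beneath \<and>
     {psl_act u ` K | K. K \<in> cores T \<and> K \<subseteq> H} = horoball_cores c \<and>
     d = - lim (\<lambda>j. of_int (c j)))"

definition index_sum_is :: "complex set \<Rightarrow> (real^2^2) set set \<Rightarrow> dyadic \<Rightarrow> bool" where
  "index_sum_is \<beta> T w \<longleftrightarrow> (\<forall>t\<in>triangles (packing_of \<beta> T).
     (\<Sum>H\<in>{H \<in> packing_of \<beta> T. H \<inter> t \<noteq> {}}. dyadic_index T H t) = w)"

definition tilings_w :: "complex set \<Rightarrow> dyadic \<Rightarrow> (real^2^2) set set set" where
  "tilings_w \<beta> w = Abstract_Topology.closure_of (tiling_space \<beta>)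
     {T. nondegenerate \<beta> T \<and> index_sum_is \<beta> T w}"

definition packing_fiber :: "complex set \<Rightarrow> dyadic \<Rightarrow> complex set set \<Rightarrow> (real^2^2) set set set" where
  "packing_fiber \<beta> w P = {T \<in> tilings_w \<beta> w - degenerate_tilings \<beta>. packing_of \<beta> T = P}"

text \<open>An isometry \<open>s\<close> moves the tiling with set of tile placements \<open>T\<close> to the one with set \<open>s T\<close>.\<close>

definition pointwise_symmetries :: "(real^2^2) set set set \<Rightarrow> (real^2^2) set set" where
  "pointwise_symmetries \<X> = {s \<in> carrier PSL2R. \<forall>T\<in>\<X>. s <#\<^bsub>PSL2R\<^esub> T = T}"

definition L2 :: "(real^2^2) set" where
  "L2 = L_mat [^]\<^bsub>PSL2Z\<^esub> (2::nat)"

definition R2 :: "(real^2^2) set" where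
  "R2 = C_mat [^]\<^bsub>PSL2Z\<^esub> (2::nat) \<otimes>\<^bsub>PSL2Z\<^esub> L_mat \<otimes>\<^bsub>PSL2Z\<^esub>
     C_mat [^]\<^bsub>PSL2Z\<^esub> (2::nat) \<otimes>\<^bsub>PSL2Z\<^esub> L_mat"

definition E_set :: "(real^2^2) set set" where
  "E_set = generate PSL2Z {L2, R2}"

definition E_group :: "(real^2^2) set monoid" where
  "E_group = PSL2Z\<lparr>carrier := E_set\<rparr>"

end

theory Submission
  imports Defs
begin

text \<open>
  The dyadic indices of the three horoballs at a triangle form a vector \<open>(a, b, c)\<close> with sum \<open>w\<close>.
  Moving to an adjacent triangle shifts one index by \<open>1\<close> and another one by \<open>-1\<close> and permutes them,
  so the vector at a single triangle determines all indices, and \<open>L\<^sup>2\<close> and \<open>R\<^sup>2\<close> translate the vector by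
  \<open>(2, -1, -1)\<close> and \<open>(1, -2, 1)\<close>, which are linearly independent. Hence the elements of the kernel of the
  abelianization fix every tiling in the fibre. Conversely, a group element that fixes all translates of one
  tiling by the modular group acts trivially on the vectors of that tiling, which forces its permutation
  part to be trivial, so that it lies in \<open>\<E>\<close>, and its translation part to vanish.

  Taking the closure of the tilings with index sum \<open>w\<close> adds only degenerate tilings: these tilings satisfy
  local rules that pass to Fell limits, and a set of tiles satisfying the local rules is degenerate if each
  of its tiles has a child, and otherwise it fills a horoball packing with index sum \<open>w\<close>, because from a
  tile without a child one can walk through all horoballs of the packing.

  That \<open>L\<^sup>2\<close> and \<open>R\<^sup>2\<close> generate freely is a ping-pong argument, and the index follows from six
  explicit coset representatives.
\<close>

section \<open>Matrices up to sign\<close>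

text \<open>A horoball of \<open>packing g\<close> together with a triangle touching it is the image
  of \<open>H_inf\<close> and \<open>T0\<close> under g k for exactly one k in \<Gamma>. A
  nondegenerate tiling thus becomes a function on \<Gamma>, its dyadic indices. Symmetries of the
  packing act on this function from the left, whereas the passage to another horoball or triangle is
  right multiplication by \<open>C_mat\<close> or \<open>L_mat\<close>. The two actions commute,
  which is why agreement of index vectors at one triangle spreads to all of them, and why testing a
  symmetry on the translates of a single tiling yields a relation at every triangle. The sum
  condition closes up the transition rules: at an adjacent triangle the third horoball is new, and
  only the sum reveals its index. The obstacle is the closure in \<open>tilings_w\<close>. Fell
  convergence controls finitely many tile positions in a bounded region, while a dyadic index
  involves infinitely many tiles. The sum condition is therefore split into its residues modulo
  powers of two, each of which is visible on finitely many ancestors, and is stated relative to a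
  tile, so that it does not refer to a packing that the limit may fail to have.\<close>

abbreviation pmul :: "(real^2^2) set \<Rightarrow> (real^2^2) set \<Rightarrow> (real^2^2) set" (infixl "\<cdot>" 70) where
  "g \<cdot> h \<equiv> g \<otimes>\<^bsub>PSL2R\<^esub> h"

abbreviation pinv :: "(real^2^2) set \<Rightarrow> (real^2^2) set" where
  "pinv g \<equiv> inv\<^bsub>PSL2R\<^esub> g"

definition mat2 :: "real \<Rightarrow> real \<Rightarrow> real \<Rightarrow> real \<Rightarrow> real^2^2" where
  "mat2 a b c d = vector [vector [a, b], vector [c, d]]"

text \<open>Calculations in \<open>PSL2R\<close> are done on entries: products and inverses of such
  classes are again of this form, and an equality splits into two sign cases by
  \<open>pm_eq_iff\<close>.\<close>

definition pm :: "real \<Rightarrow> real \<Rightarrow> real \<Rightarrow> real \<Rightarrow> (real^2^2) set" where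
  "pm a b c d = psl (mat2 a b c d)"

lemma mat2_nth [simp]:
  "mat2 a b c d $ 1 $ 1 = a" "mat2 a b c d $ 1 $ 2 = b"
  "mat2 a b c d $ 2 $ 1 = c" "mat2 a b c d $ 2 $ 2 = d"
  by (simp_all add: mat2_def)

lemma mat2_eta: "mat2 (A $ 1 $ 1) (A $ 1 $ 2) (A $ 2 $ 1) (A $ 2 $ 2) = A"
  by (simp add: vec_eq_iff forall_2)

lemma mat2_eq_iff: "mat2 a b c d = mat2 a' b' c' d' \<longleftrightarrow> a = a' \<and> b = b' \<and> c = c' \<and> d = d'"
  by (auto simp: vec_eq_iff forall_2)

lemma uminus_mat2 [simp]: "- mat2 a b c d = mat2 (- a) (- b) (- c) (- d)"
  by (simp add: vec_eq_iff forall_2)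

lemma mat_1_mat2: "mat 1 = mat2 1 0 0 1"
  by (simp add: vec_eq_iff forall_2 mat_def)

lemma det_mat2 [simp]: "det (mat2 a b c d) = a * d - b * c"
  by (simp add: det_2)

lemma mat2_mult [simp]:
  "mat2 a b c d ** mat2 a' b' c' d' =
    mat2 (a * a' + b * c') (a * b' + b * d') (c * a' + d * c') (c * b' + d * d')"
  by (simp add: vec_eq_iff forall_2 matrix_matrix_mult_def sum_2)

lemma psl_eq: "psl A = {A, - A}"
proof -
  have "(- mat 1) ** A = - A"
    by (simp add: vec_eq_iff matrix_matrix_mult_def mat_def forall_2 sum_2)
  then show ?thesis by (auto simp: psl_def r_coset_def SL2R_def)
qed

lemma uminus_matrix_mult [simp]:
  fixes A B :: "real^2^2"
  shows "(- A) ** B = - (A ** B)" "A ** (- B) = - (A ** B)"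
  by (simp_all add: vec_eq_iff matrix_matrix_mult_def sum_negf)

lemma carrier_PSL2R: "carrier PSL2R = psl ` {A. det A = 1}"
  by (auto simp: PSL2R_def FactGroup_def RCOSETS_def psl_def SL2R_def)

lemma psl_mult: "psl A \<cdot> psl B = psl (A ** B)"
  by (auto simp: PSL2R_def FactGroup_def set_mult_def psl_eq SL2R_def)

lemma one_PSL2R: "\<one>\<^bsub>PSL2R\<^esub> = psl (mat 1)"
  by (auto simp: PSL2R_def FactGroup_def psl_eq)

lemma pm_eq: "pm a b c d = {mat2 a b c d, mat2 (- a) (- b) (- c) (- d)}"
  by (simp add: pm_def psl_eq)

lemma pm_eq_iff: "pm a b c d = pm a' b' c' d' \<longleftrightarrow>
    (a = a' \<and> b = b' \<and> c = c' \<and> d = d') \<or> (a = - a' \<and> b = - b' \<and> c = - c' \<and> d = - d')"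
  by (auto simp: pm_eq doubleton_eq_iff mat2_eq_iff)

lemma pm_mult: "pm a b c d \<cdot> pm a' b' c' d' =
    pm (a * a' + b * c') (a * b' + b * d') (c * a' + d * c') (c * b' + d * d')"
  by (simp add: pm_def psl_mult)

lemma one_pm: "\<one>\<^bsub>PSL2R\<^esub> = pm 1 0 0 1"
  by (simp add: pm_def one_PSL2R mat_1_mat2)

lemma pm_in_carrier [simp]: "a * d - b * c = 1 \<Longrightarrow> pm a b c d \<in> carrier PSL2R"
  by (auto simp: carrier_PSL2R pm_def)

lemma PSL2R_cases:
  assumes "g \<in> carrier PSL2R"
  obtains a b c d where "g = pm a b c d" "a * d - b * c = 1"
proof -
  obtain A where A: "det A = 1" "g = psl A" using assms by (auto simp: carrier_PSL2R)
  show ?thesis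
    by (rule that[of "A$1$1" "A$1$2" "A$2$1" "A$2$2"])
      (use A in \<open>simp_all add: pm_def mat2_eta det_2\<close>)
qed

lemma group_PSL2R: "group PSL2R"
proof (rule groupI)
  fix x y z assume "x \<in> carrier PSL2R" "y \<in> carrier PSL2R" "z \<in> carrier PSL2R"
  then obtain A B C where *: "x = psl A" "y = psl B" "z = psl C" "det A = 1" "det B = 1"
    by (auto simp: carrier_PSL2R)
  show "x \<cdot> y \<in> carrier PSL2R"
    using * by (auto simp: carrier_PSL2R psl_mult det_mul)
  show "x \<cdot> y \<cdot> z = x \<cdot> (y \<cdot> z)"
    unfolding * psl_mult by (simp add: matrix_mul_assoc)
next
  show "\<one>\<^bsub>PSL2R\<^esub> \<in> carrier PSL2R" by (simp add: one_pm)
next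
  fix x assume "x \<in> carrier PSL2R"
  then obtain a b c d where x: "x = pm a b c d" "a * d - b * c = 1" by (rule PSL2R_cases)
  show "\<one>\<^bsub>PSL2R\<^esub> \<cdot> x = x" by (simp add: x one_pm pm_mult)
  show "\<exists>y\<in>carrier PSL2R. y \<cdot> x = \<one>\<^bsub>PSL2R\<^esub>"
    by (rule bexI[of _ "pm d (- b) (- c) a"]) (use x in \<open>simp_all add: one_pm pm_mult algebra_simps\<close>)
qed

interpretation PSL: group PSL2R
  by (rule group_PSL2R)

lemma pinv_pm: "a * d - b * c = 1 \<Longrightarrow> pinv (pm a b c d) = pm d (- b) (- c) a"
  by (rule PSL.inv_equality) (simp_all add: one_pm pm_mult algebra_simps)

lemma pm_one [simp]: "pm 1 0 0 1 = \<one>\<^bsub>PSL2R\<^esub>"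
  by (simp add: one_pm)

section \<open>The modular group\<close>

abbreviation \<Gamma> :: "(real^2^2) set set" where
  "\<Gamma> \<equiv> carrier PSL2Z"

lemma modular_carrier:
  "\<Gamma> = {pm (of_int a) (of_int b) (of_int c) (of_int d) | a b c d :: int. a * d - b * c = 1}"
proof (rule Set.set_eqI, rule iffI)
  fix x assume "x \<in> \<Gamma>"
  then obtain A where A: "x = psl A" "det A = 1" "\<And>i j. A $ i $ j \<in> \<int>"
    by (auto simp: PSL2Z_def SL2R_def)
  obtain a b c d :: int where e: "A$1$1 = of_int a" "A$1$2 = of_int b" "A$2$1 = of_int c" "A$2$2 = of_int d"
    using A(3) by (metis Ints_cases)
  have "of_int (a * d - b * c) = (1::real)" using A(2) by (simp add: det_2 e)
  then have "a * d - b * c = 1" by (simp only: of_int_eq_1_iff)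
  moreover have "x = pm (of_int a) (of_int b) (of_int c) (of_int d)"
    unfolding A(1) pm_def by (simp add: mat2_eta flip: e)
  ultimately show "x \<in> {pm (of_int a) (of_int b) (of_int c) (of_int d) | a b c d :: int. a * d - b * c = 1}"
    by blast
next
  fix x assume "x \<in> {pm (of_int a) (of_int b) (of_int c) (of_int d) | a b c d :: int. a * d - b * c = 1}"
  then obtain a b c d :: int where x: "x = pm (of_int a) (of_int b) (of_int c) (of_int d)" "a * d - b * c = 1"
    by blast
  have "of_int (a * d - b * c) = (1::real)" using x(2) by simp
  then have "det (mat2 (of_int a) (of_int b) (of_int c) (of_int d)) = 1" by simp
  then show "x \<in> \<Gamma>"
    unfolding x(1) pm_def PSL2Z_def SL2R_def
    by (intro image_eqI[OF refl] | simp add: forall_2)+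
qed

lemma modular_cases:
  assumes "k \<in> \<Gamma>"
  obtains a b c d :: int where "k = pm (of_int a) (of_int b) (of_int c) (of_int d)" "a * d - b * c = 1"
  using assms by (auto simp: modular_carrier)

lemma modular_pm [simp]:
  "a * d - b * c = 1 \<Longrightarrow> pm (of_int a) (of_int b) (of_int c) (of_int d) \<in> \<Gamma>"
  by (auto simp: modular_carrier)

lemma modular_pm':
  assumes "a * d - b * c = 1" "a \<in> \<int>" "b \<in> \<int>" "c \<in> \<int>" "d \<in> \<int>"
  shows "pm a b c d \<in> \<Gamma>"
proof -
  obtain a' b' c' d' :: int where "a = of_int a'" "b = of_int b'" "c = of_int c'" "d = of_int d'"
    using assms by (metis Ints_cases)
  moreover from this have "of_int (a' * d' - b' * c') = (1::real)" using assms by simp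
  ultimately show ?thesis by (metis modular_pm of_int_eq_1_iff)
qed

lemma subgroup_modular: "subgroup \<Gamma> PSL2R"
proof (rule PSL.subgroupI)
  show "\<Gamma> \<subseteq> carrier PSL2R" by (auto simp: PSL2Z_def carrier_PSL2R SL2R_def)
  have "pm 1 0 0 1 \<in> \<Gamma>" by (rule modular_pm') simp_all
  then show "\<Gamma> \<noteq> {}" by blast
next
  fix x assume "x \<in> \<Gamma>"
  then obtain a b c d :: int where x: "x = pm (of_int a) (of_int b) (of_int c) (of_int d)" "a * d - b * c = 1"
    by (rule modular_cases)
  have "of_int (a * d - b * c) = (1::real)" using x(2) by simp
  then have e: "of_int a * of_int d - of_int b * of_int c = (1::real)" by simp
  show "pinv x \<in> \<Gamma>" unfolding x(1) pinv_pm[OF e]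
    by (rule modular_pm') (use e in \<open>simp_all add: algebra_simps\<close>)
next
  fix x y assume "x \<in> \<Gamma>" "y \<in> \<Gamma>"
  then obtain a b c d a' b' c' d' :: int where
    x: "x = pm (of_int a) (of_int b) (of_int c) (of_int d)" "a * d - b * c = 1" and
    y: "y = pm (of_int a') (of_int b') (of_int c') (of_int d')" "a' * d' - b' * c' = 1"
    by (metis modular_cases)
  have "(a * a' + b * c') * (c * b' + d * d') - (a * b' + b * d') * (c * a' + d * c')
     = (a * d - b * c) * (a' * d' - b' * c')" by algebra
  then have "(a * a' + b * c') * (c * b' + d * d') - (a * b' + b * d') * (c * a' + d * c') = 1"
    using x y by simp
  from modular_pm[OF this] show "x \<cdot> y \<in> \<Gamma>" unfolding x y pm_mult by simp
qed

lemma modular_PSL2R [simp]: "k \<in> \<Gamma> \<Longrightarrow> k \<in> carrier PSL2R"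
  using subgroup.subset[OF subgroup_modular] by blast

lemma modular_mult [simp]: "k \<in> \<Gamma> \<Longrightarrow> l \<in> \<Gamma> \<Longrightarrow> k \<cdot> l \<in> \<Gamma>"
  by (rule subgroup.m_closed[OF subgroup_modular])

lemma modular_inv [simp]: "k \<in> \<Gamma> \<Longrightarrow> pinv k \<in> \<Gamma>"
  by (rule subgroup.m_inv_closed[OF subgroup_modular])

lemma modular_one [simp]: "\<one>\<^bsub>PSL2R\<^esub> \<in> \<Gamma>"
  by (rule subgroup.one_closed[OF subgroup_modular])

lemma PSL2Z_mult [simp]: "(\<otimes>\<^bsub>PSL2Z\<^esub>) = (\<otimes>\<^bsub>PSL2R\<^esub>)"
  by (simp add: PSL2Z_def)

lemma PSL2Z_one [simp]: "\<one>\<^bsub>PSL2Z\<^esub> = \<one>\<^bsub>PSL2R\<^esub>"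
  by (simp add: PSL2Z_def)

lemma PSL2Z_eq: "PSL2Z = PSL2R\<lparr>carrier := \<Gamma>\<rparr>"
  by (simp add: PSL2Z_def)

lemma group_PSL2Z: "group PSL2Z"
  using subgroup.subgroup_is_group[OF subgroup_modular group_PSL2R] by (simp flip: PSL2Z_eq)

lemma PSL2Z_inv [simp]: "k \<in> \<Gamma> \<Longrightarrow> inv\<^bsub>PSL2Z\<^esub> k = pinv k"
  using PSL.m_inv_consistent[OF subgroup_modular] by (simp flip: PSL2Z_eq)

text \<open>The rewrites let every fact about \<open>PSL2Z\<close> speak of the product and unit of
  \<open>PSL2R\<close>, so that one notation serves both groups.\<close>

interpretation PSLZ: group PSL2Z
  rewrites "(\<otimes>\<^bsub>PSL2Z\<^esub>) = (\<otimes>\<^bsub>PSL2R\<^esub>)" and "\<one>\<^bsub>PSL2Z\<^esub> = \<one>\<^bsub>PSL2R\<^esub>"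
  by (simp_all add: group_PSL2Z)

lemma C_mat_pm: "C_mat = pm 0 1 (- 1) 1"
  by (simp add: C_mat_def pm_def mat2_def)

lemma L_mat_pm: "L_mat = pm 1 1 0 1"
  by (simp add: L_mat_def pm_def mat2_def)

lemma C_mat_modular [simp]: "C_mat \<in> \<Gamma>" and L_mat_modular [simp]: "L_mat \<in> \<Gamma>"
  by (auto simp: C_mat_pm L_mat_pm intro!: modular_pm')

lemma L2_pm: "L2 = pm 1 2 0 1"
  by (simp add: L2_def L_mat_pm numeral_2_eq_2 PSLZ.nat_pow_Suc PSLZ.nat_pow_0)
    (simp add: pm_mult flip: pm_one)

text \<open>Up to sign, \<open>C_mat \<cdot> C_mat \<cdot> L_mat\<close> is the lower triangular
  counterpart of \<open>L_mat\<close>; its square is the class stated here.\<close>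

lemma R2_pm: "R2 = pm 1 0 2 1"
  by (simp add: R2_def L_mat_pm C_mat_pm numeral_2_eq_2 PSLZ.nat_pow_Suc PSLZ.nat_pow_0)
    (simp add: pm_mult pm_eq_iff flip: pm_one)

lemma L2_modular [simp]: "L2 \<in> \<Gamma>" and R2_modular [simp]: "R2 \<in> \<Gamma>"
  by (auto simp: L2_pm R2_pm intro!: modular_pm')

lemma L_power_pm: "pm 1 (of_int n) 0 1 \<in> \<Gamma>"
  by (rule modular_pm') simp_all

text \<open>As \<open>L\<inverse> = C L C\<close> and \<open>C\<^sup>3 = 1\<close>, the group is generated by \<open>C\<close> and \<open>L\<close> as a monoid.\<close>

lemma CLC: "C_mat \<cdot> L_mat \<cdot> C_mat = pm 1 (- 1) 0 1"
  by (simp add: C_mat_pm L_mat_pm pm_mult pm_eq_iff)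

lemma CCC: "C_mat \<cdot> C_mat \<cdot> C_mat = \<one>\<^bsub>PSL2R\<^esub>"
  by (simp add: C_mat_pm pm_mult pm_eq_iff flip: pm_one)

text \<open>Generation as a monoid is the useful form: coset representatives, frames carrying tiles
  and index vectors are all followed along right multiplication by \<open>C_mat\<close> and
  \<open>L_mat\<close>, and inverses of generators give no extra case.\<close>

lemma modular_induct [consumes 1, case_names one C L]:
  assumes k: "k \<in> \<Gamma>"
    and one: "P \<one>\<^bsub>PSL2R\<^esub>"
    and C: "\<And>k. k \<in> \<Gamma> \<Longrightarrow> P k \<Longrightarrow> P (k \<cdot> C_mat)"
    and L: "\<And>k. k \<in> \<Gamma> \<Longrightarrow> P k \<Longrightarrow> P (k \<cdot> L_mat)"
  shows "P k"
proof -
  have Linv: "P (k \<cdot> pm 1 (- 1) 0 1)" if "k \<in> \<Gamma>" "P k" for k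
    using C[OF _ L[OF _ C[OF that]]] that by (simp add: PSL.m_assoc flip: CLC)
  have Lpow: "P (k \<cdot> pm 1 (of_int n) 0 1)" if "k \<in> \<Gamma>" "P k" for k and n :: int
  proof (induction n rule: int_induct[where k = 0])
    case base
    then show ?case using that by simp
  next
    case (step1 i)
    have "pm 1 (of_int (i + 1)) 0 1 = pm 1 (of_int i) 0 1 \<cdot> L_mat" by (simp add: L_mat_pm pm_mult add.commute)
    then show ?case using L[OF _ step1(2)] that L_power_pm by (simp add: PSL.m_assoc del: of_int_add)
  next
    case (step2 i)
    have "pm 1 (of_int (i - 1)) 0 1 = pm 1 (of_int i) 0 1 \<cdot> pm 1 (- 1) 0 1" by (simp add: pm_mult)
    then show ?case using Linv[OF _ step2(2)] that L_power_pm by (simp add: PSL.m_assoc del: of_int_diff)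
  qed
  have "P (pm (of_int a) (of_int b) (of_int c) (of_int d))" if "a * d - b * c = 1" for a b c d :: int
    using that
  proof (induction "nat \<bar>c\<bar>" arbitrary: a b c d rule: less_induct)
    case less
    show ?case
    proof (cases "c = 0")
      case True
      then have "a * d = 1" using less.prems by simp
      then have "(a = 1 \<and> d = 1) \<or> (a = - 1 \<and> d = - 1)" by (metis zmult_eq_1_iff)
      then have "pm (of_int a) (of_int b) (of_int c) (of_int d) = pm 1 (of_int (a * b)) 0 1"
        using True by (auto simp: pm_eq_iff)
      then show ?thesis using Lpow[OF modular_one one, of "a * b"] by (simp add: L_power_pm)
    next
      case False
      \<comment> \<open>A Euclidean step on the lower row: right multiplication by
        \<open>C_mat \<cdot> L_mat\<close> turns the row (- r, c) into (c, r) up to sign, and the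
        m-th power of \<open>L_mat\<close> then restores d = m * c + r. The induction descends from
        |c| to |r|.\<close>
      define m where "m = d div c"
      define r where "r = d mod c"
      have d: "d = m * c + r" by (simp add: m_def r_def)
      have r: "\<bar>r\<bar> < \<bar>c\<bar>" using False by (simp add: r_def abs_mod_less)
      define b' where "b' = b - m * a"
      have det: "b' * (- c) - (- a) * r = 1" "a * r - b' * c = 1"
        using less.prems by (simp_all add: b'_def d algebra_simps)
      have IH: "P (pm (of_int (- b')) (of_int a) (of_int (- r)) (of_int c))"
        by (rule less.hyps) (use r False det in \<open>auto simp: algebra_simps\<close>)
      have inG: "pm (of_int (- b')) (of_int a) (of_int (- r)) (of_int c) \<in> \<Gamma>"
        by (rule modular_pm) (use det in \<open>auto simp: algebra_simps\<close>)
      have "P (pm (of_int (- b')) (of_int a) (of_int (- r)) (of_int c) \<cdot> C_mat \<cdot> L_mat)"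
        by (intro L C IH) (use inG in auto)
      moreover have "pm (of_int (- b')) (of_int a) (of_int (- r)) (of_int c) \<cdot> C_mat \<cdot> L_mat =
          pm (of_int a) (of_int b') (of_int c) (of_int r)"
        by (simp add: C_mat_pm L_mat_pm pm_mult pm_eq_iff)
      ultimately have "P (pm (of_int a) (of_int b') (of_int c) (of_int r))" by simp
      from Lpow[OF modular_pm this, of m] show ?thesis
        using det by (simp add: pm_mult b'_def d algebra_simps)
    qed
  qed
  then show ?thesis using k by (metis modular_cases)
qed

section \<open>Abelianization of a free group of rank two\<close>

definition exponent_sum :: "nat \<Rightarrow> (nat \<times> bool) list \<Rightarrow> int" where
  "exponent_sum i ws = (\<Sum>(j, e)\<leftarrow>ws. if j = i then if e then 1 else - 1 else 0)"

lemma exponent_sum_simps [simp]: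
  "exponent_sum i [] = 0"
  "exponent_sum i ((j, e) # ws) =
    (if j = i then if e then 1 else - 1 else 0) + exponent_sum i ws"
  "exponent_sum i (us @ vs) = exponent_sum i us + exponent_sum i vs"
  by (simp_all add: exponent_sum_def)

definition inverse_word :: "(nat \<times> bool) list \<Rightarrow> (nat \<times> bool) list" where
  "inverse_word ws = rev (map (\<lambda>(i, e). (i, \<not> e)) ws)"

lemma exponent_sum_inverse_word [simp]: "exponent_sum i (inverse_word ws) = - exponent_sum i ws"
  by (induction ws) (auto simp: inverse_word_def)

lemma fst_set_inverse_word [simp]: "fst ` set (inverse_word ws) = fst ` set ws"
  by (force simp: inverse_word_def)

lemma not_reduced_split:
  assumes "\<not> reduced_word ws"
  obtains us i e vs where "ws = us @ (i, e) # (i, \<not> e) # vs"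
proof -
  have "\<exists>us i e vs. ws = us @ (i, e) # (i, \<not> e) # vs"
    using assms
  proof (induction ws)
    case Nil
    then show ?case by (simp add: reduced_word_def)
  next
    case (Cons x ws)
    show ?case
    proof (cases "reduced_word ws")
      case True
      with Cons.prems obtain y ys where ws: "ws = y # ys" "\<not> (\<lambda>(i, e) (j, e'). \<not> (i = j \<and> e \<noteq> e')) x y"
        by (cases ws) (auto simp: reduced_word_def)
      then have "x # ws = [] @ (fst x, snd x) # (fst x, \<not> snd x) # ys"
        by (cases x; cases y) auto
      then show ?thesis by blast
    next
      case False
      then obtain us i e vs where "ws = us @ (i, e) # (i, \<not> e) # vs" using Cons.IH by blast
      then have "x # ws = (x # us) @ (i, e) # (i, \<not> e) # vs" by simp
      then show ?thesis by blast
    qed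
  qed
  then show ?thesis using that by blast
qed

context group
begin

lemma word_value_simps [simp]:
  "word_value G gs [] = \<one>"
  "word_value G gs ((i, e) # ws) = (if e then gs ! i else inv (gs ! i)) \<otimes> word_value G gs ws"
  by (simp_all add: word_value_def)

lemma word_value_closed [simp]:
  assumes "set gs \<subseteq> carrier G"
  shows "fst ` set ws \<subseteq> {..<length gs} \<Longrightarrow> word_value G gs ws \<in> carrier G"
proof (induction ws)
  case (Cons x ws)
  then have "gs ! fst x \<in> carrier G" using assms by (auto intro!: subsetD[OF assms])
  then show ?case using Cons by (cases x) auto
qed simp

lemma word_value_append:
  assumes "set gs \<subseteq> carrier G" "fst ` set us \<subseteq> {..<length gs}" "fst ` set vs \<subseteq> {..<length gs}"
  shows "word_value G gs (us @ vs) = word_value G gs us \<otimes> word_value G gs vs"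
  using assms(2)
proof (induction us)
  case Nil
  then show ?case using assms by simp
next
  case (Cons x us)
  then have "gs ! fst x \<in> carrier G" using assms by (auto intro!: subsetD[OF assms(1)])
  then show ?case using Cons assms by (cases x) (auto simp: m_assoc)
qed

lemma word_value_inverse_word:
  assumes "set gs \<subseteq> carrier G" "fst ` set ws \<subseteq> {..<length gs}"
  shows "word_value G gs (inverse_word ws) = inv (word_value G gs ws)"
  using assms(2)
proof (induction ws)
  case Nil
  then show ?case by (simp add: inverse_word_def)
next
  case (Cons x ws)
  obtain i e where x: "x = (i, e)" by (cases x)
  have i: "gs ! i \<in> carrier G" using Cons.prems assms by (auto simp: x intro!: subsetD[OF assms(1)])
  have "inverse_word (x # ws) = inverse_word ws @ [(i, \<not> e)]" by (simp add: inverse_word_def x)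
  moreover have "fst ` set ws \<subseteq> {..<length gs}" "i < length gs" using Cons.prems by (auto simp: x)
  ultimately show ?case
    using Cons.IH assms(1) i by (simp add: word_value_append x inv_mult_group)
qed

lemma generate_word_value:
  assumes "set gs \<subseteq> carrier G" "x \<in> generate G (set gs)"
  shows "\<exists>ws. fst ` set ws \<subseteq> {..<length gs} \<and> word_value G gs ws = x"
  using assms(2)
proof (induction rule: generate.induct)
  case one
  then show ?case by (intro exI[of _ "[]"]) simp
next
  case (incl h)
  then obtain i where "i < length gs" "gs ! i = h" by (auto simp: in_set_conv_nth)
  then show ?case using incl assms by (intro exI[of _ "[(i, True)]"]) auto
next
  case (inv h)
  then obtain i where "i < length gs" "gs ! i = h" by (auto simp: in_set_conv_nth)
  then show ?case using inv assms by (intro exI[of _ "[(i, False)]"]) auto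
next
  case (eng h1 h2)
  then obtain us vs where "fst ` set us \<subseteq> {..<length gs}" "word_value G gs us = h1"
    "fst ` set vs \<subseteq> {..<length gs}" "word_value G gs vs = h2" by blast
  then show ?case
    by (intro exI[of _ "us @ vs"]) (simp add: image_Un word_value_append[OF assms(1)])
qed

text \<open>By freeness a nonempty word with trivial value is not reduced, so it contains a letter
  next to its inverse. Deleting the pair changes neither the value nor any exponent sum and shortens
  the word.\<close>

lemma trivial_word_exponent_sum:
  assumes free: "freely_generate G gs H"
    and "fst ` set ws \<subseteq> {..<length gs}" "word_value G gs ws = \<one>"
  shows "exponent_sum i ws = 0"
  using assms(2,3)
proof (induction "length ws" arbitrary: ws rule: less_induct)
  case less
  have gs: "set gs \<subseteq> carrier G" using free by (simp add: freely_generate_def)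
  show ?case
  proof (cases "reduced_word ws")
    case True
    then have "ws = []" using free less.prems unfolding freely_generate_def by blast
    then show ?thesis by simp
  next
    case False
    then obtain us j e vs where ws: "ws = us @ (j, e) # (j, \<not> e) # vs" by (rule not_reduced_split)
    have sets: "fst ` set us \<subseteq> {..<length gs}" "fst ` set vs \<subseteq> {..<length gs}" "j < length gs"
      using less.prems by (auto simp: ws)
    have j: "gs ! j \<in> carrier G" using sets gs by auto
    have "word_value G gs ((j, e) # (j, \<not> e) # vs) = word_value G gs vs"
      using j word_value_closed[OF gs sets(2)] by (auto simp flip: m_assoc)
    then have "word_value G gs ws = word_value G gs (us @ vs)"
      unfolding ws using sets by (subst (1 2) word_value_append[OF gs]) auto
    then have "exponent_sum i (us @ vs) = 0"
      using less.prems sets by (intro less.hyps) (auto simp: ws)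
    then show ?thesis by (simp add: ws)
  qed
qed

lemma word_value_eq_exponent_sum:
  assumes free: "freely_generate G gs H"
    and us: "fst ` set us \<subseteq> {..<length gs}" and vs: "fst ` set vs \<subseteq> {..<length gs}"
    and eq: "word_value G gs us = word_value G gs vs"
  shows "exponent_sum i us = exponent_sum i vs"
proof -
  have gs: "set gs \<subseteq> carrier G" using free by (simp add: freely_generate_def)
  have "word_value G gs (us @ inverse_word vs) = \<one>"
    using us vs eq gs by (simp add: word_value_append word_value_inverse_word)
  from trivial_word_exponent_sum[OF free _ this, of i] us vs show ?thesis
    by (simp add: image_Un)
qed

text \<open>Exponent sums give the homomorphism. Its kernel is the derived subgroup because in the
  quotient by the derived subgroup, which is commutative, the class of an element is already
  determined by its two exponent sums.\<close>

lemma free_abelianization: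
  assumes free: "freely_generate G [a, b] H"
  shows "\<exists>\<alpha>. abelianization_map (G\<lparr>carrier := H\<rparr>) (integer_group \<times>\<times> integer_group) \<alpha> \<and>
    \<alpha> a = (1, 0) \<and> \<alpha> b = (0, 1)"
proof -
  let ?gs = "[a, b]"
  let ?E = "G\<lparr>carrier := H\<rparr>"
  let ?Z2 = "integer_group \<times>\<times> integer_group"
  have gs: "set ?gs \<subseteq> carrier G" and H: "H = generate G (set ?gs)"
    using free by (simp_all add: freely_generate_def)
  have ab: "a \<in> carrier G" "b \<in> carrier G" using gs by auto
  have sub: "subgroup H G" unfolding H by (rule generate_is_subgroup[OF gs])
  interpret E: group ?E by (rule subgroup.subgroup_is_group[OF sub is_group])
  interpret Z2: comm_group ?Z2
    by (rule group.group_comm_groupI)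
      (auto simp: DirProd_group)
  define wd where "wd ws \<longleftrightarrow> fst ` set ws \<subseteq> {..<length ?gs}" for ws :: "(nat \<times> bool) list"
  \<comment> \<open>The value is read off from a chosen word;
    \<open>word_value_eq_exponent_sum\<close> makes it independent of the choice.\<close>
  define \<alpha> where "\<alpha> x = (let ws = SOME ws. wd ws \<and> word_value G ?gs ws = x
    in (exponent_sum 0 ws, exponent_sum 1 ws))" for x
  have \<alpha>: "\<alpha> (word_value G ?gs ws) = (exponent_sum 0 ws, exponent_sum 1 ws)" if "wd ws" for ws
  proof -
    have "\<exists>ws'. wd ws' \<and> word_value G ?gs ws' = word_value G ?gs ws" using that by blast
    from someI_ex[OF this] have *: "wd ws'" "word_value G ?gs ws' = word_value G ?gs ws"
      if "ws' = (SOME ws'. wd ws' \<and> word_value G ?gs ws' = word_value G ?gs ws)" for ws'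
      using that by simp_all
    show ?thesis unfolding \<alpha>_def Let_def
      using word_value_eq_exponent_sum[OF free _ _ *(2)[OF refl]] that *(1)[OF refl]
      by (simp only: wd_def prod.inject)
  qed
  have word: "\<exists>ws. wd ws \<and> word_value G ?gs ws = x" if "x \<in> H" for x
    using generate_word_value[OF gs] that unfolding H wd_def by blast
  have \<alpha>a: "\<alpha> a = (1, 0)" using \<alpha>[of "[(0, True)]"] ab by (simp add: wd_def)
  have \<alpha>b: "\<alpha> b = (0, 1)" using \<alpha>[of "[(1, True)]"] ab by (simp add: wd_def)
  have hom: "\<alpha> \<in> hom ?E ?Z2"
  proof (rule homI)
    fix x y assume "x \<in> carrier ?E" "y \<in> carrier ?E"
    then obtain us vs where *: "wd us" "word_value G ?gs us = x" "wd vs" "word_value G ?gs vs = y"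
      using word[of x] word[of y] by auto
    have "wd (us @ vs)" using * by (simp add: wd_def image_Un)
    from \<alpha>[OF this] have "\<alpha> (x \<otimes> y) = (exponent_sum 0 (us @ vs), exponent_sum 1 (us @ vs))"
      using * word_value_append[OF gs] by (simp add: wd_def)
    then show "\<alpha> (x \<otimes>\<^bsub>?E\<^esub> y) = \<alpha> x \<otimes>\<^bsub>?Z2\<^esub> \<alpha> y"
      using \<alpha>[OF *(1)] \<alpha>[OF *(3)] * by simp
  qed simp
  interpret hom: group_hom ?E ?Z2 \<alpha>
    by unfold_locales (rule hom)
  have aE: "a \<in> carrier ?E" and bE: "b \<in> carrier ?E" by (auto simp: H intro: generate.incl)
  let ?D = "derived ?E (carrier ?E)"
  interpret D: normal ?D ?E by (rule E.derived_self_is_normal)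
  define Q where "Q = ?E Mod ?D"
  define \<pi> where "\<pi> x = ?D #>\<^bsub>?E\<^esub> x" for x
  interpret Q: comm_group Q unfolding Q_def by (rule E.derived_quot_is_comm_group)
  have \<pi>: "\<pi> \<in> hom ?E Q" unfolding \<pi>_def Q_def by (rule D.r_coset_hom_Mod)
  interpret \<pi>: group_hom ?E Q \<pi> by unfold_locales (rule \<pi>)
  note \<pi>ab = \<pi>.hom_closed[OF aE] \<pi>.hom_closed[OF bE]
  define Qp where "Qp x n = x [^]\<^bsub>Q\<^esub> (n :: int)" for x n
  \<comment> \<open>Reordering in the commutative quotient: x is congruent to a power of a times a
    power of b, with exponents \<open>\<alpha> x\<close>. An element with \<alpha> trivial therefore
    lies in the derived subgroup.\<close>
  have Qp: "\<pi> x = Qp (\<pi> a) (fst (\<alpha> x)) \<otimes>\<^bsub>Q\<^esub> Qp (\<pi> b) (snd (\<alpha> x))" if "x \<in> H" for x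
  proof -
    have c: "Qp (\<pi> a) n \<in> carrier (Q)" "Qp (\<pi> b) n \<in> carrier (Q)" for n
      unfolding Qp_def by (rule Q.int_pow_closed, fact)+
    have inv_eq: "inv x = inv\<^bsub>?E\<^esub> x" if "x \<in> H" for x
      using m_inv_consistent[OF sub that] by simp
    show ?thesis
      using that unfolding H
    proof (induction rule: generate.induct)
      case one
      then show ?case using hom.hom_one \<pi>.hom_one by (simp add: Qp_def)
    next
      case (incl h)
      then show ?case using \<pi>ab
        by (auto simp: Qp_def \<alpha>a \<alpha>b Q.int_pow_1)
    next
      case (inv h)
      then consider "h = a" | "h = b" by auto
      then show ?case
        by cases (use aE bE \<pi>ab hom.hom_inv \<pi>.hom_inv in
          \<open>simp_all add: Qp_def inv_eq \<alpha>a \<alpha>b Q.int_pow_neg Q.int_pow_1\<close>)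
    next
      case (eng h1 h2)
      have h: "h1 \<in> carrier ?E" "h2 \<in> carrier ?E" using eng by (auto simp: H)
      have \<alpha>h: "\<alpha> (h1 \<otimes> h2) = (fst (\<alpha> h1) + fst (\<alpha> h2), snd (\<alpha> h1) + snd (\<alpha> h2))"
        using hom.hom_mult[OF h] by (simp add: mult_DirProd')
      have \<pi>h: "\<pi> (h1 \<otimes> h2) = \<pi> h1 \<otimes>\<^bsub>Q\<^esub> \<pi> h2" using \<pi>.hom_mult[OF h] by simp
      have add: "Qp (\<pi> a) (m + n) = Qp (\<pi> a) m \<otimes>\<^bsub>Q\<^esub> Qp (\<pi> a) n"
         "Qp (\<pi> b) (m + n) = Qp (\<pi> b) m \<otimes>\<^bsub>Q\<^esub> Qp (\<pi> b) n" for m n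
        unfolding Qp_def by (rule Q.int_pow_mult, fact)+
      show ?case unfolding \<pi>h eng.IH \<alpha>h fst_conv snd_conv add
        using c by (simp add: Q.m_ac)
    qed
  qed
  have "kernel ?E ?Z2 \<alpha> \<subseteq> ?D"
  proof
    fix x assume "x \<in> kernel ?E ?Z2 \<alpha>"
    then have x: "x \<in> H" "\<alpha> x = (0, 0)" by (auto simp: kernel_def)
    have "\<pi> x = \<one>\<^bsub>Q\<^esub>" using Qp[OF x(1)] by (simp add: x(2) Qp_def)
    then have "?D #>\<^bsub>?E\<^esub> x = ?D" by (simp add: \<pi>_def Q_def FactGroup_def)
    then show "x \<in> ?D" using E.coset_join1 x(1) D.subgroup_axioms by simp
  qed
  moreover have "?D \<subseteq> kernel ?E ?Z2 \<alpha>"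
  proof -
    have "\<alpha> ` ?D = {\<one>\<^bsub>?Z2\<^esub>}"
      using hom.derived_img[of "carrier ?E"] Z2.derived_eq_singleton[of "\<alpha> ` carrier ?E"] by auto
    moreover have "?D \<subseteq> carrier ?E" by (rule E.derived_in_carrier) simp
    ultimately show ?thesis unfolding kernel_def by blast
  qed
  moreover have "\<alpha> ` carrier ?E = carrier ?Z2"
  proof -
    have "(m, n) \<in> \<alpha> ` carrier ?E" for m n :: int
    proof -
      define x where "x = a [^]\<^bsub>?E\<^esub> m \<otimes>\<^bsub>?E\<^esub> b [^]\<^bsub>?E\<^esub> n"
      have x: "x \<in> carrier ?E" using aE bE unfolding x_def
        by (intro E.m_closed E.int_pow_closed)
      have pw: "(p, q) [^]\<^bsub>?Z2\<^esub> k = (k * p, k * q)" for p q k :: int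
      proof -
        have nat: "(p, q) [^]\<^bsub>?Z2\<^esub> k = (int k * p, int k * q)" for k :: nat
          by (induction k) (simp_all add: Z2.nat_pow_Suc algebra_simps)
        show ?thesis by (cases k rule: int_cases4) (simp_all add: Z2.int_pow_neg int_pow_int nat)
      qed
      have "\<alpha> x = \<alpha> (a [^]\<^bsub>?E\<^esub> m) \<otimes>\<^bsub>?Z2\<^esub> \<alpha> (b [^]\<^bsub>?E\<^esub> n)"
        unfolding x_def by (intro hom.hom_mult E.int_pow_closed aE bE)
      also have "\<alpha> (a [^]\<^bsub>?E\<^esub> m) = (m, 0)"
        using hom.hom_int_pow[OF aE, of m] by (simp add: \<alpha>a pw)
      also have "\<alpha> (b [^]\<^bsub>?E\<^esub> n) = (0, n)"
        using hom.hom_int_pow[OF bE, of n] by (simp add: \<alpha>b pw)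
      finally have "\<alpha> x = (m, n)" by simp
      then show ?thesis using x by force
    qed
    then show ?thesis by auto
  qed
  ultimately have "abelianization_map ?E ?Z2 \<alpha>"
    unfolding abelianization_map_def using hom Z2.comm_group_axioms by auto
  then show ?thesis using \<alpha>a \<alpha>b by blast
qed

end

section \<open>The action on the upper half-plane\<close>

abbreviation act :: "(real^2^2) set \<Rightarrow> complex \<Rightarrow> complex" where
  "act \<equiv> psl_act"

abbreviation \<H> :: "complex set" where
  "\<H> \<equiv> upper_half_plane"

lemma act_pm: "act (pm a b c d) z = (of_real a * z + of_real b) / (of_real c * z + of_real d)"
proof -
  have "(- of_real a * z - of_real b) / (- of_real c * z - of_real d)
      = (of_real a * z + of_real b) / (of_real c * z + of_real d)"
    using minus_divide_divide[of "of_real a * z + of_real b" "of_real c * z + of_real d"]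
    by (simp only: minus_add_distrib mult_minus_left diff_conv_add_uminus)
  then show ?thesis by (simp add: psl_act_def pm_eq moebius_def)
qed

lemma \<H>_iff [simp]: "z \<in> \<H> \<longleftrightarrow> Im z > 0"
  by (simp add: upper_half_plane_def)

lemma moebius_denom_nonzero:
  assumes "a * d - b * c = (1::real)" "Im z > 0"
  shows "of_real c * z + of_real d \<noteq> 0"
proof
  assume "of_real c * z + of_real d = 0"
  then have "c * Im z = 0" "c * Re z + d = 0"
    by (simp_all add: complex_eq_iff)
  then show False using assms by auto
qed

lemma Im_act:
  assumes "a * d - b * c = 1"
  shows "Im (act (pm a b c d) z) = Im z / (cmod (of_real c * z + of_real d))\<^sup>2"
proof -
  have "Im ((of_real a * z + of_real b) * cnj (of_real c * z + of_real d)) = (a * d - b * c) * Im z"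
    by (simp add: algebra_simps)
  then show ?thesis
    unfolding act_pm complex_div_cnj[of "of_real a * z + of_real b"] using assms
    by (simp flip: of_real_power del: of_real_power)
qed

lemma Im_act_pos_iff:
  assumes "g \<in> carrier PSL2R"
  shows "Im (act g z) > 0 \<longleftrightarrow> Im z > 0"
proof -
  obtain a b c d where g: "g = pm a b c d" "a * d - b * c = 1" using assms by (rule PSL2R_cases)
  show ?thesis
    unfolding g(1) Im_act[OF g(2)] using moebius_denom_nonzero[OF g(2), of z]
    by (auto simp: zero_less_divide_iff)
qed

lemma act_one [simp]: "act \<one>\<^bsub>PSL2R\<^esub> z = z"
  by (simp add: act_pm flip: pm_one)

lemma act_mult:
  assumes "g \<in> carrier PSL2R" "h \<in> carrier PSL2R" "Im z > 0"
  shows "act (g \<cdot> h) z = act g (act h z)"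
proof -
  obtain a b c d where g: "g = pm a b c d" "a * d - b * c = 1" using assms(1) by (rule PSL2R_cases)
  obtain a' b' c' d' where h: "h = pm a' b' c' d'" "a' * d' - b' * c' = 1" using assms(2) by (rule PSL2R_cases)
  define N where "N = of_real a' * z + of_real b'"
  define D where "D = of_real c' * z + of_real d'"
  have "D \<noteq> 0" unfolding D_def by (rule moebius_denom_nonzero[OF h(2) assms(3)])
  have "act g (act h z) = (of_real a * (N / D) + of_real b) / (of_real c * (N / D) + of_real d)"
    by (simp add: g h act_pm N_def D_def)
  also have "\<dots> = (of_real a * N + of_real b * D) / (of_real c * N + of_real d * D)"
    using \<open>D \<noteq> 0\<close>
    by (subst mult_divide_mult_cancel_right[of D, symmetric]) (simp_all add: distrib_right)
  also have "\<dots> = act (g \<cdot> h) z"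
    unfolding g(1) h(1) pm_mult act_pm N_def D_def
    by (simp add: distrib_left distrib_right mult.assoc add_ac)
  finally show ?thesis ..
qed

lemma act_inv_act:
  assumes "g \<in> carrier PSL2R" "Im z > 0"
  shows "act (pinv g) (act g z) = z" "act g (act (pinv g) z) = z"
  using assms by (simp_all flip: act_mult)

section \<open>The subgroup \<open>\<E>\<close>\<close>

text \<open>\<open>L2\<close> is translation by 2 in the coordinate z, and \<open>R2\<close> is
  translation by 2 in the coordinate 1 / z; each letter gets the region beyond 1 or - 1 in its own
  coordinate. The base point \<i> has real part 0 in both coordinates and so avoids every
  region.\<close>

definition pingpong :: "nat \<times> bool \<Rightarrow> complex set" where
  "pingpong = (\<lambda>(i, e). {z. Im z > 0 \<and>
     (if e then (if i = 0 then Re z else Re (1 / z)) > 1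
      else (if i = 0 then Re z else Re (1 / z)) < - 1)})"

text \<open>This separates the regions of the two generators: the hypothesis says |z|^2 < |Re z|,
  which describes two discs over the intervals from - 1 to 0 and from 0 to 1.\<close>

lemma Re_inverse_bound:
  assumes "Im z > 0" "\<bar>Re (1 / z)\<bar> > 1"
  shows "\<bar>Re z\<bar> < 1"
proof -
  have "Re (1 / z) = Re z / ((Re z)\<^sup>2 + (Im z)\<^sup>2)" by (simp add: Re_divide)
  moreover have pos: "(Re z)\<^sup>2 + (Im z)\<^sup>2 > 0" using assms(1) by (simp add: add_nonneg_pos)
  ultimately have "1 < \<bar>Re z\<bar> / ((Re z)\<^sup>2 + (Im z)\<^sup>2)" using assms(2) by simp
  then have "(Re z)\<^sup>2 + (Im z)\<^sup>2 < \<bar>Re z\<bar>" using pos by (simp add: less_divide_eq)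
  then have "\<bar>Re z\<bar>\<^sup>2 < \<bar>Re z\<bar>" using zero_le_power2[of "Im z"] by (simp only: power2_abs)
  then have "\<bar>Re z\<bar> * \<bar>Re z\<bar> < \<bar>Re z\<bar> * 1" by (simp add: power2_eq_square)
  then show ?thesis by (metis abs_ge_zero mult_less_cancel_left)
qed

lemma freely_generate_E: "freely_generate PSL2Z [L2, R2] E_set"
proof -
  define gen where "gen i e = (if e then [L2, R2] ! i else pinv ([L2, R2] ! i))" for i e
  have gen: "gen 0 e = pm 1 (if e then 2 else - 2) 0 1" "gen (Suc 0) e = pm 1 0 (if e then 2 else - 2) 1" for e
    by (simp_all add: gen_def L2_pm R2_pm pinv_pm)
  have gen_closed: "gen i e \<in> carrier PSL2R" if "i < 2" for i e
    using that by (cases i) (auto simp: gen less_Suc_eq numeral_2_eq_2)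
  have val: "word_value PSL2Z [L2, R2] ((i, e) # ws) = gen i e \<cdot> word_value PSL2Z [L2, R2] ws"
    if "i < 2" for i e ws
    using that by (auto simp: gen_def less_Suc_eq numeral_2_eq_2)
  have val_closed: "word_value PSL2Z [L2, R2] ws \<in> \<Gamma>" if "fst ` set ws \<subseteq> {..<2}" for ws
    using that PSLZ.word_value_closed[of "[L2, R2]" ws] by (simp add: numeral_2_eq_2)
  \<comment> \<open>Each letter carries the base point, and every region except that of the inverse
    letter, into its own region.\<close>
  have step: "act (gen i e) z \<in> pingpong (i, e)"
    if i: "i < 2" and z: "z = \<i> \<or> (\<exists>j e'. z \<in> pingpong (j, e') \<and> j < 2 \<and> \<not> (i = j \<and> e \<noteq> e'))" for i e z
  proof -
    have Imz: "Im z > 0" using z by (auto simp: pingpong_def split: if_splits)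
    have Im': "Im (act (gen i e) z) > 0" using Imz gen_closed[OF i] by (simp add: Im_act_pos_iff)
    have z0: "z \<noteq> 0" using Imz by auto
    consider "i = 0" | "i = 1" using i by linarith
    then show ?thesis
    proof cases
      case 1
      have a: "act (gen i e) z = z + (if e then 2 else - 2)" by (simp add: 1 gen act_pm)
      have "(e \<longrightarrow> Re z > - 1) \<and> (\<not> e \<longrightarrow> Re z < 1)"
        using z
      proof (elim disjE exE conjE)
        fix j e' assume j: "z \<in> pingpong (j, e')" "j < 2" "\<not> (i = j \<and> e \<noteq> e')"
        show ?thesis
        proof (cases "j = 0")
          case True
          then show ?thesis using j 1 by (auto simp: pingpong_def split: if_splits)
        next
          case False
          then have "\<bar>Re (1 / z)\<bar> > 1" using j by (auto simp: pingpong_def split: if_splits)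
          from Re_inverse_bound[OF Imz this] show ?thesis by auto
        qed
      next
        assume "z = \<i>"
        then show ?thesis by simp
      qed
      then show ?thesis using Im' unfolding a by (auto simp: pingpong_def 1)
    next
      case 2
      have a: "1 / act (gen i e) z = 1 / z + (if e then 2 else - 2)"
        using z0 by (auto simp: 2 gen act_pm field_simps)
      \<comment> \<open>The map - 1 / z exchanges the two coordinates up to sign, so the bound for
        the first generator is reused for the second.\<close>
      have inv: "Im (- 1 / z) > 0" using Imz by (simp add: Im_divide sum_power2_gt_zero_iff)
      have "(e \<longrightarrow> Re (1 / z) > - 1) \<and> (\<not> e \<longrightarrow> Re (1 / z) < 1)"
        using z
      proof (elim disjE exE conjE)
        fix j e' assume j: "z \<in> pingpong (j, e')" "j < 2" "\<not> (i = j \<and> e \<noteq> e')"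
        show ?thesis
        proof (cases "j = 0")
          case True
          then have "\<bar>Re z\<bar> > 1" using j by (auto simp: pingpong_def split: if_splits)
          then have "\<bar>Re (1 / (- 1 / z))\<bar> > 1" by simp
          from Re_inverse_bound[OF inv this] show ?thesis by auto
        next
          case False
          then show ?thesis using j 2 by (auto simp: pingpong_def split: if_splits)
        qed
      next
        assume "z = \<i>"
        then show ?thesis by simp
      qed
      then show ?thesis using Im' a by (auto simp: pingpong_def 2)
    qed
  qed
  have ping: "act (word_value PSL2Z [L2, R2] ws) \<i> \<in> pingpong (hd ws)"
    if "ws \<noteq> []" "fst ` set ws \<subseteq> {..<2}" "reduced_word ws" for ws
    using that
  proof (induction ws)
    case (Cons x ws)
    obtain i e where x: "x = (i, e)" by (cases x)
    have i: "i < 2" and ws: "fst ` set ws \<subseteq> {..<2}" using Cons.prems by (auto simp: x)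
    have eq: "act (word_value PSL2Z [L2, R2] (x # ws)) \<i> = act (gen i e) (act (word_value PSL2Z [L2, R2] ws) \<i>)"
      unfolding x val[OF i] by (rule act_mult) (use gen_closed[OF i] modular_PSL2R[OF val_closed[OF ws]] in auto)
    show ?case
    proof (cases ws)
      case Nil
      then show ?thesis unfolding eq using step[OF i, of \<i> e] by (simp add: x)
    next
      case (Cons y ys)
      then have r: "reduced_word ws" "\<not> (i = fst y \<and> e \<noteq> snd y)"
        using Cons.prems by (cases y; auto simp: reduced_word_def x)+
      have "act (word_value PSL2Z [L2, R2] ws) \<i> \<in> pingpong (fst y, snd y)"
        using Cons.IH[OF _ ws r(1)] Cons by simp
      moreover have "fst y < 2" using ws Cons by auto
      ultimately show ?thesis unfolding eq using step[OF i, of _ e] r(2)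
        by (simp only: x list.sel) blast
    qed
  qed simp
  have "\<i> \<notin> pingpong x" for x by (cases x) (auto simp: pingpong_def)
  then have "word_value PSL2Z [L2, R2] ws \<noteq> \<one>\<^bsub>PSL2R\<^esub>"
    if "ws \<noteq> []" "fst ` set ws \<subseteq> {..<2}" "reduced_word ws" for ws
    using ping[OF that] by (metis act_one)
  then show ?thesis
    by (simp add: freely_generate_def E_set_def numeral_2_eq_2)
qed

lemma E_abelianization:
  "\<exists>\<alpha>. abelianization_map E_group (integer_group \<times>\<times> integer_group) \<alpha> \<and>
    \<alpha> L2 = (1, 0) \<and> \<alpha> R2 = (0, 1)"
  using PSLZ.free_abelianization[OF freely_generate_E] by (simp add: E_group_def)

lemma subgroup_E: "subgroup E_set PSL2Z"
  unfolding E_set_def by (rule PSLZ.generate_is_subgroup) simp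

lemma E_modular: "e \<in> E_set \<Longrightarrow> e \<in> \<Gamma>"
  using subgroup.subset[OF subgroup_E] by blast

lemma E_mult: "e \<in> E_set \<Longrightarrow> f \<in> E_set \<Longrightarrow> e \<cdot> f \<in> E_set"
  using subgroup.m_closed[OF subgroup_E] by simp

lemma E_inv: "e \<in> E_set \<Longrightarrow> pinv e \<in> E_set"
  using subgroup.m_inv_closed[OF subgroup_E, of e] by (simp add: E_modular)

lemma L2_E: "L2 \<in> E_set" and R2_E: "R2 \<in> E_set"
  by (auto simp: E_set_def intro: generate.incl)

text \<open>Reduced modulo 2, these are the six invertible matrices over the field with two
  elements. They are written as words so that right multiplication by \<open>C_mat\<close> permutes
  the list.\<close>

definition coset_reps :: "(real^2^2) set list" where
  "coset_reps = [\<one>\<^bsub>PSL2R\<^esub>, C_mat, C_mat \<cdot> C_mat, L_mat, L_mat \<cdot> C_mat, L_mat \<cdot> C_mat \<cdot> C_mat]"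

lemma coset_reps_modular: "set coset_reps \<subseteq> \<Gamma>"
  by (simp add: coset_reps_def)

text \<open>The multiplication table for \<open>L_mat\<close> on the right cosets: each product is
  an element of \<open>E_set\<close> times a representative.\<close>

lemma coset_rep_relations:
  "C_mat \<cdot> L_mat = pinv L2 \<cdot> (L_mat \<cdot> C_mat \<cdot> C_mat)"
  "C_mat \<cdot> C_mat \<cdot> L_mat = (R2 \<cdot> pinv L2) \<cdot> (L_mat \<cdot> C_mat)"
  "L_mat \<cdot> L_mat = L2 \<cdot> \<one>\<^bsub>PSL2R\<^esub>"
  "L_mat \<cdot> C_mat \<cdot> L_mat = \<one>\<^bsub>PSL2R\<^esub> \<cdot> (C_mat \<cdot> C_mat)"
  "L_mat \<cdot> C_mat \<cdot> C_mat \<cdot> L_mat = (L2 \<cdot> pinv R2) \<cdot> C_mat"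
  unfolding L_mat_pm C_mat_pm L2_pm R2_pm one_pm
  by (simp_all add: pinv_pm pm_mult pm_eq_iff del: pm_one)

lemma modular_coset_rep:
  assumes "k \<in> \<Gamma>"
  shows "\<exists>e\<in>E_set. \<exists>r\<in>set coset_reps. k = e \<cdot> r"
  using assms
proof (induction k rule: modular_induct)
  case one
  have "\<one>\<^bsub>PSL2R\<^esub> \<in> E_set" using subgroup.one_closed[OF subgroup_E] by simp
  then show ?case by (intro bexI[of _ "\<one>\<^bsub>PSL2R\<^esub>"]) (auto simp: coset_reps_def)
next
  case (C k)
  then obtain e r where er: "e \<in> E_set" "r \<in> set coset_reps" "k = e \<cdot> r" by blast
  have "r \<cdot> C_mat \<in> set coset_reps"
  proof -
    have CCC': "C_mat \<cdot> (C_mat \<cdot> C_mat) = \<one>\<^bsub>PSL2R\<^esub>" using CCC by (simp add: PSL.m_assoc)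
    show ?thesis using er(2) by (auto simp: coset_reps_def PSL.m_assoc CCC')
  qed
  moreover have "k \<cdot> C_mat = e \<cdot> (r \<cdot> C_mat)"
    using er(3) E_modular[OF er(1)] subsetD[OF coset_reps_modular er(2)] by (simp add: PSL.m_assoc)
  ultimately show ?case using er by blast
next
  case (L k)
  then obtain e r where er: "e \<in> E_set" "r \<in> set coset_reps" "k = e \<cdot> r" by blast
  have one: "\<one>\<^bsub>PSL2R\<^esub> \<in> E_set" using subgroup.one_closed[OF subgroup_E] by simp
  have "\<exists>f\<in>E_set. \<exists>s\<in>set coset_reps. r \<cdot> L_mat = f \<cdot> s"
  proof -
    let ?case = "\<exists>f\<in>E_set. \<exists>s\<in>{\<one>\<^bsub>PSL2R\<^esub>, C_mat, C_mat \<cdot> C_mat, L_mat, L_mat \<cdot> C_mat,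
      L_mat \<cdot> C_mat \<cdot> C_mat}. r \<cdot> L_mat = f \<cdot> s"
    consider "r = \<one>\<^bsub>PSL2R\<^esub>" | "r = C_mat" | "r = C_mat \<cdot> C_mat" | "r = L_mat"
      | "r = L_mat \<cdot> C_mat" | "r = L_mat \<cdot> C_mat \<cdot> C_mat"
      using er(2) by (auto simp: coset_reps_def)
    then have ?case
    proof cases
    assume "r = \<one>\<^bsub>PSL2R\<^esub>"
    then have "r \<cdot> L_mat = \<one>\<^bsub>PSL2R\<^esub> \<cdot> L_mat" by simp
    then show ?case using one by blast
  next
    assume "r = C_mat"
    then show ?case using coset_rep_relations(1) E_inv[OF L2_E] by blast
  next
    assume "r = C_mat \<cdot> C_mat"
    then show ?case using coset_rep_relations(2) E_mult[OF R2_E E_inv[OF L2_E]] by blast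
  next
    assume "r = L_mat"
    then show ?case using coset_rep_relations(3) L2_E by blast
  next
    assume "r = L_mat \<cdot> C_mat"
    then show ?case using coset_rep_relations(4) one by blast
  next
    assume "r = L_mat \<cdot> C_mat \<cdot> C_mat"
    then show ?case using coset_rep_relations(5) E_mult[OF L2_E E_inv[OF R2_E]] by blast
    qed
    then show ?thesis by (simp add: coset_reps_def)
  qed
  then obtain f s where fs: "f \<in> E_set" "s \<in> set coset_reps" "r \<cdot> L_mat = f \<cdot> s" by blast
  note inG = E_modular[OF er(1)] E_modular[OF fs(1)]
    subsetD[OF coset_reps_modular er(2)] subsetD[OF coset_reps_modular fs(2)]
  have "k \<cdot> L_mat = e \<cdot> (r \<cdot> L_mat)"
    using er(3) inG by (simp add: PSL.m_assoc)
  also have "\<dots> = (e \<cdot> f) \<cdot> s"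
    using fs(3) inG by (simp add: PSL.m_assoc)
  finally show ?case using er fs E_mult by blast
qed

text \<open>\<open>\<E>\<close> consists of matrices congruent to the identity modulo 2, so that the parities of the
  entries are constant on its right cosets.\<close>

lemma E_entries:
  assumes "e \<in> E_set"
  shows "\<exists>a b c d :: int. e = pm (of_int a) (of_int b) (of_int c) (of_int d) \<and>
    odd a \<and> even b \<and> even c \<and> odd d"
  using assms unfolding E_set_def
proof (induction rule: generate.induct)
  case one
  show ?case by (intro exI[of _ 1] exI[of _ 0]) simp
next
  case (incl h)
  then consider "h = pm (of_int 1) (of_int 2) (of_int 0) (of_int 1)"
    | "h = pm (of_int 1) (of_int 0) (of_int 2) (of_int 1)"
    by (auto simp: L2_pm R2_pm)
  then show ?case by cases (use odd_one dvd_refl[of "2::int"] dvd_0_right[of "2::int"] in blast)+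
next
  case (inv h)
  then have "inv\<^bsub>PSL2Z\<^esub> h = pinv L2 \<or> inv\<^bsub>PSL2Z\<^esub> h = pinv R2" by auto
  then consider "inv\<^bsub>PSL2Z\<^esub> h = pm (of_int 1) (of_int (- 2)) (of_int 0) (of_int 1)"
    | "inv\<^bsub>PSL2Z\<^esub> h = pm (of_int 1) (of_int 0) (of_int (- 2)) (of_int 1)"
    by (auto simp: L2_pm R2_pm pinv_pm)
  moreover have "even (- 2 :: int)" by simp
  ultimately show ?case by cases (use odd_one dvd_0_right[of "2::int"] in blast)+
next
  case (eng h1 h2)
  then obtain a b c d a' b' c' d' :: int where
    *: "h1 = pm (of_int a) (of_int b) (of_int c) (of_int d)" "odd a" "even b" "even c" "odd d"
      "h2 = pm (of_int a') (of_int b') (of_int c') (of_int d')" "odd a'" "even b'" "even c'" "odd d'"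
    by auto
  show ?case
    by (rule exI[of _ "a * a' + b * c'"], rule exI[of _ "a * b' + b * d'"],
        rule exI[of _ "c * a' + d * c'"], rule exI[of _ "c * b' + d * d'"])
      (use * in \<open>simp add: pm_mult\<close>)
qed

definition evenreal :: "real \<Rightarrow> bool" where
  "evenreal x \<longleftrightarrow> (\<exists>n :: int. x = of_int (2 * n))"

lemma evenreal_of_int [simp]: "evenreal (of_int n) \<longleftrightarrow> even n"
  by (auto simp: evenreal_def of_int_eq_iff simp del: of_int_mult)

lemma evenreal_minus [simp]: "evenreal (- x) \<longleftrightarrow> evenreal x"
proof -
  have "evenreal (- x)" if "evenreal x" for x
    using that unfolding evenreal_def
    by (metis mult_minus_right of_int_minus)
  then show ?thesis by (metis minus_minus)
qed

lemma evenreal_numeral [simp]: "evenreal 0" "evenreal 2" "\<not> evenreal 1"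
  using evenreal_of_int[of 0] evenreal_of_int[of 2] evenreal_of_int[of 1] by simp_all

text \<open>Taking the image over both matrices of a class avoids the choice of a sign; the result
  is a singleton because parity ignores signs.\<close>

definition parities :: "(real^2^2) set \<Rightarrow> (bool \<times> bool \<times> bool \<times> bool) set" where
  "parities g = (\<lambda>A. (evenreal (A$1$1), evenreal (A$1$2), evenreal (A$2$1), evenreal (A$2$2))) ` g"

lemma parities_pm: "parities (pm a b c d) = {(evenreal a, evenreal b, evenreal c, evenreal d)}"
  by (simp add: parities_def pm_eq)

lemma parities_E_mult:
  assumes "e \<in> E_set" "r \<in> \<Gamma>"
  shows "parities (e \<cdot> r) = parities r"
proof -
  obtain a b c d :: int where e: "e = pm (of_int a) (of_int b) (of_int c) (of_int d)"
    "odd a" "even b" "even c" "odd d" using E_entries[OF assms(1)] by blast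
  obtain a' b' c' d' :: int where r: "r = pm (of_int a') (of_int b') (of_int c') (of_int d')"
    using assms(2) by (rule modular_cases)
  have "e \<cdot> r = pm (of_int (a * a' + b * c')) (of_int (a * b' + b * d'))
      (of_int (c * a' + d * c')) (of_int (c * b' + d * d'))"
    by (simp add: e r pm_mult)
  then show ?thesis using e(2-) by (simp add: r parities_pm del: of_int_add of_int_mult)
qed

lemma coset_rep_unique:
  assumes "r \<in> set coset_reps" "s \<in> set coset_reps" "s = e \<cdot> r" "e \<in> E_set"
  shows "r = s"
proof -
  have reps: "coset_reps = [pm 1 0 0 1, pm 0 1 (- 1) 1, pm (- 1) 1 (- 1) 0, pm 1 1 0 1,
      pm (- 1) 2 (- 1) 1, pm (- 2) 1 (- 1) 0]"
    by (simp add: coset_reps_def C_mat_pm L_mat_pm pm_mult one_pm del: pm_one)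
  have "parities s = parities r"
    using assms coset_reps_modular parities_E_mult by blast
  then show ?thesis
    using assms(1,2) unfolding reps by (auto simp: parities_pm simp del: pm_one)
qed

lemma card_rcosets_E: "card (rcosets\<^bsub>PSL2Z\<^esub> E_set) = 6"
proof -
  let ?f = "\<lambda>r. E_set #>\<^bsub>PSL2Z\<^esub> r"
  have "rcosets\<^bsub>PSL2Z\<^esub> E_set = ?f ` set coset_reps"
  proof
    show "?f ` set coset_reps \<subseteq> rcosets\<^bsub>PSL2Z\<^esub> E_set"
      using coset_reps_modular by (auto simp: RCOSETS_def)
    show "rcosets\<^bsub>PSL2Z\<^esub> E_set \<subseteq> ?f ` set coset_reps"
    proof
      fix K assume "K \<in> rcosets\<^bsub>PSL2Z\<^esub> E_set"
      then obtain k where k: "k \<in> \<Gamma>" "K = ?f k" by (auto simp: RCOSETS_def)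
      then obtain e r where er: "e \<in> E_set" "r \<in> set coset_reps" "k = e \<cdot> r"
        using modular_coset_rep by blast
      have "?f k = ?f r"
        using PSLZ.repr_independence[OF _ _ subgroup_E, of k r] er coset_reps_modular
        by (auto simp: r_coset_def)
      then show "K \<in> ?f ` set coset_reps" using k er by blast
    qed
  qed
  moreover have "inj_on ?f (set coset_reps)"
  proof (rule inj_onI)
    fix r s assume rs: "r \<in> set coset_reps" "s \<in> set coset_reps" "?f r = ?f s"
    have "s \<in> ?f s" using rs coset_reps_modular by (intro PSLZ.rcos_self[OF _ subgroup_E]) auto
    then have "s \<in> ?f r" by (simp only: rs(3))
    then obtain e where e: "e \<in> E_set" "s = e \<cdot> r" by (auto simp: r_coset_def)
    then show "r = s" using coset_rep_unique rs by blast
  qed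
  moreover have "distinct coset_reps"
    by (simp add: coset_reps_def C_mat_pm L_mat_pm pm_mult one_pm pm_eq_iff del: pm_one)
  then have "card (set coset_reps) = length coset_reps" by (rule distinct_card)
  ultimately have "card (rcosets\<^bsub>PSL2Z\<^esub> E_set) = length coset_reps" by (simp only: card_image)
  then show ?thesis by (simp add: coset_reps_def)
qed

section \<open>Affine maps, images and cores\<close>

text \<open>For s > 0 this is the isometry sending z to s * z + b; the square roots normalize the
  determinant to 1.\<close>

definition aff :: "real \<Rightarrow> real \<Rightarrow> (real^2^2) set" where
  "aff s b = pm (sqrt s) (b / sqrt s) 0 (1 / sqrt s)"

lemma aff_carrier [simp]: "s > 0 \<Longrightarrow> aff s b \<in> carrier PSL2R"
  by (simp add: aff_def)

lemma act_aff: "s > 0 \<Longrightarrow> act (aff s b) z = of_real s * z + of_real b"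
proof -
  assume s: "s > 0"
  then have n: "complex_of_real (sqrt s) \<noteq> 0" by simp
  have "complex_of_real s = of_real (sqrt s) * of_real (sqrt s)"
    using s by (simp flip: of_real_mult)
  then show ?thesis using n by (simp add: aff_def act_pm distrib_right divide_simps)
qed

lemma aff_mult: "s > 0 \<Longrightarrow> t > 0 \<Longrightarrow> aff s b \<cdot> aff t c = aff (s * t) (s * c + b)"
  by (simp add: aff_def pm_mult real_sqrt_mult pm_eq_iff field_simps)

lemma aff_1_0: "aff 1 0 = \<one>\<^bsub>PSL2R\<^esub>"
  by (simp add: aff_def)

lemma aff_inject: "s > 0 \<Longrightarrow> t > 0 \<Longrightarrow> aff s b = aff t c \<longleftrightarrow> s = t \<and> b = c"
  by (auto simp: aff_def pm_eq_iff)
    (metis order_less_imp_not_less neg_less_0_iff_less real_sqrt_gt_0_iff)+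

lemma pinv_aff: "s > 0 \<Longrightarrow> pinv (aff s b) = aff (1 / s) (- b / s)"
  by (rule PSL.inv_equality) (simp_all add: aff_mult aff_1_0)

lemma L_mat_aff: "L_mat = aff 1 1"
  by (simp add: L_mat_pm aff_def)

lemma aff_1_modular [simp]: "aff 1 (of_int n) \<in> \<Gamma>"
  by (simp add: aff_def L_power_pm)

lemma Im_act_aff [simp]: "s > 0 \<Longrightarrow> Im (act (aff s b) z) = s * Im z"
  by (simp add: act_aff)

lemma continuous_on_act: "g \<in> carrier PSL2R \<Longrightarrow> continuous_on \<H> (act g)"
proof -
  assume "g \<in> carrier PSL2R"
  then obtain a b c d where g: "g = pm a b c d" "a * d - b * c = 1" by (rule PSL2R_cases)
  have "continuous_on \<H> (\<lambda>z. (of_real a * z + of_real b) / (of_real c * z + of_real d))"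
    by (intro continuous_intros) (use moebius_denom_nonzero[OF g(2)] in auto)
  then show ?thesis by (simp add: g act_pm[abs_def])
qed

lemma mem_act_image:
  assumes "g \<in> carrier PSL2R" "S \<subseteq> \<H>"
  shows "z \<in> act g ` S \<longleftrightarrow> Im z > 0 \<and> act (pinv g) z \<in> S"
proof
  assume "z \<in> act g ` S"
  then obtain w where w: "w \<in> S" "z = act g w" by blast
  have "Im w > 0" using w(1) assms(2) by auto
  then show "Im z > 0 \<and> act (pinv g) z \<in> S"
    using w assms by (simp add: act_inv_act Im_act_pos_iff)
next
  assume "Im z > 0 \<and> act (pinv g) z \<in> S"
  then show "z \<in> act g ` S" using act_inv_act(2)[OF assms(1), of z] by (metis imageI)
qed

lemma act_image_subset: "g \<in> carrier PSL2R \<Longrightarrow> S \<subseteq> \<H> \<Longrightarrow> act g ` S \<subseteq> \<H>"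
  by (auto simp: Im_act_pos_iff)

lemma act_image_mult:
  assumes "g \<in> carrier PSL2R" "h \<in> carrier PSL2R" "S \<subseteq> \<H>"
  shows "act (g \<cdot> h) ` S = act g ` act h ` S"
  unfolding image_image using assms by (intro image_cong refl act_mult) auto

lemma act_image_inv:
  assumes "g \<in> carrier PSL2R" "S \<subseteq> \<H>"
  shows "act (pinv g) ` act g ` S = S" "act g ` act (pinv g) ` S = S"
  using assms by (simp_all flip: act_image_mult)

lemma inj_on_act: "g \<in> carrier PSL2R \<Longrightarrow> inj_on (act g) \<H>"
  by (rule inj_on_inverseI[of _ "act (pinv g)"]) (simp add: act_inv_act)

lemma open_act_image:
  assumes "g \<in> carrier PSL2R" "open S" "S \<subseteq> \<H>"
  shows "open (act g ` S)"
proof -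
  have oH: "open \<H>" by (simp add: upper_half_plane_def open_halfspace_Im_gt)
  have "act g ` S = \<H> \<inter> act (pinv g) -` S"
    by (rule Set.set_eqI) (simp add: mem_act_image assms)
  then show ?thesis
    using continuous_open_preimage[OF continuous_on_act[OF PSL.inv_closed[OF assms(1)]] oH assms(2)] by simp
qed

lemma connected_act_image:
  "g \<in> carrier PSL2R \<Longrightarrow> connected S \<Longrightarrow> S \<subseteq> \<H> \<Longrightarrow> connected (act g ` S)"
  by (meson connected_continuous_image continuous_on_act continuous_on_subset)

text \<open>Overlap of tiles is tested on open cores, since neighbouring closed cores share
  edges.\<close>

definition ocore :: "complex set" where
  "ocore = {z. 0 < Re z \<and> Re z < 2 \<and> 1 < Im z \<and> Im z < 2}"

lemma ocore_box: "ocore = box \<i> (2 + 2 * \<i>)" and core_cbox: "core = cbox \<i> (2 + 2 * \<i>)"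
  by (auto simp: ocore_def core_def mem_box Basis_complex_def)

lemma open_ocore: "open ocore" and connected_ocore: "connected ocore"
  and closure_ocore: "closure ocore = core"
  and ocore_subset: "ocore \<subseteq> \<H>" and core_subset: "core \<subseteq> \<H>" and ocore_core: "ocore \<subseteq> core"
proof -
  have "1 + 3/2 * \<i> \<in> ocore" by (simp add: ocore_def)
  then have "box \<i> (2 + 2 * \<i>) \<noteq> {}" by (auto simp: ocore_box)
  then show "closure ocore = core" by (simp add: ocore_box core_cbox closure_box)
  show "open ocore" "connected ocore"
    by (simp_all add: ocore_box open_box convex_connected convex_box)
qed (auto simp: ocore_def core_def)

text \<open>If d is the hyperbolic distance, this is 2 * (cosh d - 1): an invariant that increases
  with d and is a rational expression in the coordinates.\<close>

definition hdist :: "complex \<Rightarrow> complex \<Rightarrow> real" where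
  "hdist z w = (cmod (z - w))\<^sup>2 / (Im z * Im w)"

lemma hdist_act:
  assumes "g \<in> carrier PSL2R" "Im z > 0" "Im w > 0"
  shows "hdist (act g z) (act g w) = hdist z w"
proof -
  obtain a b c d where g: "g = pm a b c d" "a * d - b * c = 1" using assms(1) by (rule PSL2R_cases)
  define D where "D z = of_real c * z + of_real d" for z :: complex
  have D: "D z \<noteq> 0" "D w \<noteq> 0" using assms moebius_denom_nonzero[OF g(2)] by (auto simp: D_def)
  have "(of_real a * z + of_real b) * D w - (of_real a * w + of_real b) * D z
      = of_real (a * d - b * c) * (z - w)"
    by (simp add: D_def algebra_simps)
  then have "act g z - act g w = (z - w) / (D z * D w)"
    using D g(2) by (simp add: g(1) act_pm diff_frac_eq flip: D_def)
  then show ?thesis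
    using D by (simp add: hdist_def g(1) Im_act[OF g(2)] norm_divide norm_mult power_mult_distrib power_divide
      flip: D_def)
qed

text \<open>The lower corners realize the hyperbolic diameter of the core, so that an isometry preserving
  the core fixes or swaps them.\<close>

lemma hdist_core:
  assumes "z \<in> core" "w \<in> core" "hdist z w = 4"
  shows "(z = \<i> \<and> w = 2 + \<i>) \<or> (z = 2 + \<i> \<and> w = \<i>)"
proof -
  define x y x' y' where d: "x = Re z" "y = Im z" "x' = Re w" "y' = Im w"
  have b: "0 \<le> x" "x \<le> 2" "1 \<le> y" "y \<le> 2" "0 \<le> x'" "x' \<le> 2" "1 \<le> y'" "y' \<le> 2"
    using assms by (auto simp: core_def d)
  have e: "(x - x')\<^sup>2 + (y - y')\<^sup>2 = 4 * (y * y')"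
    using assms(3) b by (simp add: hdist_def cmod_power2 divide_eq_eq flip: d)
  have "\<bar>x - x'\<bar> \<le> 2" using b by auto
  then have x4: "(x - x')\<^sup>2 \<le> 2\<^sup>2" by (metis abs_ge_zero power2_abs power_mono)
  \<comment> \<open>Since |x - x'| is at most 2, the equation leaves 4 * y * y' - 4 - (y - y')^2 at
    most 0. The present bound gives the opposite sign, with equality only if both points lie on the
    bottom edge.\<close>
  have sq: "4 * (u * v) - 4 - (u - v)\<^sup>2 \<ge> (v - u) * (4 - (v - u)) \<and>
      (4 * (u * v) - 4 - (u - v)\<^sup>2 = 0 \<longrightarrow> u = 1 \<and> v = 1)" if uv: "1 \<le> u" "u \<le> v" "v \<le> 2" for u v :: real
  proof -
    have m: "1 * (1 + (v - u)) \<le> u * v" using uv by (intro mult_mono) auto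
    have p: "(v - u) * (4 - (v - u)) \<ge> 0" using uv by (intro mult_nonneg_nonneg) auto
    have i: "4 * (u * v) - 4 - (u - v)\<^sup>2 \<ge> (v - u) * (4 - (v - u))"
      using m by (simp add: power2_eq_square algebra_simps)
    moreover have "u = 1 \<and> v = 1" if "4 * (u * v) - 4 - (u - v)\<^sup>2 = 0"
    proof -
      have "(v - u) * (4 - (v - u)) = 0" using i p that by linarith
      then have "u = v" using uv by auto
      with that have "u\<^sup>2 = 1" by (simp add: power2_eq_square)
      then show ?thesis using uv \<open>u = v\<close> by (simp add: power2_eq_1_iff)
    qed
    ultimately show ?thesis by blast
  qed
  have f: "4 * (y * y') - 4 - (y - y')\<^sup>2 \<le> 0" using e x4 by simp
  have "y = 1 \<and> y' = 1"
  proof (cases "y \<le> y'")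
    case True
    moreover have "(y' - y) * (4 - (y' - y)) \<ge> 0" using b True by (intro mult_nonneg_nonneg) auto
    ultimately show ?thesis using sq[of y y'] f b by linarith
  next
    case False
    moreover have "(y - y') * (4 - (y - y')) \<ge> 0" using b False by (intro mult_nonneg_nonneg) auto
    moreover have "(y - y')\<^sup>2 = (y' - y)\<^sup>2" "y * y' = y' * y" by (simp_all add: power2_commute)
    ultimately show ?thesis using sq[of y' y] f b by linarith
  qed
  then have "(x - x')\<^sup>2 = 2\<^sup>2" "y = 1" "y' = 1" using e by auto
  then have "x - x' = 2 \<or> x - x' = - 2" by (simp only: power2_eq_iff)
  then have "(x = 0 \<and> x' = 2) \<or> (x = 2 \<and> x' = 0)" using b by auto
  then show ?thesis using \<open>y = 1\<close> \<open>y' = 1\<close> by (auto simp: d complex_eq_iff)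
qed

text \<open>The two lower corners are fixed or swapped. Fixing both forces the identity; the half
  turn that swaps them moves 2 * \<i> to height 4/5, outside the core. Hence a core determines the
  placement of its tile, and cores can stand for elements of \<open>PSL2R\<close>.\<close>

lemma core_stabilizer:
  assumes m: "m \<in> carrier PSL2R" and eq: "act m ` core = core"
  shows "m = \<one>\<^bsub>PSL2R\<^esub>"
proof -
  obtain a b c d where g: "m = pm a b c d" "a * d - b * c = 1" using m by (rule PSL2R_cases)
  have in_core: "act m z \<in> core" if "z \<in> core" for z using eq that by blast
  have D: "of_real c * z + of_real d \<noteq> 0" if "Im z > 0" for z
    using moebius_denom_nonzero[OF g(2) that] .
  have c: "\<i> \<in> core" "2 + \<i> \<in> core" "2 * \<i> \<in> core" by (auto simp: core_def)
  have "hdist (act m \<i>) (act m (2 + \<i>)) = hdist \<i> (2 + \<i>)" by (rule hdist_act[OF m]) auto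
  also have "\<dots> = 4" by (simp add: hdist_def cmod_power2)
  finally consider "act m \<i> = \<i>" "act m (2 + \<i>) = 2 + \<i>" | "act m \<i> = 2 + \<i>" "act m (2 + \<i>) = \<i>"
    using hdist_core in_core c by meson
  then show ?thesis
  proof cases
    case 1
    then have e: "of_real a * \<i> + of_real b = \<i> * (of_real c * \<i> + of_real d)"
      "of_real a * (2 + \<i>) + of_real b = (2 + \<i>) * (of_real c * (2 + \<i>) + of_real d)"
      using D[of \<i>] D[of "2 + \<i>"] by (simp_all add: g(1) act_pm divide_eq_eq)
    then have "a = d" "b = - c" "a * 2 + b = c * 3 + 2 * d" "a = 4 * c + d"
      by (simp_all add: complex_eq_iff algebra_simps)
    then have "c = 0" "b = 0" "a = d" by auto
    then have "a = 1 \<or> a = - 1" using g(2) by (simp flip: power2_eq_square add: power2_eq_1_iff)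
    then show ?thesis using \<open>c = 0\<close> \<open>b = 0\<close> \<open>a = d\<close> by (auto simp: g(1) pm_eq_iff simp flip: pm_one)
  next
    case 2
    then have e: "of_real a * \<i> + of_real b = (2 + \<i>) * (of_real c * \<i> + of_real d)"
      "of_real a * (2 + \<i>) + of_real b = \<i> * (of_real c * (2 + \<i>) + of_real d)"
      using D[of \<i>] D[of "2 + \<i>"] by (simp_all add: g(1) act_pm divide_eq_eq)
    then have "a = 2 * c + d" "b = 2 * d - c" "a * 2 + b = - c"
      by (simp_all add: complex_eq_iff algebra_simps)
    then have v: "d = - c" "a = c" "b = - 3 * c" by auto
    then have c2: "2 * c\<^sup>2 = 1" using g(2) by (simp add: power2_eq_square)
    have "Im (act m (2 * \<i>)) = 2 / (cmod (of_real c * (2 * \<i>) + of_real d))\<^sup>2"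
      by (simp add: g(1) Im_act[OF g(2)])
    also have "\<dots> = 2 / (5 * c\<^sup>2)" by (simp add: v cmod_power2 power_mult_distrib)
    also have "5 * c\<^sup>2 = 5 / 2" using c2 by simp
    finally have "Im (act m (2 * \<i>)) < 1" by simp
    then show ?thesis using in_core[OF c(3)] by (simp add: core_def)
  qed
qed

lemma core_image_inject:
  assumes "g \<in> carrier PSL2R" "h \<in> carrier PSL2R" "act g ` core = act h ` core"
  shows "g = h"
proof -
  have "act (pinv g \<cdot> h) ` core = core"
    using assms core_subset by (simp add: act_image_mult act_image_inv flip: assms(3))
  then have "pinv g \<cdot> h = \<one>\<^bsub>PSL2R\<^esub>" using core_stabilizer assms by simp
  then show ?thesis using assms PSL.inv_equality[of "pinv g" h]
    by (metis PSL.inv_closed PSL.inv_inv)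
qed

lemma mem_aff_image:
  assumes "s > 0" "S \<subseteq> \<H>"
  shows "z \<in> act (aff s b) ` S \<longleftrightarrow> Im z > 0 \<and> Complex ((Re z - b) / s) (Im z / s) \<in> S"
proof -
  have "z \<in> act (aff s b) ` S \<longleftrightarrow> Im z > 0 \<and> act (pinv (aff s b)) z \<in> S"
    by (rule mem_act_image) (simp_all add: assms)
  also have "act (pinv (aff s b)) z = of_real (1 / s) * z + of_real (- b / s)"
    using assms by (subst pinv_aff, simp, subst act_aff) simp_all
  also have "\<dots> = Complex ((Re z - b) / s) (Im z / s)"
    by (simp add: complex_eq_iff diff_divide_distrib)
  finally show ?thesis .
qed

lemma mem_aff_ocore:
  assumes "s > 0"
  shows "z \<in> act (aff s b) ` ocore \<longleftrightarrow> b < Re z \<and> Re z < b + 2 * s \<and> s < Im z \<and> Im z < 2 * s"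
  unfolding mem_aff_image[OF assms ocore_subset] using assms
  by (auto simp: ocore_def divide_less_eq less_divide_eq algebra_simps)

lemma box_aff:
  "core_box c j l = act (aff (2 powi j) (c + 2 powi (j + 1) * of_int l)) ` core"
proof -
  define s where "s = (2 powi j :: real)"
  have s: "s > 0" by (simp add: s_def)
  have p: "2 powi (j + 1) = 2 * s" by (simp add: power_int_add s_def)
  have "z \<in> core_box c j l \<longleftrightarrow> z \<in> act (aff s (c + 2 * s * of_int l)) ` core" for z
    unfolding mem_aff_image[OF s core_subset] core_box_def p s_def[symmetric] using s
    by (auto simp: core_def divide_le_eq le_divide_eq algebra_simps)
  then show ?thesis by (simp add: p set_eq_iff flip: s_def)
qed

section \<open>The modular packing\<close>

abbreviation H_inf :: "complex set" where
  "H_inf \<equiv> horoball_inf"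

lemma H_inf_iff [simp]: "z \<in> H_inf \<longleftrightarrow> Im z \<ge> 1"
  by (simp add: horoball_inf_def)

lemma H_inf_subset: "H_inf \<subseteq> \<H>"
  by auto

lemma act_aff_H_inf [simp]: "act (aff 1 b) ` H_inf = H_inf"
proof (rule Set.set_eqI)
  fix z
  show "z \<in> act (aff 1 b) ` H_inf \<longleftrightarrow> z \<in> H_inf"
    using H_inf_subset by (auto simp: mem_act_image pinv_aff)
qed

lemma norm_denom_power2:
  "(cmod (of_real c * z + of_real d))\<^sup>2 = (c * Re z + d)\<^sup>2 + c\<^sup>2 * (Im z)\<^sup>2"
  by (simp add: cmod_power2 power_mult_distrib)

lemma denom_power2_pos:
  assumes "a * d - b * c = (1::real)" "Im z > 0"
  shows "(c * Re z + d)\<^sup>2 + c\<^sup>2 * (Im z)\<^sup>2 > 0"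
  using moebius_denom_nonzero[OF assms] by (simp flip: norm_denom_power2)

lemma Im_act_ge_iff:
  assumes "a * d - b * c = 1" "Im z > 0"
  shows "Im (act (pm a b c d) z) \<ge> 1 \<longleftrightarrow> (c * Re z + d)\<^sup>2 + c\<^sup>2 * (Im z)\<^sup>2 \<le> Im z"
  using denom_power2_pos[OF assms]
  by (simp add: Im_act[OF assms(1)] norm_denom_power2 le_divide_eq)

lemma modular_lower_zero:
  assumes "pm a b 0 d \<in> \<Gamma>" "a * d = 1"
  shows "\<exists>n::int. pm a b 0 d = aff 1 (of_int n)"
proof -
  obtain a' b' c' d' :: int where k: "pm a b 0 d = pm (of_int a') (of_int b') (of_int c') (of_int d')"
    "a' * d' - b' * c' = 1" using assms(1) by (rule modular_cases)
  then have "c' = 0" by (auto simp: pm_eq_iff)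
  then have "a' * d' = 1" using k by simp
  then have "(a' = 1 \<and> d' = 1) \<or> (a' = - 1 \<and> d' = - 1)" by (metis zmult_eq_1_iff)
  then have "pm a b 0 d = aff 1 (of_int (a' * b'))"
    using k(1) \<open>c' = 0\<close> by (auto simp: aff_def pm_eq_iff)
  then show ?thesis by blast
qed

text \<open>A nonzero integer c satisfies c^2 \<ge> 1, hence |c * z + d|^2 \<ge> (Im z)^2. This
  inequality is the reason why distinct horoballs of the packing do not overlap.\<close>

lemma modular_dichotomy:
  assumes "k \<in> \<Gamma>"
  shows "(\<exists>n::int. k = aff 1 (of_int n)) \<or> (\<forall>z. Im z > 0 \<longrightarrow> Im (act k z) * Im z \<le> 1)"
proof -
  obtain a b c d :: int where k: "k = pm (of_int a) (of_int b) (of_int c) (of_int d)"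
    "a * d - b * c = 1" using assms by (rule modular_cases)
  have "of_int (a * d - b * c) = (1::real)" using k(2) by simp
  then have e: "of_int a * of_int d - of_int b * of_int c = (1::real)" by simp
  show ?thesis
  proof (cases "c = 0")
    case True
    then show ?thesis using modular_lower_zero[of "of_int a" "of_int b" "of_int d"] assms k(1) e by simp
  next
    case False
    have "Im (act k z) * Im z \<le> 1" if z: "Im z > 0" for z
    proof -
      have "1\<^sup>2 \<le> (\<bar>c\<bar>)\<^sup>2" using False by (intro power_mono) auto
      then have "1 \<le> c\<^sup>2" by simp
      then have "1 * (Im z)\<^sup>2 \<le> (of_int c)\<^sup>2 * (Im z)\<^sup>2"
        by (intro mult_right_mono) (simp_all flip: of_int_power)
      then have "(Im z)\<^sup>2 \<le> (of_int c * Re z + of_int d)\<^sup>2 + (of_int c)\<^sup>2 * (Im z)\<^sup>2"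
        using zero_le_power2[of "of_int c * Re z + of_int d"] by linarith
      moreover have "Im (act k z) = Im z / ((of_int c * Re z + of_int d)\<^sup>2 + (of_int c)\<^sup>2 * (Im z)\<^sup>2)"
        by (simp only: k(1) Im_act[OF e] norm_denom_power2)
      ultimately show ?thesis
        using denom_power2_pos[OF e z] by (simp add: divide_le_eq) (simp add: power2_eq_square)
    qed
    then show ?thesis by blast
  qed
qed

lemma H_inf_stabilizer:
  assumes v: "v \<in> carrier PSL2R" and eq: "act v ` H_inf = H_inf"
  shows "\<exists>b. v = aff 1 b"
proof -
  obtain a b c d where g: "v = pm a b c d" "a * d - b * c = 1" using v by (rule PSL2R_cases)
  have "c = 0"
  proof (rule ccontr)
    assume c: "c \<noteq> 0"
    \<comment> \<open>For c \<noteq> 0 the image of \<open>H_inf\<close> under v stays below height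
      1 / c^2; t exceeds this bound as well as 1.\<close>
    define t where "t = 1 + 1 / c\<^sup>2"
    have t: "t > 1" using c by (simp add: t_def)
    then have "Complex 0 t \<in> act v ` H_inf" by (simp add: eq)
    then obtain z where z: "Im z \<ge> 1" "Complex 0 t = act v z" by auto
    have pos: "(c * Re z + d)\<^sup>2 + c\<^sup>2 * (Im z)\<^sup>2 > 0" using denom_power2_pos[OF g(2)] z by simp
    have "t = Im z / ((c * Re z + d)\<^sup>2 + c\<^sup>2 * (Im z)\<^sup>2)"
      using arg_cong[OF z(2), of Im] by (simp add: g(1) Im_act[OF g(2)] norm_denom_power2)
    then have "t * ((c * Re z + d)\<^sup>2 + c\<^sup>2 * (Im z)\<^sup>2) = Im z" using pos by (simp add: field_simps)
    moreover have "t * (c\<^sup>2 * (Im z)\<^sup>2) \<le> t * ((c * Re z + d)\<^sup>2 + c\<^sup>2 * (Im z)\<^sup>2)"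
      using t by (intro mult_left_mono) auto
    moreover have "t * c\<^sup>2 = c\<^sup>2 + 1" using c by (simp add: t_def field_simps)
    then have "t * (c\<^sup>2 * (Im z)\<^sup>2) = (c\<^sup>2 + 1) * (Im z)\<^sup>2" by (simp flip: mult.assoc)
    ultimately have "(c\<^sup>2 + 1) * (Im z)\<^sup>2 \<le> Im z" by linarith
    moreover have "1 * (Im z * 1) < (c\<^sup>2 + 1) * (Im z * Im z)"
      using c z by (intro mult_less_le_imp_less mult_left_mono) auto
    ultimately show False by (simp add: power2_eq_square)
  qed
  then have ad: "a * d = 1" using g by simp
  have im: "Im (act v z) = a\<^sup>2 * Im z" for z
  proof -
    have d: "d \<noteq> 0" using ad by auto
    then have "a = 1 / d" using ad by (simp add: eq_divide_eq)
    then show ?thesis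
      unfolding g(1) Im_act[OF g(2)] norm_denom_power2 using d \<open>c = 0\<close> by (simp add: power_divide)
  qed
  have "act v \<i> \<in> act v ` H_inf" by (rule imageI) simp
  then have "a\<^sup>2 \<ge> 1" unfolding eq by (simp add: im)
  have "\<i> \<in> act v ` H_inf" unfolding eq by simp
  then obtain w where "Im w \<ge> 1" "\<i> = act v w" by auto
  then have "a\<^sup>2 * Im w = 1" using im[of w] by simp
  moreover have "a\<^sup>2 * 1 \<le> a\<^sup>2 * Im w" using \<open>Im w \<ge> 1\<close> by (intro mult_left_mono) auto
  ultimately have "a\<^sup>2 = 1" using \<open>a\<^sup>2 \<ge> 1\<close> by linarith
  then have "a = 1 \<and> d = 1 \<or> a = - 1 \<and> d = - 1" using ad by (auto simp: power2_eq_1_iff)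
  then have "v = aff 1 (a * b)" using \<open>c = 0\<close> by (auto simp: g(1) aff_def pm_eq_iff)
  then show ?thesis by blast
qed

abbreviation packing :: "(real^2^2) set \<Rightarrow> complex set set" where
  "packing g \<equiv> move_packing g modular_packing"

lemma packing_eq:
  assumes "g \<in> carrier PSL2R"
  shows "packing g = (\<lambda>k. act (g \<cdot> k) ` H_inf) ` \<Gamma>"
  unfolding move_packing_def modular_packing_def image_image
  by (rule image_cong[OF refl]) (simp add: act_image_mult[OF assms modular_PSL2R H_inf_subset] flip: image_image)

lemma packing_mult_modular:
  assumes "g \<in> carrier PSL2R" "k \<in> \<Gamma>"
  shows "packing (g \<cdot> k) = packing g"
proof
  show "packing (g \<cdot> k) \<subseteq> packing g"
    using assms by (auto simp: packing_eq PSL.m_assoc)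
  have "act (g \<cdot> l) ` H_inf \<in> packing (g \<cdot> k)" if "l \<in> \<Gamma>" for l
  proof -
    have "g \<cdot> l = g \<cdot> k \<cdot> (pinv k \<cdot> l)"
      using assms that by (simp add: PSL.m_assoc) (simp add: PSL.m_assoc[symmetric])
    then show ?thesis using assms that by (auto simp: packing_eq)
  qed
  then show "packing g \<subseteq> packing (g \<cdot> k)" using assms(1) by (auto simp: packing_eq)
qed

lemma Union_packing:
  assumes "g \<in> carrier PSL2R"
  shows "z \<in> \<Union>(packing g) \<longleftrightarrow> Im z > 0 \<and> (\<exists>k\<in>\<Gamma>. Im (act k (act (pinv g) z)) \<ge> 1)"
proof -
  have "z \<in> act (g \<cdot> k) ` H_inf \<longleftrightarrow> Im z > 0 \<and> Im (act (pinv k) (act (pinv g) z)) \<ge> 1"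
    if k: "k \<in> \<Gamma>" for k
  proof (cases "Im z > 0")
    case True
    then have "act (pinv (g \<cdot> k)) z = act (pinv k) (act (pinv g) z)"
      using k assms by (simp add: PSL.inv_mult_group act_mult)
    then show ?thesis using k assms mem_act_image[OF _ H_inf_subset, of "g \<cdot> k" z] by simp
  next
    case False
    then show ?thesis using k assms mem_act_image[OF _ H_inf_subset, of "g \<cdot> k" z] by simp
  qed
  then have "z \<in> \<Union>(packing g) \<longleftrightarrow> (\<exists>k\<in>\<Gamma>. Im z > 0 \<and> Im (act (pinv k) (act (pinv g) z)) \<ge> 1)"
    by (simp add: packing_eq[OF assms])
  also have "\<dots> \<longleftrightarrow> (\<exists>k\<in>\<Gamma>. Im z > 0 \<and> Im (act k (act (pinv g) z)) \<ge> 1)"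
    by (metis modular_inv modular_PSL2R PSL.inv_inv)
  finally show ?thesis by blast
qed

text \<open>Just below a point of the horocycle Im z = 1 that is away from the tangency points there
  is a gap. A horoball containing p would have a lower row (c, d) with |c| \<le> 1, by the height of
  p. If c = 0 the point is too low, and if |c| = 1 it would have to lie within \<delta> of an
  integer abscissa.\<close>

lemma not_Union_packing_near:
  assumes p: "Re p = x" "Im p = 1 - e" "0 < e" "e \<le> 1/4" "e < \<delta>\<^sup>2" "\<delta> > 0"
    and \<delta>: "\<And>n::int. \<bar>x - of_int n\<bar> \<ge> \<delta>"
  shows "p \<notin> \<Union>(packing \<one>\<^bsub>PSL2R\<^esub>)"
proof
  assume "p \<in> \<Union>(packing \<one>\<^bsub>PSL2R\<^esub>)"
  then obtain k where k: "k \<in> \<Gamma>" "Im (act k p) \<ge> 1"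
    using Union_packing[OF PSL.one_closed, of p] by auto
  obtain a b c d :: int where m: "k = pm (of_int a) (of_int b) (of_int c) (of_int d)"
    "a * d - b * c = 1" using k(1) by (rule modular_cases)
  have "of_int (a * d - b * c) = (1::real)" using m(2) by simp
  then have e: "of_int a * of_int d - of_int b * of_int c = (1::real)" by simp
  define y where "y = 1 - e"
  have y: "y \<ge> 3/4" "y < 1" using p by (simp_all add: y_def)
  have le: "(of_int c * x + of_int d)\<^sup>2 + (of_int c)\<^sup>2 * y\<^sup>2 \<le> y"
    using k(2) y unfolding m(1) by (subst (asm) Im_act_ge_iff[OF e]) (simp_all add: p y_def)
  then have "(of_int c)\<^sup>2 * y * y \<le> 1 * y"
    using zero_le_power2[of "of_int c * x + of_int d"] by (simp add: power2_eq_square algebra_simps)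
  then have "(of_int c)\<^sup>2 * y \<le> 1" using y by (simp add: mult_le_cancel_right)
  moreover have "(of_int c)\<^sup>2 * (3/4) \<le> (of_int c)\<^sup>2 * y" using y by (intro mult_left_mono) auto
  ultimately have "real_of_int (c\<^sup>2) < of_int 2" by simp
  then have "c\<^sup>2 < 2" by (simp only: of_int_less_iff)
  have "\<bar>c\<bar> < 2"
  proof (rule ccontr)
    assume "\<not> \<bar>c\<bar> < 2"
    then have "2\<^sup>2 \<le> \<bar>c\<bar>\<^sup>2" by (intro power_mono) auto
    then show False using \<open>c\<^sup>2 < 2\<close> by simp
  qed
  then consider "c = 0" | "c = 1" | "c = - 1" by linarith
  then show False
  proof cases
    case 1
    then have "d \<noteq> 0" using m by auto
    then have "1\<^sup>2 \<le> \<bar>d\<bar>\<^sup>2" by (intro power_mono) auto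
    then have "1 \<le> d\<^sup>2" by simp
    then have "1 \<le> real_of_int (d\<^sup>2)" by (simp only: of_int_1_le_iff)
    then show False using le y 1 by simp
  next
    case 2
    then have "(x - of_int (- d))\<^sup>2 + y\<^sup>2 \<le> y" using le by simp
    moreover have "\<delta>\<^sup>2 \<le> (x - of_int (- d))\<^sup>2"
      using power_mono[OF \<delta>[of "- d"], of 2] p by simp
    ultimately have "\<delta>\<^sup>2 \<le> y * (1 - y)" by (simp add: power2_eq_square algebra_simps)
    also have "\<dots> \<le> 1 * e" using y p by (intro mult_mono) (auto simp: y_def)
    finally show False using p by simp
  next
    case 3
    then have "(x - of_int d)\<^sup>2 + y\<^sup>2 \<le> y" using le by (simp add: power2_commute[of x])
    moreover have "\<delta>\<^sup>2 \<le> (x - of_int d)\<^sup>2"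
      using power_mono[OF \<delta>[of d], of 2] p by simp
    ultimately have "\<delta>\<^sup>2 \<le> y * (1 - y)" by (simp add: power2_eq_square algebra_simps)
    also have "\<dots> \<le> 1 * e" using y p by (intro mult_mono) (auto simp: y_def)
    finally show False using p by simp
  qed
qed

text \<open>Distinct horoballs meet only in isolated points. An open connected set that leaves
  \<open>H_inf\<close> contains a point of height 1, and then, by openness, also a nearby point of
  the gap found in \<open>not_Union_packing_near\<close>.\<close>

lemma connected_in_horoball_inf:
  assumes W: "open W" "connected W" "W \<subseteq> \<Union>(packing \<one>\<^bsub>PSL2R\<^esub>)" and z: "z \<in> W" "Im z \<ge> 1"
  shows "W \<subseteq> H_inf"
proof (rule ccontr)
  assume "\<not> W \<subseteq> H_inf"
  then obtain w where "w \<in> W" "w \<notin> H_inf" by blast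
  then have w: "w \<in> W" "Im w < 1" by (simp_all add: not_le)
  have "connected (Im ` W)" by (intro connected_continuous_image W continuous_intros)
  moreover have "Im w \<in> Im ` W" "Im z \<in> Im ` W" using w z by auto
  ultimately have "1 \<in> Im ` W" using w z
    by (meson connected_contains_Icc atLeastAtMost_iff less_imp_le subsetD)
  then obtain u where u: "u \<in> W" "Im u = 1" by auto
  obtain r where r: "r > 0" "ball u r \<subseteq> W" using W(1) u(1) by (meson openE)
  define s where "s = min r 1"
  have s: "0 < s" "s \<le> 1" "s \<le> r" using r by (auto simp: s_def)
  \<comment> \<open>At an integer abscissa the point below would lie in a tangent horoball, hence
    the small shift; s / 4 is at most 1/4 and so never an integer.\<close>
  define x where "x = (if Re u \<in> \<int> then Re u + s / 4 else Re u)"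
  have xZ: "x \<notin> \<int>"
  proof
    assume "x \<in> \<int>"
    then have "s / 4 \<in> \<int>" unfolding x_def by (auto split: if_splits dest: Ints_diff)
    then obtain n :: int where "s / 4 = of_int n" by (auto elim: Ints_cases)
    then have "0 < real_of_int n" "real_of_int n < 1" using s by linarith+
    then show False by simp
  qed
  define \<delta> where "\<delta> = min (frac x) (1 - frac x)"
  have \<delta>: "\<delta> > 0" using xZ by (simp add: \<delta>_def frac_gt_0_iff frac_lt_1)
  have \<delta>': "\<bar>x - of_int n\<bar> \<ge> \<delta>" for n :: int
  proof (cases "n \<le> \<lfloor>x\<rfloor>")
    case True
    then have "real_of_int n \<le> of_int \<lfloor>x\<rfloor>" by simp
    then have "frac x \<le> x - of_int n" by (simp add: frac_def)
    then show ?thesis by (simp add: \<delta>_def)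
  next
    case False
    then have "\<lfloor>x\<rfloor> + 1 \<le> n" by simp
    then have "of_int (\<lfloor>x\<rfloor> + 1) \<le> real_of_int n" by (simp only: of_int_le_iff)
    then have "1 - frac x \<le> of_int n - x" by (simp add: frac_def)
    then show ?thesis by (simp add: \<delta>_def)
  qed
  define e where "e = min (s / 4) (\<delta>\<^sup>2 / 2)"
  have e: "0 < e" "e \<le> s / 4" "e < \<delta>\<^sup>2" "e \<le> 1/4" using s \<delta> by (auto simp: e_def min_def not_le)
  define p where "p = Complex x (1 - e)"
  have "cmod (p - u) \<le> \<bar>Re (p - u)\<bar> + \<bar>Im (p - u)\<bar>" by (rule cmod_le)
  also have "\<dots> \<le> s / 4 + s / 4" using e s u by (intro add_mono) (auto simp: p_def x_def)
  also have "\<dots> < r" using s by simp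
  finally have "p \<in> ball u r" by (simp add: dist_norm norm_minus_commute)
  then have "p \<in> \<Union>(packing \<one>\<^bsub>PSL2R\<^esub>)" using r W by blast
  moreover have "p \<notin> \<Union>(packing \<one>\<^bsub>PSL2R\<^esub>)"
    by (rule not_Union_packing_near[of p x e \<delta>]) (use e \<delta> \<delta>' in \<open>auto simp: p_def\<close>)
  ultimately show False by blast
qed

lemma packing_subset: "g \<in> carrier PSL2R \<Longrightarrow> \<Union>(packing g) \<subseteq> \<H>"
  by (rule subsetI) (simp only: Union_packing \<H>_iff)

lemma Union_packing_image:
  assumes "g \<in> carrier PSL2R" "h \<in> carrier PSL2R"
  shows "act h ` \<Union>(packing g) = \<Union>(packing (h \<cdot> g))"
  using assms
  by (simp add: packing_eq image_Union image_image PSL.m_assoc)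
    (simp add: act_image_mult[OF _ _ H_inf_subset] flip: image_image)

lemma connected_in_horoball:
  assumes g: "g \<in> carrier PSL2R" and W: "open W" "connected W" "W \<noteq> {}" "W \<subseteq> \<Union>(packing g)"
  shows "\<exists>k\<in>\<Gamma>. W \<subseteq> act (g \<cdot> k) ` H_inf"
proof -
  obtain z where z: "z \<in> W" using W by blast
  then obtain k where k: "k \<in> \<Gamma>" "z \<in> act (g \<cdot> k) ` H_inf" using W(4) packing_eq[OF g] by auto
  have gk: "g \<cdot> k \<in> carrier PSL2R" using g k by simp
  have WH: "W \<subseteq> \<H>" using W packing_subset[OF g] by blast
  define V where "V = act (pinv (g \<cdot> k)) ` W"
  have VW: "act (g \<cdot> k) ` V = W" unfolding V_def using gk WH by (simp add: act_image_inv)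
  have "V \<subseteq> act (pinv (g \<cdot> k)) ` \<Union>(packing (g \<cdot> k))"
    unfolding V_def using W k g by (auto simp: packing_mult_modular)
  also have "\<dots> = \<Union>(packing \<one>\<^bsub>PSL2R\<^esub>)" using gk by (simp add: Union_packing_image)
  finally have "V \<subseteq> \<Union>(packing \<one>\<^bsub>PSL2R\<^esub>)" .
  moreover have "open V" "connected V"
    unfolding V_def using W WH gk by (auto intro!: open_act_image connected_act_image)
  moreover have "act (pinv (g \<cdot> k)) z \<in> V" "Im (act (pinv (g \<cdot> k)) z) \<ge> 1"
    using z k gk by (auto simp: V_def mem_act_image[OF gk H_inf_subset])
  ultimately have "V \<subseteq> H_inf" using connected_in_horoball_inf by blast
  then show ?thesis using VW k(1) by blast
qed

text \<open>In the coordinates of the two frames the heights multiply to more than 1, so by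
  \<open>modular_dichotomy\<close> the frames differ by a translation. Strict height in one of them
  excludes mere tangency.\<close>

lemma horoball_overlap:
  assumes "g \<in> carrier PSL2R" "k \<in> \<Gamma>" "l \<in> \<Gamma>"
    and z: "z \<in> act (g \<cdot> k) ` {z. Im z > 1}" "z \<in> act (g \<cdot> l) ` H_inf"
  shows "\<exists>n::int. l = k \<cdot> aff 1 (of_int n)"
proof -
  have c: "g \<cdot> k \<in> carrier PSL2R" "g \<cdot> l \<in> carrier PSL2R" using assms by auto
  have sub: "{z. Im z > 1} \<subseteq> \<H>" by auto
  define u where "u = act (pinv (g \<cdot> k)) z"
  define v where "v = act (pinv (g \<cdot> l)) z"
  have u: "Im u > 1" and z0: "Im z > 0" using z(1) by (auto simp: u_def mem_act_image[OF c(1) sub])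
  have v: "Im v \<ge> 1" using z(2) by (auto simp: v_def mem_act_image[OF c(2) H_inf_subset])
  have "act (pinv k \<cdot> l) v = act (pinv (g \<cdot> k) \<cdot> (g \<cdot> l)) v"
    using assms by (simp add: PSL.inv_mult_group PSL.m_assoc) (simp add: PSL.m_assoc[symmetric])
  also have "\<dots> = act (pinv (g \<cdot> k)) (act (g \<cdot> l) v)" using c v by (intro act_mult) auto
  also have "\<dots> = u" using z0 c by (simp add: u_def v_def act_inv_act)
  finally have uv: "act (pinv k \<cdot> l) v = u" .
  have "\<not> Im u * Im v \<le> 1"
  proof -
    have "1 * 1 < Im u * Im v" using u v by (intro mult_less_le_imp_less) auto
    then show ?thesis by simp
  qed
  then obtain n :: int where n: "pinv k \<cdot> l = aff 1 (of_int n)"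
    using modular_dichotomy[of "pinv k \<cdot> l"] assms v uv by fastforce
  have "l = k \<cdot> (pinv k \<cdot> l)" using assms by (simp add: PSL.m_assoc[symmetric])
  then show ?thesis unfolding n by blast
qed

section \<open>Tangency points and triangles\<close>

lemma modular_int_entries:
  assumes "k \<in> \<Gamma>"
  obtains a b c d :: int where "k = pm (of_int a) (of_int b) (of_int c) (of_int d)"
    "of_int a * of_int d - of_int b * of_int c = (1::real)" "a * d - b * c = 1"
proof -
  obtain a b c d :: int where k: "k = pm (of_int a) (of_int b) (of_int c) (of_int d)"
    "a * d - b * c = 1" using assms by (rule modular_cases)
  have "of_int (a * d - b * c) = (1::real)" using k(2) by simp
  then show ?thesis using that[OF k(1) _ k(2)] by simp
qed

lemma sum_squares_le_1:
  fixes c d :: int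
  assumes "c \<noteq> 0" "(of_int c * x + of_int d)\<^sup>2 + (of_int c)\<^sup>2 \<le> (1::real)"
  shows "x \<in> \<int>"
proof -
  have "1\<^sup>2 \<le> \<bar>c\<bar>\<^sup>2" using assms(1) by (intro power_mono) auto
  then have "1 \<le> c\<^sup>2" by simp
  then have "1 \<le> real_of_int (c\<^sup>2)" by (simp only: of_int_1_le_iff)
  moreover have "real_of_int (c\<^sup>2) = (of_int c)\<^sup>2" by simp
  ultimately have "(of_int c * x + of_int d)\<^sup>2 \<le> 0" "real_of_int (c\<^sup>2) \<le> 1"
    using assms(2) zero_le_power2[of "of_int c * x + of_int d"] by linarith+
  then have e: "of_int c * x + of_int d = 0" "c\<^sup>2 \<le> 1" by (simp_all only: power2_less_eq_zero_iff of_int_le_1_iff)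
  then have "c\<^sup>2 = 1" using \<open>1 \<le> c\<^sup>2\<close> by simp
  then have "c = 1 \<or> c = - 1" by (simp add: power2_eq_1_iff)
  then have "x = of_int (- d) \<or> x = of_int d" using e(1) by auto
  then show ?thesis by auto
qed

text \<open>The equality case of \<open>modular_dichotomy\<close>: both heights are forced to be 1,
  and then (c * Re u + d)^2 + c^2 \<le> 1 with c \<noteq> 0 leaves only integer abscissas.\<close>

lemma modular_tangent:
  assumes "k \<in> \<Gamma>" "\<not> (\<exists>n::int. k = aff 1 (of_int n))" "Im u \<ge> 1" "Im (act k u) \<ge> 1"
  shows "\<exists>n::int. u = \<i> + of_int n"
proof -
  obtain a b c d :: int where k: "k = pm (of_int a) (of_int b) (of_int c) (of_int d)"
    "of_int a * of_int d - of_int b * of_int c = (1::real)" "a * d - b * c = 1"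
    using assms(1) by (rule modular_int_entries)
  have "c \<noteq> 0"
  proof
    assume "c = 0"
    then have "k = pm (of_int a) (of_int b) 0 (of_int d)" "of_int a * of_int d = (1::real)" using k by simp_all
    then show False using modular_lower_zero[of "of_int a" "of_int b" "of_int d"] assms(1,2) by simp
  qed
  have "Im (act k u) * Im u \<le> 1" using modular_dichotomy[OF assms(1)] assms by auto
  moreover have "1 * Im u \<le> Im (act k u) * Im u" using assms by (intro mult_right_mono) auto
  ultimately have u: "Im u = 1" using assms(3) by linarith
  have "(of_int c * Re u + of_int d)\<^sup>2 + (of_int c)\<^sup>2 * (Im u)\<^sup>2 \<le> Im u"
    using assms(3,4) unfolding k(1) by (subst (asm) Im_act_ge_iff[OF k(2)]) auto
  then have "Re u \<in> \<int>" using sum_squares_le_1[OF \<open>c \<noteq> 0\<close>, of "Re u" d] by (simp add: u)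
  then obtain n :: int where "Re u = of_int n" by (auto elim: Ints_cases)
  then show ?thesis using u by (intro exI[of _ n]) (simp add: complex_eq_iff)
qed

lemma tangency_points_frame:
  assumes g: "g \<in> carrier PSL2R" and k: "k \<in> \<Gamma>"
  shows "tangency_points (packing g) (act (g \<cdot> k) ` H_inf) = act (g \<cdot> k) ` {\<i> + of_int n | n. True}"
proof
  have y: "g \<cdot> k \<in> carrier PSL2R" using g k by simp
  show "tangency_points (packing g) (act (g \<cdot> k) ` H_inf) \<subseteq> act (g \<cdot> k) ` {\<i> + of_int n | n. True}"
  proof
    fix z assume "z \<in> tangency_points (packing g) (act (g \<cdot> k) ` H_inf)"
    then obtain l where l: "l \<in> \<Gamma>" "act (g \<cdot> l) ` H_inf \<noteq> act (g \<cdot> k) ` H_inf"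
      "z \<in> act (g \<cdot> k) ` H_inf" "z \<in> act (g \<cdot> l) ` H_inf"
      unfolding tangency_points_def packing_eq[OF g] by blast
    obtain u where u: "Im u \<ge> 1" "z = act (g \<cdot> k) u" using l(3) by auto
    have m: "pinv l \<cdot> k \<in> \<Gamma>" using k l by simp
    have gl: "g \<cdot> l \<in> carrier PSL2R" using g l by simp
    have "Im (act (pinv (g \<cdot> l)) z) \<ge> 1" using l(4) by (simp add: mem_act_image[OF gl H_inf_subset])
    moreover have "act (pinv (g \<cdot> l)) z = act (pinv (g \<cdot> l) \<cdot> (g \<cdot> k)) u"
      unfolding u(2) by (rule act_mult[symmetric]) (use g k l u in auto)
    moreover have "pinv (g \<cdot> l) \<cdot> (g \<cdot> k) = pinv l \<cdot> k"
      using g k l by (simp add: PSL.inv_mult_group PSL.m_assoc) (simp add: PSL.m_assoc[symmetric])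
    ultimately have "Im (act (pinv l \<cdot> k) u) \<ge> 1" by simp
    moreover have "\<not> (\<exists>n::int. pinv l \<cdot> k = aff 1 (of_int n))"
    proof
      assume "\<exists>n::int. pinv l \<cdot> k = aff 1 (of_int n)"
      then obtain n :: int where n: "pinv l \<cdot> k = aff 1 (of_int n)" by blast
      have "g \<cdot> k = g \<cdot> l \<cdot> (pinv l \<cdot> k)"
        using g k l by (simp add: PSL.m_assoc) (simp add: PSL.m_assoc[symmetric])
      then have "act (g \<cdot> k) ` H_inf = act (g \<cdot> l) ` H_inf"
        unfolding n using gl by (simp add: act_image_mult[OF _ _ H_inf_subset])
      then show False using l(2) by simp
    qed
    ultimately obtain n :: int where "u = \<i> + of_int n"
      using modular_tangent[OF m _ u(1)] by blast
    then show "z \<in> act (g \<cdot> k) ` {\<i> + of_int n | n. True}" using u(2) by blast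
  qed
  show "act (g \<cdot> k) ` {\<i> + of_int n | n. True} \<subseteq> tangency_points (packing g) (act (g \<cdot> k) ` H_inf)"
  proof
    fix z assume "z \<in> act (g \<cdot> k) ` {\<i> + of_int n | n. True}"
    then obtain n :: int where n: "z = act (g \<cdot> k) (\<i> + of_int n)" by blast
    \<comment> \<open>The map z to n - 1 / z sends \<i> to \<i> + n and \<open>H_inf\<close> to the
      horoball tangent there. It lowers 2 * \<i> to height 1/2, which shows that the two horoballs
      differ.\<close>
    define S where "S = pm (of_int n) (- 1) 1 0"
    have S: "S \<in> \<Gamma>" unfolding S_def by (rule modular_pm') simp_all
    have yS: "act (g \<cdot> (k \<cdot> S)) w = act (g \<cdot> k) (act S w)" if "Im w > 0" for w
      using g k S that by (simp add: act_mult Im_act_pos_iff)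
    have "act S \<i> = \<i> + of_int n" by (simp add: S_def act_pm complex_eq_iff)
    then have z: "z = act (g \<cdot> (k \<cdot> S)) \<i>" by (simp add: n yS)
    have z: "z \<in> act (g \<cdot> (k \<cdot> S)) ` H_inf" unfolding z by (rule imageI) simp
    have z': "z \<in> act (g \<cdot> k) ` H_inf" unfolding n by (rule imageI) simp
    have "act (g \<cdot> (k \<cdot> S)) ` H_inf \<noteq> act (g \<cdot> k) ` H_inf"
    proof
      assume eq: "act (g \<cdot> (k \<cdot> S)) ` H_inf = act (g \<cdot> k) ` H_inf"
      have "act (g \<cdot> (k \<cdot> S)) (2 * \<i>) \<in> act (g \<cdot> (k \<cdot> S)) ` H_inf" by (rule imageI) simp
      then have "Im (act (pinv (g \<cdot> k)) (act (g \<cdot> k) (act S (2 * \<i>)))) \<ge> 1"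
        unfolding eq by (simp add: yS mem_act_image[OF y H_inf_subset] del: image_image)
      moreover have "Im (act S (2 * \<i>)) = 1/2" by (simp add: S_def Im_act norm_mult power2_eq_square)
      ultimately show False using y by (simp add: act_inv_act)
    qed
    then show "z \<in> tangency_points (packing g) (act (g \<cdot> k) ` H_inf)"
      using z z' modular_mult[OF k S] unfolding tangency_points_def packing_eq[OF g] by blast
  qed
qed

section \<open>The open triangle, its closure and its rotation of order three\<close>

abbreviation T0 :: "complex set" where
  "T0 \<equiv> triangle_beneath"

definition W0 :: "complex set" where
  "W0 = {z. 0 < Re z \<and> Re z < 1 \<and> 1/2 < Im z \<and> Im z < 1 \<and>
     1/2 < cmod (z - \<i>/2) \<and> 1/2 < cmod (z - (1 + \<i>/2))}"

lemma disc_iff: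
  "1/2 \<le> cmod (z - \<i>/2) \<longleftrightarrow> Im z \<le> (Re z)\<^sup>2 + (Im z)\<^sup>2"
  "1/2 \<le> cmod (z - (1 + \<i>/2)) \<longleftrightarrow> Im z \<le> (Re z - 1)\<^sup>2 + (Im z)\<^sup>2"
  "1/2 < cmod (z - \<i>/2) \<longleftrightarrow> Im z < (Re z)\<^sup>2 + (Im z)\<^sup>2"
  "1/2 < cmod (z - (1 + \<i>/2)) \<longleftrightarrow> Im z < (Re z - 1)\<^sup>2 + (Im z)\<^sup>2"
proof -
  have le: "1/2 \<le> cmod w \<longleftrightarrow> 1/4 \<le> (Re w)\<^sup>2 + (Im w)\<^sup>2" for w
    using abs_le_square_iff[of "1/2" "cmod w"] by (simp add: cmod_power2 power_divide)
  have lt: "1/2 < cmod w \<longleftrightarrow> 1/4 < (Re w)\<^sup>2 + (Im w)\<^sup>2" for w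
  proof -
    have "cmod w \<le> 1/2 \<longleftrightarrow> (Re w)\<^sup>2 + (Im w)\<^sup>2 \<le> 1/4"
      using abs_le_square_iff[of "cmod w" "1/2"] by (simp add: cmod_power2 power_divide)
    then show ?thesis by linarith
  qed
  show "1/2 \<le> cmod (z - \<i>/2) \<longleftrightarrow> Im z \<le> (Re z)\<^sup>2 + (Im z)\<^sup>2"
    "1/2 \<le> cmod (z - (1 + \<i>/2)) \<longleftrightarrow> Im z \<le> (Re z - 1)\<^sup>2 + (Im z)\<^sup>2"
    unfolding le by (auto simp: power2_eq_square algebra_simps)
  show "1/2 < cmod (z - \<i>/2) \<longleftrightarrow> Im z < (Re z)\<^sup>2 + (Im z)\<^sup>2"
    "1/2 < cmod (z - (1 + \<i>/2)) \<longleftrightarrow> Im z < (Re z - 1)\<^sup>2 + (Im z)\<^sup>2"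
    unfolding lt by (auto simp: power2_eq_square algebra_simps)
qed

lemma W0_iff: "z \<in> W0 \<longleftrightarrow> 0 < Re z \<and> Re z < 1 \<and> 1/2 < Im z \<and> Im z < 1 \<and>
    Im z < (Re z)\<^sup>2 + (Im z)\<^sup>2 \<and> Im z < (Re z - 1)\<^sup>2 + (Im z)\<^sup>2"
  by (simp only: W0_def disc_iff mem_Collect_eq)

lemma T0_iff: "z \<in> T0 \<longleftrightarrow> 0 \<le> Re z \<and> Re z \<le> 1 \<and> 1/2 \<le> Im z \<and> Im z \<le> 1 \<and>
    Im z \<le> (Re z)\<^sup>2 + (Im z)\<^sup>2 \<and> Im z \<le> (Re z - 1)\<^sup>2 + (Im z)\<^sup>2"
  by (simp only: triangle_beneath_def disc_iff mem_Collect_eq)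

lemma T0_subset: "T0 \<subseteq> \<H>" and W0_T0: "W0 \<subseteq> T0" and W0_subset: "W0 \<subseteq> \<H>"
  by (auto simp: T0_iff W0_iff)

lemma open_W0: "open W0"
proof -
  have eq: "W0 = {z. 0 < Re z} \<inter> {z. Re z < 1} \<inter> {z. 1/2 < Im z} \<inter> {z. Im z < 1} \<inter>
      {z. 1/2 < cmod (z - \<i>/2)} \<inter> {z. 1/2 < cmod (z - (1 + \<i>/2))}"
    by (auto simp: W0_def)
  show ?thesis
    unfolding eq by (intro open_Int open_Collect_less continuous_intros)
qed

lemma compact_T0: "compact T0"
proof -
  have eq: "T0 = {z. 0 \<le> Re z} \<inter> {z. Re z \<le> 1} \<inter> {z. 1/2 \<le> Im z} \<inter> {z. Im z \<le> 1} \<inter>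
      {z. 1/2 \<le> cmod (z - \<i>/2)} \<inter> {z. 1/2 \<le> cmod (z - (1 + \<i>/2))}"
    by (auto simp: triangle_beneath_def)
  have "closed T0"
    unfolding eq by (intro closed_Int closed_Collect_le continuous_intros)
  moreover have "T0 \<subseteq> cball 0 2"
  proof
    fix z assume z: "z \<in> T0"
    have "cmod z \<le> \<bar>Re z\<bar> + \<bar>Im z\<bar>" by (rule cmod_le)
    also have "\<dots> \<le> 2" using z by (auto simp: T0_iff)
    finally show "z \<in> cball 0 2" by simp
  qed
  ultimately show ?thesis by (meson bounded_cball bounded_subset compact_eq_bounded_closed)
qed

text \<open>At a height strictly between the vertex and the top edge, a horizontal move towards the
  line Re z = 1/2 leaves both discs at once. This gives connectedness of \<open>W0\<close> as well
  as the main part of its closure.\<close>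

lemma T0_towards_middle:
  assumes z: "z \<in> T0" "1/2 < Im z" "Im z < 1" and t: "0 < t" "t \<le> 1"
  shows "Complex (Re z + t * (1/2 - Re z)) (Im z) \<in> W0"
proof -
  define x where "x = Re z + t * (1/2 - Re z)"
  have zz: "0 \<le> Re z" "Re z \<le> 1" "Im z \<le> (Re z)\<^sup>2 + (Im z)\<^sup>2" "Im z \<le> (Re z - 1)\<^sup>2 + (Im z)\<^sup>2"
    using z by (auto simp: T0_iff)
  have mid: "Im z < (1/2)\<^sup>2 + (Im z)\<^sup>2"
  proof -
    have "0 < (Im z - 1/2)\<^sup>2" using z(2) by simp
    then show ?thesis by (simp add: power2_eq_square algebra_simps)
  qed
  have yy: "Im z - (Im z)\<^sup>2 > 0"
  proof -
    have "Im z * Im z < Im z * 1" using z by (intro mult_strict_left_mono) auto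
    then show ?thesis by (simp add: power2_eq_square)
  qed
  have "Re z \<noteq> 0" "Re z \<noteq> 1" using zz yy by auto
  then have z01: "0 < Re z" "Re z < 1" using zz by auto
  have x01: "0 < x" "x < 1"
  proof -
    have "x = (1 - t) * Re z + t * (1/2)" "1 - x = (1 - t) * (1 - Re z) + t * (1/2)"
      by (simp_all add: x_def algebra_simps)
    moreover have "(1 - t) * Re z \<ge> 0" "(1 - t) * (1 - Re z) \<ge> 0"
      using t z01 by (auto intro!: mult_nonneg_nonneg)
    ultimately show "0 < x" "x < 1" using t by linarith+
  qed
  have "Im z < x\<^sup>2 + (Im z)\<^sup>2 \<and> Im z < (x - 1)\<^sup>2 + (Im z)\<^sup>2"
  proof (cases "Re z \<le> 1/2")
    case True
    show ?thesis
    proof (cases "Re z = 1/2")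
      case True
      have x: "x = 1/2" unfolding x_def True by simp
      show ?thesis unfolding x using mid by (simp add: power2_eq_square)
    next
      case False
      have r: "Re z < x" "x \<le> 1/2"
      proof -
        have "t * (1/2 - Re z) > 0" using t True False by (intro mult_pos_pos) auto
        then show "Re z < x" by (simp add: x_def)
        have "t * (1/2 - Re z) \<le> 1 * (1/2 - Re z)" using t True by (intro mult_right_mono) auto
        then show "x \<le> 1/2" by (simp add: x_def)
      qed
      have "(Re z)\<^sup>2 < x\<^sup>2" using r z01 by (intro power_strict_mono) auto
      moreover have "(1/2)\<^sup>2 \<le> (1 - x)\<^sup>2" using r by (intro power_mono) auto
      ultimately show ?thesis using zz mid by (simp add: power2_commute[of x])
    qed
  next
    case False
    then have r: "x < Re z" "1/2 \<le> x"
    proof -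
      have "t * (Re z - 1/2) > 0" using t False by (intro mult_pos_pos) auto
      then show "x < Re z" by (simp add: x_def algebra_simps)
      have "t * (Re z - 1/2) \<le> 1 * (Re z - 1/2)" using t False by (intro mult_right_mono) auto
      then show "1/2 \<le> x" by (simp add: x_def algebra_simps)
    qed
    have "(1 - Re z)\<^sup>2 < (1 - x)\<^sup>2" using r z01 by (intro power_strict_mono) auto
    moreover have "(1/2)\<^sup>2 \<le> x\<^sup>2" using r by (intro power_mono) auto
    ultimately show ?thesis using zz mid by (simp add: power2_commute[of _ 1])
  qed
  then show ?thesis using x01 z by (simp add: W0_iff flip: x_def)
qed

lemma W0_middle: "1/2 < y \<Longrightarrow> y < 1 \<Longrightarrow> Complex (1/2) y \<in> W0"
proof -
  assume y: "1/2 < y" "y < 1"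
  have "0 < (y - 1/2)\<^sup>2" using y by simp
  then have "y < (1/2)\<^sup>2 + y\<^sup>2" by (simp add: power2_eq_square algebra_simps)
  then show ?thesis using y by (simp add: W0_iff power2_eq_square)
qed

text \<open>\<open>W0\<close> is the vertical midline with horizontal segments attached to
  it.\<close>

lemma connected_W0: "connected W0"
proof -
  define M where "M = (\<lambda>y. Complex (1/2) y) ` {1/2<..<1::real}"
  have "connected M" unfolding M_def
    by (intro connected_continuous_image continuous_intros) auto
  define seg where "seg z = closed_segment z (Complex (1/2) (Im z))" for z
  have seg: "seg z \<subseteq> W0" if "z \<in> W0" for z
  proof
    fix w assume "w \<in> seg z"
    then obtain t where t: "0 \<le> t" "t \<le> 1" "w = (1 - t) *\<^sub>R z + t *\<^sub>R Complex (1/2) (Im z)"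
      by (auto simp: seg_def closed_segment_def)
    have "w = Complex (Re z + t * (1/2 - Re z)) (Im z)"
      by (simp add: t(3) complex_eq_iff algebra_simps)
    then show "w \<in> W0"
      using T0_towards_middle[of z t] that t W0_T0 by (cases "t = 0") (auto simp: W0_iff)
  qed
  have "W0 = (\<Union>z\<in>W0. seg z \<union> M)"
  proof
    show "W0 \<subseteq> (\<Union>z\<in>W0. seg z \<union> M)" by (auto simp: seg_def)
    show "(\<Union>z\<in>W0. seg z \<union> M) \<subseteq> W0" using seg by (auto simp: M_def intro: W0_middle)
  qed
  moreover have "connected (\<Union>z\<in>W0. seg z \<union> M)"
  proof (rule connected_Union)
    fix s assume "s \<in> (\<lambda>z. seg z \<union> M) ` W0"
    then obtain z where z: "z \<in> W0" "s = seg z \<union> M" by blast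
    have "Complex (1/2) (Im z) \<in> seg z \<inter> M" using z by (auto simp: seg_def M_def W0_iff)
    then have "seg z \<inter> M \<noteq> {}" by blast
    then show "connected s" unfolding z(2)
      by (intro connected_Un \<open>connected M\<close>) (simp_all add: seg_def)
  next
    have "Complex (1/2) (3/4) \<in> M" by (auto simp: M_def)
    then show "\<Inter> ((\<lambda>z. seg z \<union> M) ` W0) \<noteq> {}" by blast
  qed
  ultimately show ?thesis by simp
qed

text \<open>The boundary is reached in pieces: intermediate heights along horizontal segments, the
  open top edge from below, the two upper corners along the top edge, and the lowest vertex along
  the midline.\<close>

lemma closure_W0: "closure W0 = T0"
proof
  show "closure W0 \<subseteq> T0"
    by (rule closure_minimal[OF W0_T0 compact_imp_closed[OF compact_T0]])
  have inner: "z \<in> closure W0" if z: "z \<in> T0" "1/2 < Im z" "Im z < 1" for z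
  proof (rule Lim_in_closed_set[where F = "at_right (0::real)" and f = "\<lambda>t. Complex (Re z + t * (1/2 - Re z)) (Im z)"])
    show "\<forall>\<^sub>F t in at_right 0. Complex (Re z + t * (1/2 - Re z)) (Im z) \<in> closure W0"
      using eventually_at_right_real[of 0 "1::real"]
      by (auto elim!: eventually_mono intro!: subsetD[OF closure_subset] T0_towards_middle z)
    have "((\<lambda>t. Complex (Re z + t * (1/2 - Re z)) (Im z)) \<longlongrightarrow> Complex (Re z + 0 * (1/2 - Re z)) (Im z)) (at_right 0)"
      by (intro tendsto_intros)
    then show "((\<lambda>t. Complex (Re z + t * (1/2 - Re z)) (Im z)) \<longlongrightarrow> z) (at_right 0)" by simp
  qed simp_all
  have top: "Complex x 1 \<in> closure W0" if x: "0 < x" "x < 1" for x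
  proof (rule Lim_in_closed_set[where F = "at_right (0::real)" and f = "\<lambda>t. Complex x (1 - t)"])
    define e where "e = min (1/2) (min (x\<^sup>2) ((x - 1)\<^sup>2))"
    have e: "e > 0" using x by (simp add: e_def)
    have "Complex x (1 - t) \<in> closure W0" if t: "0 < t" "t < e" for t
    proof -
      have "t < x\<^sup>2" "t < (x - 1)\<^sup>2" "t < 1/2" using t by (simp_all add: e_def)
      then have "t < x\<^sup>2 + t\<^sup>2" "t < (x - 1)\<^sup>2 + t\<^sup>2" using zero_le_power2[of t] by linarith+
      then have "Complex x (1 - t) \<in> W0" using x t \<open>t < 1/2\<close>
        by (simp add: W0_iff power2_diff[of 1 t])
      then show ?thesis using closure_subset by blast
    qed
    then show "\<forall>\<^sub>F t in at_right 0. Complex x (1 - t) \<in> closure W0"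
      using eventually_at_right_real[OF e] by (auto elim: eventually_mono)
    have "((\<lambda>t. Complex x (1 - t)) \<longlongrightarrow> Complex x (1 - 0)) (at_right 0)" by (intro tendsto_intros)
    then show "((\<lambda>t. Complex x (1 - t)) \<longlongrightarrow> Complex x 1) (at_right 0)" by simp
  qed simp_all
  have left: "\<i> \<in> closure W0"
  proof (rule Lim_in_closed_set[where F = "at_right (0::real)" and f = "\<lambda>t. Complex t 1"])
    show "\<forall>\<^sub>F t in at_right 0. Complex t 1 \<in> closure W0"
      using eventually_at_right_real[of 0 "1::real"] by (auto elim!: eventually_mono intro!: top)
    have "((\<lambda>t. Complex t 1) \<longlongrightarrow> Complex 0 1) (at_right 0)" by (intro tendsto_intros)
    then show "((\<lambda>t. Complex t 1) \<longlongrightarrow> \<i>) (at_right 0)" by (simp add: imaginary_unit.code)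
  qed simp_all
  have right: "Complex 1 1 \<in> closure W0"
  proof (rule Lim_in_closed_set[where F = "at_right (0::real)" and f = "\<lambda>t. Complex (1 - t) 1"])
    show "\<forall>\<^sub>F t in at_right 0. Complex (1 - t) 1 \<in> closure W0"
      using eventually_at_right_real[of 0 "1::real"] by (auto elim!: eventually_mono intro!: top)
    have "((\<lambda>t. Complex (1 - t) 1) \<longlongrightarrow> Complex (1 - 0) 1) (at_right 0)" by (intro tendsto_intros)
    then show "((\<lambda>t. Complex (1 - t) 1) \<longlongrightarrow> Complex 1 1) (at_right 0)" by simp
  qed simp_all
  have bot: "Complex (1/2) (1/2) \<in> closure W0"
  proof (rule Lim_in_closed_set[where F = "at_right (0::real)" and f = "\<lambda>t. Complex (1/2) (1/2 + t)"])
    show "\<forall>\<^sub>F t in at_right 0. Complex (1/2) (1/2 + t) \<in> closure W0"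
      using eventually_at_right_real[of 0 "1/2::real"]
      by (auto elim!: eventually_mono intro!: subsetD[OF closure_subset] W0_middle)
    have "((\<lambda>t. Complex (1/2) (1/2 + t)) \<longlongrightarrow> Complex (1/2) (1/2 + 0)) (at_right 0)" by (intro tendsto_intros)
    then show "((\<lambda>t. Complex (1/2) (1/2 + t)) \<longlongrightarrow> Complex (1/2) (1/2)) (at_right 0)" by simp
  qed simp_all
  show "T0 \<subseteq> closure W0"
  proof
    fix z assume z: "z \<in> T0"
    then consider "1/2 < Im z" "Im z < 1" | "Im z = 1" | "Im z = 1/2" by (force simp: T0_iff)
    then show "z \<in> closure W0"
    proof cases
      case 1
      then show ?thesis using inner z by blast
    next
      case 2
      then have "z = Complex (Re z) 1" by (simp add: complex_eq_iff)
      moreover have "Re z = 0 \<or> Re z = 1 \<or> (0 < Re z \<and> Re z < 1)" using z by (auto simp: T0_iff)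
      ultimately show ?thesis using top[of "Re z"] left right by (metis imaginary_unit.code)
    next
      case 3
      have zT: "0 \<le> Re z" "Re z \<le> 1" "Im z \<le> (Re z)\<^sup>2 + (Im z)\<^sup>2" "Im z \<le> (Re z - 1)\<^sup>2 + (Im z)\<^sup>2"
        using z by (auto simp: T0_iff)
      have "(Im z)\<^sup>2 = 1/4" by (simp add: 3 power_divide)
      then have "1/4 \<le> (Re z)\<^sup>2" "1/4 \<le> (Re z - 1)\<^sup>2" "0 \<le> Re z" "Re z \<le> 1"
        using zT 3 by linarith+
      then have "(1/2)\<^sup>2 \<le> (Re z)\<^sup>2" "(1/2)\<^sup>2 \<le> (1 - Re z)\<^sup>2" "0 \<le> Re z" "0 \<le> 1 - Re z"
        by (simp_all add: power2_commute[of 1] power_divide)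
      then have "1/2 \<le> Re z" "1/2 \<le> 1 - Re z" using power2_le_imp_le by blast+
      then have "z = Complex (1/2) (1/2)" using 3 by (simp add: complex_eq_iff)
      then show ?thesis using bot by simp
    qed
  qed
qed

text \<open>\<open>C_mat\<close> acts as z to 1 / (1 - z), the rotation of order three about the
  centre exp (\<i> * pi / 3) of the triangle. One inclusion is computed; the order gives the
  other.\<close>

lemma C_T0: "act C_mat ` T0 = T0"
proof -
  have sub: "act C_mat z \<in> T0" if z: "z \<in> T0" for z
  proof -
    define x y where d: "x = Re z" "y = Im z"
    have b: "0 \<le> x" "x \<le> 1" "1/2 \<le> y" "y \<le> 1" "y \<le> x\<^sup>2 + y\<^sup>2" "y \<le> (x - 1)\<^sup>2 + y\<^sup>2"
      using z by (auto simp: T0_iff d)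
    define N where "N = (1 - x)\<^sup>2 + y\<^sup>2"
    have "y\<^sup>2 > 0" using b by simp
    then have N: "N > 0" unfolding N_def by (intro add_nonneg_pos) auto
    have Ny: "y \<le> N" using b by (simp add: N_def power2_commute)
    have "act C_mat z = 1 / (1 - z)" by (simp add: C_mat_pm act_pm)
    then have r: "Re (act C_mat z) = (1 - x) / N" and i: "Im (act C_mat z) = y / N"
      by (simp_all add: Re_divide Im_divide N_def d)
    have q1: "(Re (act C_mat z))\<^sup>2 + (Im (act C_mat z))\<^sup>2 = 1 / N"
    proof -
      have "((1 - x) / N)\<^sup>2 + (y / N)\<^sup>2 = N / N\<^sup>2" by (simp add: power_divide N_def add_divide_distrib)
      then show ?thesis using N by (simp add: r i power2_eq_square)
    qed
    have q2: "(Re (act C_mat z) - 1)\<^sup>2 + (Im (act C_mat z))\<^sup>2 = (x\<^sup>2 + y\<^sup>2) / N"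
    proof -
      have "(Re (act C_mat z) - 1)\<^sup>2 + (Im (act C_mat z))\<^sup>2 = 1 / N - 2 * ((1 - x) / N) + 1"
        using q1 by (simp add: r power2_diff)
      also have "\<dots> = (1 - 2 * (1 - x) + N) / N" using N by (simp add: field_simps)
      also have "1 - 2 * (1 - x) + N = x\<^sup>2 + y\<^sup>2" by (simp add: N_def power2_eq_square algebra_simps)
      finally show ?thesis .
    qed
    \<comment> \<open>The image has height y / N, so N \<le> 2 * y is wanted. It follows from 1 - y
      \<le> x, which in turn comes from y \<ge> 1/2 and the disc at 0.\<close>
    have "(1 - y) * (1 - y) \<le> y * (1 - y)" using b by (intro mult_right_mono) auto
    then have "(1 - y)\<^sup>2 \<le> x\<^sup>2" using b by (simp add: power2_eq_square algebra_simps)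
    then have "1 - y \<le> x" using b(1) by (rule power2_le_imp_le)
    then have "(1 - x)\<^sup>2 \<le> y\<^sup>2" using b by (intro power_mono) auto
    moreover have "y * y \<le> y * 1" using b by (intro mult_left_mono) auto
    ultimately have N2: "N \<le> 2 * y" by (simp add: N_def power2_eq_square)
    have "x * (1 - x) \<le> y\<^sup>2"
    proof -
      have "x * (1 - x) \<le> (1/2)\<^sup>2" using zero_le_power2[of "x - 1/2"] by (simp add: power2_eq_square algebra_simps)
      also have "(1/2)\<^sup>2 \<le> y\<^sup>2" using b by (intro power_mono) auto
      finally show ?thesis .
    qed
    then have "1 - x \<le> N" by (simp add: N_def power2_eq_square algebra_simps)
    then show ?thesis
      unfolding T0_iff q1 q2 unfolding r i using b N Ny N2 by (simp add: divide_le_eq le_divide_eq divide_right_mono)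
  qed
  have "act C_mat ` T0 \<subseteq> T0" using sub by blast
  moreover have "T0 \<subseteq> act C_mat ` T0"
  proof
    fix z assume z: "z \<in> T0"
    then have "Im z > 0" using T0_subset by auto
    then have "z = act C_mat (act C_mat (act C_mat z))"
      using CCC by (simp add: act_mult[symmetric] Im_act_pos_iff PSL.m_assoc)
    then show "z \<in> act C_mat ` T0" using sub z by blast
  qed
  ultimately show ?thesis by blast
qed

text \<open>Both facts come from one computation with the lower row (c, d) of the inverse of k.
  Since the triangle has height at least 1/2, only |c| \<le> 1 survives, and for |c| = 1 only the
  discs resting on 0 and 1; the strict inequalities of \<open>W0\<close> exclude all three
  horoballs.\<close>

lemma W0_disjoint_packing: "W0 \<inter> \<Union>(packing \<one>\<^bsub>PSL2R\<^esub>) = {}"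
  and T0_horoballs: "k \<in> \<Gamma> \<Longrightarrow> z \<in> T0 \<Longrightarrow> z \<in> act k ` H_inf \<Longrightarrow>
    \<exists>n::int. k = aff 1 (of_int n) \<or> k = C_mat \<cdot> aff 1 (of_int n) \<or> k = C_mat \<cdot> C_mat \<cdot> aff 1 (of_int n)"
proof -
  have main: "z \<notin> W0 \<and> (\<exists>n::int. k = aff 1 (of_int n) \<or> k = C_mat \<cdot> aff 1 (of_int n) \<or>
      k = C_mat \<cdot> C_mat \<cdot> aff 1 (of_int n))"
    if k: "k \<in> \<Gamma>" and z: "z \<in> T0" "z \<in> act k ` H_inf" for k z
  proof -
    obtain a b c d :: int where m: "pinv k = pm (of_int a) (of_int b) (of_int c) (of_int d)"
      "of_int a * of_int d - of_int b * of_int c = (1::real)" "a * d - b * c = 1"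
      using modular_inv[OF k] by (rule modular_int_entries)
    have z0: "Im z > 0" "Im (act (pinv k) z) \<ge> 1"
      using z(2) k by (auto simp: mem_act_image[OF _ H_inf_subset] simp del: image_eqI)
    have kk: "k = pm (of_int d) (- of_int b) (- of_int c) (of_int a)"
      using pinv_pm[OF m(2)] k by (simp flip: m(1))
    have le: "(of_int c * Re z + of_int d)\<^sup>2 + (of_int c)\<^sup>2 * (Im z)\<^sup>2 \<le> Im z"
      using z0(2) Im_act_ge_iff[OF m(2) z0(1)] by (simp add: m(1))
    have b: "0 \<le> Re z" "Re z \<le> 1" "1/2 \<le> Im z" "Im z \<le> 1"
      using z(1) by (auto simp: T0_iff)
    have affine: "\<exists>n::int. l = aff 1 (of_int n)"
      if "l \<in> \<Gamma>" "l = pm p q 0 r" "p * r = 1" for l p q r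
      using modular_lower_zero[of p q r] that by simp
    show ?thesis
    proof (cases "c = 0")
      case True
      then have "a * d = 1" using m by simp
      then have "d = 1 \<or> d = - 1" by (metis zmult_eq_1_iff)
      then have "Im z \<ge> 1" using le True by auto
      then have "z \<notin> W0" by (simp add: W0_iff)
      moreover have "\<exists>n::int. k = aff 1 (of_int n)"
        by (rule affine[OF k kk[unfolded True, simplified]]) (use m True in \<open>simp add: mult.commute\<close>)
      ultimately show ?thesis by blast
    next
      case False
      have "(of_int c)\<^sup>2 * (Im z)\<^sup>2 \<le> Im z" using le zero_le_power2[of "of_int c * Re z + of_int d"] by linarith
      then have "(of_int c)\<^sup>2 * Im z * Im z \<le> 1 * Im z" by (simp add: power2_eq_square mult.assoc)
      then have "(of_int c)\<^sup>2 * Im z \<le> 1" using z0 by (simp only: mult_le_cancel_right_pos)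
      moreover have "(of_int c)\<^sup>2 * (1/2) \<le> (of_int c)\<^sup>2 * Im z" using b by (intro mult_left_mono) auto
      ultimately have "(of_int c)\<^sup>2 < (4::real)" by linarith
      then have "\<bar>of_int c\<bar> < (2::real)" using abs_le_square_iff[of 2 "real_of_int c"] by (simp add: not_le[symmetric])
      then have "\<bar>c\<bar> < 2" by linarith
      then have c: "c = 1 \<or> c = - 1" using False by linarith
      \<comment> \<open>For |c| = 1 the horoball is the disc of diameter 1 resting on n = - d /
        c.\<close>
      define n where "n = - (c * d)"
      have eq: "(of_int c * Re z + of_int d)\<^sup>2 = (Re z - of_int n)\<^sup>2"
        using c by (auto simp: n_def power2_commute)
      have le': "(Re z - of_int n)\<^sup>2 + (Im z)\<^sup>2 \<le> Im z" using le c unfolding eq by auto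
      have "(Re z - of_int n)\<^sup>2 < 1\<^sup>2"
      proof -
        have "(1/2)\<^sup>2 \<le> (Im z)\<^sup>2" using b by (intro power_mono) auto
        then show ?thesis using le' b by (simp add: power_divide)
      qed
      then have "\<bar>Re z - of_int n\<bar> < 1" using abs_le_square_iff[of 1 "Re z - of_int n"] by (simp add: not_le[symmetric])
      moreover have "(Im z - 1/2)\<^sup>2 \<ge> 0" by simp
      then have "(Re z - of_int n)\<^sup>2 \<le> (1/2)\<^sup>2" using le' by (simp add: power2_eq_square algebra_simps)
      then have "\<bar>Re z - of_int n\<bar> \<le> 1/2" using abs_le_square_iff[of "Re z - of_int n" "1/2"] by simp
      then have "of_int n < (2::real)" "of_int n > (- 1::real)" using b by linarith+
      then have n: "n = 0 \<or> n = 1" by linarith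
      have nW: "z \<notin> W0" using le' n by (auto simp: W0_iff)
      show ?thesis
      proof (cases "n = 0")
        case True
        then have d: "d = 0" using c by (auto simp: n_def)
        have "pinv C_mat \<cdot> k \<in> \<Gamma>" using k by simp
        moreover have "pinv C_mat \<cdot> k = pm (of_int c) (- of_int b - of_int a) 0 (- of_int b)"
          using d by (simp add: C_mat_pm pinv_pm kk pm_mult)
        moreover have "of_int c * (- of_int b) = (1::real)" using m d by (simp add: mult.commute)
        ultimately obtain j :: int where j: "pinv C_mat \<cdot> k = aff 1 (of_int j)"
          using affine by blast
        have "k = C_mat \<cdot> (pinv C_mat \<cdot> k)" using k by (simp add: PSL.m_assoc[symmetric])
        then show ?thesis using j nW by auto
      next
        case False
        then have d: "d = - c" using n c by (auto simp: n_def)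
        have "pinv (C_mat \<cdot> C_mat) \<cdot> k \<in> \<Gamma>" using k by simp
        moreover have "pinv (C_mat \<cdot> C_mat) \<cdot> k = pm (- of_int c) (of_int a) 0 (of_int b + of_int a)"
          using d by (simp add: C_mat_pm pm_mult pinv_pm kk pm_eq_iff)
        moreover have "- of_int c * (of_int b + of_int a) = (1::real)" using m d by (simp add: algebra_simps)
        ultimately obtain j :: int where j: "pinv (C_mat \<cdot> C_mat) \<cdot> k = aff 1 (of_int j)"
          using affine by blast
        have "k = C_mat \<cdot> C_mat \<cdot> (pinv (C_mat \<cdot> C_mat) \<cdot> k)" using k by (simp add: PSL.m_assoc[symmetric])
        then show ?thesis using j nW by auto
      qed
    qed
  qed
  show "W0 \<inter> \<Union>(packing \<one>\<^bsub>PSL2R\<^esub>) = {}"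
    using main W0_T0 by (fastforce simp: packing_eq)
  show "k \<in> \<Gamma> \<Longrightarrow> z \<in> T0 \<Longrightarrow> z \<in> act k ` H_inf \<Longrightarrow>
    \<exists>n::int. k = aff 1 (of_int n) \<or> k = C_mat \<cdot> aff 1 (of_int n) \<or> k = C_mat \<cdot> C_mat \<cdot> aff 1 (of_int n)"
    using main by blast
qed

lemma horoball_aff [simp]:
  "y \<in> carrier PSL2R \<Longrightarrow> act (y \<cdot> aff 1 b) ` H_inf = act y ` H_inf"
  by (simp add: act_image_mult[OF _ _ H_inf_subset])

section \<open>The components of the complement of the packing\<close>

lemma T0_minus_W0: "z \<in> T0 \<Longrightarrow> z \<notin> W0 \<Longrightarrow> z \<in> \<Union>(packing \<one>\<^bsub>PSL2R\<^esub>)"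
proof -
  assume z: "z \<in> T0" "z \<notin> W0"
  have z0: "Im z > 0" using z T0_subset by auto
  \<comment> \<open>The maps - 1 / z and - 1 / (z - 1) carry the discs resting on 0 and 1 to
    \<open>H_inf\<close>.\<close>
  have "pm 0 (- 1) 1 0 \<in> \<Gamma>" "pm 0 (- 1) 1 (- 1) \<in> \<Gamma>" by (rule modular_pm'; simp)+
  moreover have "Im (act \<one>\<^bsub>PSL2R\<^esub> z) \<ge> 1 \<or> Im (act (pm 0 (- 1) 1 0) z) \<ge> 1 \<or> Im (act (pm 0 (- 1) 1 (- 1)) z) \<ge> 1"
  proof -
    have "Im z = 1 \<or> Im z = (Re z)\<^sup>2 + (Im z)\<^sup>2 \<or> Im z = (Re z - 1)\<^sup>2 + (Im z)\<^sup>2"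
    proof (rule ccontr)
      assume "\<not> ?thesis"
      then have s: "0 \<le> Re z" "Re z \<le> 1" "1/2 \<le> Im z" "Im z < 1"
        "Im z < (Re z)\<^sup>2 + (Im z)\<^sup>2" "Im z < (Re z - 1)\<^sup>2 + (Im z)\<^sup>2"
        using z by (auto simp: T0_iff)
      have "Im z \<noteq> 1/2"
      proof
        assume y: "Im z = 1/2"
        have "(Im z)\<^sup>2 = 1/4" by (simp add: y power_divide)
        then have "1/4 < (Re z)\<^sup>2" "1/4 < (Re z - 1)\<^sup>2" using s y by linarith+
        then have "(1/2)\<^sup>2 < (Re z)\<^sup>2" "(1/2)\<^sup>2 < (1 - Re z)\<^sup>2"
          by (simp_all add: power_divide power2_commute[of 1])
        then have "1/2 < Re z" "1/2 < 1 - Re z"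
          using power2_less_imp_less[of "1/2" "Re z"] power2_less_imp_less[of "1/2" "1 - Re z"] s by simp_all
        then show False by simp
      qed
      moreover have "Im z * Im z < Im z * 1" using s by (intro mult_strict_left_mono) auto
      then have "Re z \<noteq> 0" "Re z \<noteq> 1" using s z0 by (auto simp: power2_eq_square)
      ultimately show False using z(2) s by (simp add: W0_iff)
    qed
    then show ?thesis
      using z0 by (subst (1 2) Im_act_ge_iff) auto
  qed
  ultimately have "\<exists>k\<in>\<Gamma>. Im (act k z) \<ge> 1" using modular_one by blast
  then show ?thesis using z0 by (simp only: Union_packing[OF PSL.one_closed] PSL.inv_one act_one)
qed

text \<open>Heights in the orbit are Im z divided by |c * z + d|^2, and only finitely many integer
  rows (c, d) make the denominator at most 1. The row (0, 1) is one of them, so a minimum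
  exists.\<close>

lemma modular_max_height:
  assumes "Im z > 0"
  shows "\<exists>k\<in>\<Gamma>. \<forall>l\<in>\<Gamma>. Im (act l z) \<le> Im (act k z)"
proof -
  define f where "f = (\<lambda>(c, d). (of_int c * Re z + of_int d)\<^sup>2 + (of_int c)\<^sup>2 * (Im z)\<^sup>2 :: real)"
  define D where "D = {(c, d). (\<exists>a b. a * d - b * c = 1) \<and> f (c, d) \<le> 1}"
  have "D \<subseteq> {- \<lfloor>1 / Im z\<rfloor>..\<lfloor>1 / Im z\<rfloor>} \<times> {- \<lfloor>1 + \<bar>Re z\<bar> / Im z\<rfloor>..\<lfloor>1 + \<bar>Re z\<bar> / Im z\<rfloor>}"
  proof
    fix x assume "x \<in> D"
    then obtain c d where x: "x = (c, d)" "f (c, d) \<le> 1" by (auto simp: D_def)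
    have "(of_int c * Im z)\<^sup>2 \<le> 1\<^sup>2" "(of_int c * Re z + of_int d)\<^sup>2 \<le> 1\<^sup>2"
      using x(2) zero_le_power2[of "of_int c * Re z + of_int d"] zero_le_power2[of "of_int c * Im z"]
      unfolding f_def prod.case power_mult_distrib one_power2 by linarith+
    then have c: "\<bar>of_int c * Im z\<bar> \<le> 1" and d: "\<bar>of_int c * Re z + of_int d\<bar> \<le> 1"
      by (simp_all add: abs_square_le_1)
    have c': "\<bar>real_of_int c\<bar> \<le> 1 / Im z" using c assms by (simp add: le_divide_eq abs_mult)
    then have "\<bar>of_int c * Re z\<bar> \<le> 1 / Im z * \<bar>Re z\<bar>" unfolding abs_mult by (intro mult_right_mono) auto
    then have d': "\<bar>real_of_int d\<bar> \<le> 1 + \<bar>Re z\<bar> / Im z" using d by simp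
    have "of_int \<bar>c\<bar> \<le> 1 / Im z" "of_int \<bar>d\<bar> \<le> 1 + \<bar>Re z\<bar> / Im z" using c' d' by simp_all
    then have "\<bar>c\<bar> \<le> \<lfloor>1 / Im z\<rfloor>" "\<bar>d\<bar> \<le> \<lfloor>1 + \<bar>Re z\<bar> / Im z\<rfloor>" by (simp_all only: le_floor_iff)
    then show "x \<in> {- \<lfloor>1 / Im z\<rfloor>..\<lfloor>1 / Im z\<rfloor>} \<times> {- \<lfloor>1 + \<bar>Re z\<bar> / Im z\<rfloor>..\<lfloor>1 + \<bar>Re z\<bar> / Im z\<rfloor>}"
      unfolding x mem_Times_iff fst_conv snd_conv atLeastAtMost_iff abs_le_iff by linarith
  qed
  then have fin: "finite D" by (rule finite_subset) simp
  have "(0, 1) \<in> D" by (simp add: D_def f_def)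
  then obtain x where x: "x \<in> D" "\<And>y. y \<in> D \<Longrightarrow> f x \<le> f y"
    using arg_min_if_finite[OF fin, of f] by (metis empty_iff not_le)
  then obtain a b c d where abcd: "x = (c, d)" "a * d - b * c = 1" "f x \<le> 1"
    by (auto simp: D_def)
  have hI: "Im (act (pm (of_int a) (of_int b) (of_int c) (of_int d)) z) = Im z / f (c, d)" "f (c, d) > 0"
    if "a * d - b * c = 1" for a b c d :: int
  proof -
    have "of_int (a * d - b * c) = (1::real)" using that by simp
    then have e: "of_int a * of_int d - of_int b * of_int c = (1::real)" by simp
    show "Im (act (pm (of_int a) (of_int b) (of_int c) (of_int d)) z) = Im z / f (c, d)"
      by (simp only: Im_act[OF e] norm_denom_power2 f_def prod.case)
    show "f (c, d) > 0" unfolding f_def prod.case by (rule denom_power2_pos[OF e assms])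
  qed
  show ?thesis
  proof (intro bexI ballI)
    show "pm (of_int a) (of_int b) (of_int c) (of_int d) \<in> \<Gamma>" using abcd by simp
    fix l assume "l \<in> \<Gamma>"
    then obtain a' b' c' d' :: int where l: "l = pm (of_int a') (of_int b') (of_int c') (of_int d')"
      "a' * d' - b' * c' = 1" by (rule modular_cases)
    have "f (c, d) \<le> f (c', d')"
    proof (cases "f (c', d') \<le> 1")
      case True
      then have "(c', d') \<in> D" using l by (auto simp: D_def)
      then show ?thesis using x(2) abcd by auto
    next
      case False
      then show ?thesis using abcd by simp
    qed
    then show "Im (act l z) \<le> Im (act (pm (of_int a) (of_int b) (of_int c) (of_int d)) z)"
      unfolding l(1) hI[OF l(2)] hI(1)[OF abcd(2)] using hI(2)[OF abcd(2)] assms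
      by (intro divide_left_mono) auto
  qed
qed

text \<open>Classical reduction: take the highest point w of the orbit and translate it into 0 \<le>
  Re w < 1. Maximality against - 1 / z and - 1 / (z - 1) gives |w| \<ge> 1 and |w - 1| \<ge> 1, and
  lying outside the packing gives Im w < 1.\<close>

lemma complement_covered:
  assumes "Im z > 0" "z \<notin> \<Union>(packing \<one>\<^bsub>PSL2R\<^esub>)"
  shows "\<exists>k\<in>\<Gamma>. act k z \<in> W0"
proof -
  obtain k where k: "k \<in> \<Gamma>" "\<And>l. l \<in> \<Gamma> \<Longrightarrow> Im (act l z) \<le> Im (act k z)"
    using modular_max_height[OF assms(1)] by blast
  define n where "n = \<lfloor>Re (act k z)\<rfloor>"
  define m where "m = aff 1 (of_int (- n)) \<cdot> k"
  have mG: "m \<in> \<Gamma>" unfolding m_def by (intro modular_mult aff_1_modular k)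
  define w where "w = act m z"
  have w: "w = act k z - of_int n"
    unfolding w_def m_def using k(1) assms(1) by (subst act_mult) (simp_all add: act_aff)
  have w0: "Im w > 0" unfolding w_def using mG assms by (simp add: Im_act_pos_iff)
  have max: "Im (act l w) \<le> Im w" if "l \<in> \<Gamma>" for l
  proof -
    have "act l w = act (l \<cdot> m) z" unfolding w_def using that mG assms by (simp add: act_mult)
    then show ?thesis using k(2)[of "l \<cdot> m"] that mG by (simp add: w)
  qed
  have re: "0 \<le> Re w" "Re w < 1" unfolding w n_def by (simp_all add: floor_le_iff) linarith
  have e: "0 * 0 - (- 1) * 1 = (1::real)" "0 * (- 1) - (- 1) * 1 = (1::real)" by simp_all
  have "pm 0 (- 1) 1 0 \<in> \<Gamma>" "pm 0 (- 1) 1 (- 1) \<in> \<Gamma>" by (rule modular_pm'; simp)+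
  from max[OF this(1)] max[OF this(2)]
  have q: "1 \<le> (Re w)\<^sup>2 + (Im w)\<^sup>2" "1 \<le> (Re w - 1)\<^sup>2 + (Im w)\<^sup>2"
    using denom_power2_pos[OF e(1) w0] denom_power2_pos[OF e(2) w0] w0
    by (simp_all add: Im_act[OF e(1)] Im_act[OF e(2)] cmod_power2 divide_le_eq)
  have "Im (act m z) < 1" using assms mG Union_packing[OF PSL.one_closed, of z] by (auto simp: not_le)
  then have im: "Im w < 1" by (simp add: w_def)
  have "(1/2)\<^sup>2 < (Im w)\<^sup>2"
  proof (cases "Re w \<le> 1/2")
    case True
    then have "(Re w)\<^sup>2 \<le> (1/2)\<^sup>2" using re by (intro power_mono) auto
    then show ?thesis using q by (simp add: power_divide)
  next
    case False
    then have "(1 - Re w)\<^sup>2 \<le> (1/2)\<^sup>2" using re by (intro power_mono) auto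
    then show ?thesis using q by (simp add: power_divide power2_commute[of 1])
  qed
  then have im2: "1/2 < Im w" using w0 by (intro power2_less_imp_less[of "1/2" "Im w"]) auto
  have "Re w \<noteq> 0"
  proof
    assume "Re w = 0"
    then have "1 \<le> (Im w)\<^sup>2" using q by simp
    moreover have "(Im w)\<^sup>2 < 1" using im w0 by (simp add: abs_square_less_1)
    ultimately show False by simp
  qed
  then have "w \<in> W0" using re im im2 q by (simp add: W0_iff)
  then show ?thesis using mG by (auto simp: w_def)
qed

text \<open>Each image of \<open>W0\<close> is open, and it is closed in the complement because it
  is the trace of the compact image of \<open>T0\<close>. Being connected, it is a component, and by
  \<open>complement_covered\<close> there are no others.\<close>

lemma triangles_packing:
  assumes g: "g \<in> carrier PSL2R"
  shows "triangles (packing g) = (\<lambda>k. act (g \<cdot> k) ` T0) ` \<Gamma>"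
proof -
  let ?A = "\<H> - \<Union>(packing g)"
  have T0W0: "T0 \<inter> (\<H> - \<Union>(packing \<one>\<^bsub>PSL2R\<^esub>)) = W0"
    using T0_minus_W0 W0_disjoint_packing W0_T0 W0_subset by blast
  have comp: "act (g \<cdot> k) ` W0 \<in> components ?A" and clos: "closure (act (g \<cdot> k) ` W0) = act (g \<cdot> k) ` T0"
    if k: "k \<in> \<Gamma>" for k
  proof -
    let ?y = "g \<cdot> k"
    have y: "?y \<in> carrier PSL2R" using g k by simp
    have A: "?A = act ?y ` (\<H> - \<Union>(packing \<one>\<^bsub>PSL2R\<^esub>))"
    proof -
      have "act ?y ` \<H> = \<H>"
        using act_image_subset[OF y subset_refl] act_image_subset[OF PSL.inv_closed[OF y] subset_refl]
          act_image_inv(2)[OF y subset_refl] by (metis image_mono subset_antisym)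
      moreover have "act ?y ` \<Union>(packing \<one>\<^bsub>PSL2R\<^esub>) = \<Union>(packing g)"
        using y g k by (simp add: Union_packing_image packing_mult_modular)
      moreover have "act ?y ` (\<H> - \<Union>(packing \<one>\<^bsub>PSL2R\<^esub>)) = act ?y ` \<H> - act ?y ` \<Union>(packing \<one>\<^bsub>PSL2R\<^esub>)"
        by (rule inj_on_image_set_diff[OF inj_on_act[OF y]]) (auto intro: subsetD[OF packing_subset[OF PSL.one_closed]])
      ultimately show ?thesis by simp
    qed
    have comT: "compact (act ?y ` T0)"
      using compact_T0 continuous_on_act[OF y] T0_subset by (meson compact_continuous_image continuous_on_subset)
    have yW: "act ?y ` T0 \<inter> ?A = act ?y ` W0"
      unfolding A T0W0[symmetric]
      by (rule inj_on_image_Int[OF inj_on_act[OF y], symmetric]) (use T0_subset in auto)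
    show "closure (act ?y ` W0) = act ?y ` T0"
    proof
      show "closure (act ?y ` W0) \<subseteq> act ?y ` T0"
        by (rule closure_minimal) (use W0_T0 comT compact_imp_closed in auto)
      show "act ?y ` T0 \<subseteq> closure (act ?y ` W0)"
      proof -
        have "continuous_on (closure W0) (act ?y)"
          unfolding closure_W0 by (rule continuous_on_subset[OF continuous_on_act[OF y] T0_subset])
        from image_closure_subset[OF this closed_closure closure_subset] show ?thesis
          unfolding closure_W0 .
      qed
    qed
    have op: "open (act ?y ` W0)" by (rule open_act_image[OF y open_W0 W0_subset])
    have sub: "act ?y ` W0 \<subseteq> ?A" using yW by blast
    have con: "connected (act ?y ` W0)" by (rule connected_act_image[OF y connected_W0 W0_subset])
    have "W0 \<noteq> {}" using W0_middle[of "3/4"] by auto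
    then obtain x where x: "x \<in> act ?y ` W0" by blast
    have "connected_component_set ?A x = act ?y ` W0"
    proof
      show "act ?y ` W0 \<subseteq> connected_component_set ?A x"
        by (rule connected_component_maximal[OF x con sub])
      let ?K = "connected_component_set ?A x"
      have K: "connected ?K" "?K \<subseteq> ?A" by (simp_all add: connected_component_subset)
      have "x \<in> ?K" using x sub by auto
      have "openin (top_of_set ?K) (?K \<inter> act ?y ` W0)" "closedin (top_of_set ?K) (?K \<inter> act ?y ` W0)"
        using op compact_imp_closed[OF comT] yW K(2) unfolding openin_open closedin_closed by blast+
      then have "?K \<inter> act ?y ` W0 = {} \<or> ?K \<inter> act ?y ` W0 = ?K"
        using K(1) unfolding connected_clopen by blast
      then show "?K \<subseteq> act ?y ` W0" using x \<open>x \<in> ?K\<close> by blast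
    qed
    then show "act ?y ` W0 \<in> components ?A" using x sub by (auto simp: components_def)
  qed
  have "components ?A = (\<lambda>k. act (g \<cdot> k) ` W0) ` \<Gamma>"
  proof
    show "(\<lambda>k. act (g \<cdot> k) ` W0) ` \<Gamma> \<subseteq> components ?A" using comp by blast
    show "components ?A \<subseteq> (\<lambda>k. act (g \<cdot> k) ` W0) ` \<Gamma>"
    proof
      fix K assume K: "K \<in> components ?A"
      obtain z where z: "z \<in> K" using in_components_nonempty[OF K] by blast
      have zA: "z \<in> ?A" using in_components_subset[OF K] z by blast
      define w where "w = act (pinv g) z"
      have w: "Im w > 0" "act g w = z" using zA g by (auto simp: w_def Im_act_pos_iff act_inv_act)
      have "w \<notin> \<Union>(packing \<one>\<^bsub>PSL2R\<^esub>)"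
        using zA Union_packing[OF g, of z] Union_packing[OF PSL.one_closed, of w] w by (auto simp flip: w_def)
      then obtain k where k: "k \<in> \<Gamma>" "act k w \<in> W0" using complement_covered w by blast
      have "act (g \<cdot> pinv k) (act k w) = z"
        using g k w by (simp add: act_mult act_inv_act Im_act_pos_iff)
      then have "z \<in> act (g \<cdot> pinv k) ` W0" using k by blast
      moreover have "act (g \<cdot> pinv k) ` W0 \<in> components ?A" by (rule comp[OF modular_inv[OF k(1)]])
      ultimately have "K = act (g \<cdot> pinv k) ` W0" using K z components_nonoverlap[OF K, of "act (g \<cdot> pinv k) ` W0"] by blast
      then show "K \<in> (\<lambda>k. act (g \<cdot> k) ` W0) ` \<Gamma>" by (rule image_eqI) (rule modular_inv[OF k(1)])
    qed
  qed
  then show ?thesis unfolding triangles_def by (simp add: image_image clos)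
qed

lemma C_power_T0: "act (C_mat \<cdot> C_mat) ` T0 = T0"
  by (simp add: act_image_mult[OF _ _ T0_subset] C_T0)

text \<open>Right multiplication by \<open>C_mat\<close> keeps the triangle and passes to another of
  its three horoballs. Pairs of a horoball and a triangle touching it are therefore indexed by
  \<Gamma>.\<close>

lemma horoballs_at_triangle:
  assumes g: "g \<in> carrier PSL2R" and k: "k \<in> \<Gamma>"
  shows "{H \<in> packing g. H \<inter> act (g \<cdot> k) ` T0 \<noteq> {}} =
    {act (g \<cdot> k) ` H_inf, act (g \<cdot> (k \<cdot> C_mat)) ` H_inf, act (g \<cdot> (k \<cdot> C_mat \<cdot> C_mat)) ` H_inf}" (is "?L = ?R")
proof
  have "\<i> \<in> T0 \<inter> H_inf" by (simp add: T0_iff)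
  have meet: "act (g \<cdot> k \<cdot> c) ` H_inf \<inter> act (g \<cdot> k) ` T0 \<noteq> {}"
    if c: "c \<in> \<Gamma>" "act c ` T0 = T0" for c
  proof -
    have "act (g \<cdot> k \<cdot> c) ` T0 = act (g \<cdot> k) ` T0"
      using g k c by (simp add: act_image_mult[OF _ _ T0_subset])
    then show ?thesis using \<open>\<i> \<in> T0 \<inter> H_inf\<close> by blast
  qed
  have "act (g \<cdot> k) ` H_inf \<inter> act (g \<cdot> k) ` T0 \<noteq> {}" using \<open>\<i> \<in> T0 \<inter> H_inf\<close> by blast
  moreover have "act (g \<cdot> (k \<cdot> C_mat)) ` H_inf \<inter> act (g \<cdot> k) ` T0 \<noteq> {}"
    using meet[of C_mat] g k C_T0 by (simp add: PSL.m_assoc)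
  moreover have "act (g \<cdot> (k \<cdot> C_mat \<cdot> C_mat)) ` H_inf \<inter> act (g \<cdot> k) ` T0 \<noteq> {}"
    using meet[of "C_mat \<cdot> C_mat"] g k C_power_T0 by (simp add: PSL.m_assoc)
  moreover have "?R \<subseteq> packing g" using k unfolding packing_eq[OF g] by auto
  ultimately show "?R \<subseteq> ?L" by blast
  show "?L \<subseteq> ?R"
  proof
    fix H assume "H \<in> ?L"
    then obtain l z where l: "l \<in> \<Gamma>" "H = act (g \<cdot> l) ` H_inf" and z: "z \<in> H" "z \<in> act (g \<cdot> k) ` T0"
      unfolding packing_eq[OF g] by blast
    obtain w where w: "w \<in> T0" "z = act (g \<cdot> k) w" using z by blast
    have w0: "Im w > 0" using w T0_subset by auto
    have gl: "g \<cdot> l \<in> carrier PSL2R" "g \<cdot> k \<in> carrier PSL2R" using g k l by auto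
    have m: "pinv k \<cdot> l \<in> \<Gamma>" using k l by simp
    have kl: "l = k \<cdot> (pinv k \<cdot> l)" using k l by (simp add: PSL.m_assoc[symmetric])
    have "H = act (g \<cdot> k) ` act (pinv k \<cdot> l) ` H_inf"
    proof -
      have "g \<cdot> l = (g \<cdot> k) \<cdot> (pinv k \<cdot> l)" using g k l kl by (simp add: PSL.m_assoc)
      then show ?thesis using gl m l by (simp add: act_image_mult[OF _ _ H_inf_subset])
    qed
    then obtain v where v: "v \<in> act (pinv k \<cdot> l) ` H_inf" "z = act (g \<cdot> k) v" using z by blast
    have "Im v > 0" using v(1) m by (auto simp: mem_act_image[OF _ H_inf_subset])
    then have "v = w" using inj_on_act[OF gl(2)] v w w0 by (auto dest: inj_onD)
    then obtain n :: int where "pinv k \<cdot> l = aff 1 (of_int n) \<or> pinv k \<cdot> l = C_mat \<cdot> aff 1 (of_int n) \<or>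
        pinv k \<cdot> l = C_mat \<cdot> C_mat \<cdot> aff 1 (of_int n)"
      using T0_horoballs[OF m w(1)] v by blast
    then have "l = k \<cdot> aff 1 (of_int n) \<or> l = k \<cdot> C_mat \<cdot> aff 1 (of_int n) \<or>
        l = k \<cdot> C_mat \<cdot> C_mat \<cdot> aff 1 (of_int n)"
      using kl k by (metis C_mat_modular PSL.m_assoc PSL.m_closed aff_1_modular modular_PSL2R)
    then have "g \<cdot> l = g \<cdot> k \<cdot> aff 1 (of_int n) \<or> g \<cdot> l = g \<cdot> (k \<cdot> C_mat) \<cdot> aff 1 (of_int n) \<or>
        g \<cdot> l = g \<cdot> (k \<cdot> C_mat \<cdot> C_mat) \<cdot> aff 1 (of_int n)"
      using g k by (auto simp: PSL.m_assoc)
    then show "H \<in> ?R" using l(2) g k by (elim disjE) simp_all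
  qed
qed

lemma horoballs_at_triangle_distinct:
  assumes g: "g \<in> carrier PSL2R" and k: "k \<in> \<Gamma>"
  shows "distinct [act (g \<cdot> k) ` H_inf, act (g \<cdot> (k \<cdot> C_mat)) ` H_inf, act (g \<cdot> (k \<cdot> C_mat \<cdot> C_mat)) ` H_inf]"
proof -
  have *: "act (g \<cdot> l) ` H_inf \<noteq> act (g \<cdot> (l \<cdot> m)) ` H_inf"
    if l: "l \<in> \<Gamma>" and m: "m \<in> \<Gamma>" "\<And>n::int. m \<noteq> aff 1 (of_int n)" for l m
  proof
    assume eq: "act (g \<cdot> l) ` H_inf = act (g \<cdot> (l \<cdot> m)) ` H_inf"
    have "act (g \<cdot> l) (2 * \<i>) \<in> act (g \<cdot> l) ` {z. Im z > 1}" by (rule imageI) simp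
    moreover have "act (g \<cdot> l) (2 * \<i>) \<in> act (g \<cdot> l) ` H_inf" by (rule imageI) simp
    ultimately obtain n :: int where "l \<cdot> m = l \<cdot> aff 1 (of_int n)"
      using horoball_overlap[OF g l modular_mult[OF l m(1)]] unfolding eq by blast
    then show False using l m by simp
  qed
  have C: "C_mat \<noteq> aff 1 (of_int n)" "C_mat \<cdot> C_mat \<noteq> aff 1 (of_int n)" for n :: int
    by (simp_all add: C_mat_pm aff_def pm_mult pm_eq_iff)
  show ?thesis
    using *[OF k C_mat_modular C(1)] *[OF k modular_mult[OF C_mat_modular C_mat_modular] C(2)]
      *[OF modular_mult[OF k C_mat_modular] C_mat_modular C(1)] k by (simp add: PSL.m_assoc)
qed

section \<open>Dyadic integers\<close>

lemma residue_of_nat: "residue (of_nat m) n = int m mod 2 ^ n"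
  by (induction m) (simp_all add: residue_simps mod_simps add.commute)

lemma residue_of_int: "residue (of_int a) n = a mod 2 ^ n"
  by (cases a rule: int_cases2) (simp_all add: residue_simps residue_of_nat mod_simps)

lemma coherent_cong:
  assumes "coherent c" "n \<le> j"
  shows "[c j = c n] (mod 2 ^ Suc n)"
  using assms(2)
proof (induction rule: dec_induct)
  case (step m)
  have "[c (Suc m) = c m] (mod 2 ^ Suc m)" using assms(1) by (simp add: coherent_def)
  moreover have "(2::int) ^ Suc n dvd 2 ^ Suc m" using step by (intro le_imp_power_dvd) simp
  ultimately have "[c (Suc m) = c m] (mod 2 ^ Suc n)" by (rule cong_dvd_modulus)
  then show ?case using step.IH by (rule cong_trans)
qed simp

text \<open>The sequence is eventually constant modulo each power of 2. Coherence fixes the residue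
  modulo 2 ^ (n + 1) already from \<open>c n\<close> on, one digit more than the index n
  suggests.\<close>

lemma coherent_limit:
  assumes "coherent c"
  obtains d where "\<And>n. residue d (Suc n) = c n mod 2 ^ Suc n" "lim (\<lambda>j. of_int (c j)) = d"
proof -
  define f where "f n = c n mod 2 ^ n" for n
  have cm: "c j mod 2 ^ n = c n mod 2 ^ n" if "n \<le> j" for n j
    using cong_dvd_modulus[OF coherent_cong[OF assms that], of "2 ^ n"] by (simp add: cong_def)
  have coh: "f n = f (Suc n) mod 2 ^ n" for n
  proof -
    have "f (Suc n) mod 2 ^ n = c (Suc n) mod 2 ^ n"
      unfolding f_def by (rule mod_mod_cancel) simp
    then show ?thesis using cm[of n "Suc n"] by (simp add: f_def)
  qed
  have d: "residue (Abs_dyadic f) = f" by (rule Abs_dyadic_inverse) (use coh in blast)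
  have "(\<lambda>j. of_int (c j)) \<longlonglongrightarrow> Abs_dyadic f"
    unfolding tendsto_def
  proof (intro allI impI)
    fix S assume S: "open S" "Abs_dyadic f \<in> S"
    then obtain n where n: "\<And>y. residue y n = residue (Abs_dyadic f) n \<Longrightarrow> y \<in> S"
      unfolding open_dyadic_def by metis
    have "of_int (c j) \<in> S" if "j \<ge> n" for j
      by (rule n) (use cm[OF that] in \<open>simp add: residue_of_int d f_def\<close>)
    then show "\<forall>\<^sub>F j in sequentially. of_int (c j) \<in> S" by (auto simp: eventually_sequentially)
  qed
  then have "lim (\<lambda>j. of_int (c j)) = Abs_dyadic f" by (rule limI)
  moreover have "residue (Abs_dyadic f) (Suc n) = c n mod 2 ^ Suc n" for n
    using coherent_cong[OF assms, of n "Suc n"] by (simp add: d f_def cong_def)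
  ultimately show ?thesis using that by blast
qed

definition coherent_index :: "(nat \<Rightarrow> int) \<Rightarrow> dyadic" where
  "coherent_index c = - lim (\<lambda>j. of_int (c j))"

lemma residue_coherent_index:
  "coherent c \<Longrightarrow> residue (coherent_index c) (Suc n) = (- c n) mod 2 ^ Suc n"
  by (rule coherent_limit[of c]) (simp_all add: coherent_index_def residue_simps mod_simps)

lemma dyadic_eqI_Suc: "(\<And>n. residue x (Suc n) = residue y (Suc n)) \<Longrightarrow> x = y"
  by (rule dyadic_eqI) (metis not0_implies_Suc residue_0)

section \<open>Tilings subordinate to a packing\<close>

text \<open>For a frame \<open>g k\<close> of the horoball \<open>g k {Im z \<ge> 1}\<close>, the tile \<open>g k (2\<^sup>n z + r)\<close> belongs to \<open>T\<close>
  if and only if \<open>- r\<close> is congruent modulo \<open>2 ^ (n + 1)\<close> to the dyadic index at the triangle \<open>g k T0\<close>.\<close>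

definition index_at :: "(real^2^2) set \<Rightarrow> (real^2^2) set set \<Rightarrow> (real^2^2) set \<Rightarrow> dyadic \<Rightarrow> bool" where
  "index_at g T k d \<longleftrightarrow> (\<forall>n r. g \<cdot> k \<cdot> aff (2 ^ n) (of_int r) \<in> T \<longleftrightarrow> residue d (Suc n) = (- r) mod 2 ^ Suc n)"

definition index_fun :: "(real^2^2) set \<Rightarrow> (real^2^2) set set \<Rightarrow> (real^2^2) set \<Rightarrow> dyadic" where
  "index_fun g T k = (THE d. index_at g T k d)"

text \<open>The combinatorial form of being nondegenerate over \<open>packing g\<close>, phrased
  through membership in T alone. For tilings it is equivalent to \<open>nondegenerate_over\<close>,
  by \<open>nondegenerate_imp_packed\<close> and \<open>packed_imp_nondegenerate\<close>.\<close>

definition packed :: "(real^2^2) set \<Rightarrow> (real^2^2) set set \<Rightarrow> bool" where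
  "packed g T \<longleftrightarrow> g \<in> carrier PSL2R \<and> T \<subseteq> carrier PSL2R \<and>
    (\<forall>x\<in>T. \<exists>k\<in>\<Gamma>. \<exists>n. \<exists>r::int. x = g \<cdot> k \<cdot> aff (2 ^ n) (of_int r)) \<and>
    (\<forall>k\<in>\<Gamma>. \<exists>d. index_at g T k d)"

lemma index_at_unique: "index_at g T k d \<Longrightarrow> index_at g T k d' \<Longrightarrow> d = d'"
proof (rule dyadic_eqI_Suc)
  fix n
  assume d: "index_at g T k d" and d': "index_at g T k d'"
  have "residue d (Suc n) = (- (- residue d (Suc n))) mod 2 ^ Suc n" by (simp del: power_Suc)
  then have "g \<cdot> k \<cdot> aff (2 ^ n) (of_int (- residue d (Suc n))) \<in> T"
    using d unfolding index_at_def by blast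
  then have "residue d' (Suc n) = (- (- residue d (Suc n))) mod 2 ^ Suc n"
    using d' unfolding index_at_def by blast
  then show "residue d (Suc n) = residue d' (Suc n)" by (simp del: power_Suc)
qed

lemma index_fun_eq: "index_at g T k d \<Longrightarrow> index_fun g T k = d"
  unfolding index_fun_def by (rule the_equality) (auto intro: index_at_unique)

lemma packed_index:
  assumes "packed g T" "k \<in> \<Gamma>"
  shows "g \<cdot> k \<cdot> aff (2 ^ n) (of_int r) \<in> T \<longleftrightarrow> residue (index_fun g T k) (Suc n) = (- r) mod 2 ^ Suc n"
  using assms index_fun_eq unfolding packed_def by (metis index_at_def)

lemma packed_cases:
  assumes "packed g T" "x \<in> T"
  obtains k n r where "k \<in> \<Gamma>" "x = g \<cdot> k \<cdot> aff (2 ^ n) (of_int r)"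
proof -
  have "\<forall>x\<in>T. \<exists>k\<in>\<Gamma>. \<exists>n. \<exists>r::int. x = g \<cdot> k \<cdot> aff (2 ^ n) (of_int r)"
    using assms(1) unfolding packed_def by (elim conjE)
  from bspec[OF this assms(2)] show ?thesis by (elim bexE exE) (rule that)
qed

lemma packed_carrier: "packed g T \<Longrightarrow> g \<in> carrier PSL2R" "packed g T \<Longrightarrow> x \<in> T \<Longrightarrow> x \<in> carrier PSL2R"
  by (auto simp: packed_def)

lemma aff_modular_scale: "s > 0 \<Longrightarrow> aff s b \<in> \<Gamma> \<Longrightarrow> s = 1"
proof -
  assume s: "s > 0" "aff s b \<in> \<Gamma>"
  have c: "aff s b = pm (sqrt s) (b / sqrt s) 0 (1 / sqrt s)" by (simp add: aff_def)
  obtain n :: int where "aff s b = aff 1 (of_int n)"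
    using modular_lower_zero[of "sqrt s" "b / sqrt s" "1 / sqrt s"] s by (auto simp: c)
  then show "s = 1" using s by (simp add: aff_inject)
qed

lemma power2_aff_pos [simp]: "(2::real) ^ n > 0"
  by simp

text \<open>An affine map in \<Gamma> has scale 1. Hence half of a bottom tile fits into no frame,
  while a tile of higher level has a child and is not itself a frame. The coset of g modulo \<Gamma>
  can thus be recovered from T, which makes the packing unique and locates the symmetries.\<close>

lemma packed_childless:
  assumes p: "packed g T" and x: "x \<in> T"
  shows "x \<cdot> aff (1 / 2) 0 \<notin> T \<longleftrightarrow> (\<exists>k\<in>\<Gamma>. x = g \<cdot> k)"
proof -
  note g = packed_carrier(1)[OF p]
  obtain k n and r :: int where k: "k \<in> \<Gamma>" "x = g \<cdot> k \<cdot> aff (2 ^ n) (of_int r)"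
    using packed_cases[OF p x] .
  show ?thesis
  proof (cases n)
    case 0
    then have xk: "x = g \<cdot> (k \<cdot> aff 1 (of_int r))" using k g by (simp add: PSL.m_assoc)
    have "x \<cdot> aff (1 / 2) 0 \<notin> T"
    proof
      assume "x \<cdot> aff (1 / 2) 0 \<in> T"
      then obtain l m and q :: int where l: "l \<in> \<Gamma>" "x \<cdot> aff (1 / 2) 0 = g \<cdot> l \<cdot> aff (2 ^ m) (of_int q)"
        using packed_cases[OF p] by metis
      then have "g \<cdot> (k \<cdot> aff (1 / 2) (of_int r)) = g \<cdot> (l \<cdot> aff (2 ^ m) (of_int q))"
        using g k 0 by (simp add: PSL.m_assoc aff_mult)
      then have e: "k \<cdot> aff (1 / 2) (of_int r) = l \<cdot> aff (2 ^ m) (of_int q)"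
        using g k l by simp
      have "pinv l \<cdot> k = pinv l \<cdot> (k \<cdot> aff (1 / 2) (of_int r)) \<cdot> pinv (aff (1 / 2) (of_int r))"
        using k l by (simp add: PSL.m_assoc)
      also have "\<dots> = aff (2 ^ m) (of_int q) \<cdot> pinv (aff (1 / 2) (of_int r))"
        unfolding e using l by (simp add: PSL.m_assoc[symmetric])
      also have "\<dots> = aff (2 ^ m * 2) (2 ^ m * (- 2 * of_int r) + of_int q)"
        by (simp add: pinv_aff aff_mult mult.commute)
      finally have "aff (2 ^ m * 2) (2 ^ m * (- 2 * of_int r) + of_int q) \<in> \<Gamma>"
        using k l by (metis modular_inv modular_mult)
      then have "(2::real) ^ m * 2 = 1" using aff_modular_scale by (metis power2_aff_pos zero_less_mult_iff zero_less_numeral)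
      then have "(2::real) ^ Suc m = 1" by simp
      moreover have "(1::real) < 2 ^ Suc m" by (rule one_less_power) auto
      ultimately show False by simp
    qed
    then show ?thesis using xk k by auto
  next
    case (Suc m)
    have res: "residue (index_fun g T k) (Suc n) = (- r) mod 2 ^ Suc n"
      using x packed_index[OF p k(1)] by (simp add: k(2))
    have "residue (index_fun g T k) n = residue (index_fun g T k) (Suc n) mod 2 ^ n"
      by (rule residue_Suc_mod[symmetric])
    also have "\<dots> = (- r) mod 2 ^ n" unfolding res by (rule mod_mod_cancel) simp
    finally have "g \<cdot> k \<cdot> aff (2 ^ m) (of_int r) \<in> T" using packed_index[OF p k(1), of m r] Suc by simp
    moreover have "x \<cdot> aff (1 / 2) 0 = g \<cdot> k \<cdot> aff (2 ^ m) (of_int r)"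
      using g k by (simp add: PSL.m_assoc aff_mult Suc)
    ultimately have c: "x \<cdot> aff (1 / 2) 0 \<in> T" by simp
    have "\<not> (\<exists>l\<in>\<Gamma>. x = g \<cdot> l)"
    proof
      assume "\<exists>l\<in>\<Gamma>. x = g \<cdot> l"
      then obtain l where l: "l \<in> \<Gamma>" "x = g \<cdot> l" by blast
      then have "g \<cdot> (k \<cdot> aff (2 ^ n) (of_int r)) = g \<cdot> l" using k g by (simp add: PSL.m_assoc)
      then have "k \<cdot> aff (2 ^ n) (of_int r) = l" using g k l by simp
      then have "aff (2 ^ n) (of_int r) = pinv k \<cdot> l" using k by (auto simp: PSL.m_assoc[symmetric])
      then have "aff (2 ^ n) (of_int r) \<in> \<Gamma>" using k l by simp
      then have "(2::real) ^ n = 1" by (rule aff_modular_scale[rotated]) simp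
      moreover have "(1::real) < 2 ^ n" by (rule one_less_power) (use Suc in auto)
      ultimately show False by simp
    qed
    then show ?thesis using c by blast
  qed
qed

lemma packed_level_zero:
  assumes p: "packed g T" and k: "k \<in> \<Gamma>"
  shows "\<exists>r::int. g \<cdot> k \<cdot> aff 1 (of_int r) \<in> T"
proof
  show "g \<cdot> k \<cdot> aff 1 (of_int (- residue (index_fun g T k) (Suc 0))) \<in> T"
    using packed_index[OF p k, of 0 "- residue (index_fun g T k) (Suc 0)"]
      residue_mod[of "index_fun g T k" "Suc 0"] by simp
qed

text \<open>A tile without a child is a frame for g and for h at the same time.\<close>

lemma packed_same_packing:
  assumes p: "packed g T" "packed h T"
  shows "packing g = packing h" and "\<exists>k\<in>\<Gamma>. h = g \<cdot> k"
proof -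
  note g = packed_carrier(1)[OF p(1)] and h = packed_carrier(1)[OF p(2)]
  obtain r :: int where r: "g \<cdot> \<one>\<^bsub>PSL2R\<^esub> \<cdot> aff 1 (of_int r) \<in> T"
    using packed_level_zero[OF p(1) modular_one] by blast
  define x where "x = g \<cdot> aff 1 (of_int r)"
  have x: "x \<in> T" using r g by (simp add: x_def)
  have "\<exists>k\<in>\<Gamma>. x = g \<cdot> k" unfolding x_def using aff_1_modular by blast
  then have "\<exists>k\<in>\<Gamma>. x = h \<cdot> k" using packed_childless[OF p(1) x] packed_childless[OF p(2) x] by blast
  then obtain k where k: "k \<in> \<Gamma>" "x = h \<cdot> k" by blast
  show "packing g = packing h"
    using packing_mult_modular[OF g aff_1_modular, of r] packing_mult_modular[OF h k(1)] k(2) by (simp add: x_def)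
  have "h = h \<cdot> k \<cdot> pinv k" using h k by (simp add: PSL.m_assoc)
  also have "\<dots> = g \<cdot> (aff 1 (of_int r) \<cdot> pinv k)" using g k by (simp add: x_def PSL.m_assoc flip: k(2))
  finally have "h = g \<cdot> (aff 1 (of_int r) \<cdot> pinv k)" .
  then show "\<exists>k\<in>\<Gamma>. h = g \<cdot> k" by (rule bexI) (simp add: k)
qed

section \<open>Cores inside a horoball and the link with the defining notions\<close>

lemma core_box_nat:
  "core_box (of_int a) (int j) l = act (aff (2 ^ j) (of_int (a + 2 ^ Suc j * l))) ` core"
  by (simp add: box_aff power_int_add flip: power_int_of_nat) (simp add: mult.commute mult.left_commute)

lemma horoball_cores_iff:
  "act (aff (2 ^ n) (of_int r)) ` core \<in> horoball_cores c \<longleftrightarrow> [r = c n] (mod 2 ^ Suc n)"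
proof
  assume "act (aff (2 ^ n) (of_int r)) ` core \<in> horoball_cores c"
  then obtain j l where "act (aff (2 ^ n) (of_int r)) ` core = act (aff (2 ^ j) (of_int (c j + 2 ^ Suc j * l))) ` core"
    unfolding horoball_cores_def core_box_nat by blast
  then have "aff (2 ^ n) (of_int r) = aff (2 ^ j) (of_int (c j + 2 ^ Suc j * l))"
    by (intro core_image_inject) simp_all
  then have "(2::real) ^ n = 2 ^ j" "real_of_int r = of_int (c j + 2 ^ Suc j * l)"
    by (simp_all add: aff_inject del: of_int_add)
  then have "n = j" "r = c j + 2 ^ Suc j * l" by (simp_all only: power_inject_exp of_int_eq_iff)
  then show "[r = c n] (mod 2 ^ Suc n)" by (simp add: cong_def)
next
  assume "[r = c n] (mod 2 ^ Suc n)"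
  then have "[c n = r] (mod 2 ^ Suc n)" by (rule cong_sym)
  then obtain l where "r = c n + 2 ^ Suc n * l" by (auto simp: cong_iff_lin)
  then show "act (aff (2 ^ n) (of_int r)) ` core \<in> horoball_cores c"
    unfolding horoball_cores_def core_box_nat by blast
qed

lemma horoball_coresE:
  assumes "K \<in> horoball_cores c"
  obtains n r where "K = act (aff (2 ^ n) (of_int r)) ` core" "[r = c n] (mod 2 ^ Suc n)"
proof -
  obtain j l where "K = act (aff (2 ^ j) (of_int (c j + 2 ^ Suc j * l))) ` core"
    using assms unfolding horoball_cores_def core_box_nat by blast
  then show ?thesis by (rule that) (simp add: cong_def)
qed

lemma aff_core_H_inf: "act (aff (2 ^ n) b) ` core \<subseteq> H_inf"
proof -
  have "1 \<le> 2 ^ n * Im z" if "z \<in> core" for z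
  proof -
    have "1 * 1 \<le> 2 ^ n * Im z" using that by (intro mult_mono) (auto simp: core_def)
    then show ?thesis by simp
  qed
  then show ?thesis by auto
qed

lemma H_inf_core_image:
  assumes m: "m \<in> carrier PSL2R" and sub: "act m ` ocore \<subseteq> H_inf"
  shows "act m ` core \<subseteq> H_inf"
proof -
  have "continuous_on (closure ocore) (\<lambda>z. Im (act m z))"
    unfolding closure_ocore
    by (intro continuous_on_Im continuous_on_subset[OF continuous_on_act[OF m] core_subset])
  moreover have "1 \<le> Im (act m z)" if "z \<in> ocore" for z using sub that by auto
  ultimately have "1 \<le> Im (act m z)" if "z \<in> closure ocore" for z
    using continuous_ge_on_closure[of ocore "\<lambda>z. Im (act m z)" z 1] that by blast
  then show ?thesis by (auto simp: closure_ocore)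
qed

lemma cores_iff: "K \<in> cores T \<longleftrightarrow> (\<exists>x\<in>T. K = act x ` core)"
  by (auto simp: cores_def)

text \<open>The isometry u given for a horoball and the frame g k differ by a translation, since
  their quotient preserves \<open>H_inf\<close>; it is by an integer m, since tangency points go to
  tangency points. That every tile belongs to some horoball is a connectedness argument.\<close>

lemma nondegenerate_imp_packed:
  assumes nd: "nondegenerate_over \<beta> T (packing g)" and g: "g \<in> carrier PSL2R"
  shows "packed g T"
proof -
  have T: "T \<subseteq> carrier PSL2R" using nd by (auto simp: nondegenerate_over_def tilings_def)
  have hb: "\<forall>H\<in>packing g. \<exists>u\<in>carrier PSL2R. \<exists>c. coherent c \<and> act u ` H = H_inf \<and>
      act u ` tangency_points (packing g) H = {\<i> + of_int k | k. True} \<and>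
      {act u ` K | K. K \<in> cores T \<and> K \<subseteq> H} = horoball_cores c"
    using nd unfolding nondegenerate_over_def by (elim conjE)
  have frame: "\<exists>u m c. u \<in> carrier PSL2R \<and> coherent c \<and> u \<cdot> (g \<cdot> k) = aff 1 (of_int (m :: int)) \<and>
      {act u ` K | K. K \<in> cores T \<and> K \<subseteq> act (g \<cdot> k) ` H_inf} = horoball_cores c"
    if k: "k \<in> \<Gamma>" for k
  proof -
    have HP: "act (g \<cdot> k) ` H_inf \<in> packing g" using k by (simp add: packing_eq[OF g])
    obtain u c where u: "u \<in> carrier PSL2R" "coherent c" "act u ` act (g \<cdot> k) ` H_inf = H_inf"
      "act u ` tangency_points (packing g) (act (g \<cdot> k) ` H_inf) = {\<i> + of_int k | k. True}"
      "{act u ` K | K. K \<in> cores T \<and> K \<subseteq> act (g \<cdot> k) ` H_inf} = horoball_cores c"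
      using bspec[OF hb HP] by (elim bexE exE conjE) (rule that)
    have gk: "g \<cdot> k \<in> carrier PSL2R" using g k by simp
    have "act (u \<cdot> (g \<cdot> k)) ` H_inf = H_inf"
      using u(1,3) gk by (simp only: act_image_mult[OF _ _ H_inf_subset])
    from H_inf_stabilizer[OF PSL.m_closed[OF u(1) gk] this]
    obtain b where b: "u \<cdot> (g \<cdot> k) = aff 1 b" by (elim exE) (rule that)
    have "\<i> + of_int 0 \<in> {\<i> + complex_of_int k | k. True}" by blast
    then have "act (g \<cdot> k) \<i> \<in> tangency_points (packing g) (act (g \<cdot> k) ` H_inf)"
      unfolding tangency_points_frame[OF g k] by (intro imageI) simp
    then have "act u (act (g \<cdot> k) \<i>) \<in> {\<i> + of_int k | k. True}" unfolding u(4)[symmetric] by (rule imageI)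
    moreover have "act u (act (g \<cdot> k) \<i>) = act (u \<cdot> (g \<cdot> k)) \<i>" using u gk by (simp add: act_mult)
    ultimately obtain m :: int where "\<i> + of_real b = \<i> + of_int m" by (auto simp: b act_aff)
    then have "b = of_int m" by (simp add: complex_eq_iff)
    then have "u \<cdot> (g \<cdot> k) = aff 1 (of_int m)" using b by simp
    then show ?thesis using u(1,2,5)
      by (intro exI[of _ u] exI[of _ m] exI[of _ c] conjI)
  qed
  show ?thesis
    unfolding packed_def
  proof (intro conjI ballI g T)
    fix k assume k: "k \<in> \<Gamma>"
    obtain u m c where u: "u \<in> carrier PSL2R" "coherent c" "u \<cdot> (g \<cdot> k) = aff 1 (of_int m)"
      "{act u ` K | K. K \<in> cores T \<and> K \<subseteq> act (g \<cdot> k) ` H_inf} = horoball_cores c"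
      using frame[OF k] by (elim exE conjE) (rule that)
    have gk: "g \<cdot> k \<in> carrier PSL2R" using g k by simp
    \<comment> \<open>Offsets relative to the frame g k instead of u.\<close>
    define c' where "c' n = c n - m" for n
    have c': "coherent c'" using u(2) by (simp add: coherent_def c'_def cong_diff)
    have "index_at g T k (coherent_index c')"
      unfolding index_at_def residue_coherent_index[OF c']
    proof (intro allI)
      fix n and r :: int
      define x where "x = g \<cdot> k \<cdot> aff (2 ^ n) (of_int r)"
      have x: "x \<in> carrier PSL2R" unfolding x_def using gk by simp
      have sub: "act x ` core \<subseteq> act (g \<cdot> k) ` H_inf"
        unfolding x_def using gk by (simp add: act_image_mult[OF _ _ core_subset] image_mono aff_core_H_inf)
      have "u \<cdot> x = u \<cdot> (g \<cdot> k) \<cdot> aff (2 ^ n) (of_int r)" unfolding x_def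
        by (rule PSL.m_assoc[symmetric]) (simp_all add: u(1) gk)
      also have "\<dots> = aff (2 ^ n) (of_int (r + m))" by (simp add: u(3) aff_mult)
      finally have ux: "act u ` act x ` core = act (aff (2 ^ n) (of_int (r + m))) ` core"
        using u x by (simp flip: act_image_mult[OF _ _ core_subset])
      have "x \<in> T \<longleftrightarrow> act u ` act x ` core \<in> horoball_cores c"
      proof
        assume "x \<in> T"
        then show "act u ` act x ` core \<in> horoball_cores c"
          unfolding u(4)[symmetric] using sub by (auto simp: cores_iff)
      next
        assume "act u ` act x ` core \<in> horoball_cores c"
        then obtain y where y: "y \<in> T" "act u ` act x ` core = act u ` act y ` core"
          unfolding u(4)[symmetric] cores_iff by blast
        have yc: "y \<in> carrier PSL2R" using y T by blast
        have "u \<cdot> x = u \<cdot> y"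
          by (rule core_image_inject) (use y yc u x in \<open>simp_all add: act_image_mult[OF _ _ core_subset]\<close>)
        then show "x \<in> T" using y yc u x by simp
      qed
      also have "\<dots> \<longleftrightarrow> [r + m = c n] (mod 2 ^ Suc n)" unfolding ux horoball_cores_iff ..
      also have "\<dots> \<longleftrightarrow> [- c' n = - r] (mod 2 ^ Suc n)"
        by (simp add: c'_def cong_iff_dvd_diff algebra_simps)
      finally show "g \<cdot> k \<cdot> aff (2 ^ n) (of_int r) \<in> T \<longleftrightarrow> (- c' n) mod 2 ^ Suc n = (- r) mod 2 ^ Suc n"
        by (simp add: x_def cong_def)
    qed
    then show "\<exists>d. index_at g T k d" by blast
  next
    fix x assume x: "x \<in> T"
    have xc: "x \<in> carrier PSL2R" using x T by blast
    \<comment> \<open>The open core is connected and hence lies in a single horoball; the closed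
      core follows by continuity.\<close>
    have "act x ` core \<subseteq> \<Union>(packing g)"
      using nd x unfolding nondegenerate_over_def cores_def by blast
    then have "act x ` ocore \<subseteq> \<Union>(packing g)" using ocore_core by blast
    moreover have "1 + 3/2 * \<i> \<in> ocore" by (simp add: ocore_def)
    then have "act x ` ocore \<noteq> {}" by blast
    ultimately obtain k where k: "k \<in> \<Gamma>" "act x ` ocore \<subseteq> act (g \<cdot> k) ` H_inf"
      using connected_in_horoball[OF g, of "act x ` ocore"] xc
        open_act_image[OF xc open_ocore ocore_subset] connected_act_image[OF xc connected_ocore ocore_subset] by blast
    have gk: "g \<cdot> k \<in> carrier PSL2R" using g k by simp
    have "act (pinv (g \<cdot> k) \<cdot> x) ` ocore = act (pinv (g \<cdot> k)) ` act x ` ocore"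
      using gk xc by (simp add: act_image_mult[OF _ _ ocore_subset])
    also have "\<dots> \<subseteq> act (pinv (g \<cdot> k)) ` act (g \<cdot> k) ` H_inf" using k(2) by (rule image_mono)
    finally have "act (pinv (g \<cdot> k) \<cdot> x) ` ocore \<subseteq> H_inf" using gk by (simp add: act_image_inv[OF _ H_inf_subset])
    then have "act (pinv (g \<cdot> k) \<cdot> x) ` core \<subseteq> H_inf" using gk xc by (intro H_inf_core_image) auto
    then have "act (g \<cdot> k) ` act (pinv (g \<cdot> k) \<cdot> x) ` core \<subseteq> act (g \<cdot> k) ` H_inf" by (rule image_mono)
    then have sub: "act x ` core \<subseteq> act (g \<cdot> k) ` H_inf"
      using gk xc by (simp add: PSL.m_assoc[symmetric] flip: act_image_mult[OF _ _ core_subset])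
    obtain u m c where u: "u \<in> carrier PSL2R" "u \<cdot> (g \<cdot> k) = aff 1 (of_int m)"
      "{act u ` K | K. K \<in> cores T \<and> K \<subseteq> act (g \<cdot> k) ` H_inf} = horoball_cores c"
      using frame[OF k(1)] by (elim exE conjE) (rule that)
    have "act u ` act x ` core \<in> horoball_cores c" unfolding u(3)[symmetric] using sub x by (auto simp: cores_iff)
    then obtain n r where nr: "act u ` act x ` core = act (aff (2 ^ n) (of_int r)) ` core"
      by (rule horoball_coresE)
    have "u \<cdot> x = aff (2 ^ n) (of_int r)"
      by (rule core_image_inject) (use u xc nr in \<open>simp_all add: act_image_mult[OF _ _ core_subset]\<close>)
    moreover have "x = pinv u \<cdot> (u \<cdot> x)" using u xc by (simp add: PSL.m_assoc[symmetric])
    moreover have "pinv u = g \<cdot> k \<cdot> aff 1 (- of_int m)"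
    proof -
      have "g \<cdot> k = pinv u \<cdot> aff 1 (of_int m)" unfolding u(2)[symmetric] using u(1) gk by (simp add: PSL.m_assoc[symmetric])
      then have "g \<cdot> k \<cdot> aff 1 (- of_int m) = pinv u \<cdot> (aff 1 (of_int m) \<cdot> aff 1 (- of_int m))"
        using u(1) by (simp add: PSL.m_assoc)
      then show ?thesis using u(1) by (simp add: aff_mult aff_1_0)
    qed
    ultimately have "x = g \<cdot> k \<cdot> aff (2 ^ n) (of_int (r - m))"
      using gk by (simp add: PSL.m_assoc aff_mult)
    then show "\<exists>k\<in>\<Gamma>. \<exists>n. \<exists>r::int. x = g \<cdot> k \<cdot> aff (2 ^ n) (of_int r)" using k(1) by blast
  qed
qed

text \<open>The level is the integer part of the binary logarithm of the height, and half-open boxes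
  of any row offset c j cover the row.\<close>

lemma half_open_box:
  assumes "Im z > 0"
  obtains j l :: int where "2 powi j \<le> Im z" "Im z < 2 * 2 powi j"
    "c j + 2 * 2 powi j * of_int l \<le> Re z" "Re z < c j + 2 * 2 powi j * of_int l + 2 * 2 powi j"
    "Im z \<ge> 1 \<Longrightarrow> j \<ge> 0"
proof -
  define j where "j = \<lfloor>log 2 (Im z)\<rfloor>"
  have j: "of_int j \<le> log 2 (Im z)" "log 2 (Im z) < of_int (j + 1)" by (simp_all add: j_def)
  have "2 powr of_int j \<le> Im z" "Im z < 2 powr of_int (j + 1)"
    using j assms by (simp_all add: le_log_iff log_less_iff del: of_int_add)
  then have im: "2 powi j \<le> Im z" "Im z < 2 * 2 powi j"
    by (simp_all add: powr_real_of_int' powr_add)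
  define s where "s = (2 * 2 powi j :: real)"
  have s: "s > 0" by (simp add: s_def)
  define l where "l = \<lfloor>(Re z - c j) / s\<rfloor>"
  have "of_int l \<le> (Re z - c j) / s" "(Re z - c j) / s < of_int l + 1" by (simp_all add: l_def)
  then have re: "c j + s * of_int l \<le> Re z" "Re z < c j + s * of_int l + s"
    using s by (simp_all add: le_divide_eq divide_less_eq algebra_simps)
  have "j \<ge> 0" if "Im z \<ge> 1"
    using that assms by (simp add: j_def zero_le_log_cancel_iff)
  then show ?thesis using that im re by (simp add: s_def)
qed

lemma cores_in_horoball:
  assumes p: "packed g T" and k: "k \<in> \<Gamma>" and c: "\<And>n. [c n = - residue (index_fun g T k) (Suc n)] (mod 2 ^ Suc n)"
  shows "{act (pinv (g \<cdot> k)) ` K | K. K \<in> cores T \<and> K \<subseteq> act (g \<cdot> k) ` H_inf} = horoball_cores c"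
proof -
  note g = packed_carrier(1)[OF p]
  have gk: "g \<cdot> k \<in> carrier PSL2R" using g k by simp
  have mem: "g \<cdot> k \<cdot> aff (2 ^ n) (of_int r) \<in> T \<longleftrightarrow> [r = c n] (mod 2 ^ Suc n)" for n and r :: int
  proof -
    have "g \<cdot> k \<cdot> aff (2 ^ n) (of_int r) \<in> T \<longleftrightarrow> [residue (index_fun g T k) (Suc n) = - r] (mod 2 ^ Suc n)"
      unfolding packed_index[OF p k] by (simp add: cong_def del: power_Suc)
    also have "\<dots> \<longleftrightarrow> [r = - residue (index_fun g T k) (Suc n)] (mod 2 ^ Suc n)"
      by (metis cong_minus_minus_iff cong_sym_eq minus_minus)
    also have "\<dots> \<longleftrightarrow> [r = c n] (mod 2 ^ Suc n)" using c cong_sym cong_trans by meson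
    finally show ?thesis .
  qed
  have img: "act (pinv (g \<cdot> k)) ` act (g \<cdot> k \<cdot> aff (2 ^ n) (of_int r)) ` core = act (aff (2 ^ n) (of_int r)) ` core"
    for n and r :: int
  proof -
    have "pinv (g \<cdot> k) \<cdot> (g \<cdot> k \<cdot> aff (2 ^ n) (of_int r)) = aff (2 ^ n) (of_int r)"
      using PSL.inv_solve_left'[of "aff (2 ^ n) (of_int r)" "g \<cdot> k"] gk by simp
    then show ?thesis using gk by (simp flip: act_image_mult[OF _ _ core_subset])
  qed
  show ?thesis
  proof
    show "{act (pinv (g \<cdot> k)) ` K | K. K \<in> cores T \<and> K \<subseteq> act (g \<cdot> k) ` H_inf} \<subseteq> horoball_cores c"
    proof
      fix J assume "J \<in> {act (pinv (g \<cdot> k)) ` K | K. K \<in> cores T \<and> K \<subseteq> act (g \<cdot> k) ` H_inf}"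
      then obtain x where x: "x \<in> T" "act x ` core \<subseteq> act (g \<cdot> k) ` H_inf" "J = act (pinv (g \<cdot> k)) ` act x ` core"
        unfolding cores_iff by blast
      obtain l n and r :: int where l: "l \<in> \<Gamma>" "x = g \<cdot> l \<cdot> aff (2 ^ n) (of_int r)"
        using packed_cases[OF p x(1)] .
      \<comment> \<open>A point in the interior of the core has height above 1 in its own horoball,
        so that \<open>horoball_overlap\<close> identifies this horoball with that of k.\<close>
      define z where "z = act (aff (2 ^ n) (of_int r)) (1 + 3/2 * \<i>)"
      have n1: "(1::real) \<le> 2 ^ n" by simp
      have "Im z = 2 ^ n * (3/2)" by (simp add: z_def)
      then have z: "Im z > 1" using n1 by linarith
      have "act x (1 + 3/2 * \<i>) = act (g \<cdot> l) z" unfolding z_def l(2) using g l by (simp add: act_mult)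
      moreover have "act x (1 + 3/2 * \<i>) \<in> act (g \<cdot> k) ` H_inf" using x(2) by (rule subsetD) (simp add: core_def)
      ultimately have "act (g \<cdot> l) z \<in> act (g \<cdot> l) ` {z. Im z > 1}" "act (g \<cdot> l) z \<in> act (g \<cdot> k) ` H_inf"
        using z by simp_all
      then obtain b :: int where b: "k = l \<cdot> aff 1 (of_int b)" using horoball_overlap[OF g l(1) k] by blast
      then have "k \<cdot> aff 1 (- of_int b) = l" using l by (simp add: PSL.m_assoc aff_mult aff_1_0)
      then have e: "x = g \<cdot> k \<cdot> aff (2 ^ n) (of_int (r - b))"
        unfolding l(2) using g k by (auto simp: PSL.m_assoc aff_mult)
      have "J = act (aff (2 ^ n) (of_int (r - b))) ` core" by (simp only: x(3) e img)
      moreover have "[r - b = c n] (mod 2 ^ Suc n)" using x(1) by (simp only: e mem)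
      ultimately show "J \<in> horoball_cores c" by (simp only: horoball_cores_iff)
    qed
    show "horoball_cores c \<subseteq> {act (pinv (g \<cdot> k)) ` K | K. K \<in> cores T \<and> K \<subseteq> act (g \<cdot> k) ` H_inf}"
    proof
      fix J assume "J \<in> horoball_cores c"
      then obtain n r where nr: "J = act (aff (2 ^ n) (of_int r)) ` core" "[r = c n] (mod 2 ^ Suc n)"
        by (rule horoball_coresE)
      have "act (g \<cdot> k \<cdot> aff (2 ^ n) (of_int r)) ` core \<in> cores T" using mem nr(2) by (auto simp: cores_iff)
      moreover have "act (g \<cdot> k \<cdot> aff (2 ^ n) (of_int r)) ` core \<subseteq> act (g \<cdot> k) ` H_inf"
        using gk by (simp add: act_image_mult[OF _ _ core_subset] image_mono aff_core_H_inf)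
      ultimately show "J \<in> {act (pinv (g \<cdot> k)) ` K | K. K \<in> cores T \<and> K \<subseteq> act (g \<cdot> k) ` H_inf}"
        unfolding nr(1) img[symmetric] by blast
    qed
  qed
qed

lemma coherent_residue: "coherent (\<lambda>n. - residue d (Suc n))"
  unfolding coherent_def cong_minus_minus_iff
  by (metis Suc_eq_plus1 cong_def mod_mod_trivial residue_Suc_mod)

lemma packed_imp_nondegenerate:
  assumes p: "packed g T" and T: "T \<in> tilings \<beta>"
  shows "nondegenerate_over \<beta> T (packing g)"
proof -
  note g = packed_carrier(1)[OF p]
  have U: "\<Union>(cores T) = \<Union>(packing g)"
  proof
    have "act x ` core \<subseteq> \<Union>(packing g)" if x: "x \<in> T" for x
    proof -
      obtain k n and r :: int where k: "k \<in> \<Gamma>" "x = g \<cdot> k \<cdot> aff (2 ^ n) (of_int r)"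
        using packed_cases[OF p x] .
      have "act x ` core \<subseteq> act (g \<cdot> k) ` H_inf"
        unfolding k(2) using g k by (simp add: act_image_mult[OF _ _ core_subset] image_mono aff_core_H_inf)
      moreover have "act (g \<cdot> k) ` H_inf \<in> packing g" using k by (simp add: packing_eq[OF g])
      ultimately show ?thesis by blast
    qed
    then show "\<Union>(cores T) \<subseteq> \<Union>(packing g)" by (auto simp: cores_def)
    show "\<Union>(packing g) \<subseteq> \<Union>(cores T)"
    proof
      fix z assume "z \<in> \<Union>(packing g)"
      then obtain k where k: "k \<in> \<Gamma>" "z \<in> act (g \<cdot> k) ` H_inf" unfolding packing_eq[OF g] by blast
      then obtain w where w: "Im w \<ge> 1" "z = act (g \<cdot> k) w" by auto
      define c where "c n = - residue (index_fun g T k) (Suc n)" for n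
      obtain j l :: int where "2 powi j \<le> Im w" "Im w < 2 * 2 powi j"
        "of_int (c (nat j)) + 2 * 2 powi j * of_int l \<le> Re w" "Re w < of_int (c (nat j)) + 2 * 2 powi j * of_int l + 2 * 2 powi j"
        "Im w \<ge> 1 \<Longrightarrow> j \<ge> 0"
        using half_open_box[of w "\<lambda>j. of_int (c (nat j))"] w by auto
      then have "w \<in> core_box (of_int (c (nat j))) (int (nat j)) l"
        using w by (simp add: core_box_def power_int_add algebra_simps)
      then have "w \<in> act (aff (2 ^ nat j) (of_int (c (nat j) + 2 ^ Suc (nat j) * l))) ` core"
        by (simp only: core_box_nat)
      then have "z \<in> act (g \<cdot> k) ` act (aff (2 ^ nat j) (of_int (c (nat j) + 2 ^ Suc (nat j) * l))) ` core"
        unfolding w(2) by (rule imageI)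
      then have zy: "z \<in> act (g \<cdot> k \<cdot> aff (2 ^ nat j) (of_int (c (nat j) + 2 ^ Suc (nat j) * l))) ` core"
        using g k by (simp add: act_image_mult[OF _ _ core_subset])
      have "g \<cdot> k \<cdot> aff (2 ^ nat j) (of_int (c (nat j) + 2 ^ Suc (nat j) * l)) \<in> T"
        unfolding packed_index[OF p k(1)] by (simp add: c_def mod_diff_eq[symmetric] del: power_Suc)
      from imageI[OF this, of "\<lambda>x. act x ` core"] zy show "z \<in> \<Union>(cores T)"
        unfolding cores_def by (rule UnionI)
    qed
  qed
  have F: "\<exists>u\<in>carrier PSL2R. \<exists>c. coherent c \<and> act u ` H = H_inf \<and>
      act u ` tangency_points (packing g) H = {\<i> + of_int k | k. True} \<and>
      {act u ` K | K. K \<in> cores T \<and> K \<subseteq> H} = horoball_cores c" if HP: "H \<in> packing g" for H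
  proof -
    obtain k where k: "k \<in> \<Gamma>" "H = act (g \<cdot> k) ` H_inf"
      using HP unfolding packing_eq[OF g] by (elim imageE) (rule that)
    have gk: "g \<cdot> k \<in> carrier PSL2R" using g k by simp
    have sub: "{\<i> + of_int n | n. True} \<subseteq> \<H>" by auto
    show ?thesis
    proof (rule bexI[of _ "pinv (g \<cdot> k)"], rule exI[of _ "\<lambda>n. - residue (index_fun g T k) (Suc n)"], intro conjI)
      show "coherent (\<lambda>n. - residue (index_fun g T k) (Suc n))" by (rule coherent_residue)
      show "act (pinv (g \<cdot> k)) ` H = H_inf" unfolding k(2) by (rule act_image_inv(1)[OF gk H_inf_subset])
      show "act (pinv (g \<cdot> k)) ` tangency_points (packing g) H = {\<i> + of_int k | k. True}"
        unfolding k(2) tangency_points_frame[OF g k(1)] by (rule act_image_inv(1)[OF gk sub])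
      show "{act (pinv (g \<cdot> k)) ` K | K. K \<in> cores T \<and> K \<subseteq> H} =
          horoball_cores (\<lambda>n. - residue (index_fun g T k) (Suc n))"
        unfolding k(2) by (rule cores_in_horoball[OF p k(1)]) simp
    qed (use gk in simp)
  qed
  show ?thesis
    unfolding nondegenerate_over_def
    by (intro conjI) (rule T, rule bexI[OF refl g], rule U, rule ballI, rule F)
qed

lemma packing_of_eq:
  assumes "nondegenerate_over \<beta> T P"
  shows "packing_of \<beta> T = P"
  unfolding packing_of_def
proof (rule the_equality)
  show "nondegenerate_over \<beta> T P" by (rule assms)
  fix Q assume Q: "nondegenerate_over \<beta> T Q"
  obtain g where g: "g \<in> carrier PSL2R" "P = packing g" using assms by (auto simp: nondegenerate_over_def)
  obtain h where h: "h \<in> carrier PSL2R" "Q = packing h" using Q by (auto simp: nondegenerate_over_def)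
  show "Q = P"
    using packed_same_packing(1)[of g T h] nondegenerate_imp_packed assms Q g h by metis
qed

text \<open>Prescribing the triangle removes the freedom of horizontal translation; this is why an
  index belongs to a horoball together with a triangle.\<close>

lemma T0_translation:
  assumes "act (aff 1 b) ` T0 = T0"
  shows "b = 0"
proof -
  have "\<i> \<in> T0" "1 + \<i> \<in> T0" by (simp_all add: T0_iff)
  then have "act (aff 1 b) \<i> \<in> T0" "act (aff 1 b) (1 + \<i>) \<in> T0" using assms by blast+
  then show ?thesis by (simp add: act_aff T0_iff)
qed

lemma dyadic_index_eq:
  assumes p: "packed g T" and k: "k \<in> \<Gamma>"
  shows "dyadic_index T (act (g \<cdot> k) ` H_inf) (act (g \<cdot> k) ` T0) = index_fun g T k"
  unfolding dyadic_index_def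
proof (rule the_equality)
  note g = packed_carrier(1)[OF p]
  have gk: "g \<cdot> k \<in> carrier PSL2R" using g k by simp
  define c where "c n = - residue (index_fun g T k) (Suc n)" for n
  have c: "coherent c" unfolding c_def by (rule coherent_residue)
  have d: "coherent_index c = index_fun g T k"
    by (rule dyadic_eqI_Suc) (simp add: residue_coherent_index[OF c] c_def del: power_Suc)
  have cores: "{act (pinv (g \<cdot> k)) ` K | K. K \<in> cores T \<and> K \<subseteq> act (g \<cdot> k) ` H_inf} = horoball_cores c"
    by (rule cores_in_horoball[OF p k]) (simp add: c_def)
  show "\<exists>u\<in>carrier PSL2R. \<exists>c. coherent c \<and> act u ` act (g \<cdot> k) ` H_inf = H_inf \<and>
     act u ` act (g \<cdot> k) ` T0 = T0 \<and>
     {act u ` K | K. K \<in> cores T \<and> K \<subseteq> act (g \<cdot> k) ` H_inf} = horoball_cores c \<and>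
     index_fun g T k = - lim (\<lambda>j. of_int (c j))"
    by (rule bexI[of _ "pinv (g \<cdot> k)"], rule exI[of _ c])
      (use gk c cores d in \<open>simp_all add: act_image_inv[OF gk H_inf_subset] act_image_inv[OF gk T0_subset] coherent_index_def\<close>)
  fix e :: dyadic
  assume "\<exists>u\<in>carrier PSL2R. \<exists>c. coherent c \<and> act u ` act (g \<cdot> k) ` H_inf = H_inf \<and>
     act u ` act (g \<cdot> k) ` T0 = T0 \<and>
     {act u ` K | K. K \<in> cores T \<and> K \<subseteq> act (g \<cdot> k) ` H_inf} = horoball_cores c \<and>
     e = - lim (\<lambda>j. of_int (c j))"
  then obtain u c' where u: "u \<in> carrier PSL2R" "coherent c'" "act u ` act (g \<cdot> k) ` H_inf = H_inf"
     "act u ` act (g \<cdot> k) ` T0 = T0"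
     "{act u ` K | K. K \<in> cores T \<and> K \<subseteq> act (g \<cdot> k) ` H_inf} = horoball_cores c'"
     "e = coherent_index c'" unfolding coherent_index_def by blast
  \<comment> \<open>Any other admissible isometry differs from the inverse frame by a translation,
    and the triangle forces this translation to be trivial.\<close>
  obtain b where b: "u \<cdot> (g \<cdot> k) = aff 1 b"
    using H_inf_stabilizer[of "u \<cdot> (g \<cdot> k)"] u gk by (auto simp: act_image_mult[OF _ _ H_inf_subset])
  have "act (aff 1 b) ` T0 = T0" using u gk by (simp add: act_image_mult[OF _ _ T0_subset] flip: b)
  then have "b = 0" by (rule T0_translation)
  then have "u \<cdot> (g \<cdot> k) = \<one>\<^bsub>PSL2R\<^esub>" using b by (simp add: aff_1_0)
  then have "pinv (g \<cdot> k) = u" by (rule PSL.inv_equality[OF _ gk u(1)])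
  then have eq: "horoball_cores c' = horoball_cores c" using u(5) cores by (simp only:)
  have "[c' n = c n] (mod 2 ^ Suc n)" for n
    using horoball_cores_iff[of n "c' n" c'] horoball_cores_iff[of n "c' n" c] by (simp add: eq del: power_Suc)
  then have "(- c' n) mod 2 ^ Suc n = (- c n) mod 2 ^ Suc n" for n
    using cong_minus_minus_iff[of "c' n" "c n" "2 ^ Suc n"] unfolding cong_def by blast
  then have "coherent_index c' = coherent_index c"
    by (intro dyadic_eqI_Suc) (simp add: residue_coherent_index[OF c] residue_coherent_index[OF u(2)] del: power_Suc)
  then show "e = index_fun g T k" using u(6) d by simp
qed

text \<open>The frames k, \<open>k \<cdot> C_mat\<close> and
  \<open>k \<cdot> C_mat \<cdot> C_mat\<close> belong to the same triangle and to its three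
  horoballs.\<close>

definition sum_rule :: "(real^2^2) set \<Rightarrow> (real^2^2) set set \<Rightarrow> dyadic \<Rightarrow> bool" where
  "sum_rule g T w \<longleftrightarrow> (\<forall>k\<in>\<Gamma>. index_fun g T k + index_fun g T (k \<cdot> C_mat) + index_fun g T (k \<cdot> C_mat \<cdot> C_mat) = w)"

lemma index_sum_iff:
  assumes p: "packed g T" and T: "T \<in> tilings \<beta>"
  shows "index_sum_is \<beta> T w \<longleftrightarrow> sum_rule g T w"
proof -
  note g = packed_carrier(1)[OF p]
  have P: "packing_of \<beta> T = packing g" by (rule packing_of_eq[OF packed_imp_nondegenerate[OF p T]])
  have "(\<Sum>H\<in>{H \<in> packing g. H \<inter> act (g \<cdot> k) ` T0 \<noteq> {}}. dyadic_index T H (act (g \<cdot> k) ` T0)) =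
      index_fun g T k + index_fun g T (k \<cdot> C_mat) + index_fun g T (k \<cdot> C_mat \<cdot> C_mat)" (is "?S = _")
    if k: "k \<in> \<Gamma>" for k
  proof -
    have t: "act (g \<cdot> k) ` T0 = act (g \<cdot> (k \<cdot> C_mat)) ` T0"
      "act (g \<cdot> k) ` T0 = act (g \<cdot> (k \<cdot> C_mat \<cdot> C_mat)) ` T0"
      using g k by (simp_all add: act_image_mult[OF _ _ T0_subset] C_T0 PSL.m_assoc[symmetric])
    have "?S = dyadic_index T (act (g \<cdot> k) ` H_inf) (act (g \<cdot> k) ` T0) +
        dyadic_index T (act (g \<cdot> (k \<cdot> C_mat)) ` H_inf) (act (g \<cdot> k) ` T0) +
        dyadic_index T (act (g \<cdot> (k \<cdot> C_mat \<cdot> C_mat)) ` H_inf) (act (g \<cdot> k) ` T0)"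
      unfolding horoballs_at_triangle[OF g k] using horoballs_at_triangle_distinct[OF g k] by (simp add: add.assoc)
    also have "dyadic_index T (act (g \<cdot> k) ` H_inf) (act (g \<cdot> k) ` T0) = index_fun g T k"
      by (rule dyadic_index_eq[OF p k])
    also have "dyadic_index T (act (g \<cdot> (k \<cdot> C_mat)) ` H_inf) (act (g \<cdot> k) ` T0) = index_fun g T (k \<cdot> C_mat)"
      unfolding t(1) by (rule dyadic_index_eq[OF p]) (simp add: k)
    also have "dyadic_index T (act (g \<cdot> (k \<cdot> C_mat \<cdot> C_mat)) ` H_inf) (act (g \<cdot> k) ` T0) = index_fun g T (k \<cdot> C_mat \<cdot> C_mat)"
      unfolding t(2) by (rule dyadic_index_eq[OF p]) (simp add: k)
    finally show ?thesis .
  qed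
  then show ?thesis
    unfolding index_sum_is_def sum_rule_def P triangles_packing[OF g] by simp
qed

section \<open>Local rules and their limits\<close>

lemma PSL2R_memb: "x \<in> carrier PSL2R \<Longrightarrow> A \<in> x \<Longrightarrow> x = psl A \<and> det A = 1"
proof -
  assume x: "x \<in> carrier PSL2R" "A \<in> x"
  then obtain B where B: "det B = 1" "x = psl B" by (auto simp: carrier_PSL2R)
  have "det (- B) = det B" by (simp add: det_2)
  then show ?thesis using x(2) B by (auto simp: psl_eq)
qed

lemma psl_carrier: "det A = 1 \<Longrightarrow> psl A \<in> carrier PSL2R"
  by (simp add: carrier_PSL2R)

lemma carrier_SL2R: "carrier SL2R = {A. det A = 1}"
  by (simp add: SL2R_def)

lemma Union_psl_image: "\<Union>(psl ` S) = S \<union> uminus ` S"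
  by (auto simp: psl_eq)

lemma topspace_PSL2R [simp]: "topspace PSL2R_topology = carrier PSL2R"
proof -
  have "\<Union>(carrier PSL2R) = carrier SL2R"
    by (auto simp: carrier_PSL2R carrier_SL2R Union_psl_image det_2)
  then have "openin PSL2R_topology (carrier PSL2R)" by (simp add: openin_PSL2R_topology)
  then show ?thesis
    using openin_subset openin_PSL2R_topology by (intro subset_antisym) (auto simp: topspace_def)
qed

lemma continuous_on_det: "continuous_on S (\<lambda>A::real^2^2. det A)"
  unfolding det_2 by (intro continuous_intros)

lemma continuous_on_matrix_mult_right: "continuous_on S (\<lambda>A::real^2^2. A ** B)"
  unfolding matrix_matrix_mult_def by (intro continuous_intros)

lemma openin_psl_ball: "openin PSL2R_topology (psl ` (ball A e \<inter> carrier SL2R))"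
proof -
  have "uminus ` (ball A e \<inter> carrier SL2R) = ball (- A) e \<inter> carrier SL2R"
  proof -
    have "X \<in> uminus ` (ball A e \<inter> carrier SL2R)" if "X \<in> ball (- A) e \<inter> carrier SL2R" for X
      by (rule image_eqI[of _ _ "- X"]) (use that in \<open>auto simp: carrier_SL2R det_2 dist_norm norm_minus_commute\<close>,
        metis minus_add_distrib norm_minus_cancel uminus_add_conv_diff add.commute diff_conv_add_uminus)
    moreover have "- X \<in> ball (- A) e \<inter> carrier SL2R" if "X \<in> ball A e \<inter> carrier SL2R" for X
      using that by (auto simp: carrier_SL2R det_2 dist_norm norm_minus_commute)
    ultimately show ?thesis by blast
  qed
  then have "\<Union>(psl ` (ball A e \<inter> carrier SL2R)) = carrier SL2R \<inter> (ball A e \<union> ball (- A) e)"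
    unfolding Union_psl_image by auto
  moreover have "psl ` (ball A e \<inter> carrier SL2R) \<subseteq> carrier PSL2R"
    by (auto simp: carrier_SL2R psl_carrier)
  ultimately show ?thesis
    unfolding openin_PSL2R_topology by (auto simp: openin_open intro!: exI[of _ "ball A e \<union> ball (- A) e"])
qed

lemma continuous_map_psl: "continuous_map (top_of_set (carrier SL2R)) PSL2R_topology psl"
  unfolding continuous_map_def
proof (intro conjI allI impI)
  show "psl \<in> topspace (top_of_set (carrier SL2R)) \<rightarrow> topspace PSL2R_topology"
    by (auto simp: carrier_SL2R psl_carrier)
  fix U assume U: "openin PSL2R_topology U"
  have "{x \<in> topspace (top_of_set (carrier SL2R)). psl x \<in> U} = \<Union>U"
  proof
    show "{x \<in> topspace (top_of_set (carrier SL2R)). psl x \<in> U} \<subseteq> \<Union>U" by (auto simp: psl_eq)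
    show "\<Union>U \<subseteq> {x \<in> topspace (top_of_set (carrier SL2R)). psl x \<in> U}"
      using U PSL2R_memb unfolding openin_PSL2R_topology by (auto simp: carrier_SL2R)
  qed
  then show "openin (top_of_set (carrier SL2R)) {x \<in> topspace (top_of_set (carrier SL2R)). psl x \<in> U}"
    using U by (simp add: openin_PSL2R_topology)
qed

text \<open>A position missing from T can be kept missing nearby only by means of a compact set that
  T avoids. The right translate by f of a small closed ball of matrices around x is such a set, and
  it contains h f for all h near x.\<close>

lemma mult_nbhd:
  assumes T: "closedin PSL2R_topology T" and x: "x \<in> carrier PSL2R" and f: "f \<in> carrier PSL2R" and n: "x \<cdot> f \<notin> T"
  shows "\<exists>U K. openin PSL2R_topology U \<and> x \<in> U \<and> compactin PSL2R_topology K \<and> K \<inter> T = {} \<and> (\<forall>h\<in>U. h \<cdot> f \<in> K)"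
proof -
  obtain A B where A: "det A = 1" "x = psl A" and B: "det B = 1" "f = psl B"
    using x f by (auto simp: carrier_PSL2R)
  have "openin PSL2R_topology (carrier PSL2R - T)" using T by (simp add: closedin_def)
  then obtain W where W: "open W" "\<Union>(carrier PSL2R - T) = carrier SL2R \<inter> W"
    by (auto simp: openin_PSL2R_topology openin_open)
  have "psl (A ** B) \<in> carrier PSL2R - T" using n A B by (simp add: psl_mult psl_carrier det_mul)
  moreover have "A ** B \<in> psl (A ** B)" by (simp add: psl_eq)
  ultimately have "A ** B \<in> W" using W(2) by blast
  have "open ((\<lambda>X. X ** B) -` W)"
    using W(1) continuous_on_matrix_mult_right by (intro open_vimage) auto
  then obtain e where e: "e > 0" "cball A e \<subseteq> (\<lambda>X. X ** B) -` W"
    using \<open>A ** B \<in> W\<close> by (metis open_contains_cball vimageI)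
  define U where "U = psl ` (ball A e \<inter> carrier SL2R)"
  define K where "K = psl ` (\<lambda>X. X ** B) ` (cball A e \<inter> carrier SL2R)"
  have "closed (carrier SL2R)"
    unfolding carrier_SL2R by (intro closed_Collect_eq continuous_on_det continuous_intros)
  then have "compact (cball A e \<inter> carrier SL2R)" by (intro compact_Int_closed) auto
  then have "compact ((\<lambda>X. X ** B) ` (cball A e \<inter> carrier SL2R))"
    by (intro compact_continuous_image continuous_on_matrix_mult_right)
  moreover have "(\<lambda>X. X ** B) ` (cball A e \<inter> carrier SL2R) \<subseteq> carrier SL2R"
    using B by (auto simp: carrier_SL2R det_mul)
  ultimately have "compactin PSL2R_topology K"
    unfolding K_def by (intro image_compactin[OF _ continuous_map_psl]) (simp add: compactin_subtopology)
  moreover have "K \<inter> T = {}"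
  proof -
    have "psl (X ** B) \<notin> T" if X: "X \<in> cball A e \<inter> carrier SL2R" for X
    proof
      assume t: "psl (X ** B) \<in> T"
      have "X ** B \<in> W" using X e by blast
      moreover have "det (X ** B) = 1" using X B by (simp add: carrier_SL2R det_mul)
      ultimately have "X ** B \<in> \<Union>(carrier PSL2R - T)" using W(2) by (simp add: carrier_SL2R)
      then obtain y where y: "y \<in> carrier PSL2R" "y \<notin> T" "X ** B \<in> y" by blast
      then show False using PSL2R_memb[OF y(1,3)] t by simp
    qed
    then show ?thesis by (auto simp: K_def)
  qed
  moreover have "h \<cdot> f \<in> K" if hU: "h \<in> U" for h
  proof -
    obtain X where X: "X \<in> ball A e \<inter> carrier SL2R" "h = psl X"
      using hU unfolding U_def by (elim imageE) (rule that)
    then have "h \<cdot> f = psl (X ** B)" by (simp add: B psl_mult)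
    moreover have "X \<in> cball A e \<inter> carrier SL2R" using X(1) by auto
    ultimately show ?thesis unfolding K_def by blast
  qed
  moreover have "x \<in> U" unfolding U_def A(2) using A e by (intro imageI) (simp add: carrier_SL2R)
  moreover have "openin PSL2R_topology U" unfolding U_def by (rule openin_psl_ball)
  ultimately show ?thesis by blast
qed

text \<open>Basic Fell neighbourhoods with two open sets to be hit and one compact set to be missed
  suffice for all limit arguments: the first two for overlaps, the last for missing tiles.\<close>

lemma fell_approx:
  assumes X0: "X0 \<in> Abstract_Topology.closure_of (tiling_space \<beta>) S"
    and U: "openin PSL2R_topology U" "X0 \<inter> U \<noteq> {}" and V: "openin PSL2R_topology V" "X0 \<inter> V \<noteq> {}"
    and K: "compactin PSL2R_topology K" "X0 \<inter> K = {}"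
  shows "\<exists>T\<in>S. T \<inter> U \<noteq> {} \<and> T \<inter> V \<noteq> {} \<and> T \<inter> K = {}"
proof -
  let ?F = "fell_topology PSL2R_topology"
  let ?U = "\<lambda>U. {A. closedin PSL2R_topology A \<and> A \<inter> U \<noteq> {}}"
  let ?K = "{A. closedin PSL2R_topology A \<and> A \<inter> K = {}}"
  have top: "X0 \<in> topspace ?F" "X0 \<in> tilings \<beta>"
    using X0 by (auto simp: in_closure_of tiling_space_def)
  have closed: "closedin PSL2R_topology X0"
    using top(1) unfolding fell_topology_def by auto
  have gen: "openin ?F (?U U)" "openin ?F (?U V)" "openin ?F ?K"
    unfolding fell_topology_def using U V K by (auto intro!: topology_generated_by_Basis)
  define N where "N = ?U U \<inter> ?U V \<inter> ?K"
  have "openin ?F N" unfolding N_def using gen by (intro openin_Int)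
  then have "openin (tiling_space \<beta>) (N \<inter> tilings \<beta>)"
    unfolding tiling_space_def by (auto simp: openin_subtopology)
  moreover have "X0 \<in> N \<inter> tilings \<beta>" using closed U V K top by (auto simp: N_def)
  ultimately have "\<exists>T. T \<in> S \<and> T \<in> N \<inter> tilings \<beta>"
    using X0 unfolding in_closure_of by blast
  then show ?thesis by (auto simp: N_def)
qed

lemma tilings_closure:
  assumes "X0 \<in> Abstract_Topology.closure_of (tiling_space \<beta>) S"
  shows "X0 \<in> tilings \<beta>" "closedin PSL2R_topology X0" "X0 \<subseteq> carrier PSL2R"
proof -
  have "X0 \<in> topspace (fell_topology PSL2R_topology)" "X0 \<in> tilings \<beta>"
    using assms by (auto simp: in_closure_of tiling_space_def)
  then show "X0 \<in> tilings \<beta>" "closedin PSL2R_topology X0"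
    unfolding fell_topology_def by auto
  then show "X0 \<subseteq> carrier PSL2R" using closedin_subset by fastforce
qed

text \<open>If every configuration failed at \<open>x\<close>, then the finitely many missing positions would be
  missing in all tilings near \<open>X0\<close> as well.\<close>

lemma limit_rule:
  assumes X0: "X0 \<in> Abstract_Topology.closure_of (tiling_space \<beta>) S"
    and rule: "\<And>T x. T \<in> S \<Longrightarrow> x \<in> T \<Longrightarrow> \<exists>F\<in>\<F>. \<forall>f\<in>F. x \<cdot> f \<in> T"
    and fin: "finite \<F>" and sub: "\<Union>\<F> \<subseteq> carrier PSL2R" and x: "x \<in> X0"
  shows "\<exists>F\<in>\<F>. \<forall>f\<in>F. x \<cdot> f \<in> X0"
proof (rule ccontr)
  assume "\<not> ?thesis"
  then have "\<forall>F\<in>\<F>. \<exists>f. f \<in> F \<and> x \<cdot> f \<notin> X0" by blast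
  then obtain f where f: "\<And>F. F \<in> \<F> \<Longrightarrow> f F \<in> F" "\<And>F. F \<in> \<F> \<Longrightarrow> x \<cdot> f F \<notin> X0" by metis
  note cl = tilings_closure[OF X0]
  have xc: "x \<in> carrier PSL2R" using cl(3) x by blast
  have "\<forall>F\<in>\<F>. \<exists>U K. openin PSL2R_topology U \<and> x \<in> U \<and> compactin PSL2R_topology K \<and> K \<inter> X0 = {} \<and> (\<forall>h\<in>U. h \<cdot> f F \<in> K)"
  proof
    fix F assume F: "F \<in> \<F>"
    have "f F \<in> carrier PSL2R" using f(1)[OF F] F sub by blast
    then show "\<exists>U K. openin PSL2R_topology U \<and> x \<in> U \<and> compactin PSL2R_topology K \<and> K \<inter> X0 = {} \<and> (\<forall>h\<in>U. h \<cdot> f F \<in> K)"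
      using mult_nbhd[OF cl(2) xc _ f(2)[OF F]] by simp
  qed
  then obtain U K where UK: "\<And>F. F \<in> \<F> \<Longrightarrow> openin PSL2R_topology (U F)" "\<And>F. F \<in> \<F> \<Longrightarrow> x \<in> U F"
    "\<And>F. F \<in> \<F> \<Longrightarrow> compactin PSL2R_topology (K F)" "\<And>F. F \<in> \<F> \<Longrightarrow> K F \<inter> X0 = {}"
    "\<And>F h. F \<in> \<F> \<Longrightarrow> h \<in> U F \<Longrightarrow> h \<cdot> f F \<in> K F" by metis
  define V where "V = (\<Inter>F\<in>\<F>. U F) \<inter> topspace PSL2R_topology"
  have V: "openin PSL2R_topology V" unfolding V_def by (rule openin_INT[OF fin UK(1)])
  have comp: "compactin PSL2R_topology (\<Union>(K ` \<F>))"
    by (rule compactin_Union) (use fin UK(3) in auto)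
  have miss: "X0 \<inter> \<Union>(K ` \<F>) = {}" using UK(4) by blast
  have meets: "X0 \<inter> V \<noteq> {}" using x xc UK(2) by (auto simp: V_def)
  from fell_approx[OF X0 V meets V meets comp miss]
  obtain T where T: "T \<in> S" "T \<inter> V \<noteq> {}" "T \<inter> \<Union>(K ` \<F>) = {}"
    by (elim bexE conjE) (rule that)
  then obtain h where h: "h \<in> T" "h \<in> V" by blast
  obtain F where F: "F \<in> \<F>" "\<forall>f\<in>F. h \<cdot> f \<in> T" using rule[OF T(1) h(1)] by blast
  have "h \<cdot> f F \<in> K F" using UK(5)[OF F(1)] h(2) F(1) by (simp add: V_def)
  moreover have "h \<cdot> f F \<in> T" using F(2) f(1)[OF F(1)] by blast
  ultimately show False using T(3) F(1) by blast
qed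

text \<open>That a given point lies in the open core of h survives small changes of h. Here
  \<open>\<phi>\<close> is the inverse Moebius map at z as a function of the matrix entries, which
  displays the continuity.\<close>

lemma openin_core_through:
  assumes z: "Im z > 0"
  shows "openin PSL2R_topology {h \<in> carrier PSL2R. z \<in> act h ` ocore}"
proof -
  define \<phi> where "\<phi> A = (of_real (A$2$2) * z - of_real (A$1$2)) / (of_real (A$1$1) - of_real (A$2$1) * z)" for A :: "real^2^2"
  have phi: "act (pinv (psl A)) z = \<phi> A" "of_real (A$1$1) - of_real (A$2$1) * z \<noteq> 0" if "det A = 1" for A
  proof -
    have d: "A$1$1 * A$2$2 - A$1$2 * A$2$1 = 1" using that by (simp add: det_2)
    have d': "A$2$2 * A$1$1 - (- A$1$2) * (- A$2$1) = 1" using d by (simp add: mult.commute)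
    have p: "psl A = pm (A$1$1) (A$1$2) (A$2$1) (A$2$2)" by (simp add: pm_def mat2_eta)
    show "act (pinv (psl A)) z = \<phi> A" unfolding p pinv_pm[OF d] by (simp add: act_pm \<phi>_def)
    show "of_real (A$1$1) - of_real (A$2$1) * z \<noteq> 0"
      using moebius_denom_nonzero[OF d' z] by simp
  qed
  have "continuous_on (carrier SL2R) \<phi>"
    unfolding \<phi>_def by (intro continuous_intros) (use phi(2) in \<open>auto simp: carrier_SL2R\<close>)
  then have op: "openin (top_of_set (carrier SL2R)) (carrier SL2R \<inter> \<phi> -` ocore)"
    using open_ocore by (rule continuous_openin_preimage_gen)
  have "\<Union>{h \<in> carrier PSL2R. z \<in> act h ` ocore} = carrier SL2R \<inter> \<phi> -` ocore"
  proof (rule Set.set_eqI)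
    fix A
    have mem: "z \<in> act (psl A) ` ocore \<longleftrightarrow> \<phi> A \<in> ocore" if "det A = 1" for A
      using mem_act_image[OF psl_carrier[OF that] ocore_subset, of z] z phi(1)[OF that] by simp
    show "A \<in> \<Union>{h \<in> carrier PSL2R. z \<in> act h ` ocore} \<longleftrightarrow> A \<in> carrier SL2R \<inter> \<phi> -` ocore"
    proof
      assume "A \<in> \<Union>{h \<in> carrier PSL2R. z \<in> act h ` ocore}"
      then obtain h where h: "h \<in> carrier PSL2R" "z \<in> act h ` ocore" "A \<in> h" by blast
      then have "h = psl A" "det A = 1" using PSL2R_memb by blast+
      then show "A \<in> carrier SL2R \<inter> \<phi> -` ocore" using h(2) mem by (simp add: carrier_SL2R)
    next
      assume "A \<in> carrier SL2R \<inter> \<phi> -` ocore"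
      then have "det A = 1" "\<phi> A \<in> ocore" by (simp_all add: carrier_SL2R)
      then have "psl A \<in> {h \<in> carrier PSL2R. z \<in> act h ` ocore}" using mem psl_carrier by simp
      moreover have "A \<in> psl A" by (simp add: psl_eq)
      ultimately show "A \<in> \<Union>{h \<in> carrier PSL2R. z \<in> act h ` ocore}" by (rule UnionI)
    qed
  qed
  then show ?thesis unfolding openin_PSL2R_topology using op by auto
qed

lemma PSL2R_separated:
  assumes "x \<in> carrier PSL2R" "y \<in> carrier PSL2R" "x \<noteq> y"
  shows "\<exists>U V. openin PSL2R_topology U \<and> openin PSL2R_topology V \<and> x \<in> U \<and> y \<in> V \<and> U \<inter> V = {}"
proof -
  obtain A B where A: "det A = 1" "x = psl A" and B: "det B = 1" "y = psl B"
    using assms by (auto simp: carrier_PSL2R)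
  have ne: "A \<noteq> B" "A \<noteq> - B" using assms(3) by (auto simp: A B psl_eq)
  define e where "e = min (dist A B) (dist A (- B)) / 2"
  have e: "e > 0" using ne by (simp add: e_def)
  have "psl X \<noteq> psl Y" if X: "X \<in> ball A e" and Y: "Y \<in> ball B e" for X Y
  proof
    assume "psl X = psl Y"
    then have "X = Y \<or> X = - Y" by (auto simp: psl_eq doubleton_eq_iff)
    then show False
    proof
      assume "X = Y"
      then have "dist A B < e + e" using X Y dist_triangle_less_add[of A X e B e] by (simp add: dist_commute)
      then show False by (simp add: e_def)
    next
      assume "X = - Y"
      moreover have "dist (- Y) (- B) = dist Y B" by (simp add: dist_norm norm_minus_commute)
      ultimately have "dist A (- B) < e + e"
        using X Y dist_triangle_less_add[of A X e "- B" e] by (simp add: dist_commute)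
      then show False by (simp add: e_def)
    qed
  qed
  then have "psl ` (ball A e \<inter> carrier SL2R) \<inter> psl ` (ball B e \<inter> carrier SL2R) = {}" by auto
  moreover have "x \<in> psl ` (ball A e \<inter> carrier SL2R)" "y \<in> psl ` (ball B e \<inter> carrier SL2R)"
    using A B e by (auto simp: carrier_SL2R)
  ultimately show ?thesis
    by (intro exI[of _ "psl ` (ball A e \<inter> carrier SL2R)"] exI[of _ "psl ` (ball B e \<inter> carrier SL2R)"]
        conjI openin_psl_ball)
qed

definition disjoint_cores :: "(real^2^2) set set \<Rightarrow> bool" where
  "disjoint_cores T \<longleftrightarrow> (\<forall>x\<in>T. \<forall>y\<in>T. act x ` ocore \<inter> act y ` ocore \<noteq> {} \<longrightarrow> x = y)"

lemma disjoint_coresD: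
  "disjoint_cores T \<Longrightarrow> x \<in> T \<Longrightarrow> y \<in> T \<Longrightarrow> z \<in> act x ` ocore \<Longrightarrow> z \<in> act y ` ocore \<Longrightarrow> x = y"
  unfolding disjoint_cores_def by blast

text \<open>Overlap at a point is an open condition. Two distinct overlapping tiles of the limit
  would have overlapping counterparts in a member of S, kept distinct by disjoint
  neighbourhoods.\<close>

lemma limit_disjoint_cores:
  assumes X0: "X0 \<in> Abstract_Topology.closure_of (tiling_space \<beta>) S"
    and S: "\<And>T. T \<in> S \<Longrightarrow> disjoint_cores T"
  shows "disjoint_cores X0"
  unfolding disjoint_cores_def
proof (intro ballI impI, rule ccontr)
  fix x y assume x: "x \<in> X0" and y: "y \<in> X0" and i: "act x ` ocore \<inter> act y ` ocore \<noteq> {}" and ne: "x \<noteq> y"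
  note cl = tilings_closure[OF X0]
  have c: "x \<in> carrier PSL2R" "y \<in> carrier PSL2R" using cl(3) x y by auto
  obtain z where z: "z \<in> act x ` ocore" "z \<in> act y ` ocore" using i by blast
  have z0: "Im z > 0" using z(1) by (simp add: mem_act_image[OF c(1) ocore_subset])
  let ?O = "{h \<in> carrier PSL2R. z \<in> act h ` ocore}"
  obtain U V where UV: "openin PSL2R_topology U" "openin PSL2R_topology V" "x \<in> U" "y \<in> V" "U \<inter> V = {}"
    using PSL2R_separated[OF c ne] by blast
  have o: "openin PSL2R_topology (U \<inter> ?O)" "openin PSL2R_topology (V \<inter> ?O)"
    using UV openin_core_through[OF z0] by (auto intro: openin_Int)
  have n: "X0 \<inter> (U \<inter> ?O) \<noteq> {}" "X0 \<inter> (V \<inter> ?O) \<noteq> {}" using x y z c UV by blast+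
  obtain T where T: "T \<in> S" "T \<inter> (U \<inter> ?O) \<noteq> {}" "T \<inter> (V \<inter> ?O) \<noteq> {}"
    using fell_approx[OF X0 o(1) n(1) o(2) n(2) compactin_empty Int_empty_right]
    by (elim bexE conjE) (rule that)
  then obtain h h' where h: "h \<in> T" "h \<in> U" "z \<in> act h ` ocore" "h' \<in> T" "h' \<in> V" "z \<in> act h' ` ocore"
    by blast
  have "h = h'" by (rule disjoint_coresD[OF S[OF T(1)] h(1,4,3,6)])
  then show False using h(2,5) UV(5) by blast
qed

text \<open>Positions of tiles are given relative to a tile \<open>x\<close>: its horizontal neighbours, its parent, its
  left child and, for a tile without children and one of the two triangles below it, the \<open>n\<close>-th ancestors
  of the three tiles around that triangle. Each rule involves only finitely many configurations, so that
  the rules pass to Fell limits.\<close>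

definition local_rules :: "dyadic \<Rightarrow> (real^2^2) set set \<Rightarrow> bool" where
  "local_rules w T \<longleftrightarrow> T \<subseteq> carrier PSL2R \<and> disjoint_cores T \<and>
    (\<forall>x\<in>T. x \<cdot> aff 1 2 \<in> T \<and> x \<cdot> aff 1 (- 2) \<in> T) \<and>
    (\<forall>x\<in>T. x \<cdot> aff 2 0 \<in> T \<or> x \<cdot> aff 2 (- 2) \<in> T) \<and>
    (\<forall>n. \<forall>s\<in>{0, 1}. \<forall>x\<in>T. x \<cdot> aff (1/2) 0 \<in> T \<or>
      (\<exists>p\<in>{0..<2 ^ Suc n}. \<exists>q\<in>{0..<2 ^ Suc n}. \<exists>r\<in>{0..<2 ^ Suc n}.
        residue w (Suc n) = (p + q + r) mod 2 ^ Suc n \<and>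
        x \<cdot> (aff 1 s \<cdot> aff (2 ^ n) (- of_int p)) \<in> T \<and>
        x \<cdot> (aff 1 s \<cdot> C_mat \<cdot> aff (2 ^ n) (- of_int q)) \<in> T \<and>
        x \<cdot> (aff 1 s \<cdot> C_mat \<cdot> C_mat \<cdot> aff (2 ^ n) (- of_int r)) \<in> T))"

lemma limit_local_rules:
  assumes X0: "X0 \<in> Abstract_Topology.closure_of (tiling_space \<beta>) S"
    and S: "\<And>T. T \<in> S \<Longrightarrow> local_rules w T"
  shows "local_rules w X0"
  unfolding local_rules_def
proof (intro conjI allI ballI)
  show "X0 \<subseteq> carrier PSL2R" by (rule tilings_closure(3)[OF X0])
  show "disjoint_cores X0" by (rule limit_disjoint_cores[OF X0]) (use S in \<open>simp add: local_rules_def\<close>)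
next
  fix x assume x: "x \<in> X0"
  have "\<exists>F\<in>{{aff 1 2}}. \<forall>f\<in>F. x \<cdot> f \<in> X0"
    by (rule limit_rule[OF X0 _ _ _ x]) (use S in \<open>auto simp: local_rules_def\<close>)
  then show "x \<cdot> aff 1 2 \<in> X0" by simp
  have "\<exists>F\<in>{{aff 1 (- 2)}}. \<forall>f\<in>F. x \<cdot> f \<in> X0"
    by (rule limit_rule[OF X0 _ _ _ x]) (use S in \<open>auto simp: local_rules_def\<close>)
  then show "x \<cdot> aff 1 (- 2) \<in> X0" by simp
  have "\<exists>F\<in>{{aff 2 0}, {aff 2 (- 2)}}. \<forall>f\<in>F. x \<cdot> f \<in> X0"
    by (rule limit_rule[OF X0 _ _ _ x]) (use S in \<open>auto simp: local_rules_def\<close>)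
  then show "x \<cdot> aff 2 0 \<in> X0 \<or> x \<cdot> aff 2 (- 2) \<in> X0" by simp
next
  fix n :: nat and s :: real and x assume x: "x \<in> X0" and s: "s \<in> {0, 1}"
  let ?I = "{0..<2 ^ Suc n} :: int set"
  \<comment> \<open>One configuration of three tiles for each triple of residues with the prescribed
    sum, a finite family. The extra configuration \<open>{aff (1/2) 0}\<close> stands for the
    alternative that the tile has a child.\<close>
  define \<G> where "\<G> = (\<lambda>(p :: int, q :: int, r :: int). {aff 1 s \<cdot> aff (2 ^ n) (- of_int p),
    aff 1 s \<cdot> C_mat \<cdot> aff (2 ^ n) (- of_int q), aff 1 s \<cdot> C_mat \<cdot> C_mat \<cdot> aff (2 ^ n) (- of_int r)}) `
    {(p, q, r) \<in> ?I \<times> ?I \<times> ?I. residue w (Suc n) = (p + q + r) mod 2 ^ Suc n}"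
  have "finite {(p, q, r) \<in> ?I \<times> ?I \<times> ?I. residue w (Suc n) = (p + q + r) mod 2 ^ Suc n}"
    by (rule finite_subset[of _ "?I \<times> ?I \<times> ?I"]) auto
  then have fin: "finite (insert {aff (1/2) 0} \<G>)" by (simp add: \<G>_def del: power_Suc)
  have sub: "\<Union>(insert {aff (1/2) 0} \<G>) \<subseteq> carrier PSL2R" by (auto simp: \<G>_def)
  have iff: "(\<exists>F\<in>insert {aff (1/2) 0} \<G>. \<forall>f\<in>F. x \<cdot> f \<in> T) \<longleftrightarrow> x \<cdot> aff (1/2) 0 \<in> T \<or>
      (\<exists>p\<in>?I. \<exists>q\<in>?I. \<exists>r\<in>?I. residue w (Suc n) = (p + q + r) mod 2 ^ Suc n \<and>
        x \<cdot> (aff 1 s \<cdot> aff (2 ^ n) (- of_int p)) \<in> T \<and>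
        x \<cdot> (aff 1 s \<cdot> C_mat \<cdot> aff (2 ^ n) (- of_int q)) \<in> T \<and>
        x \<cdot> (aff 1 s \<cdot> C_mat \<cdot> C_mat \<cdot> aff (2 ^ n) (- of_int r)) \<in> T)" for x T
  proof -
    have "(\<exists>F\<in>\<G>. \<forall>f\<in>F. x \<cdot> f \<in> T) \<longleftrightarrow>
      (\<exists>p\<in>?I. \<exists>q\<in>?I. \<exists>r\<in>?I. residue w (Suc n) = (p + q + r) mod 2 ^ Suc n \<and>
        x \<cdot> (aff 1 s \<cdot> aff (2 ^ n) (- of_int p)) \<in> T \<and>
        x \<cdot> (aff 1 s \<cdot> C_mat \<cdot> aff (2 ^ n) (- of_int q)) \<in> T \<and>
        x \<cdot> (aff 1 s \<cdot> C_mat \<cdot> C_mat \<cdot> aff (2 ^ n) (- of_int r)) \<in> T)"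
      unfolding \<G>_def bex_simps(7) by (simp add: Bex_def split: prod.splits del: power_Suc)
    then show ?thesis by simp
  qed
  have "\<exists>F\<in>insert {aff (1/2) 0} \<G>. \<forall>f\<in>F. x \<cdot> f \<in> X0"
  proof (rule limit_rule[OF X0 _ fin sub x])
    fix T x assume T: "T \<in> S" "x \<in> T"
    show "\<exists>F\<in>insert {aff (1/2) 0} \<G>. \<forall>f\<in>F. x \<cdot> f \<in> T"
      unfolding iff using S[OF T(1)] T(2) s unfolding local_rules_def by (elim conjE) (drule spec, drule bspec, assumption, erule bspec)
  qed
  then show "x \<cdot> aff (1/2) 0 \<in> X0 \<or>
      (\<exists>p\<in>?I. \<exists>q\<in>?I. \<exists>r\<in>?I. residue w (Suc n) = (p + q + r) mod 2 ^ Suc n \<and>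
        x \<cdot> (aff 1 s \<cdot> aff (2 ^ n) (- of_int p)) \<in> X0 \<and>
        x \<cdot> (aff 1 s \<cdot> C_mat \<cdot> aff (2 ^ n) (- of_int q)) \<in> X0 \<and>
        x \<cdot> (aff 1 s \<cdot> C_mat \<cdot> C_mat \<cdot> aff (2 ^ n) (- of_int r)) \<in> X0)"
    unfolding iff .
qed

lemma int_residue_unique:
  fixes r q :: int
  assumes "[r = q] (mod m)" "\<bar>r - q\<bar> < m"
  shows "r = q"
proof -
  have "m dvd r - q" using assms(1) by (simp add: cong_iff_dvd_diff)
  then have "r - q = 0" using assms(2) by (metis dvd_abs_iff zdvd_not_zless zero_less_abs_iff)
  then show ?thesis by simp
qed

lemma aff_ocore_Im: "z \<in> act (aff (2 ^ n) b) ` ocore \<Longrightarrow> Im z > 1"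
proof -
  assume "z \<in> act (aff (2 ^ n) b) ` ocore"
  then have "2 ^ n < Im z" by (simp add: mem_aff_ocore)
  moreover have "(1::real) \<le> 2 ^ n" by simp
  ultimately show ?thesis by linarith
qed

lemma act_mult_ocore: "g \<in> carrier PSL2R \<Longrightarrow> h \<in> carrier PSL2R \<Longrightarrow> act (g \<cdot> h) ` ocore = act g ` act h ` ocore"
  by (rule act_image_mult[OF _ _ ocore_subset])

lemma act_mult_ocoreE:
  assumes "g \<in> carrier PSL2R" "h \<in> carrier PSL2R" "z \<in> act (g \<cdot> h) ` ocore"
  obtains u where "u \<in> act h ` ocore" "z = act g u"
proof -
  have "z \<in> act g ` (act h ` ocore)" using assms(3) unfolding act_mult_ocore[OF assms(1,2)] .
  then show ?thesis by (rule imageE) (rule that)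
qed

lemma power2_between_unique:
  assumes "2 ^ n < (y::real)" "y < 2 * 2 ^ n" "2 ^ m < y" "y < 2 * 2 ^ m"
  shows "n = m"
proof -
  have a: "(2::real) ^ n < 2 ^ Suc m" and b: "(2::real) ^ m < 2 ^ Suc n" using assms by simp_all
  have "n < Suc m" by (rule power_less_imp_less_exp[OF _ a]) simp
  moreover have "m < Suc n" by (rule power_less_imp_less_exp[OF _ b]) simp
  ultimately show ?thesis by simp
qed

text \<open>Overlapping tiles lie in one horoball, have the same level because their ranges of
  heights overlap, and then have congruent offsets that differ by less than the modulus 2 ^ (n +
  1).\<close>

lemma packed_disjoint_cores:
  assumes p: "packed g T"
  shows "disjoint_cores T"
  unfolding disjoint_cores_def
proof (intro ballI impI)
  note g = packed_carrier(1)[OF p]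
  fix x y assume x: "x \<in> T" and y: "y \<in> T" and "act x ` ocore \<inter> act y ` ocore \<noteq> {}"
  then obtain z where z: "z \<in> act x ` ocore" "z \<in> act y ` ocore" by blast
  obtain k n and r :: int where k: "k \<in> \<Gamma>" "x = g \<cdot> k \<cdot> aff (2 ^ n) (of_int r)" using packed_cases[OF p x] .
  obtain l m and q :: int where l: "l \<in> \<Gamma>" "y = g \<cdot> l \<cdot> aff (2 ^ m) (of_int q)" using packed_cases[OF p y] .
  have gk: "g \<cdot> k \<in> carrier PSL2R" "g \<cdot> l \<in> carrier PSL2R" using g k l by simp_all
  obtain u where u: "u \<in> act (aff (2 ^ n) (of_int r)) ` ocore" "z = act (g \<cdot> k) u"
    using act_mult_ocoreE[OF gk(1) aff_carrier[OF power2_aff_pos] z(1)[unfolded k(2)]] .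
  obtain v where v: "v \<in> act (aff (2 ^ m) (of_int q)) ` ocore" "z = act (g \<cdot> l) v"
    using act_mult_ocoreE[OF gk(2) aff_carrier[OF power2_aff_pos] z(2)[unfolded l(2)]] .
  have zk: "z \<in> act (g \<cdot> k) ` {z. Im z > 1}" unfolding u(2) using aff_ocore_Im[OF u(1)] by (intro imageI) simp
  have zl: "z \<in> act (g \<cdot> l) ` H_inf" unfolding v(2) using aff_ocore_Im[OF v(1)] by (intro imageI) simp
  obtain b :: int where b: "l = k \<cdot> aff 1 (of_int b)"
    using horoball_overlap[OF g k(1) l(1) zk zl] by (elim exE) (rule that)
  have y': "y = g \<cdot> k \<cdot> aff (2 ^ m) (of_int (q + b))" using g k(1) by (simp add: l(2) b PSL.m_assoc aff_mult)
  obtain v' where v': "v' \<in> act (aff (2 ^ m) (of_int (q + b))) ` ocore" "z = act (g \<cdot> k) v'"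
    using act_mult_ocoreE[OF gk(1) aff_carrier[OF power2_aff_pos] z(2)[unfolded y']] .
  have "Im u > 0" "Im v' > 0" using aff_ocore_Im[OF u(1)] aff_ocore_Im[OF v'(1)] by simp_all
  then have "u = v'" using inj_onD[OF inj_on_act[OF gk(1)], of u v'] u(2) v'(2) by simp
  then have uu: "u \<in> act (aff (2 ^ m) (of_int (q + b))) ` ocore" using v' by simp
  have b1: "of_int r < Re u" "Re u < of_int r + 2 * 2 ^ n" "2 ^ n < Im u" "Im u < 2 * 2 ^ n"
    using u(1) by (simp_all add: mem_aff_ocore)
  have b2: "of_int (q + b) < Re u" "Re u < of_int (q + b) + 2 * 2 ^ m" "2 ^ m < Im u" "Im u < 2 * 2 ^ m"
    using uu unfolding mem_aff_ocore[OF power2_aff_pos] by blast+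
  have nm: "n = m" using power2_between_unique b1 b2 by blast
  have "residue (index_fun g T k) (Suc n) = (- r) mod 2 ^ Suc n"
    using x unfolding k(2) packed_index[OF p k(1)] .
  moreover have "residue (index_fun g T k) (Suc n) = (- (q + b)) mod 2 ^ Suc n"
    using y unfolding y' packed_index[OF p k(1)] nm .
  ultimately have "[- r = - (q + b)] (mod 2 ^ Suc n)" by (simp add: cong_def)
  then have c: "[r = q + b] (mod 2 ^ Suc n)" unfolding cong_minus_minus_iff .
  have "\<bar>of_int r - of_int (q + b)\<bar> < (2 * 2 ^ n :: real)" using b1 b2[folded nm] by linarith
  then have "real_of_int \<bar>r - (q + b)\<bar> < of_int (2 ^ Suc n)" by simp
  then have "\<bar>r - (q + b)\<bar> < 2 ^ Suc n" by (simp only: of_int_less_iff)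
  with c have "r = q + b" by (rule int_residue_unique)
  then show "x = y" by (simp only: k(2) y' nm)
qed

lemma packed_imp_local_rules:
  assumes p: "packed g T" and w: "sum_rule g T w"
  shows "local_rules w T"
  unfolding local_rules_def
proof (intro conjI allI ballI)
  note g = packed_carrier(1)[OF p]
  show "T \<subseteq> carrier PSL2R" using packed_carrier(2)[OF p] by (rule subsetI)
  show "disjoint_cores T" by (rule packed_disjoint_cores[OF p])
  fix x assume x: "x \<in> T"
  obtain k n and r :: int where k: "k \<in> \<Gamma>" "x = g \<cdot> k \<cdot> aff (2 ^ n) (of_int r)" using packed_cases[OF p x] .
  have res: "residue (index_fun g T k) (Suc n) = (- r) mod 2 ^ Suc n"
    using x unfolding k(2) packed_index[OF p k(1)] .
  have "x \<cdot> aff 1 2 = g \<cdot> k \<cdot> aff (2 ^ n) (of_int (r + 2 ^ Suc n))"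
    using g k(1) by (simp add: k(2) PSL.m_assoc aff_mult add.commute mult.commute)
  moreover have "(- (r + 2 ^ Suc n)) mod 2 ^ Suc n = (- r) mod 2 ^ Suc n" for n
    using mod_add_self2[of "- (r + 2 ^ Suc n)" "2 ^ Suc n"] by (simp del: power_Suc)
  ultimately show "x \<cdot> aff 1 2 \<in> T" using res packed_index[OF p k(1), of n "r + 2 ^ Suc n"] by simp
  have "x \<cdot> aff 1 (- 2) = g \<cdot> k \<cdot> aff (2 ^ n) (of_int (r - 2 ^ Suc n))"
    using g k(1) by (simp add: k(2) PSL.m_assoc aff_mult add.commute mult.commute)
  moreover have "(- (r - 2 ^ Suc n)) mod 2 ^ Suc n = (- r) mod 2 ^ Suc n" for n
    using mod_add_self2[of "- r" "2 ^ Suc n"] by (simp add: algebra_simps del: power_Suc)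
  ultimately show "x \<cdot> aff 1 (- 2) \<in> T" using res packed_index[OF p k(1), of n "r - 2 ^ Suc n"] by simp
  have "x \<cdot> aff 2 0 = g \<cdot> k \<cdot> aff (2 ^ Suc n) (of_int r)"
    using g k(1) by (simp add: k(2) PSL.m_assoc aff_mult mult.commute)
  then have up0: "x \<cdot> aff 2 0 \<in> T \<longleftrightarrow> residue (index_fun g T k) (Suc (Suc n)) = (- r) mod 2 ^ Suc (Suc n)"
    using packed_index[OF p k(1), of "Suc n" r] by (simp only:)
  have "x \<cdot> aff 2 (- 2) = g \<cdot> k \<cdot> aff (2 ^ Suc n) (of_int (r - 2 ^ Suc n))"
    using g k(1) by (simp add: k(2) PSL.m_assoc aff_mult mult.commute add.commute)
  then have up2: "x \<cdot> aff 2 (- 2) \<in> T \<longleftrightarrow> residue (index_fun g T k) (Suc (Suc n)) = (- (r - 2 ^ Suc n)) mod 2 ^ Suc (Suc n)"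
    using packed_index[OF p k(1), of "Suc n" "r - 2 ^ Suc n"] by (simp only:)
  \<comment> \<open>The next residue of the index reduces to - r modulo 2 ^ (n + 1). Modulo 2 ^ (n +
    2) it is therefore - r or - r + 2 ^ (n + 1), and these two cases are the two possible
    parents.\<close>
  define d where "d = residue (index_fun g T k) (Suc (Suc n))"
  have "d mod 2 ^ Suc n = (- r) mod 2 ^ Suc n" unfolding d_def residue_Suc_mod by (rule res)
  then have "[d = - r] (mod 2 ^ Suc n)" by (simp add: cong_def)
  then obtain j where j: "- r = d + 2 ^ Suc n * j" by (auto simp: cong_iff_lin)
  have dd: "d mod 2 ^ Suc (Suc n) = d" unfolding d_def by (rule residue_mod)
  have "d = (- r) mod 2 ^ Suc (Suc n) \<or> d = (- (r - 2 ^ Suc n)) mod 2 ^ Suc (Suc n)"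
  proof (cases "even j")
    case True
    then obtain i where "j = 2 * i" by blast
    then have "- r = d + 2 ^ Suc (Suc n) * i" using j by simp
    then show ?thesis using dd by (metis mod_mult_self2)
  next
    case False
    then obtain i where "j = 2 * i + 1" by (blast elim: oddE)
    then have "- (r - 2 ^ Suc n) = d + 2 ^ Suc (Suc n) * (i + 1)" using j by (simp add: algebra_simps)
    then show ?thesis using dd by (metis mod_mult_self2)
  qed
  then show "x \<cdot> aff 2 0 \<in> T \<or> x \<cdot> aff 2 (- 2) \<in> T" unfolding up0 up2 d_def[symmetric] .
next
  note g = packed_carrier(1)[OF p]
  fix n :: nat and s :: real and x assume s: "s \<in> {0, 1}" and x: "x \<in> T"
  let ?I = "{0..<2 ^ Suc n} :: int set"
  show "x \<cdot> aff (1/2) 0 \<in> T \<or>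
      (\<exists>p\<in>?I. \<exists>q\<in>?I. \<exists>r\<in>?I. residue w (Suc n) = (p + q + r) mod 2 ^ Suc n \<and>
        x \<cdot> (aff 1 s \<cdot> aff (2 ^ n) (- of_int p)) \<in> T \<and>
        x \<cdot> (aff 1 s \<cdot> C_mat \<cdot> aff (2 ^ n) (- of_int q)) \<in> T \<and>
        x \<cdot> (aff 1 s \<cdot> C_mat \<cdot> C_mat \<cdot> aff (2 ^ n) (- of_int r)) \<in> T)"
  proof (cases "x \<cdot> aff (1/2) 0 \<in> T")
    case False
    then obtain l where l: "l \<in> \<Gamma>" "x = g \<cdot> l" using packed_childless[OF p x] by (elim iffE) (auto simp only:)
    have sG: "aff 1 s \<in> \<Gamma>" using s aff_1_modular[of 0] aff_1_modular[of 1] by auto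
    \<comment> \<open>A tile without a child is itself a frame; s = 0 and s = 1 select the triangle
      below its left and its right half.\<close>
    define k where "k = l \<cdot> aff 1 s"
    have k: "k \<in> \<Gamma>" using l sG by (simp add: k_def)
    have mem: "x \<cdot> (aff 1 s \<cdot> c \<cdot> aff (2 ^ n) (- of_int (residue (index_fun g T (k \<cdot> c)) (Suc n)))) \<in> T"
      if c: "c \<in> \<Gamma>" for c
    proof -
      have "g \<cdot> (k \<cdot> c) \<cdot> aff (2 ^ n) (of_int (- residue (index_fun g T (k \<cdot> c)) (Suc n))) \<in> T"
        unfolding packed_index[OF p modular_mult[OF k c]] by (simp del: power_Suc)
      then show ?thesis using g l c k_def by (simp add: PSL.m_assoc)
    qed
    have I: "residue d (Suc n) \<in> ?I" for d
    proof -
      have "residue d (Suc n) = residue d (Suc n) mod 2 ^ Suc n" by (simp del: power_Suc)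
      moreover have "(0::int) < 2 ^ Suc n" by simp
      ultimately show ?thesis by (metis atLeastLessThan_iff pos_mod_bound pos_mod_sign)
    qed
    have "w = index_fun g T k + index_fun g T (k \<cdot> C_mat) + index_fun g T (k \<cdot> C_mat \<cdot> C_mat)"
      using w k unfolding sum_rule_def by simp
    then have "residue w (Suc n) = (residue (index_fun g T k) (Suc n) + residue (index_fun g T (k \<cdot> C_mat)) (Suc n)
       + residue (index_fun g T (k \<cdot> C_mat \<cdot> C_mat)) (Suc n)) mod 2 ^ Suc n"
      by (simp add: residue_simps mod_simps del: power_Suc)
    moreover have "x \<cdot> (aff 1 s \<cdot> aff (2 ^ n) (- of_int (residue (index_fun g T k) (Suc n)))) \<in> T"
      using mem[OF modular_one] sG k by simp
    moreover have "x \<cdot> (aff 1 s \<cdot> C_mat \<cdot> aff (2 ^ n) (- of_int (residue (index_fun g T (k \<cdot> C_mat)) (Suc n)))) \<in> T"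
      by (rule mem[OF C_mat_modular])
    moreover have "x \<cdot> (aff 1 s \<cdot> C_mat \<cdot> C_mat \<cdot> aff (2 ^ n) (- of_int (residue (index_fun g T (k \<cdot> C_mat \<cdot> C_mat)) (Suc n)))) \<in> T"
      using mem[OF modular_mult[OF C_mat_modular C_mat_modular]] sG k by (simp add: PSL.m_assoc)
    ultimately show ?thesis using I by (intro disjI2 bexI conjI)
  qed simp
qed

section \<open>Sets of tiles satisfying the local rules\<close>

lemma local_rulesD:
  assumes "local_rules w T"
  shows "x \<in> T \<Longrightarrow> x \<in> carrier PSL2R" "disjoint_cores T"
    "x \<in> T \<Longrightarrow> x \<cdot> aff 1 2 \<in> T" "x \<in> T \<Longrightarrow> x \<cdot> aff 1 (- 2) \<in> T"
    "x \<in> T \<Longrightarrow> x \<cdot> aff 2 0 \<in> T \<or> x \<cdot> aff 2 (- 2) \<in> T"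
  using assms unfolding local_rules_def by (auto simp only:)

lemma local_rules_triangle:
  assumes "local_rules w T" "x \<in> T" "x \<cdot> aff (1/2) 0 \<notin> T" "s \<in> {0, 1}"
  obtains p q r :: int where "residue w (Suc n) = (p + q + r) mod 2 ^ Suc n"
        "x \<cdot> (aff 1 s \<cdot> aff (2 ^ n) (- of_int p)) \<in> T"
        "x \<cdot> (aff 1 s \<cdot> C_mat \<cdot> aff (2 ^ n) (- of_int q)) \<in> T"
        "x \<cdot> (aff 1 s \<cdot> C_mat \<cdot> C_mat \<cdot> aff (2 ^ n) (- of_int r)) \<in> T"
proof -
  have "\<forall>n. \<forall>s\<in>{0, 1}. \<forall>x\<in>T. x \<cdot> aff (1/2) 0 \<in> T \<or>
      (\<exists>p\<in>{0..<2 ^ Suc n}. \<exists>q\<in>{0..<2 ^ Suc n}. \<exists>r\<in>{0..<2 ^ Suc n}.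
        residue w (Suc n) = (p + q + r) mod 2 ^ Suc n \<and>
        x \<cdot> (aff 1 s \<cdot> aff (2 ^ n) (- of_int p)) \<in> T \<and>
        x \<cdot> (aff 1 s \<cdot> C_mat \<cdot> aff (2 ^ n) (- of_int q)) \<in> T \<and>
        x \<cdot> (aff 1 s \<cdot> C_mat \<cdot> C_mat \<cdot> aff (2 ^ n) (- of_int r)) \<in> T)"
    using assms(1) unfolding local_rules_def by (elim conjE)
  from bspec[OF bspec[OF spec[OF this] assms(4)] assms(2), of n] assms(3) show ?thesis
    by (elim disjE bexE conjE) (erule notE, assumption, rule that)
qed

lemma horizontal:
  assumes R: "local_rules w T" and y: "y \<in> carrier PSL2R" and s: "s > 0" and x: "y \<cdot> aff s b \<in> T"
  shows "y \<cdot> aff s (b + 2 * s * of_int l) \<in> T"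
proof (induction l rule: int_induct[where k = 0])
  case base
  then show ?case using x by simp
next
  case (step1 i)
  have "y \<cdot> aff s (b + 2 * s * of_int (i + 1)) = y \<cdot> aff s (b + 2 * s * of_int i) \<cdot> aff 1 2"
    using y s by (simp add: PSL.m_assoc aff_mult algebra_simps)
  then show ?case using local_rulesD(3)[OF R step1(2)] by (simp only:)
next
  case (step2 i)
  have "y \<cdot> aff s (b + 2 * s * of_int (i - 1)) = y \<cdot> aff s (b + 2 * s * of_int i) \<cdot> aff 1 (- 2)"
    using y s by (simp add: PSL.m_assoc aff_mult algebra_simps)
  then show ?case using local_rulesD(4)[OF R step2(2)] by (simp only:)
qed

text \<open>Parents are chosen one level at a time, and \<open>horizontal\<close> completes each
  ancestor to a whole row. The rows from level 0 on fill the horoball above the bottom edge of x,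
  although no packing is known yet.\<close>

lemma ancestors:
  assumes R: "local_rules w T" and x: "x \<in> T"
  obtains b :: "nat \<Rightarrow> int" where "b 0 = 0" "coherent b"
    "\<And>n r. [r = b n] (mod 2 ^ Suc n) \<Longrightarrow> x \<cdot> aff (2 ^ n) (of_int r) \<in> T"
proof -
  note xc = local_rulesD(1)[OF R x]
  \<comment> \<open>The offset of the ancestor row in the coordinates of x: unchanged when the
    parent is \<open>aff 2 0\<close>, lowered by 2 ^ (n + 1) when it is
    \<open>aff 2 (- 2)\<close>.\<close>
  define b where "b = rec_nat (0::int) (\<lambda>n c. if x \<cdot> aff (2 ^ Suc n) (of_int c) \<in> T then c else c - 2 ^ Suc n)"
  have b0: "b 0 = 0" and bS: "b (Suc n) = (if x \<cdot> aff (2 ^ Suc n) (of_int (b n)) \<in> T then b n else b n - 2 ^ Suc n)" for n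
    by (simp_all add: b_def)
  have coh: "coherent b" unfolding coherent_def bS by (simp add: cong_def)
  have mem: "x \<cdot> aff (2 ^ n) (of_int (b n)) \<in> T" for n
  proof (induction n)
    case 0
    then show ?case using x xc by (simp add: b0 aff_1_0)
  next
    case (Suc n)
    have "x \<cdot> aff (2 ^ n) (of_int (b n)) \<cdot> aff 2 0 = x \<cdot> aff (2 ^ Suc n) (of_int (b n))"
      "x \<cdot> aff (2 ^ n) (of_int (b n)) \<cdot> aff 2 (- 2) = x \<cdot> aff (2 ^ Suc n) (of_int (b n - 2 ^ Suc n))"
      using xc by (simp_all add: PSL.m_assoc aff_mult mult.commute)
    then show ?case using local_rulesD(5)[OF R Suc] by (auto simp only: bS split: if_splits)
  qed
  have "x \<cdot> aff (2 ^ n) (of_int r) \<in> T" if rb: "[r = b n] (mod 2 ^ Suc n)" for n r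
  proof -
    obtain l where l: "r = b n + 2 ^ Suc n * l" using cong_sym[OF rb] by (auto simp: cong_iff_lin)
    have "x \<cdot> aff (2 ^ n) (of_int (b n) + 2 * 2 ^ n * of_int l) \<in> T"
      by (rule horizontal[OF R xc _ mem]) simp
    then show ?thesis by (simp add: l)
  qed
  then show ?thesis using that b0 coh by blast
qed

text \<open>A point of a half-open box may lie on the lower or left edge; a small push to the upper
  right, possible within the open set W, brings it into the open box.\<close>

lemma open_box_meets:
  assumes W: "open W" and z: "z \<in> W" "Im z > 0"
  obtains j l :: int where "W \<inter> act (aff (2 powi j) (c j + 2 * 2 powi j * of_int l)) ` ocore \<noteq> {}"
    "Im z \<ge> 1 \<Longrightarrow> j \<ge> 0"
proof -
  obtain j l :: int where jl: "2 powi j \<le> Im z" "Im z < 2 * 2 powi j"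
    "c j + 2 * 2 powi j * of_int l \<le> Re z" "Re z < c j + 2 * 2 powi j * of_int l + 2 * 2 powi j"
    "Im z \<ge> 1 \<Longrightarrow> j \<ge> 0"
    using half_open_box[OF z(2), of c] by blast
  obtain e where e: "e > 0" "ball z e \<subseteq> W" using W z(1) by (rule openE)
  define b where "b = c j + 2 * 2 powi j * of_int l"
  define \<delta> where "\<delta> = min (e / 4) (min ((2 * 2 powi j - Im z) / 2) ((b + 2 * 2 powi j - Re z) / 2))"
  have \<delta>: "\<delta> > 0" "\<delta> < 2 * 2 powi j - Im z" "\<delta> < b + 2 * 2 powi j - Re z" "\<delta> \<le> e / 4"
  proof -
    have pos: "0 < 2 * 2 powi j - Im z" "0 < b + 2 * 2 powi j - Re z" using jl by (simp_all add: b_def)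
    then show "\<delta> > 0" using e(1) by (simp add: \<delta>_def)
    have "\<delta> \<le> (2 * 2 powi j - Im z) / 2" "\<delta> \<le> (b + 2 * 2 powi j - Re z) / 2" "\<delta> \<le> e / 4"
      unfolding \<delta>_def by (simp_all only: min_le_iff_disj order_refl simp_thms)
    moreover have "\<delta> < y" if "\<delta> \<le> y / 2" "0 < y" for y using that by simp
    ultimately show "\<delta> < 2 * 2 powi j - Im z" "\<delta> < b + 2 * 2 powi j - Re z" "\<delta> \<le> e / 4" using pos by blast+
  qed
  define v where "v = z + Complex \<delta> \<delta>"
  have "cmod (Complex \<delta> \<delta>) \<le> \<bar>\<delta>\<bar> + \<bar>\<delta>\<bar>" using cmod_le[of "Complex \<delta> \<delta>"] by simp
  then have "cmod (Complex \<delta> \<delta>) < e" using \<delta> e by linarith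
  then have "v \<in> W" using e(2) by (auto simp: v_def dist_norm)
  moreover have "v \<in> act (aff (2 powi j) b) ` ocore"
  proof (subst mem_aff_ocore)
    show "b < Re v \<and> Re v < b + 2 * 2 powi j \<and> 2 powi j < Im v \<and> Im v < 2 * 2 powi j"
      using \<delta> jl by (simp add: v_def b_def)
  qed simp
  ultimately have "W \<inter> act (aff (2 powi j) (c j + 2 * 2 powi j * of_int l)) ` ocore \<noteq> {}"
    unfolding b_def by blast
  then show ?thesis using that jl(5) by blast
qed

section \<open>Tiles whose horoballs overlap have a common ancestor\<close>

abbreviation deep :: "complex set" where
  "deep \<equiv> {z. Im z > 1}"

lemma deep_subset: "deep \<subseteq> \<H>" and open_deep: "open deep"
  by (auto simp: open_halfspace_Im_gt)

text \<open>The rows of ancestors of x cover the image of \<open>deep\<close> under x up to edges,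
  and an open set cannot hide in the edges.\<close>

lemma ancestor_meets:
  assumes R: "local_rules w T" and x: "x \<in> T" and W: "open W" "W \<subseteq> \<H>" and z: "z \<in> W" "z \<in> act x ` deep"
  shows "\<exists>n r. x \<cdot> aff (2 ^ n) (of_int r) \<in> T \<and> W \<inter> act (x \<cdot> aff (2 ^ n) (of_int r)) ` ocore \<noteq> {}"
proof -
  note xc = local_rulesD(1)[OF R x]
  obtain b where b: "b 0 = 0" "coherent b" "\<And>n r. [r = b n] (mod 2 ^ Suc n) \<Longrightarrow> x \<cdot> aff (2 ^ n) (of_int r) \<in> T"
    using ancestors[OF R x] by blast
  define V where "V = act (pinv x) ` W"
  have V: "open V" unfolding V_def by (rule open_act_image) (use xc W in auto)
  define u where "u = act (pinv x) z"
  have u: "u \<in> V" "Im u > 1" using z by (auto simp: V_def u_def mem_act_image[OF xc deep_subset])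
  obtain j l :: int where jl: "V \<inter> act (aff (2 powi j) (of_int (b (nat j)) + 2 * 2 powi j * of_int l)) ` ocore \<noteq> {}"
    "j \<ge> 0"
    using open_box_meets[OF V u(1), of "\<lambda>j. of_int (b (nat j))"] u(2)
    by (metis less_imp_le order.strict_trans zero_less_one)
  define n where "n = nat j"
  have pj: "(2::real) powi j = 2 ^ n" using jl(2) by (simp add: n_def power_int_def)
  define r where "r = b n + 2 ^ Suc n * l"
  have r: "of_int (b (nat j)) + 2 * 2 powi j * of_int l = (of_int r :: real)" by (simp add: r_def pj n_def[symmetric])
  obtain v where v: "v \<in> V" "v \<in> act (aff (2 ^ n) (of_int r)) ` ocore" using jl(1) unfolding r unfolding pj by blast
  have "act x v \<in> W" using imageI[OF v(1), of "act x"] unfolding V_def act_image_inv(2)[OF xc W(2)] .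
  moreover have "act x v \<in> act (x \<cdot> aff (2 ^ n) (of_int r)) ` ocore"
    unfolding act_mult_ocore[OF xc aff_carrier[OF power2_aff_pos]] using v(2) by (rule imageI)
  ultimately have "W \<inter> act (x \<cdot> aff (2 ^ n) (of_int r)) ` ocore \<noteq> {}" by blast
  moreover have "x \<cdot> aff (2 ^ n) (of_int r) \<in> T" by (rule b(3)) (simp add: r_def cong_def)
  ultimately show ?thesis by (intro exI conjI)
qed

text \<open>An ancestor row of x puts an open core into the overlap, and an ancestor row of y puts
  one into that core; disjointness of open cores makes the two tiles equal. The outcome relates x
  and y by an affine map.\<close>

lemma common_ancestor:
  assumes R: "local_rules w T" and x: "x \<in> T" and y: "y \<in> T"
    and z: "z \<in> act x ` deep" "z \<in> act y ` deep"
  shows "\<exists>n m. \<exists>r q::int. x \<cdot> aff (2 ^ n) (of_int r) = y \<cdot> aff (2 ^ m) (of_int q)"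
proof -
  note xc = local_rulesD(1)[OF R x] and yc = local_rulesD(1)[OF R y]
  define W where "W = act x ` deep \<inter> act y ` deep"
  have W: "open W" "W \<subseteq> \<H>" "z \<in> W"
    unfolding W_def using xc yc z act_image_subset[OF xc deep_subset]
    by (auto intro!: open_Int open_act_image open_deep deep_subset)
  obtain n r where nr: "x \<cdot> aff (2 ^ n) (of_int r) \<in> T" "W \<inter> act (x \<cdot> aff (2 ^ n) (of_int r)) ` ocore \<noteq> {}"
    using ancestor_meets[OF R x W(1,2,3) z(1)] by (elim exE conjE) (rule that)
  define V where "V = W \<inter> act (x \<cdot> aff (2 ^ n) (of_int r)) ` ocore"
  obtain v where v: "v \<in> V" using nr(2) unfolding V_def by blast
  have V: "open V" "V \<subseteq> \<H>"
    unfolding V_def using W(1,2) local_rulesD(1)[OF R nr(1)] by (auto intro!: open_Int open_act_image open_ocore ocore_subset)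
  have vy: "v \<in> act y ` deep" using v unfolding V_def W_def by blast
  obtain m q where mq: "y \<cdot> aff (2 ^ m) (of_int q) \<in> T" "V \<inter> act (y \<cdot> aff (2 ^ m) (of_int q)) ` ocore \<noteq> {}"
    using ancestor_meets[OF R y V v vy] by (elim exE conjE) (rule that)
  obtain v' where "v' \<in> act (x \<cdot> aff (2 ^ n) (of_int r)) ` ocore" "v' \<in> act (y \<cdot> aff (2 ^ m) (of_int q)) ` ocore"
    using mq(2) unfolding V_def by blast
  then have "x \<cdot> aff (2 ^ n) (of_int r) = y \<cdot> aff (2 ^ m) (of_int q)"
    by (rule disjoint_coresD[OF local_rulesD(2)[OF R] nr(1) mq(1)])
  then show ?thesis by (intro exI)
qed

text \<open>Two such horoballs overlap as soon as the lower left entry e of the quotient satisfies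
  |e| < 1. If c \<noteq> 0, the horoball of x rests on a / c, and a rational point Q / P close to it
  makes |e| = |c| * |P * (a / c) - Q| small by Dirichlet approximation.\<close>

lemma horoball_meets_packing:
  assumes "x \<in> carrier PSL2R"
  shows "\<exists>k\<in>\<Gamma>. \<exists>z. z \<in> act x ` deep \<and> z \<in> act k ` deep"
proof -
  obtain a b c d where x: "x = pm a b c d" "a * d - b * c = 1" using assms by (rule PSL2R_cases)
  obtain k where k: "k \<in> \<Gamma>" "\<exists>a' b' e d'. pinv k \<cdot> x = pm a' b' e d' \<and> a' * d' - b' * e = 1 \<and> \<bar>e\<bar> < 1"
  proof (cases "c = 0")
    case True
    have "pinv \<one>\<^bsub>PSL2R\<^esub> \<cdot> x = pm a b c d" using x by simp
    then have "\<exists>a' b' e d'. pinv \<one>\<^bsub>PSL2R\<^esub> \<cdot> x = pm a' b' e d' \<and> a' * d' - b' * e = 1 \<and> \<bar>e\<bar> < 1"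
      using x(2) True by (intro exI[of _ a] exI[of _ b] exI[of _ c] exI[of _ d] conjI) simp_all
    then show ?thesis using that modular_one by blast
  next
    case False
    \<comment> \<open>A bound on denominators larger than |c|, so that |c| / N < 1.\<close>
    define N where "N = nat \<lceil>\<bar>c\<bar>\<rceil> + 1"
    have N: "N > 0" "\<bar>c\<bar> < real N" by (simp_all add: N_def) linarith
    obtain h p where hp: "0 < p" "p \<le> int N" "\<bar>of_int p * (a / c) - of_int h\<bar> < 1 / real N"
      using Dirichlet_approx[OF N(1), of "a / c"] by blast
    \<comment> \<open>In lowest terms Q / P is the point where a horoball of the packing rests;
      dividing by the gcd does not worsen the approximation.\<close>
    define G where "G = gcd p h"
    have G: "G > 0" using hp(1) by (simp add: G_def gcd_pos_int)
    obtain P Q where PQ: "p = G * P" "h = G * Q" "coprime P Q"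
      using gcd_coprime_exists[of p h] G unfolding G_def by (metis mult.commute less_numeral_extra(3))
    have "\<bar>of_int P * (a / c) - of_int Q\<bar> \<le> of_int G * \<bar>of_int P * (a / c) - of_int Q\<bar>"
      using G by (intro mult_left_le[of _ "of_int G", simplified] | simp add: mult_le_cancel_right1)+
    also have "\<dots> = \<bar>of_int p * (a / c) - of_int h\<bar>"
    proof -
      have "of_int p * (a / c) - of_int h = of_int G * (of_int P * (a / c) - of_int Q)"
        by (simp add: PQ algebra_simps)
      then show ?thesis using G by (simp add: abs_mult)
    qed
    finally have small: "\<bar>of_int P * (a / c) - of_int Q\<bar> < 1 / real N" using hp(3) by linarith
    obtain u v where uv: "u * P + v * Q = 1" using PQ(3) bezout_int[of P Q] by auto
    define k where "k = pm (of_int Q) (- of_int u) (of_int P) (of_int v)"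
    have det: "of_int Q * of_int v - (- of_int u) * of_int P = (1::real)"
      using arg_cong[OF uv, of "of_int :: int \<Rightarrow> real"] by (simp add: algebra_simps)
    have kG: "k \<in> \<Gamma>" unfolding k_def by (rule modular_pm'[OF det]) simp_all
    define e where "e = - of_int P * a + of_int Q * c"
    have "e = - c * (of_int P * (a / c) - of_int Q)" using False by (simp add: e_def field_simps)
    then have "\<bar>e\<bar> = \<bar>c\<bar> * \<bar>of_int P * (a / c) - of_int Q\<bar>" by (simp add: abs_mult)
    also have "\<dots> < \<bar>c\<bar> * (1 / real N)" using small False by (intro mult_strict_left_mono) auto
    also have "\<dots> < 1" using N by (simp add: divide_less_eq)
    finally have e: "\<bar>e\<bar> < 1" .
    have kx: "pinv k \<cdot> x = pm (of_int v * a + of_int u * c) (of_int v * b + of_int u * d) e (- of_int P * b + of_int Q * d)"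
      unfolding k_def pinv_pm[OF det] x(1) pm_mult by (simp add: e_def)
    have "(of_int v * a + of_int u * c) * (- of_int P * b + of_int Q * d) - (of_int v * b + of_int u * d) * e
      = (of_int Q * of_int v - (- of_int u) * of_int P) * (a * d - b * c)"
      unfolding e_def by algebra
    then have "(of_int v * a + of_int u * c) * (- of_int P * b + of_int Q * d) - (of_int v * b + of_int u * d) * e = 1"
      unfolding det x(2) by simp
    with kx e show ?thesis using that[OF kG] by blast
  qed
  then obtain a' b' e d' where m: "pinv k \<cdot> x = pm a' b' e d'" "a' * d' - b' * e = 1" "\<bar>e\<bar> < 1" by blast
  obtain v where v: "Im v > 1" "Im (act (pm a' b' e d') v) > 1"
  proof (cases "e = 0")
    case True
    define t where "t = 1 + d'\<^sup>2"
    have d0: "d' \<noteq> 0" using m(2) True by auto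
    have "Im (act (pm a' b' e d') (Complex 0 t)) = t / d'\<^sup>2"
      unfolding Im_act[OF m(2)] norm_denom_power2 using True by simp
    also have "\<dots> > 1" using d0 by (simp add: t_def less_divide_eq)
    finally show ?thesis using that[of "Complex 0 t"] d0 by (simp add: t_def)
  next
    case False
    have "e\<^sup>2 < 1" using m(3) by (simp add: abs_square_less_1)
    then have e2: "0 < e\<^sup>2" "1 < 1 / e\<^sup>2" using False by (simp_all add: less_divide_eq)
    then obtain t where t: "1 < t" "t < 1 / e\<^sup>2" using dense by blast
    have "Im (act (pm a' b' e d') (Complex (- d' / e) t)) = t / (e\<^sup>2 * t\<^sup>2)"
      unfolding Im_act[OF m(2)] norm_denom_power2 using False by simp
    also have "\<dots> = 1 / (e\<^sup>2 * t)" using t by (simp add: power2_eq_square)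
    also have "\<dots> > 1" using t e2 by (simp add: less_divide_eq mult.commute)
    finally show ?thesis using that[of "Complex (- d' / e) t"] t by simp
  qed
  have v0: "Im v > 0" using v by simp
  have "act x v = act (k \<cdot> (pinv k \<cdot> x)) v" using k(1) assms by (simp add: PSL.m_assoc[symmetric])
  also have "\<dots> = act k (act (pinv k \<cdot> x) v)" using k(1) assms v0 by (intro act_mult) simp_all
  finally have "act x v \<in> act k ` deep" unfolding m(1) using v(2) by (simp add: imageI)
  moreover have "act x v \<in> act x ` deep" using v(1) by (simp add: imageI)
  ultimately show ?thesis using k(1) by (intro bexI exI conjI)
qed

text \<open>Children in a row are spaced by 1, so having a child does not change under integer
  translations of the frame.\<close>

lemma child_shift:
  assumes R: "local_rules w T" and y: "y \<in> carrier PSL2R" and x: "y \<cdot> aff (1/2) b \<in> T"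
  shows "y \<cdot> aff (1/2) (b + of_int l) \<in> T"
  using horizontal[OF R y _ x, of l] by simp

text \<open>The local rule is stated at a tile, but a frame may lie at any integer offset m from
  one. The parity of m decides which of the two triangles below a tile is the triangle of the
  frame.\<close>

lemma frame_triangle:
  assumes R: "local_rules w T" and y: "y \<in> carrier PSL2R" and m: "y \<cdot> aff 1 (of_int m) \<in> T" and nb: "y \<cdot> aff (1/2) 0 \<notin> T"
  obtains p q r :: int where "residue w (Suc n) = (p + q + r) mod 2 ^ Suc n"
        "y \<cdot> aff (2 ^ n) (of_int (- p)) \<in> T"
        "y \<cdot> C_mat \<cdot> aff (2 ^ n) (of_int (- q)) \<in> T"
        "y \<cdot> C_mat \<cdot> C_mat \<cdot> aff (2 ^ n) (of_int (- r)) \<in> T"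
proof -
  obtain s :: real where s: "s \<in> {0, 1}" "y \<cdot> aff 1 (- s) \<in> T" "y \<cdot> aff 1 (- s) \<cdot> aff (1/2) 0 \<notin> T"
  proof (cases "even m")
    case True
    then obtain i where i: "m = 2 * i" by blast
    have "y \<cdot> aff 1 (- 0) \<in> T" using horizontal[OF R y _ m, of "- i"] by (simp add: i)
    moreover have "y \<cdot> aff 1 (- 0) \<cdot> aff (1/2) 0 \<notin> T" using nb y by (simp add: PSL.m_assoc aff_mult)
    ultimately show ?thesis by (intro that[of 0]) simp_all
  next
    case False
    then obtain i where i: "m = 2 * i + 1" by (blast elim: oddE)
    have "y \<cdot> aff 1 (- 1) \<in> T" using horizontal[OF R y _ m, of "- i - 1"] by (simp add: i)
    moreover have "y \<cdot> aff 1 (- 1) \<cdot> aff (1/2) 0 \<notin> T"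
    proof
      assume "y \<cdot> aff 1 (- 1) \<cdot> aff (1/2) 0 \<in> T"
      then have "y \<cdot> aff (1/2) (- 1) \<in> T" using y by (simp add: PSL.m_assoc aff_mult)
      then show False using child_shift[OF R y, of "- 1" 1] nb by simp
    qed
    ultimately show ?thesis by (intro that[of 1]) simp_all
  qed
  obtain p q r :: int where pqr: "residue w (Suc n) = (p + q + r) mod 2 ^ Suc n"
        "y \<cdot> aff 1 (- s) \<cdot> (aff 1 s \<cdot> aff (2 ^ n) (- of_int p)) \<in> T"
        "y \<cdot> aff 1 (- s) \<cdot> (aff 1 s \<cdot> C_mat \<cdot> aff (2 ^ n) (- of_int q)) \<in> T"
        "y \<cdot> aff 1 (- s) \<cdot> (aff 1 s \<cdot> C_mat \<cdot> C_mat \<cdot> aff (2 ^ n) (- of_int r)) \<in> T"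
    using local_rules_triangle[OF R s(2,3,1)] .
  have "y \<cdot> aff 1 (- s) \<cdot> (aff 1 s \<cdot> c) = y \<cdot> c" if "c \<in> carrier PSL2R" for c
  proof -
    have "aff 1 (- s) \<cdot> (aff 1 s \<cdot> c) = c"
      using that by (simp add: PSL.m_assoc[symmetric] aff_mult aff_1_0)
    then show ?thesis using y that by (simp add: PSL.m_assoc)
  qed
  then have e: "y \<cdot> aff 1 (- s) \<cdot> (aff 1 s \<cdot> aff (2 ^ n) (- of_int p)) = y \<cdot> aff (2 ^ n) (of_int (- p))"
    "y \<cdot> aff 1 (- s) \<cdot> (aff 1 s \<cdot> C_mat \<cdot> aff (2 ^ n) (- of_int q)) = y \<cdot> C_mat \<cdot> aff (2 ^ n) (of_int (- q))"
    "y \<cdot> aff 1 (- s) \<cdot> (aff 1 s \<cdot> C_mat \<cdot> C_mat \<cdot> aff (2 ^ n) (- of_int r)) = y \<cdot> C_mat \<cdot> C_mat \<cdot> aff (2 ^ n) (of_int (- r))"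
    using y by (simp_all add: PSL.m_assoc)
  show ?thesis using pqr unfolding e by (rule that)
qed

text \<open>The ancestor rows already fill the horoball of the frame. A further tile of level n with
  an arbitrary real offset would overlap one in the row of that level, so it coincides with it and
  its offset is an integer.\<close>

lemma frame_offsets:
  assumes R: "local_rules w T" and y: "y \<in> carrier PSL2R" and m: "y \<cdot> aff 1 (of_int m) \<in> T"
  obtains c :: "nat \<Rightarrow> int" where "coherent c"
    "\<And>n r. [r = c n] (mod 2 ^ Suc n) \<Longrightarrow> y \<cdot> aff (2 ^ n) (of_int r) \<in> T"
    "\<And>n \<beta>. y \<cdot> aff (2 ^ n) \<beta> \<in> T \<Longrightarrow> \<exists>r. \<beta> = of_int r \<and> [r = c n] (mod 2 ^ Suc n)"
proof -
  obtain b where b: "b 0 = 0" "coherent b"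
    "\<And>n r. [r = b n] (mod 2 ^ Suc n) \<Longrightarrow> y \<cdot> aff 1 (of_int m) \<cdot> aff (2 ^ n) (of_int r) \<in> T"
    using ancestors[OF R m] by blast
  define c where "c n = b n + m" for n
  have c: "coherent c" using b(2) by (simp add: coherent_def c_def cong_add_rcancel)
  have mem: "y \<cdot> aff (2 ^ n) (of_int r) \<in> T" if rc: "[r = c n] (mod 2 ^ Suc n)" for n r
  proof -
    have "[r - m = b n] (mod 2 ^ Suc n)"
      using rc by (simp add: c_def cong_iff_dvd_diff algebra_simps)
    from b(3)[OF this] show ?thesis using y by (simp add: PSL.m_assoc aff_mult)
  qed
  have "\<exists>r. \<beta> = of_int r \<and> [r = c n] (mod 2 ^ Suc n)" if \<beta>: "y \<cdot> aff (2 ^ n) \<beta> \<in> T" for n \<beta>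
  proof -
    define s where "s = (2 ^ Suc n :: real)"
    have s: "s > 0" by (simp add: s_def)
    define l where "l = \<lfloor>(\<beta> - of_int (c n)) / s\<rfloor>"
    have "of_int l \<le> (\<beta> - of_int (c n)) / s" "(\<beta> - of_int (c n)) / s < of_int l + 1" by (simp_all add: l_def)
    then have re: "of_int (c n) + s * of_int l \<le> \<beta>" "\<beta> < of_int (c n) + s * of_int l + s"
      using s by (simp_all add: le_divide_eq divide_less_eq algebra_simps)
    define r where "r = c n + 2 ^ Suc n * l"
    have rr: "of_int r = of_int (c n) + s * of_int l" by (simp add: r_def s_def)
    have rc: "[r = c n] (mod 2 ^ Suc n)" by (simp add: r_def cong_def)
    \<comment> \<open>The middle of the strip common to the two boxes, which begin at
      \<open>of_int r\<close> and at \<beta> and have width s.\<close>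
    define v where "v = Complex ((\<beta> + of_int r + s) / 2) (3/2 * 2 ^ n)"
    have "v \<in> act (aff (2 ^ n) \<beta>) ` ocore" "v \<in> act (aff (2 ^ n) (of_int r)) ` ocore"
      using re s by (simp_all add: mem_aff_ocore v_def rr) (simp_all add: s_def)
    then have "act y v \<in> act (y \<cdot> aff (2 ^ n) \<beta>) ` ocore" "act y v \<in> act (y \<cdot> aff (2 ^ n) (of_int r)) ` ocore"
      unfolding act_mult_ocore[OF y aff_carrier[OF power2_aff_pos]] by (simp_all add: imageI)
    then have "y \<cdot> aff (2 ^ n) \<beta> = y \<cdot> aff (2 ^ n) (of_int r)"
      by (rule disjoint_coresD[OF local_rulesD(2)[OF R] \<beta> mem[OF rc]])
    then have "aff (2 ^ n) \<beta> = aff (2 ^ n) (of_int r)" using y by simp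
    then have "\<beta> = of_int r" by (simp add: aff_inject)
    then show ?thesis using rc by (intro exI[of _ r] conjI)
  qed
  with c mem show ?thesis by (rule that)
qed

lemma act_deep_aff: "y \<in> carrier PSL2R \<Longrightarrow> v \<in> deep \<Longrightarrow> act y v \<in> act (y \<cdot> aff 1 b) ` deep"
proof -
  assume y: "y \<in> carrier PSL2R" and v: "v \<in> deep"
  have "act (y \<cdot> aff 1 b) (v - of_real b) = act y (act (aff 1 b) (v - of_real b))"
    using y v by (intro act_mult) simp_all
  also have "\<dots> = act y v" by (simp add: act_aff)
  finally show ?thesis using v by (intro image_eqI[of _ _ "v - of_real b"]) simp_all
qed

text \<open>A child of a tile of the neighbouring horoball would overlap the horoball in the frame \<open>y\<close>.\<close>

lemma bottom_step:
  assumes R: "local_rules w T" and y: "y \<in> carrier PSL2R" and m: "y \<cdot> aff 1 (of_int m) \<in> T"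
  shows "y \<cdot> C_mat \<cdot> aff (1/2) 0 \<notin> T"
proof
  assume z: "y \<cdot> C_mat \<cdot> aff (1/2) 0 \<in> T"
  \<comment> \<open>Height 3/5 is above the bottom 1/2 of the presumed child, and
    \<open>C_mat\<close> raises v to height 5/3 in the frame y. A common ancestor would then express
    an affine map as \<open>C_mat\<close> times an affine map, which moves infinity.\<close>
  define v where "v = 1 + 3/5 * \<i>"
  have Cv: "act C_mat v = 5/3 * \<i>" by (simp add: v_def C_mat_pm act_pm complex_eq_iff Re_divide Im_divide)
  have "act y (act C_mat v) \<in> act (y \<cdot> aff 1 (of_int m)) ` deep"
    by (rule act_deep_aff[OF y]) (simp add: Cv)
  moreover have "act y (act C_mat v) \<in> act (y \<cdot> C_mat \<cdot> aff (1/2) 0) ` deep"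
  proof (rule image_eqI[of _ _ "2 * v"])
    have "act (y \<cdot> C_mat \<cdot> aff (1/2) 0) (2 * v) = act (y \<cdot> C_mat) (act (aff (1/2) 0) (2 * v))"
      using y by (intro act_mult) (simp_all add: v_def)
    also have "act (aff (1/2) 0) (2 * v) = v" by (simp add: act_aff)
    also have "act (y \<cdot> C_mat) v = act y (act C_mat v)" using y by (intro act_mult) (simp_all add: v_def)
    finally show "act y (act C_mat v) = act (y \<cdot> C_mat \<cdot> aff (1/2) 0) (2 * v)" by (rule sym)
    show "2 * v \<in> deep" by (simp add: v_def)
  qed
  ultimately obtain n p and r q :: int where
    "y \<cdot> aff 1 (of_int m) \<cdot> aff (2 ^ n) (of_int r) = y \<cdot> C_mat \<cdot> aff (1/2) 0 \<cdot> aff (2 ^ p) (of_int q)"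
    using common_ancestor[OF R m z] by blast
  then have "y \<cdot> aff (2 ^ n) (of_int r + of_int m) = y \<cdot> (C_mat \<cdot> aff (2 ^ p / 2) (of_int q / 2))"
    using y by (simp add: PSL.m_assoc aff_mult)
  then have "aff (2 ^ n) (of_int r + of_int m) = C_mat \<cdot> aff (2 ^ p / 2) (of_int q / 2)" using y by simp
  then show False by (simp add: aff_def C_mat_pm pm_mult pm_eq_iff)
qed

text \<open>Absence of children must travel along with the tile, because the triangle rule applies
  only to tiles without a child. The step by \<open>C_mat\<close> uses that rule at level 0 and then
  \<open>bottom_step\<close>; the step by \<open>L_mat\<close> is a horizontal shift.\<close>

lemma all_frames:
  assumes R: "local_rules w T" and g: "g \<in> T" "g \<cdot> aff (1/2) 0 \<notin> T" and k: "k \<in> \<Gamma>"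
  shows "(\<exists>m::int. g \<cdot> k \<cdot> aff 1 (of_int m) \<in> T) \<and> g \<cdot> k \<cdot> aff (1/2) 0 \<notin> T"
  using k
proof (induction k rule: modular_induct)
  case one
  have "g \<cdot> \<one>\<^bsub>PSL2R\<^esub> \<cdot> aff 1 (of_int 0) = g" using local_rulesD(1)[OF R g(1)] by (simp add: aff_1_0)
  then have "g \<cdot> \<one>\<^bsub>PSL2R\<^esub> \<cdot> aff 1 (of_int 0) \<in> T" using g(1) by (simp only:)
  moreover have "g \<cdot> \<one>\<^bsub>PSL2R\<^esub> \<cdot> aff (1/2) 0 \<notin> T" using g(2) local_rulesD(1)[OF R g(1)] by simp
  ultimately show ?case by (intro conjI exI)
next
  case (C k)
  note gc = local_rulesD(1)[OF R g(1)]
  have gk: "g \<cdot> k \<in> carrier PSL2R" using gc C by simp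
  obtain m :: int where m: "g \<cdot> k \<cdot> aff 1 (of_int m) \<in> T" using C by (elim conjE exE) (rule that)
  have nb: "g \<cdot> k \<cdot> aff (1/2) 0 \<notin> T" using C(2) by (rule conjunct2)
  obtain p q r :: int where pqr: "residue w (Suc 0) = (p + q + r) mod 2 ^ Suc 0"
      "g \<cdot> k \<cdot> aff (2 ^ 0) (of_int (- p)) \<in> T"
      "g \<cdot> k \<cdot> C_mat \<cdot> aff (2 ^ 0) (of_int (- q)) \<in> T"
      "g \<cdot> k \<cdot> C_mat \<cdot> C_mat \<cdot> aff (2 ^ 0) (of_int (- r)) \<in> T"
    using frame_triangle[OF R gk m nb, of 0] .
  from pqr(3) have "g \<cdot> (k \<cdot> C_mat) \<cdot> aff 1 (of_int (- q)) \<in> T" using gc C(1) by (simp add: PSL.m_assoc)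
  moreover have "g \<cdot> (k \<cdot> C_mat) \<cdot> aff (1/2) 0 \<notin> T"
    using bottom_step[OF R gk m] gc C(1) by (simp add: PSL.m_assoc)
  ultimately show ?case by (intro conjI exI)
next
  case (L k)
  note gc = local_rulesD(1)[OF R g(1)]
  have gk: "g \<cdot> k \<in> carrier PSL2R" using gc L by simp
  obtain m :: int where m: "g \<cdot> k \<cdot> aff 1 (of_int m) \<in> T" using L by (elim conjE exE) (rule that)
  have "g \<cdot> (k \<cdot> L_mat) \<cdot> aff 1 (of_int (m - 1)) = g \<cdot> k \<cdot> aff 1 (of_int m)"
    using gc L(1) by (simp add: PSL.m_assoc L_mat_aff aff_mult)
  then have "g \<cdot> (k \<cdot> L_mat) \<cdot> aff 1 (of_int (m - 1)) \<in> T" using m by (simp only:)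
  moreover have "g \<cdot> (k \<cdot> L_mat) \<cdot> aff (1/2) 0 \<notin> T"
  proof
    assume "g \<cdot> (k \<cdot> L_mat) \<cdot> aff (1/2) 0 \<in> T"
    then have "g \<cdot> k \<cdot> aff (1/2) 1 \<in> T" using gc L(1) by (simp add: PSL.m_assoc L_mat_aff aff_mult)
    from child_shift[OF R gk this, of "- 1"] show False using L(2) by simp
  qed
  ultimately show ?case by (intro conjI exI)
qed

lemma local_rules_imp_packed:
  assumes R: "local_rules w T" and g: "g \<in> T" "g \<cdot> aff (1/2) 0 \<notin> T"
  shows "packed g T" and "sum_rule g T w"
proof -
  note gc = local_rulesD(1)[OF R g(1)]
  show p: "packed g T"
    unfolding packed_def
  proof (intro conjI ballI gc)
    show "T \<subseteq> carrier PSL2R" using local_rulesD(1)[OF R] by (rule subsetI)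
  next
    fix k assume k: "k \<in> \<Gamma>"
    have gk: "g \<cdot> k \<in> carrier PSL2R" using gc k by simp
    obtain m :: int where m: "g \<cdot> k \<cdot> aff 1 (of_int m) \<in> T" using all_frames[OF R g k] by (elim conjE exE) (rule that)
    obtain c where c: "coherent c" "\<And>n r. [r = c n] (mod 2 ^ Suc n) \<Longrightarrow> g \<cdot> k \<cdot> aff (2 ^ n) (of_int r) \<in> T"
      "\<And>n \<beta>. g \<cdot> k \<cdot> aff (2 ^ n) \<beta> \<in> T \<Longrightarrow> \<exists>r. \<beta> = of_int r \<and> [r = c n] (mod 2 ^ Suc n)"
      by (rule frame_offsets[OF R gk m]) (rule that)
    have "index_at g T k (coherent_index c)"
      unfolding index_at_def residue_coherent_index[OF c(1)]
    proof (intro allI)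
      fix n and r :: int
      have "g \<cdot> k \<cdot> aff (2 ^ n) (of_int r) \<in> T \<longleftrightarrow> [r = c n] (mod 2 ^ Suc n)"
      proof
        assume "g \<cdot> k \<cdot> aff (2 ^ n) (of_int r) \<in> T"
        from c(3)[OF this] show "[r = c n] (mod 2 ^ Suc n)" by (auto simp only: of_int_eq_iff)
      qed (rule c(2))
      also have "\<dots> \<longleftrightarrow> [- c n = - r] (mod 2 ^ Suc n)" unfolding cong_minus_minus_iff by (rule cong_sym_eq)
      finally show "g \<cdot> k \<cdot> aff (2 ^ n) (of_int r) \<in> T \<longleftrightarrow> (- c n) mod 2 ^ Suc n = (- r) mod 2 ^ Suc n"
        unfolding cong_def .
    qed
    then show "\<exists>d. index_at g T k d" by (rule exI)
  next
    fix x assume x: "x \<in> T"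
    note xc = local_rulesD(1)[OF R x]
    \<comment> \<open>The horoball of x overlaps a horoball of the packing, whose frame carries a
      tile by \<open>all_frames\<close>. Their common ancestor makes x affine in this frame, with
      scale 2 ^ p / 2 ^ n.\<close>
    obtain k z where k: "k \<in> \<Gamma>" "z \<in> act (pinv g \<cdot> x) ` deep" "z \<in> act k ` deep"
      using horoball_meets_packing[of "pinv g \<cdot> x"] gc xc by (elim meta_impE bexE exE conjE) simp_all
    have gk: "g \<cdot> k \<in> carrier PSL2R" using gc k by simp
    obtain m :: int where m: "g \<cdot> k \<cdot> aff 1 (of_int m) \<in> T" and nb: "g \<cdot> k \<cdot> aff (1/2) 0 \<notin> T"
      using all_frames[OF R g k(1)] by (elim conjE exE) (rule that)
    obtain c where c: "\<And>n \<beta>. g \<cdot> k \<cdot> aff (2 ^ n) \<beta> \<in> T \<Longrightarrow> \<exists>r. \<beta> = of_int r \<and> [r = c n] (mod 2 ^ Suc n)"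
      by (rule frame_offsets[OF R gk m]) (rule that)
    have "act g z \<in> act x ` deep"
    proof -
      have "act g z \<in> act g ` act (pinv g \<cdot> x) ` deep" using k(2) by (rule imageI)
      also have "\<dots> = act (g \<cdot> (pinv g \<cdot> x)) ` deep"
        using gc xc by (intro act_image_mult[symmetric] deep_subset) simp_all
      also have "g \<cdot> (pinv g \<cdot> x) = x" using gc xc by (simp add: PSL.m_assoc[symmetric])
      finally show ?thesis .
    qed
    moreover have "act g z \<in> act (g \<cdot> k \<cdot> aff 1 (of_int m)) ` deep"
    proof -
      obtain v where v: "v \<in> deep" "z = act k v" using k(3) by (elim imageE) (rule that)
      have "act g z = act (g \<cdot> k) v" unfolding v(2) using gc k(1) v(1) by (intro act_mult[symmetric]) simp_all
      then show ?thesis using act_deep_aff[OF gk v(1)] by (simp only:)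
    qed
    ultimately obtain n p and r q :: int where
      e: "x \<cdot> aff (2 ^ n) (of_int r) = g \<cdot> k \<cdot> aff 1 (of_int m) \<cdot> aff (2 ^ p) (of_int q)"
      using common_ancestor[OF R x m] by blast
    have "x = x \<cdot> aff (2 ^ n) (of_int r) \<cdot> aff (1 / 2 ^ n) (- of_int r / 2 ^ n)"
      using xc by (simp add: PSL.m_assoc aff_mult aff_1_0)
    also have "\<dots> = g \<cdot> k \<cdot> aff (2 ^ p * (1 / 2 ^ n)) (2 ^ p * (- of_int r / 2 ^ n) + (of_int q + of_int m))"
      unfolding e using gk by (simp add: PSL.m_assoc aff_mult)
    finally have "x = g \<cdot> k \<cdot> aff (2 ^ p / 2 ^ n) (2 ^ p * (- of_int r / 2 ^ n) + (of_int q + of_int m))"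
      by (simp only: times_divide_eq_right mult_1_right)
    then obtain \<beta> where xb: "x = g \<cdot> k \<cdot> aff (2 ^ p / 2 ^ n) \<beta>" by (rule that)
    show "\<exists>k\<in>\<Gamma>. \<exists>n. \<exists>r::int. x = g \<cdot> k \<cdot> aff (2 ^ n) (of_int r)"
    proof (cases "n \<le> p")
      case True
      then have "(2::real) ^ p / 2 ^ n = 2 ^ (p - n)" by (simp add: power_diff)
      then have xb': "x = g \<cdot> k \<cdot> aff (2 ^ (p - n)) \<beta>" using xb by (simp only:)
      then have "g \<cdot> k \<cdot> aff (2 ^ (p - n)) \<beta> \<in> T" using x by (simp only:)
      then obtain i :: int where "\<beta> = of_int i" using c by blast
      then show ?thesis using xb' k(1) by (intro bexI[of _ k] exI[of _ "p - n"] exI[of _ i]) simp_all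
    next
      case False
      \<comment> \<open>The scale is below 1. Climbing j levels from x leads to a tile of scale 1/2
        in the frame; its parent has an integer offset, so the tile itself does, and
        \<open>child_shift\<close> produces the child excluded by \<open>nb\<close>.\<close>
      define j where "j = n - p - 1"
      have n: "n = p + Suc j" using False by (simp add: j_def)
      obtain b :: "nat \<Rightarrow> int" where b: "\<And>n r. [r = b n] (mod 2 ^ Suc n) \<Longrightarrow> x \<cdot> aff (2 ^ n) (of_int r) \<in> T"
        by (rule ancestors[OF R x]) (rule that)
      have v: "x \<cdot> aff (2 ^ j) (of_int (b j)) \<in> T" by (rule b) simp
      define \<beta>' where "\<beta>' = 2 ^ p / 2 ^ n * of_int (b j) + \<beta>"
      have "2 ^ p / 2 ^ n * 2 ^ j = (1/2 :: real)" by (simp add: n power_add)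
      then have ve: "x \<cdot> aff (2 ^ j) (of_int (b j)) = g \<cdot> k \<cdot> aff (1/2) \<beta>'"
        using gk by (subst xb) (simp add: PSL.m_assoc aff_mult \<beta>'_def)
      have v': "g \<cdot> k \<cdot> aff (1/2) \<beta>' \<in> T" using v unfolding ve .
      have up: "g \<cdot> k \<cdot> aff (1/2) \<beta>' \<cdot> aff 2 0 = g \<cdot> k \<cdot> aff (2 ^ 0) \<beta>'"
        "g \<cdot> k \<cdot> aff (1/2) \<beta>' \<cdot> aff 2 (- 2) = g \<cdot> k \<cdot> aff (2 ^ 0) (\<beta>' - 1)"
        using gk by (simp_all add: PSL.m_assoc aff_mult)
      have "\<exists>i::int. \<beta>' = of_int i"
        using local_rulesD(5)[OF R v'] unfolding up
      proof
        assume "g \<cdot> k \<cdot> aff (2 ^ 0) \<beta>' \<in> T"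
        from c[OF this] show ?thesis by (elim exE conjE) (rule exI)
      next
        assume "g \<cdot> k \<cdot> aff (2 ^ 0) (\<beta>' - 1) \<in> T"
        from c[OF this] obtain i :: int where "\<beta>' - 1 = of_int i" by (elim exE conjE) (rule that)
        then have "\<beta>' = of_int (i + 1)" by simp
        then show ?thesis by (rule exI)
      qed
      then obtain i :: int where i: "\<beta>' = of_int i" by (elim exE) (rule that)
      from child_shift[OF R gk v', of "- i"] have "g \<cdot> k \<cdot> aff (1/2) 0 \<in> T" by (simp add: i)
      then show ?thesis using nb by (rule notE[rotated])
    qed
  qed
  show "sum_rule g T w"
    unfolding sum_rule_def
  proof (intro ballI dyadic_eqI_Suc)
    fix k n assume k: "k \<in> \<Gamma>"
    have gk: "g \<cdot> k \<in> carrier PSL2R" using gc k by simp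
    obtain m :: int where m: "g \<cdot> k \<cdot> aff 1 (of_int m) \<in> T" and nb: "g \<cdot> k \<cdot> aff (1/2) 0 \<notin> T"
      using all_frames[OF R g k] by (elim conjE exE) (rule that)
    obtain i q r :: int where iqr: "residue w (Suc n) = (i + q + r) mod 2 ^ Suc n"
      "g \<cdot> k \<cdot> aff (2 ^ n) (of_int (- i)) \<in> T"
      "g \<cdot> k \<cdot> C_mat \<cdot> aff (2 ^ n) (of_int (- q)) \<in> T"
      "g \<cdot> k \<cdot> C_mat \<cdot> C_mat \<cdot> aff (2 ^ n) (of_int (- r)) \<in> T"
      using frame_triangle[OF R gk m nb] .
    have a: "g \<cdot> k \<cdot> C_mat = g \<cdot> (k \<cdot> C_mat)" "g \<cdot> k \<cdot> C_mat \<cdot> C_mat = g \<cdot> (k \<cdot> C_mat \<cdot> C_mat)"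
      using gc k by (simp_all add: PSL.m_assoc)
    have r1: "residue (index_fun g T k) (Suc n) = i mod 2 ^ Suc n"
      using iqr(2) unfolding packed_index[OF p k] minus_minus .
    have r2: "residue (index_fun g T (k \<cdot> C_mat)) (Suc n) = q mod 2 ^ Suc n"
      using iqr(3) unfolding a(1) packed_index[OF p modular_mult[OF k C_mat_modular]] minus_minus .
    have r3: "residue (index_fun g T (k \<cdot> C_mat \<cdot> C_mat)) (Suc n) = r mod 2 ^ Suc n"
      using iqr(4) unfolding a(2) packed_index[OF p modular_mult[OF modular_mult[OF k C_mat_modular] C_mat_modular]] minus_minus .
    show "residue (index_fun g T k + index_fun g T (k \<cdot> C_mat) + index_fun g T (k \<cdot> C_mat \<cdot> C_mat)) (Suc n)
       = residue w (Suc n)"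
      unfolding plus_dyadic.rep_eq r1 r2 r3 iqr(1) by (simp only: mod_simps)
  qed
qed

lemma local_rules_imp_degenerate:
  assumes R: "local_rules w T" and T: "T \<in> tilings \<beta>" and g: "g \<in> T"
    and ch: "\<And>x. x \<in> T \<Longrightarrow> x \<cdot> aff (1/2) 0 \<in> T"
  shows "T \<in> degenerate_tilings \<beta>"
proof -
  note gc = local_rulesD(1)[OF R g]
  obtain b where b: "b 0 = 0" "coherent b" "\<And>n r. [r = b n] (mod 2 ^ Suc n) \<Longrightarrow> g \<cdot> aff (2 ^ n) (of_int r) \<in> T"
    by (rule ancestors[OF R g]) (rule that)
  \<comment> \<open>Left children share the left edge with their parents, which gives offset 0 at
    all negative levels; the ancestors of g supply the other levels.\<close>
  define c :: "int \<Rightarrow> real" where "c j = (if j \<ge> 0 then of_int (b (nat j)) else 0)" for j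
  have step: "\<exists>m :: int. c (j + 1) - c j = 2 powi (j + 1) * of_int m" for j
  proof (cases "j \<ge> 0")
    case True
    then have s: "nat (j + 1) = Suc (nat j)" by simp
    have "[b (nat j) = b (Suc (nat j))] (mod 2 ^ (nat j + 1))" using b(2) by (simp add: coherent_def cong_sym_eq)
    then obtain l where "b (Suc (nat j)) = b (nat j) + 2 ^ (nat j + 1) * l" by (auto simp: cong_iff_lin)
    then have "c (j + 1) - c j = 2 ^ (nat j + 1) * of_int l" using True by (simp add: c_def s)
    also have "(2::real) ^ (nat j + 1) = 2 powi (j + 1)" using True by (simp add: power_int_def s)
    finally show ?thesis by (rule exI)
  next
    case False
    then have "c (j + 1) - c j = 0" using b(1) by (cases "j = - 1") (simp_all add: c_def)
    then show ?thesis by (intro exI[of _ 0]) simp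
  qed
  have down: "g \<cdot> aff (1 / 2 ^ n) 0 \<in> T" for n
  proof (induction n)
    case 0
    then show ?case using g gc by (simp add: aff_1_0)
  next
    case (Suc n)
    then show ?case using ch[OF Suc] gc by (simp add: PSL.m_assoc aff_mult mult.commute)
  qed
  have mem: "g \<cdot> aff (2 powi j) (c j + 2 powi (j + 1) * of_int l) \<in> T" for j l
  proof -
    have "g \<cdot> aff (2 powi j) (c j) \<in> T"
    proof (cases "j \<ge> 0")
      case True
      then show ?thesis using b(3)[of "b (nat j)" "nat j"] by (simp add: c_def power_int_def)
    next
      case False
      then have "2 powi j = (1 / 2 ^ nat (- j) :: real)" "c j = 0"
        by (simp_all add: c_def power_int_def power_one_over)
      then show ?thesis using down[of "nat (- j)"] by (simp only:)
    qed
    from horizontal[OF R gc _ this, of l] show ?thesis by (simp add: power_int_add mult.commute)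
  qed
  have "(\<lambda>K. act (pinv g) ` K) ` cores T = {core_box (c j) j l | j l. True}"
  proof
    show "{core_box (c j) j l | j l. True} \<subseteq> (\<lambda>K. act (pinv g) ` K) ` cores T"
    proof
      fix K assume "K \<in> {core_box (c j) j l | j l. True}"
      then obtain j l where K: "K = core_box (c j) j l" by blast
      define x where "x = aff (2 powi j) (c j + 2 powi (j + 1) * of_int l)"
      have xc: "x \<in> carrier PSL2R" by (simp add: x_def)
      have "K = act (pinv g) ` act (g \<cdot> x) ` core"
        unfolding K box_aff x_def[symmetric] act_image_mult[OF gc xc core_subset]
        by (rule act_image_inv(1)[symmetric, OF gc act_image_subset[OF xc core_subset]])
      moreover have "act (g \<cdot> x) ` core \<in> cores T" unfolding cores_iff x_def by (rule bexI[OF refl mem])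
      ultimately show "K \<in> (\<lambda>K. act (pinv g) ` K) ` cores T" by (rule image_eqI)
    qed
    show "(\<lambda>K. act (pinv g) ` K) ` cores T \<subseteq> {core_box (c j) j l | j l. True}"
    proof
      fix K assume "K \<in> (\<lambda>K. act (pinv g) ` K) ` cores T"
      then obtain x where x: "x \<in> T" "K = act (pinv g) ` act x ` core" unfolding cores_def by auto
      note xc = local_rulesD(1)[OF R x(1)]
      have px: "pinv g \<cdot> x \<in> carrier PSL2R" using gc xc by simp
      define W where "W = act (pinv g \<cdot> x) ` ocore"
      have W: "open W" "W \<subseteq> \<H>"
        unfolding W_def by (rule open_act_image[OF px open_ocore ocore_subset], rule act_image_subset[OF px ocore_subset])
      have "1 + 3/2 * \<i> \<in> ocore" by (simp add: ocore_def)
      then have u: "act (pinv g \<cdot> x) (1 + 3/2 * \<i>) \<in> W" unfolding W_def by (rule imageI)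
      then have "Im (act (pinv g \<cdot> x) (1 + 3/2 * \<i>)) > 0" using W(2) by auto
      from open_box_meets[OF W(1) u this, of c]
      obtain j l where jl: "W \<inter> act (aff (2 powi j) (c j + 2 * 2 powi j * of_int l)) ` ocore \<noteq> {}" .
      have p2: "2 * 2 powi j * of_int l = (2 powi (j + 1) * of_int l :: real)" by (simp add: power_int_add mult.commute)
      obtain v where v: "v \<in> W" "v \<in> act (aff (2 powi j) (c j + 2 powi (j + 1) * of_int l)) ` ocore"
        using jl unfolding p2 by blast
      have "act g v \<in> act (g \<cdot> aff (2 powi j) (c j + 2 powi (j + 1) * of_int l)) ` ocore"
        using v(2) gc by (subst act_mult_ocore) simp_all
      moreover have "act g v \<in> act x ` ocore"
      proof -
        have "act g v \<in> act g ` W" using v(1) by (rule imageI)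
        also have "\<dots> = act (g \<cdot> (pinv g \<cdot> x)) ` ocore" unfolding W_def by (rule act_mult_ocore[OF gc px, symmetric])
        also have "g \<cdot> (pinv g \<cdot> x) = x" using gc xc by (simp add: PSL.m_assoc[symmetric])
        finally show ?thesis .
      qed
      ultimately have "g \<cdot> aff (2 powi j) (c j + 2 powi (j + 1) * of_int l) = x"
        by (rule disjoint_coresD[OF local_rulesD(2)[OF R] mem x(1)])
      then have "K = act (pinv g) ` act (g \<cdot> aff (2 powi j) (c j + 2 powi (j + 1) * of_int l)) ` core"
        using x(2) by (simp only:)
      also have "\<dots> = act (aff (2 powi j) (c j + 2 powi (j + 1) * of_int l)) ` core"
        using gc by (simp add: act_image_mult[OF _ _ core_subset] act_image_inv(1)[OF gc] act_image_subset[OF _ core_subset])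
      also have "\<dots> = core_box (c j) j l" by (rule box_aff[symmetric])
      finally show "K \<in> {core_box (c j) j l | j l. True}" by blast
    qed
  qed
  then show ?thesis
    unfolding degenerate_tilings_def using T step gc by (intro CollectI conjI bexI[of _ "pinv g"] exI[of _ c]) simp_all
qed

lemma tiling_nonempty: "T \<in> tilings \<beta> \<Longrightarrow> T \<noteq> {}"
proof
  assume "T \<in> tilings \<beta>" "T = {}"
  then obtain \<T> where t: "is_tiling \<beta> \<T>" "{g \<in> carrier PSL2R. act g ` tile \<beta> \<in> \<T>} = {}"
    unfolding tilings_def by blast
  have t1: "\<T> \<subseteq> (\<lambda>g. act g ` tile \<beta>) ` carrier PSL2R" "\<Union>\<T> = \<H>"
    using t(1) unfolding is_tiling_def by simp_all
  have "\<i> \<in> \<Union>\<T>" unfolding t1(2) by simp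
  then obtain s where s: "s \<in> \<T>" by (rule UnionE)
  obtain g where g: "g \<in> carrier PSL2R" "s = act g ` tile \<beta>"
    using subsetD[OF t1(1) s] by (elim imageE) (rule that)
  have "g \<in> {g \<in> carrier PSL2R. act g ` tile \<beta> \<in> \<T>}" using g s by simp
  then show False unfolding t(2) by simp
qed

lemma local_rules_classification:
  assumes R: "local_rules w T" and T: "T \<in> tilings \<beta>" and nd: "T \<notin> degenerate_tilings \<beta>"
  obtains g where "packed g T" "sum_rule g T w"
proof -
  obtain g0 where g0: "g0 \<in> T" using tiling_nonempty[OF T] by blast
  have "\<exists>g\<in>T. g \<cdot> aff (1/2) 0 \<notin> T"
  proof (rule ccontr)
    assume "\<not> ?thesis"
    then have "\<And>x. x \<in> T \<Longrightarrow> x \<cdot> aff (1/2) 0 \<in> T" by blast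
    from local_rules_imp_degenerate[OF R T g0 this] show False using nd by (rule notE[rotated])
  qed
  then obtain g where g: "g \<in> T" "g \<cdot> aff (1/2) 0 \<notin> T" by (elim bexE) (rule that)
  show ?thesis by (rule that[OF local_rules_imp_packed[OF R g]])
qed

section \<open>The fibre over a packing\<close>

lemma sum_tilings_eq:
  assumes "T \<in> tilings \<beta>" "packed g T" "sum_rule g T w"
  shows "nondegenerate \<beta> T \<and> index_sum_is \<beta> T w"
  using packed_imp_nondegenerate[OF assms(2,1)] index_sum_iff[OF assms(2,1)] assms(3)
  unfolding nondegenerate_def by blast

lemma nondegenerate_sum_packed:
  assumes "nondegenerate_over \<beta> T (packing g)" "g \<in> carrier PSL2R" "index_sum_is \<beta> T w"
  shows "packed g T" "sum_rule g T w"
proof -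
  show p: "packed g T" by (rule nondegenerate_imp_packed[OF assms(1,2)])
  have "T \<in> tilings \<beta>" using assms(1) by (simp add: nondegenerate_over_def)
  then show "sum_rule g T w" using index_sum_iff[OF p] assms(3) by blast
qed

text \<open>Closedness of T in \<open>PSL2R\<close> is recorded because the Fell space consists of
  closed sets; it is what puts the translates of T back into the space of tilings.\<close>

lemma tilings_w_nondegenerate:
  assumes "T \<in> tilings_w \<beta> w - degenerate_tilings \<beta>"
  obtains g where "T \<in> tilings \<beta>" "closedin PSL2R_topology T" "packed g T" "sum_rule g T w"
proof -
  have cl: "T \<in> Abstract_Topology.closure_of (tiling_space \<beta>) {T. nondegenerate \<beta> T \<and> index_sum_is \<beta> T w}"
    and nd: "T \<notin> degenerate_tilings \<beta>"
    using assms by (simp_all add: tilings_w_def)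
  have "local_rules w S" if S: "S \<in> {T. nondegenerate \<beta> T \<and> index_sum_is \<beta> T w}" for S
  proof -
    obtain P where P: "nondegenerate_over \<beta> S P" using S by (auto simp: nondegenerate_def)
    then obtain g where g: "g \<in> carrier PSL2R" "P = packing g" by (auto simp: nondegenerate_over_def)
    have i: "index_sum_is \<beta> S w" using S by simp
    show ?thesis
      by (rule packed_imp_local_rules[OF nondegenerate_sum_packed[OF P[unfolded g(2)] g(1) i]])
  qed
  from limit_local_rules[OF cl this] have R: "local_rules w T" by blast
  note t = tilings_closure[OF cl]
  obtain g where "packed g T" "sum_rule g T w" using local_rules_classification[OF R t(1) nd] .
  then show ?thesis using that t(1,2) by blast
qed

section \<open>Translates of tilings\<close>

lemma l_coset_image: "h <#\<^bsub>PSL2R\<^esub> T = (\<lambda>x. h \<cdot> x) ` T"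
  by (auto simp: l_coset_def)

lemma mem_l_coset:
  assumes "h \<in> carrier PSL2R" "T \<subseteq> carrier PSL2R" "x \<in> carrier PSL2R"
  shows "x \<in> h <#\<^bsub>PSL2R\<^esub> T \<longleftrightarrow> pinv h \<cdot> x \<in> T"
proof
  assume "x \<in> h <#\<^bsub>PSL2R\<^esub> T"
  then obtain y where y: "y \<in> T" "x = h \<cdot> y" unfolding l_coset_image by (elim imageE) (rule that)
  then have "pinv h \<cdot> x = y" using assms by (auto simp: PSL.m_assoc[symmetric])
  then show "pinv h \<cdot> x \<in> T" using y by simp
next
  assume "pinv h \<cdot> x \<in> T"
  moreover have "x = h \<cdot> (pinv h \<cdot> x)" using assms by (simp add: PSL.m_assoc[symmetric])
  ultimately show "x \<in> h <#\<^bsub>PSL2R\<^esub> T" unfolding l_coset_image by (rule image_eqI[rotated])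
qed

lemma act_image_interior:
  assumes h: "h \<in> carrier PSL2R" and t: "t \<subseteq> \<H>"
  shows "interior (act h ` t) \<subseteq> act h ` interior t"
proof -
  let ?V = "interior (act h ` t)"
  have V: "?V \<subseteq> act h ` t" by (rule interior_subset)
  have VH: "?V \<subseteq> \<H>" using V act_image_subset[OF h t] by (rule subset_trans)
  have "open (act (pinv h) ` ?V)" by (rule open_act_image[OF _ open_interior VH]) (simp add: h)
  moreover have "act (pinv h) ` ?V \<subseteq> t"
    using image_mono[OF V, of "act (pinv h)"] unfolding act_image_inv(1)[OF h t] .
  ultimately have "act (pinv h) ` ?V \<subseteq> interior t" by (rule interior_maximal[rotated])
  then have "act h ` act (pinv h) ` ?V \<subseteq> act h ` interior t" by (rule image_mono)
  then show ?thesis unfolding act_image_inv(2)[OF h VH] .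
qed

lemma tilings_translate:
  assumes T: "T \<in> tilings \<beta>" and h: "h \<in> carrier PSL2R"
  shows "h <#\<^bsub>PSL2R\<^esub> T \<in> tilings \<beta>"
proof -
  obtain \<T> where t: "is_tiling \<beta> \<T>" "T = {g \<in> carrier PSL2R. act g ` tile \<beta> \<in> \<T>}"
    using T unfolding tilings_def by blast
  have sub: "\<T> \<subseteq> (\<lambda>g. act g ` tile \<beta>) ` carrier PSL2R" and un: "\<Union>\<T> = \<H>"
    and dis: "\<And>s s'. s \<in> \<T> \<Longrightarrow> s' \<in> \<T> \<Longrightarrow> s \<noteq> s' \<Longrightarrow> interior s \<inter> interior s' = {}"
    using t(1) unfolding is_tiling_def by simp_all
  have sH: "s \<subseteq> \<H>" if "s \<in> \<T>" for s using un that by (metis Union_upper)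
  \<comment> \<open>The tiling itself shows this: some image of the prototile lies in the
    half-plane, and the action preserves the sign of the imaginary part.\<close>
  have tH: "tile \<beta> \<subseteq> \<H>"
  proof
    fix z assume z: "z \<in> tile \<beta>"
    obtain g where g: "g \<in> T" using tiling_nonempty[OF T] by blast
    then have gc: "g \<in> carrier PSL2R" "act g ` tile \<beta> \<in> \<T>" by (simp_all add: t(2))
    have "act g z \<in> \<H>" using sH[OF gc(2)] imageI[OF z, of "act g"] by (rule subsetD)
    then show "z \<in> \<H>" using Im_act_pos_iff[OF gc(1), of z] by simp
  qed
  define \<T>' where "\<T>' = (\<lambda>s. act h ` s) ` \<T>"
  have "is_tiling \<beta> \<T>'"
    unfolding is_tiling_def
  proof (intro conjI ballI impI)
    show "\<T>' \<subseteq> (\<lambda>g. act g ` tile \<beta>) ` carrier PSL2R"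
    proof
      fix s' assume "s' \<in> \<T>'"
      then obtain s where s: "s \<in> \<T>" "s' = act h ` s" unfolding \<T>'_def by (elim imageE) (rule that)
      obtain g where g: "g \<in> carrier PSL2R" "s = act g ` tile \<beta>" using subsetD[OF sub s(1)] by (elim imageE) (rule that)
      have "s' = act (h \<cdot> g) ` tile \<beta>" unfolding s(2) g(2) by (rule act_image_mult[OF h g(1) tH, symmetric])
      then show "s' \<in> (\<lambda>g. act g ` tile \<beta>) ` carrier PSL2R" by (rule image_eqI) (simp add: h g(1))
    qed
    have "\<Union>\<T>' = act h ` \<Union>\<T>" unfolding \<T>'_def by (simp only: image_Union)
    also have "\<dots> = \<H>"
    proof
      show "act h ` \<Union>\<T> \<subseteq> \<H>" unfolding un by (rule act_image_subset[OF h subset_refl])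
      show "\<H> \<subseteq> act h ` \<Union>\<T>"
        unfolding un using act_image_inv(2)[OF h subset_refl] act_image_subset[OF PSL.inv_closed[OF h] subset_refl]
        by (metis image_mono)
    qed
    finally show "\<Union>\<T>' = \<H>" .
  next
    fix a b assume "a \<in> \<T>'" "b \<in> \<T>'" and ne: "a \<noteq> b"
    then obtain s s' where s: "s \<in> \<T>" "a = act h ` s" "s' \<in> \<T>" "b = act h ` s'" unfolding \<T>'_def by blast
    have "interior s \<inter> interior s' = {}" using dis[OF s(1,3)] ne s(2,4) by blast
    moreover have iH: "interior s \<subseteq> \<H>" "interior s' \<subseteq> \<H>"
      using sH[OF s(1)] sH[OF s(3)] interior_subset by (metis subset_trans)+
    ultimately have "act h ` interior s \<inter> act h ` interior s' = {}"
      using inj_on_image_Int[OF inj_on_act[OF h] iH] by simp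
    then show "interior a \<inter> interior b = {}"
      using act_image_interior[OF h sH[OF s(1)]] act_image_interior[OF h sH[OF s(3)]] unfolding s(2,4) by blast
  qed
  moreover have "h <#\<^bsub>PSL2R\<^esub> T = {g \<in> carrier PSL2R. act g ` tile \<beta> \<in> \<T>'}"
  proof (rule Set.set_eqI)
    fix g
    have Tc: "T \<subseteq> carrier PSL2R" by (auto simp: t(2))
    show "g \<in> h <#\<^bsub>PSL2R\<^esub> T \<longleftrightarrow> g \<in> {g \<in> carrier PSL2R. act g ` tile \<beta> \<in> \<T>'}"
    proof (cases "g \<in> carrier PSL2R")
      case True
      have "act g ` tile \<beta> \<in> \<T>' \<longleftrightarrow> act (pinv h \<cdot> g) ` tile \<beta> \<in> \<T>"
      proof
        assume "act g ` tile \<beta> \<in> \<T>'"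
        then obtain s where s: "s \<in> \<T>" "act g ` tile \<beta> = act h ` s" unfolding \<T>'_def by (elim imageE) (rule that)
        have "act (pinv h \<cdot> g) ` tile \<beta> = act (pinv h) ` act h ` s"
          unfolding s(2)[symmetric] using h True by (intro act_image_mult tH) simp_all
        also have "\<dots> = s" by (rule act_image_inv(1)[OF h sH[OF s(1)]])
        finally show "act (pinv h \<cdot> g) ` tile \<beta> \<in> \<T>" using s(1) by (simp only:)
      next
        assume a: "act (pinv h \<cdot> g) ` tile \<beta> \<in> \<T>"
        have "act g ` tile \<beta> = act (h \<cdot> (pinv h \<cdot> g)) ` tile \<beta>"
          using h True by (simp add: PSL.m_assoc[symmetric])
        also have "\<dots> = act h ` act (pinv h \<cdot> g) ` tile \<beta>"
          using h True by (intro act_image_mult tH) simp_all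
        finally show "act g ` tile \<beta> \<in> \<T>'" unfolding \<T>'_def using a by (rule image_eqI)
      qed
      then show ?thesis unfolding mem_l_coset[OF h Tc True] unfolding t(2) using h True by simp
    next
      case False
      then show ?thesis using Tc h by (auto simp: l_coset_image)
    qed
  qed
  ultimately show ?thesis unfolding tilings_def by blast
qed

lemma closedin_translate:
  assumes T: "closedin PSL2R_topology T" and h: "h \<in> carrier PSL2R"
  shows "closedin PSL2R_topology (h <#\<^bsub>PSL2R\<^esub> T)"
proof -
  have Tc: "T \<subseteq> carrier PSL2R" using closedin_subset[OF T] by simp
  obtain a b c d where hd: "h = pm a b c d" "a * d - b * c = 1" using h by (rule PSL2R_cases)
  define B where "B = mat2 d (- b) (- c) a"
  have B: "det B = 1" "pinv h = psl B"
    using hd(2) by (simp_all add: hd(1) pinv_pm[OF hd(2)]) (simp_all add: B_def pm_def mult.commute)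
  let ?U = "carrier PSL2R - T" and ?V = "carrier PSL2R - (h <#\<^bsub>PSL2R\<^esub> T)"
  have "openin PSL2R_topology ?U" using T by (simp add: closedin_def)
  then obtain W where W: "open W" "\<Union>?U = carrier SL2R \<inter> W"
    by (auto simp: openin_PSL2R_topology openin_open)
  have mem: "X \<in> \<Union>V \<longleftrightarrow> det X = 1 \<and> psl X \<in> V" if "V \<subseteq> carrier PSL2R" for V X
  proof
    assume "X \<in> \<Union>V"
    then obtain v where v: "v \<in> V" "X \<in> v" by blast
    then have "v = psl X \<and> det X = 1" using PSL2R_memb that by blast
    then show "det X = 1 \<and> psl X \<in> V" using v by simp
  next
    assume "det X = 1 \<and> psl X \<in> V"
    moreover have "X \<in> psl X" by (simp add: psl_eq)
    ultimately show "X \<in> \<Union>V" by blast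
  qed
  have "X \<in> \<Union>?V \<longleftrightarrow> X \<in> carrier SL2R \<inter> (\<lambda>X. B ** X) -` W" for X
  proof (cases "det X = 1")
    case True
    have d: "det (B ** X) = 1" using B True by (simp add: det_mul)
    have "X \<in> \<Union>?V \<longleftrightarrow> psl X \<in> ?V" using mem[of ?V X] True by blast
    also have "\<dots> \<longleftrightarrow> pinv h \<cdot> psl X \<notin> T" using mem_l_coset[OF h Tc psl_carrier[OF True]] psl_carrier[OF True] by blast
    also have "\<dots> \<longleftrightarrow> psl (B ** X) \<in> ?U" using psl_carrier[OF d] by (simp add: B psl_mult)
    also have "\<dots> \<longleftrightarrow> B ** X \<in> \<Union>?U" using mem[of ?U "B ** X"] d by blast
    also have "\<dots> \<longleftrightarrow> X \<in> carrier SL2R \<inter> (\<lambda>X. B ** X) -` W" unfolding W(2) using True d by (simp add: carrier_SL2R)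
    finally show ?thesis .
  next
    case False
    then show ?thesis using mem[of ?V X] by (auto simp: carrier_SL2R)
  qed
  then have eq: "\<Union>?V = carrier SL2R \<inter> (\<lambda>X. B ** X) -` W" by (rule Set.set_eqI)
  have "continuous_on UNIV (\<lambda>X::real^2^2. B ** X)"
    unfolding matrix_matrix_mult_def by (intro continuous_intros)
  then have "open ((\<lambda>X. B ** X) -` W)" using W(1) by (intro open_vimage)
  then have "openin (top_of_set (carrier SL2R)) (\<Union>?V)" unfolding eq by (rule openin_open_Int)
  then have "openin PSL2R_topology ?V" by (simp add: openin_PSL2R_topology)
  moreover have "h <#\<^bsub>PSL2R\<^esub> T \<subseteq> carrier PSL2R" using Tc h by (auto simp: l_coset_image)
  ultimately show ?thesis by (simp add: closedin_def)
qed

lemma sum_tilings_in_tilings_w: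
  assumes T: "T \<in> tilings \<beta>" and cl: "closedin PSL2R_topology T" and p: "packed g T" "sum_rule g T w"
  shows "T \<in> tilings_w \<beta> w"
proof -
  have "T \<in> topspace (fell_topology PSL2R_topology)"
    unfolding fell_topology_def topology_generated_by_topspace
    by (rule UnionI[of "{A. closedin PSL2R_topology A \<and> A \<inter> {} = {}}"]) (use cl in \<open>auto intro!: exI[of _ "{}"]\<close>)
  then have "T \<in> topspace (tiling_space \<beta>)" using T by (simp add: tiling_space_def)
  moreover have "T \<in> {T. nondegenerate \<beta> T \<and> index_sum_is \<beta> T w}" using sum_tilings_eq[OF T p] by simp
  ultimately show ?thesis
    unfolding tilings_w_def
    using closure_of_subset_Int[of "tiling_space \<beta>" "{T. nondegenerate \<beta> T \<and> index_sum_is \<beta> T w}"] by blast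
qed

lemma degenerate_translate:
  assumes T: "T \<in> tilings \<beta>" and h: "h \<in> carrier PSL2R" and deg: "h <#\<^bsub>PSL2R\<^esub> T \<in> degenerate_tilings \<beta>"
  shows "T \<in> degenerate_tilings \<beta>"
proof -
  have Tc: "T \<subseteq> carrier PSL2R" using T by (auto simp: tilings_def)
  obtain u and c :: "int \<Rightarrow> real" where u: "u \<in> carrier PSL2R"
    "\<forall>j. \<exists>m :: int. c (j + 1) - c j = 2 powi (j + 1) * of_int m"
    "(\<lambda>K. act u ` K) ` cores (h <#\<^bsub>PSL2R\<^esub> T) = {core_box (c j) j l | j l. True}"
    using deg unfolding degenerate_tilings_def by (elim CollectE conjE bexE exE) (rule that)
  have "cores (h <#\<^bsub>PSL2R\<^esub> T) = (\<lambda>K. act h ` K) ` cores T"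
    unfolding cores_def l_coset_image image_image[of "\<lambda>g. act g ` core" "\<lambda>x. h \<cdot> x"]
      image_image[of "\<lambda>K. act h ` K" "\<lambda>g. act g ` core"]
    by (rule image_cong[OF refl]) (rule act_image_mult[OF h subsetD[OF Tc] core_subset])
  then have "(\<lambda>K. act u ` K) ` cores (h <#\<^bsub>PSL2R\<^esub> T) = (\<lambda>K. act u ` act h ` K) ` cores T"
    by (simp only: image_image)
  also have "\<dots> = (\<lambda>K. act (u \<cdot> h) ` K) ` cores T"
  proof (rule image_cong[OF refl])
    fix K assume "K \<in> cores T"
    then obtain x where x: "x \<in> T" "K = act x ` core" unfolding cores_def by (elim imageE) (rule that)
    have "K \<subseteq> \<H>" unfolding x(2) by (rule act_image_subset[OF subsetD[OF Tc x(1)] core_subset])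
    then show "act u ` act h ` K = act (u \<cdot> h) ` K" by (rule act_image_mult[OF u(1) h, symmetric])
  qed
  finally have "(\<lambda>K. act (u \<cdot> h) ` K) ` cores T = {core_box (c j) j l | j l. True}" unfolding u(3) by (rule sym)
  then show ?thesis
    unfolding degenerate_tilings_def
    using T u(2) PSL.m_closed[OF u(1) h] by (intro CollectI conjI bexI[of _ "u \<cdot> h"] exI[of _ c])
qed

section \<open>The action of the modular group on the indices\<close>

text \<open>Moving the tiling by a symmetry of the packing only relabels the frames: on index
  functions it is composition with left multiplication by the inverse of m.\<close>

lemma packed_translate:
  assumes p: "packed g T" and m: "m \<in> \<Gamma>"
  defines "T' \<equiv> (g \<cdot> m \<cdot> pinv g) <#\<^bsub>PSL2R\<^esub> T"
  shows "packed g T'" and "k \<in> \<Gamma> \<Longrightarrow> index_fun g T' k = index_fun g T (pinv m \<cdot> k)"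
proof -
  note g = packed_carrier(1)[OF p]
  have h: "g \<cdot> m \<cdot> pinv g \<in> carrier PSL2R" using g m by simp
  have Tc: "T \<subseteq> carrier PSL2R" using packed_carrier(2)[OF p] by (rule subsetI)
  have hinv: "pinv (g \<cdot> m \<cdot> pinv g) \<cdot> (g \<cdot> c) = g \<cdot> (pinv m \<cdot> c)" if c: "c \<in> carrier PSL2R" for c
  proof -
    have "pinv (g \<cdot> m \<cdot> pinv g) = g \<cdot> (pinv m \<cdot> pinv g)"
      using g m by (simp add: PSL.inv_mult_group PSL.m_assoc)
    moreover have "pinv g \<cdot> (g \<cdot> c) = c" using g c by (simp add: PSL.m_assoc[symmetric])
    ultimately show ?thesis using g m c by (simp add: PSL.m_assoc)
  qed
  have mem: "g \<cdot> k \<cdot> aff (2 ^ n) (of_int r) \<in> T' \<longleftrightarrow> g \<cdot> (pinv m \<cdot> k) \<cdot> aff (2 ^ n) (of_int r) \<in> T"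
    if k: "k \<in> \<Gamma>" for k n and r :: int
  proof -
    have "g \<cdot> k \<cdot> aff (2 ^ n) (of_int r) \<in> T' \<longleftrightarrow> pinv (g \<cdot> m \<cdot> pinv g) \<cdot> (g \<cdot> (k \<cdot> aff (2 ^ n) (of_int r))) \<in> T"
      unfolding T'_def using g k by (subst mem_l_coset[OF h Tc]) (simp_all add: PSL.m_assoc)
    also have "pinv (g \<cdot> m \<cdot> pinv g) \<cdot> (g \<cdot> (k \<cdot> aff (2 ^ n) (of_int r))) = g \<cdot> (pinv m \<cdot> k) \<cdot> aff (2 ^ n) (of_int r)"
      using g k m by (subst hinv) (simp_all add: PSL.m_assoc)
    finally show ?thesis .
  qed
  have idx: "index_at g T' k (index_fun g T (pinv m \<cdot> k))" if k: "k \<in> \<Gamma>" for k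
    unfolding index_at_def mem[OF k]
    using packed_index[OF p modular_mult[OF modular_inv[OF m] k]] by blast
  show "index_fun g T' k = index_fun g T (pinv m \<cdot> k)" if "k \<in> \<Gamma>"
    by (rule index_fun_eq[OF idx[OF that]])
  show "packed g T'"
    unfolding packed_def
  proof (intro conjI ballI g)
    show "T' \<subseteq> carrier PSL2R" unfolding T'_def l_coset_image using h Tc by auto
    show "\<exists>d. index_at g T' k d" if "k \<in> \<Gamma>" for k using idx[OF that] by (rule exI)
    fix x assume "x \<in> T'"
    then obtain y where y: "y \<in> T" "x = g \<cdot> m \<cdot> pinv g \<cdot> y" unfolding T'_def l_coset_image by (elim imageE) (rule that)
    obtain k n and r :: int where k: "k \<in> \<Gamma>" "y = g \<cdot> k \<cdot> aff (2 ^ n) (of_int r)" using packed_cases[OF p y(1)] .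
    have "pinv g \<cdot> (g \<cdot> (k \<cdot> aff (2 ^ n) (of_int r))) = k \<cdot> aff (2 ^ n) (of_int r)"
      using g k by (simp add: PSL.m_assoc[symmetric])
    then have "x = g \<cdot> (m \<cdot> k) \<cdot> aff (2 ^ n) (of_int r)"
      unfolding y(2) k(2) using g m k(1) by (simp add: PSL.m_assoc)
    then show "\<exists>k\<in>\<Gamma>. \<exists>n. \<exists>r::int. x = g \<cdot> k \<cdot> aff (2 ^ n) (of_int r)"
      using modular_mult[OF m k(1)] by (intro bexI exI)
  qed
qed

lemma packed_ext:
  assumes S: "packed g S" and T: "packed g T" and eq: "\<And>k. k \<in> \<Gamma> \<Longrightarrow> index_fun g S k = index_fun g T k"
  shows "S = T"
proof -
  have "A \<subseteq> B" if A: "packed g A" and B: "packed g B" and e: "\<And>k. k \<in> \<Gamma> \<Longrightarrow> index_fun g A k = index_fun g B k" for A B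
  proof
    fix x assume x: "x \<in> A"
    obtain k n and r :: int where k: "k \<in> \<Gamma>" "x = g \<cdot> k \<cdot> aff (2 ^ n) (of_int r)" using packed_cases[OF A x] .
    show "x \<in> B" using x unfolding k(2) packed_index[OF A k(1)] packed_index[OF B k(1)] e[OF k(1)] .
  qed
  then show ?thesis using S T eq by (metis subset_antisym)
qed

text \<open>Offset r in the shifted frame is offset r + j in the old one. The index is the negative
  of an offset, so it grows by j.\<close>

lemma index_shift:
  assumes p: "packed g T" and k: "k \<in> \<Gamma>"
  shows "index_fun g T (k \<cdot> aff 1 (of_int j)) = index_fun g T k + of_int j"
proof (rule index_fun_eq, unfold index_at_def, intro allI)
  note g = packed_carrier(1)[OF p]
  fix n and r :: int
  let ?d = "index_fun g T k" and ?M = "2 ^ Suc n :: int"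
  have "g \<cdot> (k \<cdot> aff 1 (of_int j)) \<cdot> aff (2 ^ n) (of_int r) = g \<cdot> k \<cdot> aff (2 ^ n) (of_int (r + j))"
    using g k by (simp add: PSL.m_assoc aff_mult)
  then have "g \<cdot> (k \<cdot> aff 1 (of_int j)) \<cdot> aff (2 ^ n) (of_int r) \<in> T \<longleftrightarrow> residue ?d (Suc n) = (- (r + j)) mod ?M"
    using packed_index[OF p k, of n "r + j"] by (simp only:)
  also have "\<dots> \<longleftrightarrow> [residue ?d (Suc n) = - (r + j)] (mod ?M)" by (simp add: cong_def del: power_Suc)
  also have "\<dots> \<longleftrightarrow> [residue ?d (Suc n) + j = - r] (mod ?M)" by (simp add: cong_iff_dvd_diff algebra_simps del: power_Suc)
  also have "\<dots> \<longleftrightarrow> residue (?d + of_int j) (Suc n) = (- r) mod ?M"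
    by (simp add: residue_simps residue_of_int cong_def mod_simps del: power_Suc)
  finally show "g \<cdot> (k \<cdot> aff 1 (of_int j)) \<cdot> aff (2 ^ n) (of_int r) \<in> T \<longleftrightarrow> residue (?d + of_int j) (Suc n) = (- r) mod ?M" .
qed

text \<open>The three indices at the triangle of k in cyclic order, starting from the horoball of
  the frame.\<close>

definition index_vec :: "(real^2^2) set \<Rightarrow> (real^2^2) set set \<Rightarrow> (real^2^2) set \<Rightarrow> dyadic \<times> dyadic \<times> dyadic" where
  "index_vec g T k = (index_fun g T k, index_fun g T (k \<cdot> C_mat), index_fun g T (k \<cdot> C_mat \<cdot> C_mat))"

lemma index_vec_C:
  assumes "k \<in> \<Gamma>" "index_vec g T k = (a, b, c)"
  shows "index_vec g T (k \<cdot> C_mat) = (b, c, a)"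
proof -
  have "k \<cdot> C_mat \<cdot> C_mat \<cdot> C_mat = k" using assms(1) CCC by (simp add: PSL.m_assoc)
  then show ?thesis using assms(2) by (simp add: index_vec_def)
qed

text \<open>As \<open>L C = C\<^sup>2 L\<inverse>\<close>, moving to the triangle on the right shifts two of the indices in
  opposite directions; the third one is then determined by the sum.\<close>

lemma index_vec_L:
  assumes p: "packed g T" "sum_rule g T w" and k: "k \<in> \<Gamma>" "index_vec g T k = (a, b, c)"
  shows "index_vec g T (k \<cdot> L_mat) = (a + 1, c - 1, b)"
proof -
  have sum: "a + b + c = w" using p(2) k unfolding sum_rule_def index_vec_def by auto
  have 1: "index_fun g T (k \<cdot> L_mat) = a + 1"
    using index_shift[OF p(1) k(1), of 1] k(2) by (simp add: L_mat_aff index_vec_def)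
  have "L_mat \<cdot> C_mat = C_mat \<cdot> C_mat \<cdot> aff 1 (of_int (- 1))"
    by (simp add: L_mat_pm C_mat_pm aff_def pm_mult pm_eq_iff)
  then have "k \<cdot> L_mat \<cdot> C_mat = k \<cdot> C_mat \<cdot> C_mat \<cdot> aff 1 (of_int (- 1))" using k(1) by (simp add: PSL.m_assoc)
  then have 2: "index_fun g T (k \<cdot> L_mat \<cdot> C_mat) = c - 1"
    using index_shift[OF p(1), of "k \<cdot> C_mat \<cdot> C_mat" "- 1"] k by (simp add: index_vec_def)
  have "(a + 1) + (c - 1) + index_fun g T (k \<cdot> L_mat \<cdot> C_mat \<cdot> C_mat) = w"
    using p(2) k(1) 1 2 unfolding sum_rule_def by (metis L_mat_modular modular_mult)
  then have "index_fun g T (k \<cdot> L_mat \<cdot> C_mat \<cdot> C_mat) = w - (a + c)" by (simp add: algebra_simps)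
  also have "\<dots> = b" by (simp add: sum[symmetric])
  finally show ?thesis using 1 2 by (simp add: index_vec_def)
qed

text \<open>The transition rules for \<open>C_mat\<close> and \<open>L_mat\<close> involve nothing
  but the vector, so equal vectors at two frames stay equal along any common path.\<close>

lemma index_vec_determined:
  assumes p: "packed g T" "sum_rule g T w" and kl: "k \<in> \<Gamma>" "l \<in> \<Gamma>" "index_vec g T k = index_vec g T l" and m: "m \<in> \<Gamma>"
  shows "index_vec g T (k \<cdot> m) = index_vec g T (l \<cdot> m)"
  using m
proof (induction m rule: modular_induct)
  case one
  then show ?case using kl by simp
next
  case (C m)
  obtain a b c where v: "index_vec g T (k \<cdot> m) = (a, b, c)" by (metis prod.exhaust)
  have "index_vec g T (k \<cdot> m \<cdot> C_mat) = index_vec g T (l \<cdot> m \<cdot> C_mat)"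
    using index_vec_C[OF _ v] index_vec_C[of "l \<cdot> m" g T a b c] v C kl by simp
  then show ?case using kl C by (simp add: PSL.m_assoc)
next
  case (L m)
  obtain a b c where v: "index_vec g T (k \<cdot> m) = (a, b, c)" by (metis prod.exhaust)
  have "index_vec g T (k \<cdot> m \<cdot> L_mat) = index_vec g T (l \<cdot> m \<cdot> L_mat)"
    using index_vec_L[OF p _ v] index_vec_L[OF p, of "l \<cdot> m" a b c] v L kl by simp
  then show ?case using kl L by (simp add: PSL.m_assoc)
qed

lemma index_vec_L2:
  assumes p: "packed g T" "sum_rule g T w" and k: "k \<in> \<Gamma>" "index_vec g T k = (a, b, c)"
  shows "index_vec g T (k \<cdot> L2) = (a + 2, b - 1, c - 1)"
proof -
  have "L2 = L_mat \<cdot> L_mat" by (simp add: L2_pm L_mat_pm pm_mult)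
  then have "k \<cdot> L2 = k \<cdot> L_mat \<cdot> L_mat" using k(1) by (simp add: PSL.m_assoc)
  then show ?thesis using index_vec_L[OF p _ index_vec_L[OF p k]] k(1) by simp
qed

lemma index_vec_R2:
  assumes p: "packed g T" "sum_rule g T w" and k: "k \<in> \<Gamma>" "index_vec g T k = (a, b, c)"
  shows "index_vec g T (k \<cdot> R2) = (a + 1, b - 2, c + 1)"
proof -
  have R: "R2 = C_mat \<cdot> C_mat \<cdot> L_mat \<cdot> (C_mat \<cdot> C_mat \<cdot> L_mat)" by (simp add: R2_pm L_mat_pm C_mat_pm pm_mult)
  \<comment> \<open>One factor of \<open>R2\<close> still permutes the coordinates by exchanging the
    outer two; its square is a pure translation.\<close>
  have step: "index_vec g T (l \<cdot> C_mat \<cdot> C_mat \<cdot> L_mat) = (z + 1, y - 1, x)"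
    if l: "l \<in> \<Gamma>" "index_vec g T l = (x, y, z)" for l x y z
  proof -
    have "l \<cdot> C_mat \<in> \<Gamma>" "l \<cdot> C_mat \<cdot> C_mat \<in> \<Gamma>" using l(1) by simp_all
    from index_vec_L[OF p this(2) index_vec_C[OF this(1) index_vec_C[OF l]]] show ?thesis .
  qed
  have "k \<cdot> R2 = k \<cdot> C_mat \<cdot> C_mat \<cdot> L_mat \<cdot> C_mat \<cdot> C_mat \<cdot> L_mat" using k(1) by (simp add: R PSL.m_assoc)
  moreover have "k \<cdot> C_mat \<cdot> C_mat \<cdot> L_mat \<in> \<Gamma>" using k(1) by simp
  ultimately show ?thesis using step[OF _ step[OF k]] by (simp add: algebra_simps)
qed

text \<open>The integers embed: a nonzero n is not divisible by 2 ^ |n|, because |n| < 2 ^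
  |n|.\<close>

lemma of_int_dyadic_eq_0: "(of_int n :: dyadic) = 0 \<Longrightarrow> n = 0"
proof (rule ccontr)
  assume e: "(of_int n :: dyadic) = 0" and n: "n \<noteq> 0"
  define j where "j = nat \<bar>n\<bar>"
  have "n mod 2 ^ j = residue (of_int n) j" by (simp add: residue_of_int)
  also have "\<dots> = 0" unfolding e by (simp add: residue_simps)
  finally have "2 ^ j dvd n" by (simp add: dvd_eq_mod_eq_0)
  then have "2 ^ j \<le> \<bar>n\<bar>" using n by (metis abs_ge_zero dvd_imp_le_int abs_of_nonneg zero_le_numeral zero_le_power)
  moreover have "int j < 2 ^ j" by (metis of_nat_less_two_power)
  ultimately show False by (simp add: j_def)
qed

section \<open>The symmetry group\<close>

text \<open>\<open>L2\<close> and \<open>R2\<close> act by translations, which commute, so the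
  action of \<open>E_set\<close> factors through its abelianization. The inverse of a generator is
  handled by applying the rule of the generator at the frame it leads to.\<close>

lemma index_vec_E:
  assumes p: "packed g T" "sum_rule g T w"
    and ab: "abelianization_map E_group (integer_group \<times>\<times> integer_group) \<alpha>" "\<alpha> L2 = (1, 0)" "\<alpha> R2 = (0, 1)"
    and x: "x \<in> E_set" and k: "k \<in> \<Gamma>" "index_vec g T k = (a, b, c)"
  shows "index_vec g T (k \<cdot> x) = (a + of_int (2 * fst (\<alpha> x) + snd (\<alpha> x)),
    b + of_int (- fst (\<alpha> x) - 2 * snd (\<alpha> x)), c + of_int (snd (\<alpha> x) - fst (\<alpha> x)))"
proof -
  interpret E: group E_group
    unfolding E_group_def by (rule subgroup.subgroup_is_group[OF subgroup_E group_PSL2Z])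
  interpret Z2: group "integer_group \<times>\<times> integer_group" by (intro DirProd_group group_integer_group)
  interpret \<alpha>: group_hom E_group "integer_group \<times>\<times> integer_group" \<alpha>
    by unfold_locales (use ab(1) in \<open>simp add: abelianization_map_def\<close>)
  have mult: "\<alpha> (x \<cdot> y) = (fst (\<alpha> x) + fst (\<alpha> y), snd (\<alpha> x) + snd (\<alpha> y))" if "x \<in> E_set" "y \<in> E_set" for x y
    using \<alpha>.hom_mult[of x y] that by (simp add: E_group_def mult_DirProd')
  have one: "\<alpha> \<one>\<^bsub>PSL2R\<^esub> = (0, 0)" using \<alpha>.hom_one by (simp add: E_group_def)
  show ?thesis
    using x k unfolding E_set_def
  proof (induction arbitrary: k a b c rule: generate.induct)
    case one
    then show ?case by (simp add: \<open>\<alpha> \<one>\<^bsub>PSL2R\<^esub> = (0, 0)\<close>)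
  next
    case (incl h)
    then consider "h = L2" | "h = R2" by auto
    then show ?case
      by cases (use index_vec_L2[OF p incl(2,3)] index_vec_R2[OF p incl(2,3)] in \<open>simp_all add: ab(2,3)\<close>)
  next
    case (inv h)
    then have h: "h \<in> \<Gamma>" "h \<in> E_set" by (auto simp: L2_E R2_E)
    define l where "l = k \<cdot> pinv h"
    have l: "l \<in> \<Gamma>" using inv h by (simp add: l_def)
    obtain a' b' c' where v: "index_vec g T l = (a', b', c')" by (metis prod.exhaust)
    have lh: "l \<cdot> h = k" unfolding l_def using inv h by (simp add: PSL.m_assoc)
    have "\<alpha> (pinv h \<cdot> h) = (0, 0)" using h one by simp
    then have neg: "fst (\<alpha> (pinv h)) = - fst (\<alpha> h)" "snd (\<alpha> (pinv h)) = - snd (\<alpha> h)"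
      using mult[OF E_inv[OF h(2)] h(2)] by simp_all
    consider "h = L2" | "h = R2" using inv(1) by auto
    then show ?case
    proof cases
      case 1
      have "(a, b, c) = (a' + 2, b' - 1, c' - 1)" using index_vec_L2[OF p l v] lh inv(3) 1 by simp
      then show ?thesis using v neg h unfolding l_def by (simp add: 1 ab(2))
    next
      case 2
      have "(a, b, c) = (a' + 1, b' - 2, c' + 1)" using index_vec_R2[OF p l v] lh inv(3) 2 by simp
      then show ?thesis using v neg h unfolding l_def by (simp add: 2 ab(3))
    qed
  next
    case (eng h1 h2)
    have h: "h1 \<in> E_set" "h2 \<in> E_set" using eng(1,2) by (simp_all add: E_set_def)
    have "k \<cdot> h1 \<in> \<Gamma>" using eng(5) E_modular[OF h(1)] by simp
    from eng(4)[OF this eng(3)[OF eng(5,6)]] show ?case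
      using eng(5) E_modular[OF h(1)] E_modular[OF h(2)] by (simp add: mult[OF h] PSL.m_assoc algebra_simps)
  qed
qed

text \<open>A symmetry of T sends a tile without a child to another such tile, and by
  \<open>packed_childless\<close> both are frames of the same packing.\<close>

lemma packed_stabilizer:
  assumes p: "packed g T" and s: "s \<in> carrier PSL2R" "s <#\<^bsub>PSL2R\<^esub> T = T"
  shows "\<exists>m\<in>\<Gamma>. s = g \<cdot> m \<cdot> pinv g"
proof -
  note g = packed_carrier(1)[OF p]
  have Tc: "T \<subseteq> carrier PSL2R" using packed_carrier(2)[OF p] by (rule subsetI)
  obtain r :: int where r: "g \<cdot> \<one>\<^bsub>PSL2R\<^esub> \<cdot> aff 1 (of_int r) \<in> T" using packed_level_zero[OF p modular_one] by (elim exE) (rule that)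
  define k where "k = aff 1 (of_int r)"
  have k: "k \<in> \<Gamma>" by (simp add: k_def)
  have x: "g \<cdot> k \<in> T" using r g by (simp add: k_def)
  have "g \<cdot> k \<cdot> aff (1 / 2) 0 \<notin> T" using packed_childless[OF p x] k by blast
  moreover have sx: "s \<cdot> (g \<cdot> k) \<in> T"
  proof -
    have "s \<cdot> (g \<cdot> k) \<in> s <#\<^bsub>PSL2R\<^esub> T" unfolding l_coset_image using x by (rule imageI)
    then show ?thesis unfolding s(2) .
  qed
  have "s \<cdot> (g \<cdot> k) \<cdot> aff (1 / 2) 0 \<in> T \<longleftrightarrow> g \<cdot> k \<cdot> aff (1 / 2) 0 \<in> T"
  proof -
    have "s \<cdot> (g \<cdot> k) \<cdot> aff (1 / 2) 0 \<in> s <#\<^bsub>PSL2R\<^esub> T \<longleftrightarrow> pinv s \<cdot> (s \<cdot> (g \<cdot> k) \<cdot> aff (1 / 2) 0) \<in> T"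
      using g k s(1) by (intro mem_l_coset Tc) simp_all
    moreover have "pinv s \<cdot> (s \<cdot> (g \<cdot> k) \<cdot> aff (1 / 2) 0) = g \<cdot> k \<cdot> aff (1 / 2) 0"
      using g k s(1) by (simp add: PSL.m_assoc) (simp add: PSL.m_assoc[symmetric])
    ultimately show ?thesis unfolding s(2) by (simp only:)
  qed
  ultimately have "s \<cdot> (g \<cdot> k) \<cdot> aff (1 / 2) 0 \<notin> T" by blast
  then obtain l where l: "l \<in> \<Gamma>" "s \<cdot> (g \<cdot> k) = g \<cdot> l" using packed_childless[OF p sx] by blast
  have "s = s \<cdot> (g \<cdot> k) \<cdot> pinv (g \<cdot> k)" using s(1) g k by (simp add: PSL.m_assoc)
  also have "\<dots> = g \<cdot> (l \<cdot> pinv k) \<cdot> pinv g" unfolding l(2) using g k l(1) by (simp add: PSL.inv_mult_group PSL.m_assoc)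
  finally show ?thesis using k l(1) by (intro bexI[of _ "l \<cdot> pinv k"]) simp_all
qed

text \<open>The classification provides some frame h; equality of the packings of g and h transfers
  the conclusion to the prescribed g.\<close>

lemma fiber_packed:
  assumes T: "T \<in> packing_fiber \<beta> w (packing g)" and g: "g \<in> carrier PSL2R"
  shows "packed g T" "sum_rule g T w" "T \<in> tilings \<beta>" "closedin PSL2R_topology T" "T \<notin> degenerate_tilings \<beta>"
proof -
  have T': "T \<in> tilings_w \<beta> w - degenerate_tilings \<beta>" "packing_of \<beta> T = packing g"
    using T by (simp_all add: packing_fiber_def)
  obtain h where h: "T \<in> tilings \<beta>" "closedin PSL2R_topology T" "packed h T" "sum_rule h T w"
    using tilings_w_nondegenerate[OF T'(1)] .
  have nd: "nondegenerate_over \<beta> T (packing h)" by (rule packed_imp_nondegenerate[OF h(3,1)])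
  then have e: "packing h = packing g" using packing_of_eq T'(2) by blast
  have i: "index_sum_is \<beta> T w" using sum_tilings_eq[OF h(1,3,4)] by blast
  show "packed g T" "sum_rule g T w" using nondegenerate_sum_packed[OF nd[unfolded e] g i] by blast+
  show "T \<in> tilings \<beta>" "closedin PSL2R_topology T" by fact+
  show "T \<notin> degenerate_tilings \<beta>" using T'(1) by blast
qed

text \<open>Translates by symmetries of the packing are the members of the fibre on which a
  pointwise symmetry will be tested.\<close>

lemma fiber_translate:
  assumes T: "T \<in> packing_fiber \<beta> w (packing g)" and g: "g \<in> carrier PSL2R" and m: "m \<in> \<Gamma>"
  shows "(g \<cdot> m \<cdot> pinv g) <#\<^bsub>PSL2R\<^esub> T \<in> packing_fiber \<beta> w (packing g)"
proof -
  note F = fiber_packed[OF T g]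
  let ?h = "g \<cdot> m \<cdot> pinv g"
  let ?T = "?h <#\<^bsub>PSL2R\<^esub> T"
  have h: "?h \<in> carrier PSL2R" using g m by simp
  have p: "packed g ?T" by (rule packed_translate(1)[OF F(1) m])
  have t: "?T \<in> tilings \<beta>" by (rule tilings_translate[OF F(3) h])
  have s: "sum_rule g ?T w"
    unfolding sum_rule_def
  proof
    fix k assume k: "k \<in> \<Gamma>"
    have "index_fun g T (pinv m \<cdot> k) + index_fun g T (pinv m \<cdot> k \<cdot> C_mat) + index_fun g T (pinv m \<cdot> k \<cdot> C_mat \<cdot> C_mat) = w"
      using F(2) modular_mult[OF modular_inv[OF m] k] unfolding sum_rule_def by blast
    then show "index_fun g ?T k + index_fun g ?T (k \<cdot> C_mat) + index_fun g ?T (k \<cdot> C_mat \<cdot> C_mat) = w"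
      using k m by (simp add: packed_translate(2)[OF F(1) m] PSL.m_assoc)
  qed
  have "?T \<in> tilings_w \<beta> w"
    by (rule sum_tilings_in_tilings_w[OF t closedin_translate[OF F(4) h] p s])
  moreover have "?T \<notin> degenerate_tilings \<beta>" using degenerate_translate[OF F(3) h] F(5) by blast
  moreover have "packing_of \<beta> ?T = packing g" by (rule packing_of_eq[OF packed_imp_nondegenerate[OF p t]])
  ultimately show ?thesis by (simp add: packing_fiber_def)
qed

text \<open>An element that fixes all translates of a tiling acts trivially on a coset of the lattice spanned by
  \<open>(2, -1, -1)\<close> and \<open>(1, -2, 1)\<close>; its linear part, a permutation of the coordinates, is then trivial.\<close>

lemma fixing_element_in_E:
  assumes p: "packed g T" "sum_rule g T w"
    and ab: "abelianization_map E_group (integer_group \<times>\<times> integer_group) \<alpha>" "\<alpha> L2 = (1, 0)" "\<alpha> R2 = (0, 1)"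
    and m: "m \<in> \<Gamma>" and fixed: "\<And>k. k \<in> \<Gamma> \<Longrightarrow> index_vec g T (k \<cdot> m) = index_vec g T k"
  shows "m \<in> kernel E_group (integer_group \<times>\<times> integer_group) \<alpha>"
proof -
  obtain e r where er: "e \<in> E_set" "r \<in> set coset_reps" "m = e \<cdot> r" using modular_coset_rep[OF m] by blast
  note eG = E_modular[OF er(1)] and rG = subsetD[OF coset_reps_modular er(2)]
  obtain a b c where v: "index_vec g T \<one>\<^bsub>PSL2R\<^esub> = (a, b, c)" by (metis prod.exhaust)
  \<comment> \<open>The translation by which e acts on index vectors, according to
    \<open>index_vec_E\<close>.\<close>
  define x y z :: dyadic where xyz: "x = of_int (2 * fst (\<alpha> e) + snd (\<alpha> e))" "y = of_int (- fst (\<alpha> e) - 2 * snd (\<alpha> e))"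
    "z = of_int (snd (\<alpha> e) - fst (\<alpha> e))"
  have step: "index_vec g T (k \<cdot> e) = (a' + x, b' + y, c' + z)" "index_vec g T (k \<cdot> e \<cdot> r) = (a', b', c')"
    if k: "k \<in> \<Gamma>" "index_vec g T k = (a', b', c')" for k a' b' c'
  proof -
    show "index_vec g T (k \<cdot> e) = (a' + x, b' + y, c' + z)" unfolding xyz by (rule index_vec_E[OF p ab er(1) k])
    have "k \<cdot> e \<cdot> r = k \<cdot> m" using k(1) eG rG er(3) by (simp add: PSL.m_assoc)
    then show "index_vec g T (k \<cdot> e \<cdot> r) = (a', b', c')" using fixed[OF k(1)] k(2) by simp
  qed
  have v1: "index_vec g T (\<one>\<^bsub>PSL2R\<^esub> \<cdot> L2) = (a + 2, b - 1, c - 1)" by (rule index_vec_L2[OF p modular_one v])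
  have v2: "index_vec g T (\<one>\<^bsub>PSL2R\<^esub> \<cdot> R2) = (a + 1, b - 2, c + 1)" by (rule index_vec_R2[OF p modular_one v])
  have G: "\<one>\<^bsub>PSL2R\<^esub> \<cdot> L2 \<in> \<Gamma>" "\<one>\<^bsub>PSL2R\<^esub> \<cdot> R2 \<in> \<Gamma>" by simp_all
  note S0 = step[OF modular_one v] and S1 = step[OF G(1) v1] and S2 = step[OF G(2) v2]
  have three: False if "(3 :: dyadic) = 0" using of_int_dyadic_eq_0[of 3] that by simp
  have inG: "\<one>\<^bsub>PSL2R\<^esub> \<cdot> e \<in> \<Gamma>" "\<one>\<^bsub>PSL2R\<^esub> \<cdot> L2 \<cdot> e \<in> \<Gamma>" "\<one>\<^bsub>PSL2R\<^esub> \<cdot> R2 \<cdot> e \<in> \<Gamma>" using eG by simp_all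
  have C: "index_vec g T (l \<cdot> C_mat) = (v, w', u)" if "l \<in> \<Gamma>" "index_vec g T l = (u, v, w')" for l u v w'
    by (rule index_vec_C[OF that])
  have CC: "index_vec g T (l \<cdot> (C_mat \<cdot> C_mat)) = (w', u, v)" if l: "l \<in> \<Gamma>" "index_vec g T l = (u, v, w')" for l u v w'
    using C[OF _ C[OF l]] l(1) by (simp add: PSL.m_assoc)
  have L: "index_vec g T (l \<cdot> L_mat) = (u + 1, w' - 1, v)" if "l \<in> \<Gamma>" "index_vec g T l = (u, v, w')" for l u v w'
    by (rule index_vec_L[OF p that])
  have LC: "index_vec g T (l \<cdot> (L_mat \<cdot> C_mat)) = (w' - 1, v, u + 1)" if l: "l \<in> \<Gamma>" "index_vec g T l = (u, v, w')" for l u v w'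
    using C[OF _ L[OF l]] l(1) by (simp add: PSL.m_assoc)
  have LCC: "index_vec g T (l \<cdot> (L_mat \<cdot> C_mat \<cdot> C_mat)) = (v, u + 1, w' - 1)" if l: "l \<in> \<Gamma>" "index_vec g T l = (u, v, w')" for l u v w'
    using CC[OF _ L[OF l]] l(1) by (simp add: PSL.m_assoc)
  \<comment> \<open>For a nontrivial r, one coordinate of the invariance is compared at two base
    frames whose vectors differ by a known amount. The unknown shift cancels and 3 = 0 remains,
    which is false since the integers embed.\<close>
  consider "r = \<one>\<^bsub>PSL2R\<^esub>" | "r = C_mat" | "r = C_mat \<cdot> C_mat" | "r = L_mat" | "r = L_mat \<cdot> C_mat"
    | "r = L_mat \<cdot> C_mat \<cdot> C_mat" using er(2) by (auto simp: coset_reps_def)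
  then have "r = \<one>\<^bsub>PSL2R\<^esub>"
  proof cases
    case 2
    have "b + y = a" "(b - 1) + y = a + 2"
      using C[OF inG(1) S0(1)] S0(2) C[OF inG(2) S1(1)] S1(2) by (simp_all add: 2)
    then have "(3::dyadic) = 0" by (simp add: algebra_simps)
    then show ?thesis using three by blast
  next
    case 3
    have "c + z = a" "(c - 1) + z = a + 2"
      using CC[OF inG(1) S0(1)] S0(2) CC[OF inG(2) S1(1)] S1(2) by (simp_all add: 3)
    then have "(3::dyadic) = 0" by (simp add: algebra_simps)
    then show ?thesis using three by blast
  next
    \<comment> \<open>\<open>L_mat\<close> exchanges the last two coordinates, which
      \<open>L2\<close> shifts alike; the base frame \<open>R2\<close> tells them apart.\<close>
    case 4
    have "c + z - 1 = b" "(c + 1) + z - 1 = b - 2"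
      using L[OF inG(1) S0(1)] S0(2) L[OF inG(3) S2(1)] S2(2) by (simp_all add: 4)
    then have "(3::dyadic) = 0" by (simp add: algebra_simps)
    then show ?thesis using three by blast
  next
    case 5
    have "c + z - 1 = a" "(c - 1) + z - 1 = a + 2"
      using LC[OF inG(1) S0(1)] S0(2) LC[OF inG(2) S1(1)] S1(2) by (simp_all add: 5)
    then have "(3::dyadic) = 0" by (simp add: algebra_simps)
    then show ?thesis using three by blast
  next
    case 6
    have "b + y = a" "(b - 1) + y = a + 2"
      using LCC[OF inG(1) S0(1)] S0(2) LCC[OF inG(2) S1(1)] S1(2) by (simp_all add: 6)
    then have "(3::dyadic) = 0" by (simp add: algebra_simps)
    then show ?thesis using three by blast
  qed
  then have me: "m = e" and "index_vec g T (\<one>\<^bsub>PSL2R\<^esub> \<cdot> e) = (a, b, c)" using er(3) eG S0(2) by simp_all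
  then have "x = 0" "y = 0" using S0(1) by simp_all
  then have "2 * fst (\<alpha> e) + snd (\<alpha> e) = 0" "- fst (\<alpha> e) - 2 * snd (\<alpha> e) = 0"
    unfolding xyz by (blast intro: of_int_dyadic_eq_0)+
  then have "fst (\<alpha> e) = 0" "snd (\<alpha> e) = 0" by simp_all
  then have "\<alpha> e = (0, 0)" by (metis prod.collapse)
  then show ?thesis using er(1) by (simp add: kernel_def me E_group_def)
qed

lemma pointwise_symmetries_fiber:
  assumes ab: "abelianization_map E_group (integer_group \<times>\<times> integer_group) \<alpha>" "\<alpha> L2 = (1, 0)" "\<alpha> R2 = (0, 1)"
    and T0: "T\<^sub>0 \<in> packing_fiber \<beta> w (packing g)" and g: "g \<in> carrier PSL2R"
  shows "pointwise_symmetries (packing_fiber \<beta> w (packing g)) =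
    (\<lambda>k. g \<cdot> k \<cdot> pinv g) ` kernel E_group (integer_group \<times>\<times> integer_group) \<alpha>"
proof
  have sub: "subgroup (kernel E_group (integer_group \<times>\<times> integer_group) \<alpha>) E_group"
  proof -
    interpret E: group E_group
      unfolding E_group_def by (rule subgroup.subgroup_is_group[OF subgroup_E group_PSL2Z])
    interpret Z2: group "integer_group \<times>\<times> integer_group" by (intro DirProd_group group_integer_group)
    interpret \<alpha>: group_hom E_group "integer_group \<times>\<times> integer_group" \<alpha>
      by unfold_locales (use ab(1) in \<open>simp add: abelianization_map_def\<close>)
    show ?thesis by (rule \<alpha>.subgroup_kernel)
  qed
  have Einv: "inv\<^bsub>E_group\<^esub> x = pinv x" if "x \<in> E_set" for x
    using group.m_inv_consistent[OF group_PSL2Z subgroup_E that] E_modular[OF that] by (simp add: E_group_def)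
  have kinv: "pinv x \<in> kernel E_group (integer_group \<times>\<times> integer_group) \<alpha>"
    if "x \<in> kernel E_group (integer_group \<times>\<times> integer_group) \<alpha>" for x
    using subgroup.m_inv_closed[OF sub that] that by (simp add: Einv[unfolded E_group_def] kernel_def E_group_def)
  show "pointwise_symmetries (packing_fiber \<beta> w (packing g)) \<subseteq>
    (\<lambda>k. g \<cdot> k \<cdot> pinv g) ` kernel E_group (integer_group \<times>\<times> integer_group) \<alpha>"
  proof
    fix s assume "s \<in> pointwise_symmetries (packing_fiber \<beta> w (packing g))"
    then have s: "s \<in> carrier PSL2R" "\<And>T. T \<in> packing_fiber \<beta> w (packing g) \<Longrightarrow> s <#\<^bsub>PSL2R\<^esub> T = T"
      by (simp_all add: pointwise_symmetries_def)
    note F = fiber_packed[OF T0 g]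
    obtain m where m: "m \<in> \<Gamma>" "s = g \<cdot> m \<cdot> pinv g" using packed_stabilizer[OF F(1) s(1) s(2)[OF T0]] by (elim bexE) (rule that)
    \<comment> \<open>Testing s on the translate of \<open>T\<^sub>0\<close> by the inverse of k
      turns invariance at the unit frame into invariance at k.\<close>
    have inv: "index_fun g T\<^sub>0 (k \<cdot> pinv m \<cdot> j) = index_fun g T\<^sub>0 (k \<cdot> j)" if k: "k \<in> \<Gamma>" and j: "j \<in> \<Gamma>" for k j
    proof -
      let ?T = "(g \<cdot> pinv k \<cdot> pinv g) <#\<^bsub>PSL2R\<^esub> T\<^sub>0"
      have k': "pinv k \<in> \<Gamma>" using k by simp
      have Tf: "?T \<in> packing_fiber \<beta> w (packing g)" by (rule fiber_translate[OF T0 g k'])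
      note p = fiber_packed(1)[OF Tf g]
      have "index_fun g ?T j = index_fun g (s <#\<^bsub>PSL2R\<^esub> ?T) j" using s(2)[OF Tf] by simp
      also have "\<dots> = index_fun g ?T (pinv m \<cdot> j)" unfolding m(2) by (rule packed_translate(2)[OF p m(1) j])
      also have "\<dots> = index_fun g T\<^sub>0 (k \<cdot> (pinv m \<cdot> j))"
        using packed_translate(2)[OF F(1) k', of "pinv m \<cdot> j"] k m(1) j by simp
      finally show ?thesis using packed_translate(2)[OF F(1) k' j] k m(1) j by (simp add: PSL.m_assoc)
    qed
    have "pinv m \<in> kernel E_group (integer_group \<times>\<times> integer_group) \<alpha>"
    proof (rule fixing_element_in_E[OF F(1,2) ab modular_inv[OF m(1)]])
      fix k assume k: "k \<in> \<Gamma>"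
      show "index_vec g T\<^sub>0 (k \<cdot> pinv m) = index_vec g T\<^sub>0 k"
        unfolding index_vec_def
        using inv[OF k modular_one] inv[OF k C_mat_modular] inv[OF k modular_mult[OF C_mat_modular C_mat_modular]] k m(1)
        by (simp add: PSL.m_assoc)
    qed
    from kinv[OF this] have "m \<in> kernel E_group (integer_group \<times>\<times> integer_group) \<alpha>" using m(1) by simp
    then show "s \<in> (\<lambda>k. g \<cdot> k \<cdot> pinv g) ` kernel E_group (integer_group \<times>\<times> integer_group) \<alpha>"
      unfolding m(2) by (rule imageI)
  qed
  show "(\<lambda>k. g \<cdot> k \<cdot> pinv g) ` kernel E_group (integer_group \<times>\<times> integer_group) \<alpha> \<subseteq>
    pointwise_symmetries (packing_fiber \<beta> w (packing g))"
  proof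
    fix s assume "s \<in> (\<lambda>k. g \<cdot> k \<cdot> pinv g) ` kernel E_group (integer_group \<times>\<times> integer_group) \<alpha>"
    then obtain e where e: "e \<in> kernel E_group (integer_group \<times>\<times> integer_group) \<alpha>" "s = g \<cdot> e \<cdot> pinv g"
      by (elim imageE) (rule that)
    then have eE: "e \<in> E_set" by (simp add: kernel_def E_group_def)
    note eG = E_modular[OF eE]
    \<comment> \<open>With trivial exponents, the vectors at the inverse of e and at the unit agree;
      \<open>index_vec_determined\<close> spreads this to all frames, and \<open>packed_ext\<close>
      gives equality of the tilings.\<close>
    have e': "pinv e \<in> E_set" "\<alpha> (pinv e) = (0, 0)" using kinv[OF e(1)] by (simp_all add: kernel_def E_group_def)
    have "s <#\<^bsub>PSL2R\<^esub> T = T" if T: "T \<in> packing_fiber \<beta> w (packing g)" for T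
    proof -
      note F = fiber_packed[OF T g]
      have "index_fun g ((g \<cdot> e \<cdot> pinv g) <#\<^bsub>PSL2R\<^esub> T) k = index_fun g T k" if k: "k \<in> \<Gamma>" for k
      proof -
        obtain a b c where v: "index_vec g T \<one>\<^bsub>PSL2R\<^esub> = (a, b, c)" by (metis prod.exhaust)
        have "index_vec g T (\<one>\<^bsub>PSL2R\<^esub> \<cdot> pinv e) = index_vec g T \<one>\<^bsub>PSL2R\<^esub>"
          using index_vec_E[OF F(1,2) ab e'(1) modular_one v] v by (simp add: e'(2))
        then have "index_vec g T (pinv e) = index_vec g T \<one>\<^bsub>PSL2R\<^esub>" using eG by simp
        from index_vec_determined[OF F(1,2) modular_inv[OF eG] modular_one this k]
        have "index_fun g T (pinv e \<cdot> k) = index_fun g T k" using k by (simp add: index_vec_def)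
        then show ?thesis using packed_translate(2)[OF F(1) eG k] by simp
      qed
      then show ?thesis unfolding e(2) by (rule packed_ext[OF packed_translate(1)[OF F(1) eG] F(1)])
    qed
    moreover have "s \<in> carrier PSL2R" unfolding e(2) using g eG by simp
    ultimately show "s \<in> pointwise_symmetries (packing_fiber \<beta> w (packing g))"
      by (simp add: pointwise_symmetries_def)
  qed
qed

theorem theorem6:
  shows "freely_generate PSL2Z [L2, R2] E_set \<and> subgroup E_set PSL2Z \<and>
    card (rcosets\<^bsub>PSL2Z\<^esub> E_set) = 6 \<and>
    (\<exists>\<alpha>. abelianization_map E_group (integer_group \<times>\<times> integer_group) \<alpha> \<and>
      \<alpha> L2 = (1, 0) \<and> \<alpha> R2 = (0, 1) \<and>
      (\<forall>\<beta>. small_bump \<beta> \<longrightarrow>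
        (\<forall>w. \<forall>T\<^sub>0 \<in> tilings_w \<beta> w - degenerate_tilings \<beta>. \<forall>g \<in> carrier PSL2R.
          packing_of \<beta> T\<^sub>0 = move_packing g modular_packing \<longrightarrow>
          pointwise_symmetries (packing_fiber \<beta> w (packing_of \<beta> T\<^sub>0)) =
            (\<lambda>k. g \<otimes>\<^bsub>PSL2R\<^esub> k \<otimes>\<^bsub>PSL2R\<^esub> inv\<^bsub>PSL2R\<^esub> g) `
              kernel E_group (integer_group \<times>\<times> integer_group) \<alpha>)))"
proof -
  obtain \<alpha> where ab: "abelianization_map E_group (integer_group \<times>\<times> integer_group) \<alpha>" "\<alpha> L2 = (1, 0)" "\<alpha> R2 = (0, 1)"
    using E_abelianization by (elim exE conjE) (rule that)
  have "pointwise_symmetries (packing_fiber \<beta> w (packing_of \<beta> T\<^sub>0)) =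
      (\<lambda>k. g \<cdot> k \<cdot> pinv g) ` kernel E_group (integer_group \<times>\<times> integer_group) \<alpha>"
    if T: "T\<^sub>0 \<in> tilings_w \<beta> w - degenerate_tilings \<beta>" and g: "g \<in> carrier PSL2R" "packing_of \<beta> T\<^sub>0 = packing g"
    for \<beta> w T\<^sub>0 g
  proof -
    have "T\<^sub>0 \<in> packing_fiber \<beta> w (packing g)" using T g(2) by (simp add: packing_fiber_def)
    then show ?thesis unfolding g(2) by (rule pointwise_symmetries_fiber[OF ab _ g(1)])
  qed
  then show ?thesis
    by (intro conjI exI[of _ \<alpha>] allI impI ballI freely_generate_E subgroup_E card_rcosets_E ab)
qed

end
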